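(* Let $\sigma\in C^2(\mathbb T)$ with $\int_{\mathbb T}\sigma=eZ$, and let $X(0)\in\mathcal M$. Then (i) there exists a unique solution $X\in C(\mathbb R,\mathcal V)$ of the Schrödinger–Poisson–Newton system with initial state $X(0)$; (ii) the energy and charge are conserved: $E(X(t))=E(X(0))$ and $Q(X(t))=Q(X(0))$ for all $t\in\mathbb R$.
   Context: Setting. Fix $N\in\mathbb N$, constants $e>0$, $Z>0$, $M>0$. Let $\mathbb T:=\mathbb R^3/N\mathbb Z^3$, $\Gamma:=\mathbb Z^3/N\mathbb Z^3\subset\mathbb T$, $\overline N:=N^3$, $\overline{\mathbb T}:=\mathbb T^{\overline N}$ with points $\overline x=(x_1,\dots,x_{\overline N})$. The ion charge density $\sigma:\mathbb T\to\mathbb R$ satisfies $\sigma\in C^2(\mathbb T)$ and $\int_{\mathbb T}\sigma\,dx=eZ$. Let $\mathcal F$ be the real Hilbert space of complex-valued functions $\psi\in H^1(\overline{\mathbb T})$ antisymmetric under permutations of $x_1,\dots,x_{\overline N}$, with norm $\|\psi\|_{\mathcal F}^2=\|\nabla^\otimes\psi\|_{L^2(\overline{\mathbb T})}^2+\|\psi\|_{L^2(\overline{\mathbb T})}^2$ ($\nabla^\otimes$ = gradient in $\overline x$); real scalar products are $(f,g)=\mathrm{Re}\int f\bar g$. Let $\Xi:=\frac{2\pi}{N}\mathbb Z^3$ and write functions on $\mathbb T$ as Fourier series $f(x)=\sum_{\xi\in\Xi}\tilde f(\xi)e^{i\xi x}$; define $Gf:=\sum_{\xi\in\Xi\setminus0}\tilde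 f(\xi)|\xi|^{-2}e^{i\xi x}$. The phase space $\mathcal V$ is the set of triples $X=(\psi,q,p)$ with $\psi\in\mathcal F$, $q=(q(n))_{n\in\Gamma}\in\mathbb T^{\overline N}$, $p=(p(n))_{n\in\Gamma}\in\mathbb R^{3\overline N}$, with metric $d_{\mathcal V}(X,X')=\|\psi-\psi'\|_{\mathcal F}+|q-q'|+|p-p'|$ and quasinorm $|X|_{\mathcal V}=\|\psi\|_{\mathcal F}+|p|$. For $X=(\psi,q,p)$ define $\rho^i(x)=\sum_{n\in\Gamma}\sigma(x-n-q(n))$, $\rho^e(x)=-e\sum_{j=1}^{\overline N}\int_{\mathbb T^{\overline N-1}}|\psi(\overline x)|^2\big|_{x_j=x}\prod_{l\neq j}dx_l$, $\rho=\rho^i+\rho^e$, $\Phi=G\rho$, $\Phi^\otimes(\overline x)=\sum_{j}\Phi(x_j)$, $\Delta^\otimes=\sum_j\Delta_{x_j}$. Energy $E(X)=\frac12\int_{\overline{\mathbb T}}|\nabla^\otimes\psi|^2d\overline x+\frac12(\rho,G\rho)_{L^2(\mathbb T)}+\sum_{n\in\Gamma}\frac{p(n)^2}{2M}$; charge $Q(X)=\|\psi\|^2_{L^2(\overline{\mathbb T})}$; $\mathcal M:=\{X\in\mathcal V:Q(X)=Z\}$. The Schrödinger–Poisson–Newton system is $i\partial_t\psi=-\frac12\Delta^\otimes\psi-e\Phi^\otimes\psi$, $\dot q(n)=p(n)/M$ (mod $N\mathbb Z^3$), $\dot p(n)=-\int_{\mathbb T}\nabla\Phi(x)\,\sigma(x-n-q(n))\,dx$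 ($n\in\Gamma$), where $\Phi=G\rho$ is computed from the current state; a solution on an interval $I\ni0$ is $X\in C(I,\mathcal V)$ satisfying it in Duhamel form: $\psi(t)=e^{\frac i2t\Delta^\otimes}\psi(0)+ie\int_0^te^{\frac i2(t-s)\Delta^\otimes}[\Phi^\otimes(s)\psi(s)]ds$, $q(n,t)=q(n,0)+\frac1M\int_0^tp(n,s)ds$, $p(n,t)=p(n,0)-\int_0^t(\nabla\Phi(s),\sigma(\cdot-n-q(n,s)))ds$. *)

theory Defs
  imports "HOL-Analysis.Analysis"
begin

text \<open>Fundamental domain of the torus R^d / N Z^d (for any Euclidean space).\<close>
definition Tb :: "nat \<Rightarrow> 'a::euclidean_space set" where
  "Tb N = cbox 0 (real N *\<^sub>R One)"

definition latt :: "'a::euclidean_space set" where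
  "latt = {m. \<forall>b\<in>Basis. m \<bullet> b \<in> \<int>}"

text \<open>N-periodic functions (= functions on the torus).\<close>
definition per :: "nat \<Rightarrow> ('a::euclidean_space \<Rightarrow> 'b) \<Rightarrow> bool" where
  "per N f \<longleftrightarrow> (\<forall>x. \<forall>m\<in>latt. f (x + real N *\<^sub>R m) = f x)"

definition tdist :: "nat \<Rightarrow> 'a::euclidean_space \<Rightarrow> 'a \<Rightarrow> real" where
  "tdist N x y = Inf ((\<lambda>m. norm (x - y - real N *\<^sub>R m)) ` latt)"

definition teq :: "nat \<Rightarrow> 'a::euclidean_space \<Rightarrow> 'a \<Rightarrow> bool" where
  "teq N a b \<longleftrightarrow> (\<exists>m\<in>latt. a - b = real N *\<^sub>R m)"

coinductive smooth :: "('a::euclidean_space \<Rightarrow> 'b::real_normed_vector) \<Rightarrow> bool" where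
  "continuous_on UNIV f \<Longrightarrow>
   (\<forall>v. \<exists>g. (\<forall>x. ((\<lambda>t. f (x + t *\<^sub>R v)) has_vector_derivative g x) (at 0)) \<and> smooth g)
   \<Longrightarrow> smooth f"

definition C2 :: "('a::euclidean_space \<Rightarrow> real) \<Rightarrow> bool" where
  "C2 f \<longleftrightarrow> (\<exists>(D :: 'a \<Rightarrow> 'a \<Rightarrow>\<^sub>L real) (D2 :: 'a \<Rightarrow> 'a \<Rightarrow>\<^sub>L ('a \<Rightarrow>\<^sub>L real)).
      (\<forall>x. (f has_derivative blinfun_apply (D x)) (at x)) \<and>
      (\<forall>x. (D has_derivative blinfun_apply (D2 x)) (at x)) \<and>
      continuous_on UNIV D2)"

definition L2 :: "nat \<Rightarrow> ('a::euclidean_space \<Rightarrow> 'b::{real_normed_vector,second_countable_topology}) \<Rightarrow> bool" where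
  "L2 N f \<longleftrightarrow> f \<in> borel_measurable borel \<and>
     set_integrable lborel (Tb N) (\<lambda>x. (norm (f x))\<^sup>2)"

definition weak_deriv :: "nat \<Rightarrow> ('a::euclidean_space \<Rightarrow> 'b::{real_normed_field,banach,second_countable_topology})
     \<Rightarrow> 'a \<Rightarrow> ('a \<Rightarrow> 'b) \<Rightarrow> bool" where
  "weak_deriv N f v g \<longleftrightarrow> g \<in> borel_measurable borel \<and> per N g \<and> set_integrable lborel (Tb N) g \<and>
     (\<forall>\<phi> \<phi>'. smooth \<phi> \<and> per N \<phi> \<and>
        (\<forall>x. ((\<lambda>t. \<phi> (x + t *\<^sub>R v)) has_vector_derivative \<phi>' x) (at 0)) \<longrightarrow>
        (LINT x:Tb N|lborel. f x * \<phi>' x) = - (LINT x:Tb N|lborel. g x * \<phi> x))"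

definition wd :: "nat \<Rightarrow> ('a::euclidean_space \<Rightarrow> 'b::{real_normed_field,banach,second_countable_topology})
     \<Rightarrow> 'a \<Rightarrow> 'a \<Rightarrow> 'b" where
  "wd N f v = (SOME g. weak_deriv N f v g)"

definition H1 :: "nat \<Rightarrow> ('a::euclidean_space \<Rightarrow> complex) \<Rightarrow> bool" where
  "H1 N f \<longleftrightarrow> per N f \<and> L2 N f \<and> (\<forall>b\<in>Basis. \<exists>g. weak_deriv N f b g \<and> L2 N g)"

definition Fnorm :: "nat \<Rightarrow> ('a::euclidean_space \<Rightarrow> complex) \<Rightarrow> real" where
  "Fnorm N f = sqrt ((LINT x:Tb N|lborel. (\<Sum>b\<in>Basis. (cmod (wd N f b x))\<^sup>2))
                    + (LINT x:Tb N|lborel. (cmod (f x))\<^sup>2))"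

definition fc :: "nat \<Rightarrow> ('a::euclidean_space \<Rightarrow> complex) \<Rightarrow> 'a \<Rightarrow> complex" where
  "fc N f k = (LINT x:Tb N|lborel. f x * cis (- (2 * pi / real N) * (k \<bullet> x))) / (real N) ^ DIM('a)"

definition antisymm_wf :: "(real^3^'n::finite \<Rightarrow> complex) \<Rightarrow> bool" where
  "antisymm_wf f \<longleftrightarrow> (\<forall>\<pi>. \<pi> permutes (UNIV :: 'n set) \<longrightarrow>
      (AE x in lborel. f (\<chi> j. x $ \<pi> j) = of_int (sign \<pi>) * f x))"

definition Fsp :: "nat \<Rightarrow> (real^3^'n::finite \<Rightarrow> complex) \<Rightarrow> bool" where
  "Fsp N f \<longleftrightarrow> H1 N f \<and> antisymm_wf f"

text \<open>States X = (psi, q, p); q n, p n are only relevant for n in Gamma; q n is a real lift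
  of a torus point.\<close>
type_synonym 'n state = "(real^3^'n \<Rightarrow> complex) \<times> (int^3 \<Rightarrow> real^3) \<times> (int^3 \<Rightarrow> real^3)"

definition wf :: "'n state \<Rightarrow> (real^3^'n \<Rightarrow> complex)" where "wf X = fst X"
definition qs :: "'n state \<Rightarrow> (int^3 \<Rightarrow> real^3)" where "qs X = fst (snd X)"
definition ps :: "'n state \<Rightarrow> (int^3 \<Rightarrow> real^3)" where "ps X = snd (snd X)"

definition Gam :: "nat \<Rightarrow> (int^3) set" where
  "Gam N = {n. \<forall>i. 0 \<le> n $ i \<and> n $ i < int N}"

definition rv :: "int^3 \<Rightarrow> real^3" where
  "rv n = (\<chi> i. real_of_int (n $ i))"

definition Vsp :: "nat \<Rightarrow> ('n::finite) state \<Rightarrow> bool" where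
  "Vsp N X \<longleftrightarrow> Fsp N (wf X)"

definition dV :: "nat \<Rightarrow> ('n::finite) state \<Rightarrow> 'n state \<Rightarrow> real" where
  "dV N X Y = Fnorm N (\<lambda>x. wf X x - wf Y x)
     + sqrt (\<Sum>n\<in>Gam N. (tdist N (qs X n) (qs Y n))\<^sup>2)
     + sqrt (\<Sum>n\<in>Gam N. (norm (ps X n - ps Y n))\<^sup>2)"

definition Qc :: "nat \<Rightarrow> ('n::finite) state \<Rightarrow> real" where
  "Qc N X = (LINT x:Tb N|lborel. (cmod (wf X x))\<^sup>2)"

definition Mset :: "nat \<Rightarrow> real \<Rightarrow> ('n::finite) state set" where
  "Mset N Z = {X. Vsp N X \<and> Qc N X = Z}"

definition rho_i :: "nat \<Rightarrow> (real^3 \<Rightarrow> real) \<Rightarrow> (int^3 \<Rightarrow> real^3) \<Rightarrow> real^3 \<Rightarrow> real" where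
  "rho_i N \<sigma> q x = (\<Sum>n\<in>Gam N. \<sigma> (x - rv n - q n))"

text \<open>Electron density: for each j, integrate |psi|^2 over all x_l, l ~= j, with x_j = x.
  We integrate over the full torus with the j-th coordinate replaced by x and divide
  by the volume N^3 of the (unused) j-th factor.\<close>
definition rho_e :: "nat \<Rightarrow> real \<Rightarrow> (real^3^'n::finite \<Rightarrow> complex) \<Rightarrow> real^3 \<Rightarrow> real" where
  "rho_e N e \<psi> x = - e * (\<Sum>j\<in>UNIV.
      (LINT y:Tb N|lborel. (cmod (\<psi> (\<chi> l. if l = j then x else y $ l)))\<^sup>2) / (real N)^3)"

definition is_G :: "nat \<Rightarrow> (real^3 \<Rightarrow> real) \<Rightarrow> (real^3 \<Rightarrow> real) \<Rightarrow> bool" where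
  "is_G N \<rho> \<Phi> \<longleftrightarrow> \<Phi> \<in> borel_measurable borel \<and> per N \<Phi> \<and> set_integrable lborel (Tb N) \<Phi> \<and>
     (\<forall>k\<in>latt. fc N (\<lambda>x. complex_of_real (\<Phi> x)) k =
        (if k = 0 then 0
         else fc N (\<lambda>x. complex_of_real (\<rho> x)) k / complex_of_real ((2 * pi / real N)\<^sup>2 * (norm k)\<^sup>2)))"

definition Gop :: "nat \<Rightarrow> (real^3 \<Rightarrow> real) \<Rightarrow> (real^3 \<Rightarrow> real)" where
  "Gop N \<rho> = (SOME \<Phi>. is_G N \<rho> \<Phi>)"

definition rho :: "nat \<Rightarrow> real \<Rightarrow> (real^3 \<Rightarrow> real) \<Rightarrow> ('n::finite) state \<Rightarrow> real^3 \<Rightarrow> real" where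
  "rho N e \<sigma> X x = rho_i N \<sigma> (qs X) x + rho_e N e (wf X) x"

definition Phi :: "nat \<Rightarrow> real \<Rightarrow> (real^3 \<Rightarrow> real) \<Rightarrow> ('n::finite) state \<Rightarrow> real^3 \<Rightarrow> real" where
  "Phi N e \<sigma> X = Gop N (rho N e \<sigma> X)"

definition En :: "nat \<Rightarrow> real \<Rightarrow> real \<Rightarrow> (real^3 \<Rightarrow> real) \<Rightarrow> ('n::finite) state \<Rightarrow> real" where
  "En N e M \<sigma> X =
     1/2 * (LINT x:Tb N|lborel. (\<Sum>b\<in>Basis. (cmod (wd N (wf X) b x))\<^sup>2))
   + 1/2 * (LINT x:Tb N|lborel. rho N e \<sigma> X x * Phi N e \<sigma> X x)
   + (\<Sum>n\<in>Gam N. (norm (ps X n))\<^sup>2 / (2 * M))"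

definition NL :: "nat \<Rightarrow> real \<Rightarrow> (real^3 \<Rightarrow> real) \<Rightarrow> ('n::finite) state \<Rightarrow> real^3^'n \<Rightarrow> complex" where
  "NL N e \<sigma> X x = complex_of_real (\<Sum>j\<in>UNIV. Phi N e \<sigma> X (x $ j)) * wf X x"

definition force :: "nat \<Rightarrow> real \<Rightarrow> (real^3 \<Rightarrow> real) \<Rightarrow> ('n::finite) state \<Rightarrow> int^3 \<Rightarrow> real^3" where
  "force N e \<sigma> X n = (\<Sum>b\<in>Basis.
      (LINT x:Tb N|lborel. wd N (Phi N e \<sigma> X) b x * \<sigma> (x - rv n - qs X n)) *\<^sub>R b)"

text \<open>Dispersion: e^{(i/2) t Delta} acts on the mode with frequency (2 pi/N) k as
  multiplication by cis (- t |xi|^2 / 2).\<close>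
definition omega :: "nat \<Rightarrow> 'a::euclidean_space \<Rightarrow> real" where
  "omega N k = (2 * pi / real N)\<^sup>2 * (norm k)\<^sup>2 / 2"

text \<open>Solutions on R in C(R, V), Duhamel form (the Schroedinger Duhamel formula is imposed
  on every Fourier coefficient).\<close>
definition sol :: "nat \<Rightarrow> real \<Rightarrow> real \<Rightarrow> (real^3 \<Rightarrow> real) \<Rightarrow> (real \<Rightarrow> ('n::finite) state) \<Rightarrow> bool" where
  "sol N e M \<sigma> X \<longleftrightarrow>
     (\<forall>t. Vsp N (X t)) \<and>
     (\<forall>t. ((\<lambda>s. dV N (X s) (X t)) \<longlongrightarrow> 0) (at t)) \<and>
     (\<forall>s. set_integrable lborel (Tb N) (NL N e \<sigma> (X s))) \<and>
     (\<forall>t. \<forall>k\<in>latt.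
        interval_lebesgue_integrable lborel (ereal 0) (ereal t)
          (\<lambda>s. cis (- (t - s) * omega N k) * fc N (NL N e \<sigma> (X s)) k) \<and>
        fc N (wf (X t)) k =
          cis (- t * omega N k) * fc N (wf (X 0)) k
          + \<i> * complex_of_real e *
            (LBINT s=ereal 0..ereal t. cis (- (t - s) * omega N k) * fc N (NL N e \<sigma> (X s)) k)) \<and>
     (\<forall>t. \<forall>n\<in>Gam N.
        interval_lebesgue_integrable lborel (ereal 0) (ereal t) (\<lambda>s. ps (X s) n) \<and>
        teq N (qs (X t) n) (qs (X 0) n + (1 / M) *\<^sub>R (LBINT s=ereal 0..ereal t. ps (X s) n))) \<and>
     (\<forall>t. \<forall>n\<in>Gam N.
        interval_lebesgue_integrable lborel (ereal 0) (ereal t) (\<lambda>s. force N e \<sigma> (X s) n) \<and>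
        ps (X t) n = ps (X 0) n - (LBINT s=ereal 0..ereal t. force N e \<sigma> (X s) n))"

end

theory Submission
  imports Defs
begin

text \<open>Everything is transported to Fourier coefficients weighted by \<open>\<surd>(1 + |\<xi>|\<^sup>2)\<close>, so that
  \<open>H\<^sup>1\<close> of the torus becomes an \<open>\<ell>\<^sup>2\<close> space and the free evolution a diagonal unitary group. In the
  interaction picture \<open>\<phi>(t) = exp(-it\<Delta>/2) \<psi>(t)\<close> the Duhamel equations are an ordinary differential
  equation whose field is locally Lipschitz: it is assembled from the trilinear form
  \<open>\<Sum> \<gamma>(m) h(m) u(a - m) v(a)\<^sup>*\<close>, bounded because \<open>\<Sum> (1 + |m|\<^sup>2)\<^sup>-\<^sup>2\<close> converges over a
  three-dimensional lattice, and from phases \<open>exp(-i m q)\<close>, which are Lipschitz in \<open>q\<close> since \<open>\<sigma>\<close>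
  has one derivative to spare. Energy and charge are conserved along the flow; the energy is a sum
  of nonnegative terms, so together they bound \<open>\<psi>\<close> and \<open>p\<close>, and solutions are global. Antisymmetry
  persists because the field commutes with the signed permutation operators and solutions are
  unique.\<close>

section \<open>Square-summable families\<close>

text \<open>What shapes the energy identity is that \<open>\<psi> = U \<phi>\<close> need not be
  differentiable with values in H^1, even for a smooth curve \<open>\<phi>\<close>: the Laplacian
  costs two orders. Only \<open>\<psi>\<close> weighted by \<open>1 / wt^2\<close> is
  differentiable. The increment of the potential energy is therefore factored exactly, and the
  adjointness of the density operator \<open>Dop\<close> and the potential operator
  \<open>Bop\<close> puts that weight on the increment of \<open>\<psi>\<close>. Although
  \<open>\<psi>\<close> depends on the coordinates of all particles, a three-dimensional lattice sum
  suffices, because each density or potential involves one particle at a time and the weight of a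
  full frequency dominates that of any of its components. The lifted positions may drift without
  bound. This is harmless: they enter the field only through phases that are bounded and uniformly
  Lipschitz, so every estimate is relative to \<open>nu\<close>, which ignores them. Potentials and
  weak derivatives are arbitrary choices, wave functions are determined up to null sets and
  positions up to periods; all of them are handled through their Fourier coefficients, which do not
  depend on such choices.\<close>

definition sq_summable :: "('a \<Rightarrow> complex) \<Rightarrow> bool" where
  "sq_summable f \<longleftrightarrow> (\<lambda>k. (cmod (f k))\<^sup>2) summable_on UNIV"

lemma nonneg_summable_on_bound:
  fixes f :: "'a \<Rightarrow> real"
  assumes "\<And>x. x \<in> A \<Longrightarrow> 0 \<le> f x" and "\<And>F. finite F \<Longrightarrow> F \<subseteq> A \<Longrightarrow> sum f F \<le> C"
  shows "f summable_on A" and "infsum f A \<le> C"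
proof -
  show "f summable_on A"
    by (rule nonneg_bounded_partial_sums_imp_summable_on[where C=C])
       (auto intro!: eventually_finite_subsets_at_top_weakI assms)
  then show "infsum f A \<le> C"
    by (intro infsum_le_finite_sums) (use assms in auto)
qed

lemma sq_summableI:
  assumes "\<And>F. finite F \<Longrightarrow> (\<Sum>k\<in>F. (cmod (f k))\<^sup>2) \<le> C"
  shows "sq_summable f"
  unfolding sq_summable_def by (rule nonneg_summable_on_bound(1)[where C=C]) (auto intro: assms)

lemma sq_summable_mono:
  assumes "sq_summable g" "\<And>k. cmod (f k) \<le> C * cmod (g k)"
  shows "sq_summable f"
proof -
  have "(\<lambda>k. C\<^sup>2 * (cmod (g k))\<^sup>2) summable_on UNIV"
    using assms(1) unfolding sq_summable_def by (intro summable_on_cmult_right)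
  then show ?thesis unfolding sq_summable_def
  proof (rule summable_on_comparison_test)
    fix k show "(cmod (f k))\<^sup>2 \<le> C\<^sup>2 * (cmod (g k))\<^sup>2"
      using power_mono[OF assms(2), of k 2] by (simp add: power_mult_distrib)
  qed auto
qed

lemma sq_summable_add:
  assumes "sq_summable f" "sq_summable g" shows "sq_summable (\<lambda>k. f k + g k)"
proof -
  have "(\<lambda>k. 2 * (cmod (f k))\<^sup>2 + 2 * (cmod (g k))\<^sup>2) summable_on UNIV"
    using assms unfolding sq_summable_def by (intro summable_on_add summable_on_cmult_right) auto
  then show ?thesis unfolding sq_summable_def
  proof (rule summable_on_comparison_test)
    fix k
    have "(cmod (f k + g k))\<^sup>2 \<le> (cmod (f k) + cmod (g k))\<^sup>2"
      by (intro power_mono norm_triangle_ineq) auto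
    also have "\<dots> \<le> 2 * (cmod (f k))\<^sup>2 + 2 * (cmod (g k))\<^sup>2"
      using sum_squares_ge_zero[of "cmod (f k) - cmod (g k)" 0] by (simp add: power2_eq_square algebra_simps)
    finally show "(cmod (f k + g k))\<^sup>2 \<le> 2 * (cmod (f k))\<^sup>2 + 2 * (cmod (g k))\<^sup>2" .
  qed auto
qed

lemma sq_summable_product:
  assumes "sq_summable f" "sq_summable g"
  shows "(\<lambda>k. norm (f k * g k)) summable_on UNIV"
proof -
  have "(\<lambda>k. (cmod (f k))\<^sup>2 + (cmod (g k))\<^sup>2) summable_on UNIV"
    using assms unfolding sq_summable_def by (intro summable_on_add) auto
  then show ?thesis
  proof (rule summable_on_comparison_test)
    fix k
    have "0 \<le> (cmod (f k) - cmod (g k))\<^sup>2 + ((cmod (f k))\<^sup>2 + (cmod (g k))\<^sup>2)" by simp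
    then show "norm (f k * g k) \<le> (cmod (f k))\<^sup>2 + (cmod (g k))\<^sup>2"
      by (simp add: norm_mult power2_eq_square algebra_simps)
  qed auto
qed

lemma sq_summable_cnj [simp]: "sq_summable (\<lambda>k. cnj (f k)) \<longleftrightarrow> sq_summable f"
  by (simp add: sq_summable_def)

text \<open>A type of its own, so that it can be an instance of \<open>banach\<close> and carry
  derivatives, integrals and fixed points. The index runs over a whole type; families living on the
  lattice are extended by zero.\<close>

typedef 'a ell2 = "{f :: 'a \<Rightarrow> complex. sq_summable f}"
  morphisms cf Ell2
  by (rule exI[of _ "\<lambda>_. 0"]) (simp add: sq_summable_def)

setup_lifting type_definition_ell2

lemma sq_summable_cf [simp]: "sq_summable (cf u)"
  using cf by blast

lemma cf_Ell2: "sq_summable f \<Longrightarrow> cf (Ell2 f) = f"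
  by (simp add: Ell2_inverse)

lemma ell2_eqI: "(\<And>k. cf u k = cf v k) \<Longrightarrow> u = v"
  by (metis cf_inject ext)

instantiation ell2 :: (type) real_inner
begin

lift_definition zero_ell2 :: "'a ell2" is "\<lambda>_. 0" by (simp add: sq_summable_def)
lift_definition plus_ell2 :: "'a ell2 \<Rightarrow> 'a ell2 \<Rightarrow> 'a ell2" is "\<lambda>f g k. f k + g k"
  by (rule sq_summable_add)
lift_definition uminus_ell2 :: "'a ell2 \<Rightarrow> 'a ell2" is "\<lambda>f k. - f k"
  by (simp add: sq_summable_def)
definition minus_ell2 :: "'a ell2 \<Rightarrow> 'a ell2 \<Rightarrow> 'a ell2" where "minus_ell2 u v = u + - v"
lift_definition scaleR_ell2 :: "real \<Rightarrow> 'a ell2 \<Rightarrow> 'a ell2" is "\<lambda>r f k. r *\<^sub>R f k"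
  by (rule sq_summable_mono) (auto)
text \<open>The real part yields the real Hilbert space structure of the phase space; multiplication
  by \<i> is antisymmetric for it.\<close>

definition inner_ell2 :: "'a ell2 \<Rightarrow> 'a ell2 \<Rightarrow> real" where
  "inner_ell2 u v = (\<Sum>\<^sub>\<infinity>k. Re (cf u k * cnj (cf v k)))"
definition norm_ell2 :: "'a ell2 \<Rightarrow> real" where "norm_ell2 u = sqrt (inner u u)"
definition sgn_ell2 :: "'a ell2 \<Rightarrow> 'a ell2" where "sgn_ell2 u = scaleR (inverse (norm u)) u"
definition dist_ell2 :: "'a ell2 \<Rightarrow> 'a ell2 \<Rightarrow> real" where "dist_ell2 u v = norm (u - v)"
definition uniformity_ell2 :: "('a ell2 \<times> 'a ell2) filter" where
  "uniformity_ell2 = (INF e\<in>{0<..}. principal {(x, y). dist x y < e})"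
definition open_ell2 :: "'a ell2 set \<Rightarrow> bool" where
  "open_ell2 U = (\<forall>x\<in>U. eventually (\<lambda>(x', y). x' = x \<longrightarrow> y \<in> U) uniformity)"

lemma cf_inner_summable: "(\<lambda>k. Re (cf u k * cnj (cf v k))) summable_on UNIV"
  by (rule summable_on_Re[OF abs_summable_summable[OF sq_summable_product]]) auto

lemma cf_norm_summable: "(\<lambda>k. (cmod (cf u k))\<^sup>2) summable_on UNIV"
  using sq_summable_cf[of u] by (simp add: sq_summable_def)

instance
proof
  show "a + b + c = a + (b + c)" "a + b = b + a" "0 + a = a" for a b c :: "'a ell2"
    by (transfer, simp add: algebra_simps)+
  show "- a + a = 0" "a - b = a + - b" for a b :: "'a ell2"
    unfolding minus_ell2_def by (transfer, simp)+
  show "r *\<^sub>R (a + b) = r *\<^sub>R a + r *\<^sub>R b" "(r + s) *\<^sub>R a = r *\<^sub>R a + s *\<^sub>R a"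
    "r *\<^sub>R s *\<^sub>R a = (r * s) *\<^sub>R a" "1 *\<^sub>R a = a" for a b :: "'a ell2" and r s
    by (transfer, simp add: algebra_simps)+
  show "dist a b = norm (a - b)" "sgn a = inverse (norm a) *\<^sub>R a" "norm a = sqrt (inner a a)" for a b :: "'a ell2"
    by (simp_all add: dist_ell2_def sgn_ell2_def norm_ell2_def)
  show "uniformity = (INF e\<in>{0<..}. principal {(x, y). dist (x::'a ell2) y < e})"
    by (rule uniformity_ell2_def)
  show "open U = (\<forall>x\<in>U. eventually (\<lambda>(x', y). x' = x \<longrightarrow> y \<in> U) uniformity)" for U :: "'a ell2 set"
    by (rule open_ell2_def)
  show "inner a b = inner b a" for a b :: "'a ell2"
    unfolding inner_ell2_def by (intro infsum_cong) (simp add: algebra_simps)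
  show "inner (a + b) c = inner a c + inner b c" for a b c :: "'a ell2"
    unfolding inner_ell2_def
    by (subst infsum_add[symmetric, OF cf_inner_summable cf_inner_summable])
       (simp add: plus_ell2.rep_eq algebra_simps)
  show "inner (r *\<^sub>R a) b = r * inner a b" for a b :: "'a ell2" and r
    unfolding inner_ell2_def infsum_cmult_right'[symmetric]
    by (simp add: scaleR_ell2.rep_eq algebra_simps)
  have nn: "Re (cf a k * cnj (cf a k)) = (cmod (cf a k))\<^sup>2" for a :: "'a ell2" and k
    by (simp add: complex_norm_square[symmetric])
  show "0 \<le> inner a a" for a :: "'a ell2"
    unfolding inner_ell2_def nn by (rule infsum_nonneg) simp
  show "(inner a a = 0) = (a = 0)" for a :: "'a ell2"
  proof
    assume "inner a a = 0"
    then have "(cmod (cf a k))\<^sup>2 = 0" for k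
      unfolding inner_ell2_def nn
      by (intro nonneg_infsum_le_0D[where A=UNIV and f="\<lambda>k. (cmod (cf a k))\<^sup>2"] cf_norm_summable) auto
    then show "a = 0" by (intro ell2_eqI) (simp add: zero_ell2.rep_eq)
  qed (simp add: inner_ell2_def zero_ell2.rep_eq)
qed

end

lemma cf_simps [simp]:
  "cf 0 k = 0" "cf (u + v) k = cf u k + cf v k" "cf (- u) k = - cf u k"
  "cf (r *\<^sub>R u) k = r *\<^sub>R cf u k"
  by (simp_all add: zero_ell2.rep_eq plus_ell2.rep_eq uminus_ell2.rep_eq scaleR_ell2.rep_eq)

lemma cf_diff [simp]: "cf (u - v) k = cf u k - cf v k"
  using cf_simps(2)[of u "- v" k] by simp

lemma cf_sum [simp]: "cf (sum f A) k = (\<Sum>i\<in>A. cf (f i) k)"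
  by (induction A rule: infinite_finite_induct) auto

lemma norm_ell2_sq: "(norm u)\<^sup>2 = (\<Sum>\<^sub>\<infinity>k. (cmod (cf u k))\<^sup>2)"
  unfolding power2_norm_eq_inner[of u] inner_ell2_def
  by (intro infsum_cong) (simp add: complex_norm_square[symmetric])

lemma sum_le_norm_ell2:
  assumes "finite F" shows "(\<Sum>k\<in>F. (cmod (cf u k))\<^sup>2) \<le> (norm u)\<^sup>2"
  unfolding norm_ell2_sq by (rule finite_sum_le_infsum) (use assms in \<open>auto simp: cf_norm_summable\<close>)

lemma norm_ell2_le:
  assumes "0 \<le> C" "\<And>F. finite F \<Longrightarrow> (\<Sum>k\<in>F. (cmod (cf u k))\<^sup>2) \<le> C\<^sup>2"
  shows "norm u \<le> C"
proof -
  have "(norm u)\<^sup>2 \<le> C\<^sup>2"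
    unfolding norm_ell2_sq by (rule nonneg_summable_on_bound(2)) (auto intro: assms)
  then show ?thesis using assms(1) power2_le_imp_le by blast
qed

lemma cf_le_norm: "cmod (cf u k) \<le> norm u"
proof -
  have "(cmod (cf u k))\<^sup>2 \<le> (norm u)\<^sup>2" using sum_le_norm_ell2[of "{k}" u] by simp
  then show ?thesis using power2_le_imp_le norm_ge_zero by blast
qed

lemma bounded_linear_cf: "bounded_linear (\<lambda>u. cf u k)"
  by (rule bounded_linear_intro[where K=1]) (auto simp: cf_le_norm)

text \<open>The coordinatewise limit is also the norm limit, because the Cauchy estimate on finite
  partial sums passes to the limit in one index and is uniform in the finite set.\<close>

instance ell2 :: (type) banach
proof
  fix X :: "nat \<Rightarrow> 'a ell2"
  assume C: "Cauchy X"
  have "\<exists>l. (\<lambda>n. cf (X n) k) \<longlonglongrightarrow> l" for k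
    using Cauchy_convergent[OF bounded_linear.Cauchy[OF bounded_linear_cf C, of k]] by (simp add: convergent_def)
  then obtain f where f: "\<And>k. (\<lambda>n. cf (X n) k) \<longlonglongrightarrow> f k" by metis
  have bd: "\<exists>n0. \<forall>n\<ge>n0. \<forall>F. finite F \<longrightarrow> (\<Sum>k\<in>F. (cmod (cf (X n) k - f k))\<^sup>2) \<le> e\<^sup>2" if "e > 0" for e
  proof -
    obtain n0 where n0: "\<And>m n. m \<ge> n0 \<Longrightarrow> n \<ge> n0 \<Longrightarrow> dist (X m) (X n) < e"
      using C \<open>e > 0\<close> unfolding Cauchy_def by blast
    show ?thesis
    proof (intro exI[of _ n0] allI impI)
      fix n and F :: "'a set" assume n: "n0 \<le> n" and F: "finite F"
      have "(\<lambda>m. \<Sum>k\<in>F. (cmod (cf (X n) k - cf (X m) k))\<^sup>2) \<longlonglongrightarrow> (\<Sum>k\<in>F. (cmod (cf (X n) k - f k))\<^sup>2)"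
        by (intro tendsto_intros f)
      moreover have "\<forall>\<^sub>F m in sequentially. (\<Sum>k\<in>F. (cmod (cf (X n) k - cf (X m) k))\<^sup>2) \<le> e\<^sup>2"
        unfolding eventually_sequentially
      proof (intro exI[of _ n0] allI impI)
        fix m assume m: "n0 \<le> m"
        have "(\<Sum>k\<in>F. (cmod (cf (X n) k - cf (X m) k))\<^sup>2) \<le> (norm (X n - X m))\<^sup>2"
          using sum_le_norm_ell2[OF F, of "X n - X m"] by simp
        also have "\<dots> \<le> e\<^sup>2" using n0[OF n m] by (intro power_mono) (auto simp: dist_norm)
        finally show "(\<Sum>k\<in>F. (cmod (cf (X n) k - cf (X m) k))\<^sup>2) \<le> e\<^sup>2" .
      qed
      ultimately show "(\<Sum>k\<in>F. (cmod (cf (X n) k - f k))\<^sup>2) \<le> e\<^sup>2"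
        by (rule tendsto_upperbound) simp
    qed
  qed
  obtain n0 where n0: "\<And>F. finite F \<Longrightarrow> (\<Sum>k\<in>F. (cmod (cf (X n0) k - f k))\<^sup>2) \<le> 1\<^sup>2"
    using bd[of 1] by auto
  \<comment> \<open>The limit is a member of the sequence minus a square-summable difference, hence
    square-summable itself.\<close>
  have "sq_summable (\<lambda>k. cf (X n0) k + (-1) * (cf (X n0) k - f k))"
    by (intro sq_summable_add sq_summable_cf sq_summableI[where C="1\<^sup>2"])
       (use n0 in \<open>simp add: norm_minus_commute\<close>)
  then have f2: "sq_summable f" by simp
  have "X \<longlonglongrightarrow> Ell2 f"
  proof (rule LIMSEQ_I)
    fix r :: real assume "0 < r"
    then obtain n0 where n0: "\<forall>n\<ge>n0. \<forall>F. finite F \<longrightarrow> (\<Sum>k\<in>F. (cmod (cf (X n) k - f k))\<^sup>2) \<le> (r/2)\<^sup>2"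
      using bd[of "r/2"] by auto
    show "\<exists>no. \<forall>n\<ge>no. norm (X n - Ell2 f) < r"
    proof (intro exI[of _ n0] allI impI)
      fix n assume "n0 \<le> n"
      then have "norm (X n - Ell2 f) \<le> r/2"
        using \<open>0 < r\<close> n0 by (intro norm_ell2_le) (auto simp: cf_Ell2[OF f2])
      then show "norm (X n - Ell2 f) < r" using \<open>0 < r\<close> by simp
    qed
  qed
  then show "convergent X" by (auto simp: convergent_def)
qed

text \<open>Multiplication operators are only defined for multipliers bounded by \<open>C\<close>; otherwise the
  value of \<open>Ell2\<close> is unspecified.\<close>

definition diag :: "('a \<Rightarrow> complex) \<Rightarrow> 'a ell2 \<Rightarrow> 'a ell2" where
  "diag f u = Ell2 (\<lambda>k. f k * cf u k)"

lemma cf_diag: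
  assumes "\<And>k. cmod (f k) \<le> C" shows "cf (diag f u) k = f k * cf u k"
  unfolding diag_def
  by (subst cf_Ell2, rule sq_summable_mono[where g="cf u" and C=C])
     (auto simp: norm_mult assms intro!: mult_right_mono)

lemma norm_diag_le:
  assumes "\<And>k. cmod (f k) \<le> C" shows "norm (diag f u) \<le> C * norm u"
proof (rule norm_ell2_le)
  have C: "0 \<le> C" using order_trans[OF norm_ge_zero assms] by blast
  then show "0 \<le> C * norm u" by simp
  fix F :: "'a set" assume F: "finite F"
  have "(\<Sum>k\<in>F. (cmod (cf (diag f u) k))\<^sup>2) \<le> (\<Sum>k\<in>F. C\<^sup>2 * (cmod (cf u k))\<^sup>2)"
    by (intro sum_mono) (auto simp: cf_diag[OF assms] norm_mult power_mult_distrib intro!: mult_right_mono power_mono assms)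
  also have "\<dots> = C\<^sup>2 * (\<Sum>k\<in>F. (cmod (cf u k))\<^sup>2)"
    by (simp add: sum_distrib_left)
  also have "\<dots> \<le> C\<^sup>2 * (norm u)\<^sup>2"
    by (intro mult_left_mono sum_le_norm_ell2 F) auto
  finally show "(\<Sum>k\<in>F. (cmod (cf (diag f u) k))\<^sup>2) \<le> (C * norm u)\<^sup>2"
    by (simp add: power_mult_distrib)
qed

lemma bounded_linear_diag:
  assumes "\<And>k. cmod (f k) \<le> C" shows "bounded_linear (diag f)"
  using norm_diag_le[OF assms] by (intro bounded_linear_intro[where K=C])
     (auto intro!: ell2_eqI simp: cf_diag[OF assms] algebra_simps)

lemma inner_diag:
  assumes "\<And>k. cmod (f k) \<le> C"
  shows "inner (diag f u) v = inner u (diag (\<lambda>k. cnj (f k)) v)"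
proof -
  have "cmod (cnj (f k)) \<le> C" for k using assms by simp
  note b = cf_diag[OF assms] cf_diag[OF this]
  show ?thesis unfolding inner_ell2_def b by (intro infsum_cong) (simp add: algebra_simps)
qed

text \<open>A multiplier of modulus at most one that vanishes on \<open>F\<close> sees only the tail
  of \<open>u\<close>, so \<open>F\<close> can be chosen before the multiplier. This uniformity
  drives the strong convergence below.\<close>

lemma ell2_tail_small:
  assumes "0 < e"
  obtains F where "finite F" "\<And>f. (\<And>k. k \<in> F \<Longrightarrow> f k = 0) \<Longrightarrow> (\<And>k. cmod (f k) \<le> 1) \<Longrightarrow> norm (diag f u) \<le> e"
proof -
  obtain F where F: "finite F" "dist (\<Sum>k\<in>F. (cmod (cf u k))\<^sup>2) ((norm u)\<^sup>2) \<le> e\<^sup>2"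
    using infsum_finite_approximation[of "\<lambda>k. (cmod (cf u k))\<^sup>2" UNIV "e\<^sup>2"] assms
    unfolding norm_ell2_sq by (auto simp: cf_norm_summable)
  show thesis
  proof (rule that[OF F(1)])
    fix f :: "'a \<Rightarrow> complex" assume f0: "\<And>k. k \<in> F \<Longrightarrow> f k = 0" and f1: "\<And>k. cmod (f k) \<le> 1"
    show "norm (diag f u) \<le> e"
    proof (rule norm_ell2_le)
      fix G :: "'a set" assume G: "finite G"
      have "(\<Sum>k\<in>G. (cmod (cf (diag f u) k))\<^sup>2) \<le> (\<Sum>k\<in>G-F. (cmod (cf u k))\<^sup>2)"
      proof -
        have "(\<Sum>k\<in>G. (cmod (cf (diag f u) k))\<^sup>2) = (\<Sum>k\<in>G-F. (cmod (cf (diag f u) k))\<^sup>2)"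
          by (rule sum.mono_neutral_right) (use G in \<open>auto simp: cf_diag[OF f1] f0\<close>)
        also have "\<dots> \<le> (\<Sum>k\<in>G-F. (cmod (cf u k))\<^sup>2)"
          by (intro sum_mono power_mono) (auto simp: cf_diag[OF f1] norm_mult f1 mult_left_le_one_le)
        finally show ?thesis .
      qed
      also have "\<dots> = (\<Sum>k\<in>G\<union>F. (cmod (cf u k))\<^sup>2) - (\<Sum>k\<in>F. (cmod (cf u k))\<^sup>2)"
        using sum_diff[of "G \<union> F" F "\<lambda>k. (cmod (cf u k))\<^sup>2"] F(1) G by (simp add: Un_Diff)
      also have "\<dots> \<le> e\<^sup>2"
        using sum_le_norm_ell2[of "G \<union> F" u] F G by (auto simp: dist_real_def)
      finally show "(\<Sum>k\<in>G. (cmod (cf (diag f u) k))\<^sup>2) \<le> e\<^sup>2" .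
    qed (use assms in auto)
  qed
qed

text \<open>Pointwise convergence with a common bound gives convergence on each fixed vector, not in
  operator norm: finitely many indices are handled by the pointwise limit, the others by the tail of
  \<open>u\<close>.\<close>

lemma diag_tendsto_strong:
  fixes f :: "'b \<Rightarrow> 'a \<Rightarrow> complex"
  assumes lim: "\<And>k. ((\<lambda>x. f x k) \<longlongrightarrow> g k) L" and bd: "\<And>x k. cmod (f x k) \<le> C" and bg: "\<And>k. cmod (g k) \<le> C"
  shows "((\<lambda>x. diag (f x) u) \<longlongrightarrow> diag g u) L"
proof (rule tendstoI)
  fix e :: real assume e: "0 < e"
  have C0: "0 \<le> C" using order_trans[OF norm_ge_zero bg] by blast
  define K where "K = 2 * C + 1"
  have K: "K > 0" "cmod (f x k - g k) \<le> K" for x k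
    using norm_triangle_ineq4[of "f x k" "g k"] bd[of x k] bg[of k] C0 by (auto simp: K_def)
  obtain F where F: "finite F" "\<And>f. (\<And>k. k \<in> F \<Longrightarrow> f k = 0) \<Longrightarrow> (\<And>k. cmod (f k) \<le> 1) \<Longrightarrow> norm (diag f u) \<le> e/(4*K)"
    using ell2_tail_small[of "e/(4*K)" u] e K(1) by (metis divide_pos_pos mult_pos_pos zero_less_numeral)
  have "((\<lambda>x. \<Sum>k\<in>F. cmod (f x k - g k) * cmod (cf u k)) \<longlongrightarrow> (\<Sum>k\<in>F. cmod (g k - g k) * cmod (cf u k))) L"
    by (intro tendsto_intros lim)
  then have "\<forall>\<^sub>F x in L. (\<Sum>k\<in>F. cmod (f x k - g k) * cmod (cf u k)) < e/4"
    by (rule order_tendstoD) (use e in auto)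
  then show "\<forall>\<^sub>F x in L. dist (diag (f x) u) (diag g u) < e"
  proof eventually_elim
    case (elim x)
    define a where "a k = (if k \<in> F then f x k - g k else 0)" for k
    \<comment> \<open>Scaling by \<open>1/K\<close> brings the tail multiplier below one, as the
      choice of \<open>F\<close> demands. \<open>K\<close> contains the summand 1 so that it is
      positive even for \<open>C = 0\<close>.\<close>
    define b where "b k = (if k \<in> F then 0 else (1/K) *\<^sub>R (f x k - g k))" for k
    have a: "cmod (a k) \<le> K" for k using K by (auto simp: a_def less_imp_le)
    have b: "cmod (b k) \<le> 1" for k
      using K(1) K(2)[of x k] by (simp add: b_def divide_le_eq)
    have "diag (f x) u - diag g u = diag a u + K *\<^sub>R diag b u"
      using K(1) by (intro ell2_eqI) (auto simp: cf_diag[OF a] cf_diag[OF b] cf_diag[OF bd] cf_diag[OF bg] a_def b_def algebra_simps)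
    then have "dist (diag (f x) u) (diag g u) \<le> norm (diag a u) + K * norm (diag b u)"
      using K(1) norm_triangle_ineq[of "diag a u" "K *\<^sub>R diag b u"] by (simp add: dist_norm)
    moreover have "norm (diag b u) \<le> e/(4*K)" by (rule F(2)[OF _ b]) (simp add: b_def)
    then have "K * norm (diag b u) \<le> e/4" using K(1) by (simp add: field_simps)
    moreover have "norm (diag a u) \<le> (\<Sum>k\<in>F. cmod (f x k - g k) * cmod (cf u k))"
    proof (rule norm_ell2_le)
      fix G :: "'a set" assume G: "finite G"
      have "(\<Sum>k\<in>G. (cmod (cf (diag a u) k))\<^sup>2) \<le> (\<Sum>k\<in>F. (cmod (f x k - g k) * cmod (cf u k))\<^sup>2)"
      proof -
        have "(\<Sum>k\<in>G. (cmod (cf (diag a u) k))\<^sup>2) = (\<Sum>k\<in>G\<inter>F. (cmod (f x k - g k) * cmod (cf u k))\<^sup>2)"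
          by (rule sum.mono_neutral_cong_right) (use G in \<open>auto simp: cf_diag[OF a] a_def norm_mult\<close>)
        also have "\<dots> \<le> (\<Sum>k\<in>F. (cmod (f x k - g k) * cmod (cf u k))\<^sup>2)"
          by (rule sum_mono2) (use F(1) in auto)
        finally show ?thesis .
      qed
      also have "\<dots> \<le> (\<Sum>k\<in>F. cmod (f x k - g k) * cmod (cf u k))\<^sup>2"
        using L2_set_le_sum[of F "\<lambda>k. cmod (f x k - g k) * cmod (cf u k)"]
        unfolding L2_set_def by (intro sqrt_le_D) auto
      finally show "(\<Sum>k\<in>G. (cmod (cf (diag a u) k))\<^sup>2) \<le> (\<Sum>k\<in>F. cmod (f x k - g k) * cmod (cf u k))\<^sup>2" .
    qed (auto intro!: sum_nonneg)
    ultimately show ?case using elim e by linarith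
  qed
qed

lemma diag_tendsto:
  fixes f :: "'b \<Rightarrow> 'a \<Rightarrow> complex"
  assumes lim: "\<And>k. ((\<lambda>x. f x k) \<longlongrightarrow> g k) L" and bd: "\<And>x k. cmod (f x k) \<le> C" and bg: "\<And>k. cmod (g k) \<le> C"
    and u: "(u \<longlongrightarrow> v) L"
  shows "((\<lambda>x. diag (f x) (u x)) \<longlongrightarrow> diag g v) L"
proof -
  have "((\<lambda>x. C * norm (u x - v)) \<longlongrightarrow> 0) L"
    by (rule tendsto_eq_intros u refl | simp)+
  then have "((\<lambda>x. diag (f x) (u x - v)) \<longlongrightarrow> 0) L"
    by (rule Lim_null_comparison[rotated]) (auto simp: norm_diag_le[OF bd])
  moreover have "((\<lambda>x. diag (f x) v) \<longlongrightarrow> diag g v) L"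
    by (rule diag_tendsto_strong[OF lim bd bg])
  ultimately have "((\<lambda>x. diag (f x) (u x - v) + diag (f x) v) \<longlongrightarrow> 0 + diag g v) L"
    by (rule tendsto_add)
  then show ?thesis
    by (simp add: linear_diff[OF bounded_linear.linear[OF bounded_linear_diag[OF bd]]])
qed

lemma has_vector_derivative_imp_continuous_on:
  assumes "\<And>s. s \<in> A \<Longrightarrow> (f has_vector_derivative f' s) (at s)"
  shows "continuous_on A f"
  using assms by (meson continuous_at_imp_continuous_on has_vector_derivative_continuous)

section \<open>Ordinary differential equations in Banach spaces\<close>

text \<open>The oriented integral from 0 to \<open>t\<close> for either sign of \<open>t\<close>:
  the interval in the wrong order is empty and contributes nothing.\<close>

definition primit :: "(real \<Rightarrow> 'y::banach) \<Rightarrow> real \<Rightarrow> 'y" where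
  "primit f t = integral {0..t} f - integral {t..0} f"

lemma primit_has_vector_derivative:
  assumes "continuous_on UNIV f"
  shows "(primit f has_vector_derivative f t) (at t)"
proof -
  \<comment> \<open>The base point is moved to \<open>-n\<close>, left of both 0 and
    \<open>t\<close>. Then \<open>t\<close> is interior to one interval on which a single primitive
    represents \<open>primit f\<close> up to a constant.\<close>
  define n where "n = \<bar>t\<bar> + 1"
  have ig: "f integrable_on {a..b}" for a b
    by (rule integrable_continuous_interval) (use assms continuous_on_subset in blast)
  have eq: "primit f s = integral {-n..s} f - integral {-n..0} f" if "s \<in> {-n..n}" for s
  proof (cases "s \<ge> 0")
    case True
    have "integral {-n..0} f + integral {0..s} f = integral {-n..s} f"
      by (rule Henstock_Kurzweil_Integration.integral_combine) (use that True ig in auto)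
    then show ?thesis using True by (cases "s = 0") (auto simp: primit_def algebra_simps)
  next
    case False
    have "integral {-n..s} f + integral {s..0} f = integral {-n..0} f"
      by (rule Henstock_Kurzweil_Integration.integral_combine) (use that False ig in auto)
    then show ?thesis using False by (auto simp: primit_def algebra_simps)
  qed
  have t: "t \<in> {-n<..<n}" by (auto simp: n_def)
  have "((\<lambda>s. integral {-n..s} f) has_vector_derivative f t) (at t within {-n..n})"
    by (rule integral_has_vector_derivative) (use t assms continuous_on_subset in \<open>auto\<close>)
  then have "((\<lambda>s. integral {-n..s} f - integral {-n..0} f) has_vector_derivative f t - 0) (at t within {-n<..<n})"
    by (intro has_vector_derivative_diff has_vector_derivative_const)
       (rule has_vector_derivative_within_subset, auto)
  then have "((\<lambda>s. integral {-n..s} f - integral {-n..0} f) has_vector_derivative f t) (at t)"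
    using at_within_open[OF t] by simp
  then show ?thesis
    by (rule has_vector_derivative_transform_within_open[OF _ open_greaterThanLessThan t]) (simp add: eq)
qed

lemma primit_0 [simp]: "primit f 0 = 0"
  by (simp add: primit_def)

lemma has_vector_derivative_eq_primit:
  fixes y :: "real \<Rightarrow> 'y::banach"
  assumes "continuous_on UNIV f" "\<And>t. (y has_vector_derivative f t) (at t)"
  shows "y t = y 0 + primit f t"
proof -
  have "((\<lambda>t. y t - primit f t) has_vector_derivative f t - f t) (at t)" for t
    by (intro has_vector_derivative_diff assms primit_has_vector_derivative)
  then have "((\<lambda>t. y t - primit f t) has_derivative (\<lambda>_. 0)) (at t)" for t
    by (simp add: has_vector_derivative_def)
  then obtain c where "\<And>t. y t - primit f t = c"
    using has_derivative_zero_constant[of UNIV "\<lambda>t. y t - primit f t"] by auto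
  from this[of 0] this[of t] show ?thesis by (simp add: algebra_simps)
qed

text \<open>Integrating the bound \<open>K * exp (l * \<bar>s\<bar>)\<close> gains the factor
  \<open>1 / l\<close>; a large \<open>l\<close> thus makes integral operators contractive in an
  exponentially weighted norm. Negative \<open>t\<close> is reduced to positive \<open>t\<close> by
  reflection.\<close>

lemma exp_bound_between:
  fixes f :: "real \<Rightarrow> 'y::banach"
  assumes f: "\<And>s. s \<in> closed_segment 0 t \<Longrightarrow> (f has_vector_derivative f' s) (at s)"
    and b: "\<And>s. s \<in> closed_segment 0 t \<Longrightarrow> norm (f' s) \<le> K * exp (l * \<bar>s\<bar>)" and l: "l > 0" and K: "K \<ge> 0"
  shows "norm (f t - f 0) \<le> K / l * exp (l * \<bar>t\<bar>)"
proof -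
  have main: "norm (g T - g 0) \<le> K / l * exp (l * T)"
    if T: "0 \<le> T" and g: "\<And>s. s \<in> {0..T} \<Longrightarrow> (g has_vector_derivative g' s) (at s)"
      and b: "\<And>s. s \<in> {0..T} \<Longrightarrow> norm (g' s) \<le> K * exp (l * s)" for T and g g' :: "real \<Rightarrow> 'y"
  proof (cases "T = 0")
    case True then show ?thesis using l K by simp
  next
    case False
    have "norm (g T - g 0) \<le> K / l * exp (l * T) - K / l * exp (l * 0)"
    proof (rule differentiable_bound_general[where f'=g' and \<phi>'="\<lambda>s. K * exp (l * s)"])
      show "continuous_on {0..T} g"
        by (rule has_vector_derivative_imp_continuous_on[OF g])
      show "continuous_on {0..T} (\<lambda>s. K / l * exp (l * s))" by (intro continuous_intros)
      show "((\<lambda>s. K / l * exp (l * s)) has_vector_derivative K * exp (l * x)) (at x)" for x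
        unfolding has_real_derivative_iff_has_vector_derivative[symmetric]
        using l by (auto intro!: derivative_eq_intros)
    qed (use T False g b in auto)
    moreover have "0 \<le> K / l * exp (l * 0)" using l K by simp
    ultimately show ?thesis by linarith
  qed
  show ?thesis
  proof (cases "t \<ge> 0")
    case True
    then show ?thesis using main[of t f f'] f b by (auto simp: closed_segment_eq_real_ivl)
  next
    case False
    have "norm ((\<lambda>s. f (- s)) (-t) - (\<lambda>s. f (- s)) 0) \<le> K / l * exp (l * (- t))"
    proof (rule main[where g'="\<lambda>s. - f' (- s)"])
      fix s assume s: "s \<in> {0..- t}"
      then have s': "- s \<in> closed_segment 0 t" using False by (auto simp: closed_segment_eq_real_ivl)
      have "((f \<circ> uminus) has_vector_derivative (-1) *\<^sub>R f' (- s)) (at s)"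
        by (rule vector_diff_chain_at) (auto intro!: derivative_eq_intros f s')
      then show "((\<lambda>s. f (- s)) has_vector_derivative - f' (- s)) (at s)" by (simp add: o_def)
      show "norm (- f' (- s)) \<le> K * exp (l * s)" using b[OF s'] s by simp
    qed (use False in auto)
    then show ?thesis using False by simp
  qed
qed

text \<open>A Gronwall argument by maximization: at a maximum point \<open>r\<close> of the
  exponentially damped norm, the gain \<open>1 / l\<close> shows that the maximum is at most half of
  itself.\<close>

lemma zero_of_derivative_bound:
  fixes f :: "real \<Rightarrow> 'y::banach"
  assumes f: "\<And>s. s \<in> closed_segment 0 t \<Longrightarrow> (f has_vector_derivative f' s) (at s)"
    and b: "\<And>s. s \<in> closed_segment 0 t \<Longrightarrow> norm (f' s) \<le> L * norm (f s)" and f0: "f 0 = 0"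
  shows "f t = 0"
proof -
  \<comment> \<open>Any positive \<open>l\<close> with \<open>\<bar>L\<bar> / l \<le> 1/2\<close>
    would do; the added 1 keeps it positive when \<open>L = 0\<close>.\<close>
  define l where "l = 2 * (\<bar>L\<bar> + 1)"
  have l: "l > 0" by (simp add: l_def)
  have "continuous_on (closed_segment 0 t) f"
    by (rule has_vector_derivative_imp_continuous_on[OF f])
  then have "continuous_on (closed_segment 0 t) (\<lambda>s. exp (- l * \<bar>s\<bar>) * norm (f s))"
    by (intro continuous_intros)
  then have "\<exists>r\<in>closed_segment 0 t. \<forall>s\<in>closed_segment 0 t.
      exp (- l * \<bar>s\<bar>) * norm (f s) \<le> exp (- l * \<bar>r\<bar>) * norm (f r)"
    by (intro continuous_attains_sup) auto
  then obtain r where r: "r \<in> closed_segment 0 t"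
    and max: "\<And>s. s \<in> closed_segment 0 t \<Longrightarrow> exp (- l * \<bar>s\<bar>) * norm (f s) \<le> exp (- l * \<bar>r\<bar>) * norm (f r)"
    by blast
  define m where "m = exp (- l * \<bar>r\<bar>) * norm (f r)"
  have m: "norm (f s) \<le> m * exp (l * \<bar>s\<bar>)" if "s \<in> closed_segment 0 t" for s
  proof -
    have "exp (l * \<bar>s\<bar>) * (exp (- l * \<bar>s\<bar>) * norm (f s)) \<le> exp (l * \<bar>s\<bar>) * m"
      using max[OF that] by (intro mult_left_mono) (auto simp: m_def)
    moreover have "exp (l * \<bar>s\<bar>) * (exp (- l * \<bar>s\<bar>) * norm (f s)) = norm (f s)"
      unfolding mult.assoc[symmetric] exp_add[symmetric] by simp
    ultimately show ?thesis by (simp only: mult.commute[of m])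
  qed
  have m0: "m \<ge> 0" by (simp add: m_def)
  have "norm (f r - f 0) \<le> (\<bar>L\<bar> * m) / l * exp (l * \<bar>r\<bar>)"
  proof (rule exp_bound_between[OF f _ l])
    fix s assume s: "s \<in> closed_segment 0 r"
    then show s': "s \<in> closed_segment 0 t"
      using r by (auto simp: closed_segment_eq_real_ivl split: if_splits)
    have "norm (f' s) \<le> L * norm (f s)" by (rule b[OF s'])
    also have "\<dots> \<le> \<bar>L\<bar> * norm (f s)" by (intro mult_right_mono) auto
    also have "\<dots> \<le> \<bar>L\<bar> * (m * exp (l * \<bar>s\<bar>))" by (intro mult_left_mono m[OF s']) auto
    finally show "norm (f' s) \<le> \<bar>L\<bar> * m * exp (l * \<bar>s\<bar>)" by (simp add: mult.assoc)
  qed (use m0 in auto)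
  then have "norm (f r) \<le> (\<bar>L\<bar> / l) * m * exp (l * \<bar>r\<bar>)" using f0 by simp
  also have "\<dots> \<le> (1/2) * m * exp (l * \<bar>r\<bar>)"
    using m0 by (intro mult_right_mono) (auto simp: l_def field_simps)
  finally have "exp (- l * \<bar>r\<bar>) * norm (f r) \<le> exp (- l * \<bar>r\<bar>) * ((1/2) * m * exp (l * \<bar>r\<bar>))"
    by (intro mult_left_mono) auto
  also have "\<dots> = (1/2) * m * exp (- l * \<bar>r\<bar> + l * \<bar>r\<bar>)" unfolding exp_add by (simp only: mult_ac)
  also have "\<dots> = m / 2" by simp
  finally have "m = 0" using m0 by (simp add: m_def)
  then show ?thesis using m[of t] by simp
qed

text \<open>Banach's fixed point theorem on the whole line at once. The unknown \<open>v\<close> is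
  the solution divided by \<open>exp (l * \<bar>t\<bar>)\<close>, a bounded continuous function; in
  this norm the Picard map contracts by 1/2, and the bound \<open>K\<close> on the field keeps its
  values in the space.\<close>

lemma ode_global_Lipschitz:
  fixes F :: "real \<Rightarrow> 'y::banach \<Rightarrow> 'y"
  assumes cont: "\<And>y. continuous_on UNIV y \<Longrightarrow> continuous_on UNIV (\<lambda>s. F s (y s))"
    and lip: "\<And>t x y. norm (F t x - F t y) \<le> L * norm (x - y)" and bd: "\<And>t x. norm (F t x) \<le> K"
  shows "\<exists>y. y 0 = y0 \<and> (\<forall>t. (y has_vector_derivative F t (y t)) (at t))"
proof -
  define l where "l = 2 * (\<bar>L\<bar> + 1)"
  have l: "l > 0" by (simp add: l_def)
  define Y where "Y v s = exp (l * \<bar>s\<bar>) *\<^sub>R apply_bcontfun v s" for v :: "real \<Rightarrow>\<^sub>C 'y" and s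
  have contv: "continuous_on UNIV (apply_bcontfun v)" for v :: "real \<Rightarrow>\<^sub>C 'y"
    by (rule continuous_on_apply_bcontfun) 
  have contY: "continuous_on UNIV (Y v)" for v
    unfolding Y_def[abs_def] by (intro continuous_intros contv)
  define Z where "Z v t = y0 + primit (\<lambda>s. F s (Y v s)) t" for v t
  have Zd: "(Z v has_vector_derivative F t (Y v t)) (at t)" for v t
    unfolding Z_def[abs_def]
    using has_vector_derivative_add[OF has_vector_derivative_const primit_has_vector_derivative[OF cont[OF contY]], of y0 v t]
    by simp
  have contZ: "continuous_on UNIV (Z v)" for v
    by (rule has_vector_derivative_imp_continuous_on[OF Zd])
  have K: "K \<ge> 0" using order_trans[OF norm_ge_zero bd] by blast
  have Zb: "norm (exp (- l * \<bar>t\<bar>) *\<^sub>R Z v t) \<le> norm y0 + K / l" for v t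
  proof -
    have "norm (Z v t - Z v 0) \<le> K / l * exp (l * \<bar>t\<bar>)"
    proof (rule exp_bound_between[OF Zd _ l K])
      show "norm (F s (Y v s)) \<le> K * exp (l * \<bar>s\<bar>)" for s
        using bd[of s "Y v s"] K l mult_left_mono[of 1 "exp (l * \<bar>s\<bar>)" K] by auto
    qed
    then have "norm (Z v t) \<le> norm y0 + K / l * exp (l * \<bar>t\<bar>)"
      using norm_triangle_ineq2[of "Z v t" "Z v 0"] by (simp add: Z_def)
    then have "exp (- l * \<bar>t\<bar>) * norm (Z v t) \<le> exp (- l * \<bar>t\<bar>) * (norm y0 + K / l * exp (l * \<bar>t\<bar>))"
      by (intro mult_left_mono) auto
    also have "\<dots> = exp (- l * \<bar>t\<bar>) * norm y0 + K / l * exp (- l * \<bar>t\<bar> + l * \<bar>t\<bar>)"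
      unfolding exp_add by (simp only: distrib_left mult_ac)
    also have "\<dots> = exp (- l * \<bar>t\<bar>) * norm y0 + K / l" by simp
    also have "\<dots> \<le> norm y0 + K / l"
      using l by (simp add: mult_left_le_one_le)
    finally show ?thesis by simp
  qed
  define T where "T v = Bcontfun (\<lambda>t. exp (- l * \<bar>t\<bar>) *\<^sub>R Z v t)" for v
  have T: "apply_bcontfun (T v) t = exp (- l * \<bar>t\<bar>) *\<^sub>R Z v t" for v t
  proof -
    have "(\<lambda>t. exp (- l * \<bar>t\<bar>) *\<^sub>R Z v t) \<in> bcontfun"
      by (rule bcontfun_normI[where b="norm y0 + K / l"])
         (use Zb in \<open>auto intro!: continuous_intros contZ\<close>)
    then show ?thesis unfolding T_def by (simp add: Bcontfun_inverse)
  qed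
  have "\<exists>!v\<in>UNIV. T v = v"
  proof (rule Banach_fix[of UNIV "1/2" T])
    show "dist (T v) (T w) \<le> 1/2 * dist v w" for v w
    proof (rule dist_bound)
      fix t
      have dvw: "norm (apply_bcontfun v s - apply_bcontfun w s) \<le> dist v w" for s
        using dist_bounded[of v s w] by (simp add: dist_norm)
      have "norm ((Z v t - Z w t) - (Z v 0 - Z w 0)) \<le> (\<bar>L\<bar> * dist v w) / l * exp (l * \<bar>t\<bar>)"
      proof (rule exp_bound_between[where f="\<lambda>t. Z v t - Z w t", OF has_vector_derivative_diff[OF Zd Zd] _ l])
        fix s
        have "norm (F s (Y v s) - F s (Y w s)) \<le> L * norm (Y v s - Y w s)" by (rule lip)
        also have "\<dots> \<le> \<bar>L\<bar> * norm (Y v s - Y w s)" by (intro mult_right_mono) auto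
        also have "\<dots> = \<bar>L\<bar> * (exp (l * \<bar>s\<bar>) * norm (apply_bcontfun v s - apply_bcontfun w s))"
          by (simp add: Y_def scaleR_diff_right[symmetric])
        also have "\<dots> \<le> \<bar>L\<bar> * (exp (l * \<bar>s\<bar>) * dist v w)" by (intro mult_left_mono dvw) auto
        finally show "norm (F s (Y v s) - F s (Y w s)) \<le> \<bar>L\<bar> * dist v w * exp (l * \<bar>s\<bar>)"
          by (simp add: mult_ac)
      qed auto
      then have "norm (Z v t - Z w t) \<le> (\<bar>L\<bar> * dist v w) / l * exp (l * \<bar>t\<bar>)" by (simp add: Z_def)
      then have "exp (- l * \<bar>t\<bar>) * norm (Z v t - Z w t) \<le> exp (- l * \<bar>t\<bar>) * ((\<bar>L\<bar> * dist v w) / l * exp (l * \<bar>t\<bar>))"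
        by (intro mult_left_mono) auto
      also have "\<dots> = (\<bar>L\<bar> / l) * dist v w * exp (- l * \<bar>t\<bar> + l * \<bar>t\<bar>)"
        unfolding exp_add by simp
      also have "\<dots> = (\<bar>L\<bar> / l) * dist v w" by simp
      also have "\<dots> \<le> 1/2 * dist v w" by (intro mult_right_mono) (auto simp: l_def field_simps)
      finally show "dist (apply_bcontfun (T v) t) (apply_bcontfun (T w) t) \<le> 1/2 * dist v w"
        by (simp add: T dist_norm scaleR_diff_right[symmetric])
    qed
  qed (auto simp: complete_UNIV)
  then obtain v where v: "T v = v" by auto
  have "Z v = Y v"
  proof
    fix t
    have "exp (l * \<bar>t\<bar>) *\<^sub>R apply_bcontfun (T v) t = Z v t"
      by (simp add: T exp_add[symmetric])
    then show "Z v t = Y v t" by (simp add: v Y_def)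
  qed
  moreover have "Z v 0 = y0" by (simp add: Z_def)
  ultimately show ?thesis using Zd[of v] by (intro exI[of _ "Z v"]) auto
qed

text \<open>Both curves are continuous, so \<open>nu\<close> is bounded along them on the segment
  from 0 to \<open>t\<close> and one Lipschitz constant applies there.\<close>

lemma ode_unique:
  fixes F :: "real \<Rightarrow> 'y::banach \<Rightarrow> 'y" and nu :: "'y \<Rightarrow> real"
  assumes lip: "\<And>R. \<exists>L. \<forall>t x y. nu x \<le> R \<longrightarrow> nu y \<le> R \<longrightarrow> norm (F t x - F t y) \<le> L * norm (x - y)"
    and nu: "continuous_on UNIV nu"
    and y: "\<And>t. (y has_vector_derivative F t (y t)) (at t)" and z: "\<And>t. (z has_vector_derivative F t (z t)) (at t)"
    and eq: "y 0 = z 0"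
  shows "y t = z t"
proof -
  have c: "continuous_on UNIV y" "continuous_on UNIV z"
    by (rule has_vector_derivative_imp_continuous_on[OF y], rule has_vector_derivative_imp_continuous_on[OF z])
  have "continuous_on (closed_segment 0 t) (\<lambda>s. max (nu (y s)) (nu (z s)))"
    by (intro continuous_intros continuous_on_compose2[OF nu]) (auto intro: continuous_on_subset[OF c(1)] continuous_on_subset[OF c(2)])
  then have "bounded ((\<lambda>s. max (nu (y s)) (nu (z s))) ` closed_segment 0 t)"
    by (intro compact_imp_bounded compact_continuous_image) auto
  then obtain R where "\<forall>s\<in>closed_segment 0 t. norm (max (nu (y s)) (nu (z s))) \<le> R"
    unfolding bounded_iff by auto
  then have R: "nu (y s) \<le> R" "nu (z s) \<le> R" if "s \<in> closed_segment 0 t" for s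
    using that by fastforce+
  obtain L where L: "\<And>t x y. nu x \<le> R \<Longrightarrow> nu y \<le> R \<Longrightarrow> norm (F t x - F t y) \<le> L * norm (x - y)"
    using lip by blast
  have "y t - z t = 0"
    by (rule zero_of_derivative_bound[where f="\<lambda>s. y s - z s", OF has_vector_derivative_diff[OF y z]])
       (auto intro!: L R simp: eq)
  then show ?thesis by simp
qed

text \<open>The a priori bound is only required of curves solving the equation up to time \<open>\<tau>\<close>; the
  vector field is cut off far outside the bound, and the first exit time leads to a contradiction.\<close>

lemma ode_global_apriori:
  fixes F :: "real \<Rightarrow> 'y::banach \<Rightarrow> 'y" and nu :: "'y \<Rightarrow> real"
  assumes cont: "\<And>y. continuous_on UNIV y \<Longrightarrow> continuous_on UNIV (\<lambda>s. F s (y s))"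
    and lip: "\<And>R. \<exists>L. \<forall>t x y. nu x \<le> R \<longrightarrow> nu y \<le> R \<longrightarrow> norm (F t x - F t y) \<le> L * norm (x - y) \<and> norm (F t x) \<le> L"
    and nu: "\<And>x y. \<bar>nu x - nu y\<bar> \<le> C * norm (x - y)"
    and apriori: "\<And>y \<tau>. y 0 = y0 \<Longrightarrow> (\<And>s. s \<in> closed_segment 0 \<tau> \<Longrightarrow> (y has_vector_derivative F s (y s)) (at s))
        \<Longrightarrow> nu (y \<tau>) \<le> B"
  shows "\<exists>y. y 0 = y0 \<and> (\<forall>t. (y has_vector_derivative F t (y t)) (at t))"
proof -
  have nuc: "continuous_on A nu" for A
  proof (rule continuous_on_subset[of UNIV])
    show "continuous_on UNIV nu"
      unfolding continuous_on_iff
    proof (intro ballI allI impI)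
      fix x :: 'y and e :: real assume e: "e > 0"
      show "\<exists>d>0. \<forall>x'\<in>UNIV. dist x' x < d \<longrightarrow> dist (nu x') (nu x) < e"
      proof (intro exI[of _ "e / (\<bar>C\<bar> + 1)"] conjI ballI impI)
        fix x' assume d: "dist x' x < e / (\<bar>C\<bar> + 1)"
        have "dist (nu x') (nu x) \<le> C * norm (x' - x)" using nu by (simp add: dist_real_def)
        also have "\<dots> \<le> (\<bar>C\<bar> + 1) * norm (x' - x)" by (intro mult_right_mono) auto
        also have "\<dots> < e" using d by (simp add: dist_norm field_simps add_pos_nonneg)
        finally show "dist (nu x') (nu x) < e" .
      qed (use e in auto)
    qed
  qed simp
  \<comment> \<open>\<open>R\<close> lies strictly above the a priori bound and the initial value,
    so that reaching the level \<open>R\<close> is contradictory. Being at least 1, it lets the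
    cut-off inherit the Lipschitz constant of \<open>nu\<close>.\<close>
  define R where "R = max 1 (max (B + 1) (nu y0 + 1))"
  have R: "R \<ge> 1" "R > B" "R > nu y0" by (auto simp: R_def)
  obtain L where L: "\<And>t x y. nu x \<le> 2 * R \<Longrightarrow> nu y \<le> 2 * R \<Longrightarrow> norm (F t x - F t y) \<le> L * norm (x - y) \<and> norm (F t x) \<le> L"
    using lip[of "2 * R"] by blast
  have L0: "L \<ge> 0" using L[of y0 y0 0] R norm_ge_zero[of "F 0 y0"] by (smt (verit))
  \<comment> \<open>The cut-off is 1 where \<open>nu\<close> is at most \<open>R\<close>, 0 where
    \<open>nu\<close> is at least \<open>2 * R\<close>, and affine in \<open>nu\<close>
    between.\<close>
  define th where "th x = max 0 (min 1 (2 - nu x / R))" for x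
  have th01: "0 \<le> th x" "th x \<le> 1" for x by (auto simp: th_def)
  have th1: "th x = 1" if "nu x \<le> R" for x using that R by (auto simp: th_def field_simps)
  have th0: "th x = 0" if "\<not> nu x \<le> 2 * R" for x using that R by (auto simp: th_def field_simps)
  have thL: "\<bar>th x - th y\<bar> \<le> \<bar>C\<bar> * norm (x - y)" for x y
  proof -
    have "\<bar>th x - th y\<bar> \<le> \<bar>nu x / R - nu y / R\<bar>" by (auto simp: th_def)
    also have "\<dots> = \<bar>nu x - nu y\<bar> / R" using R by (simp add: diff_divide_distrib[symmetric])
    also have "\<dots> \<le> \<bar>nu x - nu y\<bar>" using R by (simp add: divide_le_eq mult_le_cancel_left1)
    also have "\<dots> \<le> \<bar>C\<bar> * norm (x - y)" using order_trans[OF nu mult_right_mono[of C "\<bar>C\<bar>"]] by auto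
    finally show ?thesis .
  qed
  define G where "G t x = th x *\<^sub>R F t x" for t x
  have lipG: "norm (G t x - G t y) \<le> (\<bar>C\<bar> * L + L) * norm (x - y)" for t x y
  proof -
    \<comment> \<open>Only \<open>x\<close> is assumed to lie in the region. If \<open>y\<close>
      lies outside, \<open>G t y\<close> vanishes and the difference of the cut-offs bounds what
      remains; the case of \<open>x\<close> outside follows by symmetry.\<close>
    have key: "norm (G t x - G t y) \<le> (\<bar>C\<bar> * L + L) * norm (x - y)" if x: "nu x \<le> 2 * R" for x y
    proof -
      have b: "norm ((th x - th y) *\<^sub>R F t x) \<le> (\<bar>C\<bar> * norm (x - y)) * L"
        using L[OF x x] by (simp, intro mult_mono thL) auto
      show ?thesis
      proof (cases "nu y \<le> 2 * R")
        case True
        have "G t x - G t y = (th x - th y) *\<^sub>R F t x + th y *\<^sub>R (F t x - F t y)"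
          by (simp add: G_def algebra_simps)
        then have "norm (G t x - G t y) \<le> norm ((th x - th y) *\<^sub>R F t x) + norm (th y *\<^sub>R (F t x - F t y))"
          using norm_triangle_ineq by metis
        moreover have "norm (th y *\<^sub>R (F t x - F t y)) \<le> 1 * (L * norm (x - y))"
          unfolding norm_scaleR using L[OF x True] th01[of y] by (intro mult_mono) auto
        ultimately have "norm (G t x - G t y) \<le> (\<bar>C\<bar> * norm (x - y)) * L + 1 * (L * norm (x - y))"
          using b by linarith
        then show ?thesis by (simp add: algebra_simps)
      next
        case False
        then have "G t x - G t y = (th x - th y) *\<^sub>R F t x" by (simp add: G_def th0)
        then have "norm (G t x - G t y) \<le> (\<bar>C\<bar> * norm (x - y)) * L + L * norm (x - y)"
          using b mult_nonneg_nonneg[OF L0 norm_ge_zero[of "x - y"]] by simp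
        then show ?thesis by (simp add: algebra_simps)
      qed
    qed
    show ?thesis
    proof (cases "nu x \<le> 2 * R \<or> nu y \<le> 2 * R")
      case True
      then show ?thesis using key[of x y] key[of y x] by (auto simp: norm_minus_commute)
    next
      case False
      then show ?thesis using L0 by (simp add: G_def th0)
    qed
  qed
  have "\<exists>y. y 0 = y0 \<and> (\<forall>t. (y has_vector_derivative G t (y t)) (at t))"
  proof (rule ode_global_Lipschitz[OF _ lipG])
    show "norm (G t x) \<le> L" for t x
    proof (cases "nu x \<le> 2 * R")
      case True
      have "norm (G t x) \<le> 1 * L" unfolding G_def norm_scaleR
        using L[OF True True] th01[of x] by (intro mult_mono) auto
      then show ?thesis by simp
    qed (use L0 in \<open>simp add: G_def th0\<close>)
    show "continuous_on UNIV (\<lambda>s. G s (y s))" if "continuous_on UNIV y" for y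
      unfolding G_def th_def
      by (intro continuous_intros cont that continuous_on_compose2[OF nuc that]) (use R in auto)
  qed
  then obtain y where y0: "y 0 = y0" and y: "\<And>t. (y has_vector_derivative G t (y t)) (at t)" by blast
  have yc: "continuous_on A y" for A
    by (rule has_vector_derivative_imp_continuous_on[OF y])
  have nyc: "continuous_on A (\<lambda>s. nu (y s))" for A
    by (rule continuous_on_compose2[OF nuc yc]) auto
  have "nu (y t) < R" for t
  proof (rule ccontr)
    assume t: "\<not> nu (y t) < R"
    \<comment> \<open>A point of \<open>S\<close> of smallest modulus is an exit time
      \<open>r\<close>. Strictly between 0 and \<open>r\<close> the cut-off equals 1, so the
      original equation holds there.\<close>
    define S where "S = closed_segment 0 t \<inter> {s. R \<le> nu (y s)}"
    have "compact S"
    proof -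
      have "closed {s. R \<le> nu (y s)}"
        by (rule closed_Collect_le) (auto intro: nyc)
      then show ?thesis unfolding S_def by (intro compact_Int_closed) auto
    qed
    moreover have "t \<in> S" using t by (auto simp: S_def)
    ultimately have "\<exists>r\<in>S. \<forall>s\<in>S. \<bar>r\<bar> \<le> \<bar>s\<bar>"
      by (intro continuous_attains_inf) (auto intro!: continuous_intros)
    then obtain r where r: "r \<in> S" and rmin: "\<And>s. s \<in> S \<Longrightarrow> \<bar>r\<bar> \<le> \<bar>s\<bar>"
      by blast
    have r0: "r \<noteq> 0" using r R(3) y0 by (auto simp: S_def)
    have small: "nu (y s) \<le> R" if "s \<in> closed_segment 0 r" "s \<noteq> r" for s
    proof (rule ccontr)
      assume "\<not> ?thesis"
      then have "s \<in> S" using that r by (auto simp: S_def closed_segment_eq_real_ivl split: if_splits)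
      then show False using rmin[of s] that by (auto simp: closed_segment_eq_real_ivl split: if_splits)
    qed
    have le: "nu (y s) \<le> B" if s: "s \<in> closed_segment 0 r" "s \<noteq> r" for s
    proof (rule apriori[where y=y, OF y0])
      fix s' assume "s' \<in> closed_segment 0 s"
      then have "s' \<in> closed_segment 0 r" "s' \<noteq> r"
        using s by (auto simp: closed_segment_eq_real_ivl split: if_splits)
      then show "(y has_vector_derivative F s' (y s')) (at s')"
        using y[of s'] th1[OF small] by (simp add: G_def)
    qed
    \<comment> \<open>The a priori bound is available only strictly before \<open>r\<close>; it is
      carried to \<open>r\<close> by continuity along points approaching \<open>r\<close> from the
      side of 0.\<close>
    have "(\<lambda>n. nu (y (r * (1 - 1 / real (Suc n))))) \<longlonglongrightarrow> nu (y (r * (1 - 0)))"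
      by (rule continuous_on_tendsto_compose[OF nyc[of UNIV]])
         (intro tendsto_mult tendsto_diff tendsto_const LIMSEQ_Suc[OF lim_1_over_n], auto)
    moreover have "nu (y (r * (1 - 1 / real (Suc n)))) \<le> B" for n
    proof (rule le)
      have "r * (1 - 1 / real (Suc n)) = (1 - (1 - 1 / real (Suc n))) *\<^sub>R 0 + (1 - 1 / real (Suc n)) *\<^sub>R r" by simp
      then show "r * (1 - 1 / real (Suc n)) \<in> closed_segment 0 r"
        unfolding closed_segment_def by (intro CollectI exI[of _ "1 - 1 / real (Suc n)"]) auto
      show "r * (1 - 1 / real (Suc n)) \<noteq> r" using r0 by simp
    qed
    ultimately have "nu (y (r * (1 - 0))) \<le> B"
      by (intro LIMSEQ_le_const2) auto
    then show False using r R by (simp add: S_def)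
  qed
  then have "G t (y t) = F t (y t)" for t using th1[of "y t"] by (simp add: G_def less_imp_le)
  with y y0 show ?thesis by auto
qed

section \<open>Fourier series on the torus\<close>

definition tor :: "nat \<Rightarrow> 'a::euclidean_space measure" where
  "tor N = restrict_space lborel (Tb N)"

lemma Tb_sets [measurable, simp]: "Tb N \<in> sets borel"
  by (simp add: Tb_def)

lemma space_tor [simp]: "space (tor N) = Tb N"
  by (simp add: tor_def space_restrict_space)

lemma set_integral_tor: "(LINT x:Tb N|lborel. f x) = (LINT x|tor N. f x)"
  for f :: "'a::euclidean_space \<Rightarrow> 'b::{banach,second_countable_topology}"
  unfolding tor_def set_lebesgue_integral_def by (subst integral_restrict_space) auto

lemma set_integrable_tor: "set_integrable lborel (Tb N) f \<longleftrightarrow> integrable (tor N) f"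
  for f :: "'a::euclidean_space \<Rightarrow> 'b::{banach,second_countable_topology}"
  unfolding tor_def set_integrable_def by (subst integrable_restrict_space) auto

lemma borel_measurable_tor: "f \<in> borel_measurable borel \<Longrightarrow> f \<in> borel_measurable (tor N)"
  unfolding tor_def by (rule measurable_restrict_space1) simp

lemma emeasure_tor_space: "emeasure (tor N :: 'a::euclidean_space measure) (Tb N) = ennreal (real N ^ DIM('a))"
  unfolding tor_def
  by (subst emeasure_restrict_space) (auto simp: Tb_def emeasure_lborel_cbox_eq inner_simps)

lemma finite_measure_tor: "finite_measure (tor N)"
  by (rule finite_measureI) (simp add: emeasure_tor_space)

lemma measure_tor: "measure (tor N :: 'a::euclidean_space measure) (Tb N) = real N ^ DIM('a)"
  by (simp add: measure_def emeasure_tor_space)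

lemma integral_tor_const: "(LINT x|(tor N :: 'a measure). c) = real N ^ DIM('a) *\<^sub>R (c::'b::{banach,second_countable_topology})"
  for N and dummy :: "'a::euclidean_space itself"
  using lebesgue_integral_const[of "tor N :: 'a measure" c] by (simp add: measure_tor)

lemma integrable_tor_bounded:
  fixes f :: "'a::euclidean_space \<Rightarrow> 'b::{banach,second_countable_topology}"
  assumes "f \<in> borel_measurable borel" "\<And>x. x \<in> Tb N \<Longrightarrow> norm (f x) \<le> C"
  shows "integrable (tor N) f"
  by (rule finite_measure.integrable_const_bound[OF finite_measure_tor, where B=C])
     (use assms in \<open>auto intro!: AE_I2 borel_measurable_tor\<close>)

lemma integrable_tor_continuous:
  fixes f :: "'a::euclidean_space \<Rightarrow> 'b::{banach,second_countable_topology}"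
  assumes "continuous_on UNIV f" shows "integrable (tor N) f"
proof -
  have "bounded (f ` Tb N)"
    by (intro compact_imp_bounded compact_continuous_image continuous_on_subset[OF assms]) (auto simp: Tb_def)
  then obtain C where "\<And>x. x \<in> Tb N \<Longrightarrow> norm (f x) \<le> C" unfolding bounded_iff by auto
  then show ?thesis
    by (intro integrable_tor_bounded[where C=C] borel_measurable_continuous_onI assms) auto
qed

lemma AE_tor_iff: "(AE x in tor N. P x) \<longleftrightarrow> (AE x in lborel. x \<in> Tb N \<longrightarrow> P x)"
  unfolding tor_def by (subst AE_restrict_space_iff) auto

section \<open>Lattice translations and the translation-invariant integral on the torus\<close>

lemma latt_closed:
  "0 \<in> latt" "k \<in> latt \<Longrightarrow> l \<in> latt \<Longrightarrow> k + l \<in> latt" "k \<in> latt \<Longrightarrow> l \<in> latt \<Longrightarrow> k - l \<in> latt"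
  "k \<in> latt \<Longrightarrow> - k \<in> latt" "b \<in> Basis \<Longrightarrow> b \<in> latt"
  by (auto simp: latt_def inner_simps inner_Basis)

lemma latt_scaleR: "z \<in> \<int> \<Longrightarrow> k \<in> latt \<Longrightarrow> z *\<^sub>R k \<in> latt"
  by (auto simp: latt_def)

lemma latt_inner_Ints:
  assumes "k \<in> latt" "l \<in> latt" shows "k \<bullet> l \<in> \<int>"
  unfolding euclidean_inner[of k l] using assms by (auto simp: latt_def intro!: Ints_sum)

lemma countable_latt: "countable (latt :: 'a::euclidean_space set)"
proof -
  have "latt \<subseteq> (\<lambda>f. \<Sum>b\<in>Basis. f b *\<^sub>R b) ` (PiE (Basis::'a set) (\<lambda>_. \<int>))"
  proof
    fix m :: 'a assume "m \<in> latt"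
    then have "restrict (\<lambda>b. m \<bullet> b) Basis \<in> PiE Basis (\<lambda>_. \<int>)" by (auto simp: latt_def)
    moreover have "m = (\<Sum>b\<in>Basis. restrict (\<lambda>b. m \<bullet> b) Basis b *\<^sub>R b)"
      by (simp add: euclidean_representation)
    ultimately show "m \<in> (\<lambda>f. \<Sum>b\<in>Basis. f b *\<^sub>R b) ` (PiE (Basis::'a set) (\<lambda>_. \<int>))" by blast
  qed
  moreover have "countable (PiE (Basis::'a set) (\<lambda>_. (\<int>::real set)))"
    by (intro countable_PiE) (auto simp: Ints_def)
  ultimately show ?thesis by (rule countable_subset[OF _ countable_image])
qed

lemma perD: "per N f \<Longrightarrow> m \<in> latt \<Longrightarrow> f (x + real N *\<^sub>R m) = f x"
  by (simp add: per_def)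

lemma per_shift: assumes "per N f" shows "per N (\<lambda>x. f (x + a))"
  unfolding per_def
proof (intro allI ballI)
  fix x m :: 'a assume "m \<in> latt"
  from perD[OF assms this, of "x + a"] show "f (x + real N *\<^sub>R m + a) = f (x + a)" by (simp add: add_ac)
qed

lemma AE_lborel_shift:
  assumes "AE x in lborel. P (x::'a::euclidean_space)" shows "AE x in lborel. P (x + a)"
proof -
  obtain S where S: "S \<in> null_sets lborel" "{x. \<not> P x} \<subseteq> S"
  proof -
    obtain S where "\<And>x. x \<in> space lborel - S \<Longrightarrow> P x" "S \<in> null_sets lborel" using AE_E3[OF assms] by blast
    then show thesis by (intro that[of S]) auto
  qed
  have "(\<lambda>x. a + x) \<in> measurable lborel (borel :: 'a measure)" by simp
  then have "emeasure lborel ((\<lambda>x. a + x) -` S) = emeasure (distr lborel borel (\<lambda>x. a + x)) S"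
    by (subst emeasure_distr) (use S in \<open>auto simp: null_sets_def\<close>)
  then have "(\<lambda>x. a + x) -` S \<in> null_sets lborel"
    using S measurable_sets[of "\<lambda>x. a + x" borel "borel :: 'a measure" S]
    by (auto simp: null_sets_def lborel_distr_plus)
  then show ?thesis by (rule AE_I') (use S in \<open>auto simp: add.commute\<close>)
qed

text \<open>The lattice translates of the box cover the space, and there are only countably many, so
  the exceptional sets add up to a null set.\<close>

lemma AE_lborel_of_tor:
  assumes N: "N \<ge> 1" and P: "\<And>x m. m \<in> latt \<Longrightarrow> P (x + real N *\<^sub>R m) \<longleftrightarrow> P x" and AE: "AE x in tor N. P x"
  shows "AE x in lborel. P (x::'a::euclidean_space)"
proof -
  have "AE x in lborel. x + real N *\<^sub>R m \<in> Tb N \<longrightarrow> P (x + real N *\<^sub>R m)" for m :: 'a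
    using AE_lborel_shift[OF AE[unfolded AE_tor_iff]] .
  then have "AE x in lborel. \<forall>m\<in>latt. x + real N *\<^sub>R m \<in> Tb N \<longrightarrow> P (x + real N *\<^sub>R m)"
    by (subst AE_ball_countable[OF countable_latt]) auto
  then show ?thesis
  proof eventually_elim
    case (elim x)
    define m :: 'a where "m = - (\<Sum>b\<in>Basis. of_int \<lfloor>(x \<bullet> b) / real N\<rfloor> *\<^sub>R b)"
    have m: "m \<in> latt" by (auto simp: m_def latt_def)
    have "x + real N *\<^sub>R m \<in> Tb N"
      unfolding Tb_def mem_box
    proof (intro ballI conjI)
      fix b :: 'a assume b: "b \<in> Basis"
      have eq: "(x + real N *\<^sub>R m) \<bullet> b = x \<bullet> b - real N * of_int \<lfloor>(x \<bullet> b) / real N\<rfloor>"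
        using b by (simp add: m_def inner_simps)
      have "real N * of_int \<lfloor>(x \<bullet> b) / real N\<rfloor> \<le> x \<bullet> b"
        using floor_divide_lower[of "real N" "x \<bullet> b"] N by (simp add: mult.commute)
      then show "0 \<bullet> b \<le> (x + real N *\<^sub>R m) \<bullet> b" unfolding eq by simp
      have "x \<bullet> b \<le> real N * (of_int \<lfloor>(x \<bullet> b) / real N\<rfloor> + 1)"
        using floor_divide_upper[of "real N" "x \<bullet> b"] N by (simp add: mult.commute)
      then show "(x + real N *\<^sub>R m) \<bullet> b \<le> (real N *\<^sub>R One) \<bullet> b" unfolding eq using b by (simp add: algebra_simps)
    qed
    with elim m have "P (x + real N *\<^sub>R m)" by blast
    then show ?case using P[OF m] by simp
  qed
qed

lemma AE_hyperplane: "b \<in> Basis \<Longrightarrow> AE x in lborel. x \<bullet> b \<noteq> (c::real)"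
proof -
  assume b: "b \<in> Basis"
  have "{x. x \<bullet> b = c} \<in> null_sets lebesgue"
    using negligible_standard_hyperplane[OF b, of c] by (simp add: negligible_iff_null_sets)
  moreover have "{x. x \<bullet> b = c} \<in> sets borel"
    by (intro borel_closed closed_Collect_eq continuous_intros)
  ultimately have "{x. x \<bullet> b = c} \<in> null_sets lborel" by (simp add: null_sets_def)
  then show ?thesis by (rule AE_I') auto
qed

lemma lborel_shift:
  fixes f :: "'a::euclidean_space \<Rightarrow> 'b::{banach,second_countable_topology}"
  assumes "f \<in> borel_measurable borel"
  shows "integrable lborel (\<lambda>x. f (x + a)) \<longleftrightarrow> integrable lborel f"
    and "(LINT x|lborel. f (x + a)) = (LINT x|lborel. f x)"
proof -
  have m: "(+) a \<in> lborel \<rightarrow>\<^sub>M borel" by simp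
  show "integrable lborel (\<lambda>x. f (x + a)) \<longleftrightarrow> integrable lborel f"
    using integrable_distr_eq[OF m assms] by (simp add: lborel_distr_plus add.commute)
  show "(LINT x|lborel. f (x + a)) = (LINT x|lborel. f x)"
    using integral_distr[OF m assms] by (simp add: lborel_distr_plus add.commute)
qed

text \<open>The box and its translate share the slab \<open>S1\<close>. The overhang
  \<open>S2\<close> lies exactly one period beyond the slab \<open>S3\<close> that was lost, so
  periodicity equates their integrals; the faces are hyperplanes and hence null.\<close>

lemma tor_axis_shift:
  fixes f :: "'a::euclidean_space \<Rightarrow> 'b::{banach,second_countable_topology}"
  assumes f: "f \<in> borel_measurable borel" "per N f" "integrable (tor N) f" and b: "b \<in> Basis" and t: "0 \<le> t" "t \<le> real N"
  shows "integrable (tor N) (\<lambda>x. f (x + t *\<^sub>R b))" "(LINT x|tor N. f (x + t *\<^sub>R b)) = (LINT x|tor N. f x)"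
proof -
  define A where "A = {x::'a. \<forall>c\<in>Basis-{b}. 0 \<le> x \<bullet> c \<and> x \<bullet> c \<le> real N}"
  define S1 where "S1 = A \<inter> {x. t < x \<bullet> b \<and> x \<bullet> b \<le> real N}"
  define S2 where "S2 = A \<inter> {x. real N < x \<bullet> b \<and> x \<bullet> b \<le> real N + t}"
  define S3 where "S3 = A \<inter> {x. 0 < x \<bullet> b \<and> x \<bullet> b \<le> t}"
  note f(1)[measurable]
  have [measurable]: "A \<in> sets borel"
  proof -
    have "A = (\<Inter>c\<in>Basis-{b}. {x. 0 \<le> x \<bullet> c} \<inter> {x. x \<bullet> c \<le> real N})" by (auto simp: A_def)
    then have "closed A" by (auto intro!: closed_INT closed_Int closed_Collect_le continuous_intros)
    then show ?thesis by (rule borel_closed)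
  qed
  have [measurable]: "S1 \<in> sets borel" "S2 \<in> sets borel" "S3 \<in> sets borel"
    unfolding S1_def S2_def S3_def by measurable
  have Tb: "x \<in> Tb N \<longleftrightarrow> x \<in> A \<and> 0 \<le> x \<bullet> b \<and> x \<bullet> b \<le> real N" for x
    using b by (auto simp: Tb_def mem_box A_def)
  have Ashift: "x + s *\<^sub>R b \<in> A \<longleftrightarrow> x \<in> A" for x s
    using b by (auto simp: A_def inner_simps inner_Basis)
  have e1: "AE x in lborel. indicator (Tb N) x *\<^sub>R f x = indicator S1 x *\<^sub>R f x + indicator S3 x *\<^sub>R f x"
    using AE_hyperplane[OF b, of 0]
    by eventually_elim (use t in \<open>auto simp: Tb S1_def S3_def indicator_def\<close>)
  have e2: "AE x in lborel. indicator (Tb N) (x - t *\<^sub>R b) *\<^sub>R f x = indicator S1 x *\<^sub>R f x + indicator S2 x *\<^sub>R f x"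
    using AE_hyperplane[OF b, of t]
    by eventually_elim
       (use t b Ashift[of _ "-t"] in \<open>auto simp: Tb S1_def S2_def indicator_def inner_simps\<close>)
  have I: "integrable lborel (\<lambda>x. indicator (Tb N) x *\<^sub>R f x)"
    using f(3) unfolding set_integrable_tor[symmetric] set_integrable_def .
  have I1: "integrable lborel (\<lambda>x. indicator S1 x *\<^sub>R f x)"
    by (rule Bochner_Integration.integrable_bound[OF I]) (auto simp: indicator_def S1_def Tb intro!: AE_I2 order_trans[OF t(1)])
  have I3: "integrable lborel (\<lambda>x. indicator S3 x *\<^sub>R f x)"
    by (rule Bochner_Integration.integrable_bound[OF I]) (use t in \<open>auto simp: indicator_def S3_def Tb intro!: AE_I2\<close>)
  have sh: "indicator S2 (x + real N *\<^sub>R b) *\<^sub>R f (x + real N *\<^sub>R b) = indicator S3 x *\<^sub>R f x" for x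
    using perD[OF f(2) latt_closed(5)[OF b], of x] b Ashift
    by (auto simp: S2_def S3_def indicator_def inner_simps)
  have I2: "integrable lborel (\<lambda>x. indicator S2 x *\<^sub>R f x)"
    using I3 lborel_shift(1)[of "\<lambda>x. indicator S2 x *\<^sub>R f x" "real N *\<^sub>R b"] by (simp add: sh)
  have J2: "(LINT x|lborel. indicator S2 x *\<^sub>R f x) = (LINT x|lborel. indicator S3 x *\<^sub>R f x)"
    using lborel_shift(2)[of "\<lambda>x. indicator S2 x *\<^sub>R f x" "real N *\<^sub>R b"] by (simp add: sh)
  have m: "(\<lambda>x. indicator (Tb N) (x - t *\<^sub>R b) *\<^sub>R f x) \<in> borel_measurable borel" by measurable
  have "integrable lborel (\<lambda>x. indicator (Tb N) (x - t *\<^sub>R b) *\<^sub>R f x)"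
    by (subst integrable_cong_AE[OF _ _ e2]) (use I1 I2 m in auto)
  then show "integrable (tor N) (\<lambda>x. f (x + t *\<^sub>R b))"
    unfolding set_integrable_tor[symmetric] set_integrable_def
    using lborel_shift(1)[OF m, of "t *\<^sub>R b"] by simp
  have "(LINT x|tor N. f (x + t *\<^sub>R b)) = (LINT x|lborel. indicator (Tb N) (x - t *\<^sub>R b) *\<^sub>R f x)"
    unfolding set_integral_tor[symmetric] set_lebesgue_integral_def
    using lborel_shift(2)[OF m, of "t *\<^sub>R b"] by simp
  also have "\<dots> = (LINT x|lborel. indicator S1 x *\<^sub>R f x + indicator S2 x *\<^sub>R f x)"
    by (rule integral_cong_AE[OF _ _ e2]) (use m in auto)
  also have "\<dots> = (LINT x|lborel. indicator S1 x *\<^sub>R f x + indicator S3 x *\<^sub>R f x)"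
    using I1 I2 I3 J2 by simp
  also have "\<dots> = (LINT x|lborel. indicator (Tb N) x *\<^sub>R f x)"
    by (rule integral_cong_AE[symmetric, OF _ _ e1]) auto
  finally show "(LINT x|tor N. f (x + t *\<^sub>R b)) = (LINT x|tor N. f x)"
    unfolding set_integral_tor[symmetric, of N f] set_lebesgue_integral_def .
qed

text \<open>One coordinate at a time, where a shift along an axis is first reduced modulo the period
  to lie between 0 and \<open>N\<close>.\<close>

lemma tor_shift:
  fixes f :: "'a::euclidean_space \<Rightarrow> 'b::{banach,second_countable_topology}"
  assumes N: "N \<ge> 1" and f: "f \<in> borel_measurable borel" "per N f" "integrable (tor N) f"
  shows "integrable (tor N) (\<lambda>x. f (x + a)) \<and> (LINT x|tor N. f (x + a)) = (LINT x|tor N. f x)"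
proof -
  have ax: "integrable (tor N) (\<lambda>x. g (x + t *\<^sub>R b)) \<and> (LINT x|tor N. g (x + t *\<^sub>R b)) = (LINT x|tor N. g x)"
    if g: "g \<in> borel_measurable borel" "per N g" "integrable (tor N) g" and b: "b \<in> Basis" for g :: "'a \<Rightarrow> 'b" and b t
  proof -
    define n where "n = \<lfloor>t / real N\<rfloor>"
    define r where "r = t - real N * of_int n"
    have r: "0 \<le> r" "r \<le> real N"
      using floor_divide_lower[of "real N" t] floor_divide_upper[of "real N" t] N
      by (auto simp: r_def n_def algebra_simps)
    have "g (x + t *\<^sub>R b) = g (x + r *\<^sub>R b)" for x
      using perD[OF g(2), of "of_int n *\<^sub>R b" "x + r *\<^sub>R b"] latt_scaleR[of "of_int n" b] latt_closed(5)[OF b]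
      by (simp add: r_def algebra_simps)
    then show ?thesis using tor_axis_shift[OF g b r] by simp
  qed
  have "finite B \<Longrightarrow> B \<subseteq> Basis \<Longrightarrow> integrable (tor N) (\<lambda>x. f (x + (\<Sum>b\<in>B. (a \<bullet> b) *\<^sub>R b)))
     \<and> (LINT x|tor N. f (x + (\<Sum>b\<in>B. (a \<bullet> b) *\<^sub>R b))) = (LINT x|tor N. f x)" for B
  proof (induction B rule: finite_induct)
    case empty then show ?case using f by simp
  next
    case (insert c B)
    define g where "g x = f (x + (\<Sum>b\<in>B. (a \<bullet> b) *\<^sub>R b))" for x
    have g: "g \<in> borel_measurable borel" "per N g" "integrable (tor N) g" "(LINT x|tor N. g x) = (LINT x|tor N. f x)"
      using f insert per_shift[OF f(2)] by (auto simp: g_def[abs_def])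
    have "f (x + (\<Sum>b\<in>insert c B. (a \<bullet> b) *\<^sub>R b)) = g (x + (a \<bullet> c) *\<^sub>R c)" for x
      using insert by (simp add: g_def add_ac)
    then show ?case using ax[OF g(1-3), of c "a \<bullet> c"] insert g(4) by simp
  qed
  from this[of Basis] show ?thesis by (simp add: euclidean_representation)
qed

section \<open>Characters, Fourier coefficients and Bessel's inequality\<close>

definition ee :: "nat \<Rightarrow> 'a::euclidean_space \<Rightarrow> 'a \<Rightarrow> complex" where
  "ee N k x = cis ((2 * pi / real N) * (k \<bullet> x))"

lemma ee_simps: "ee N 0 x = 1" "ee N (k + l) x = ee N k x * ee N l x" "ee N k (x + y) = ee N k x * ee N k y"
  "cnj (ee N k x) = ee N (- k) x" "cmod (ee N k x) = 1" "ee N (- k) x = ee N k (- x)"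
  by (auto simp: ee_def cis_mult inner_simps distrib_left cis_cnj)

lemma ee_continuous: "continuous_on A (ee N k)"
  unfolding ee_def[abs_def] by (intro continuous_intros)

lemma ee_measurable [measurable]: "ee N k \<in> borel_measurable borel"
  by (rule borel_measurable_continuous_onI[OF ee_continuous])

lemma ee_per: assumes "N \<ge> 1" "k \<in> latt" shows "per N (ee N k)"
  unfolding per_def
proof (intro allI ballI)
  fix x m :: 'a assume "m \<in> latt"
  then obtain z where z: "k \<bullet> m = of_int z" using latt_inner_Ints[OF assms(2)] by (auto elim: Ints_cases)
  have "(2 * pi / real N) * (k \<bullet> (real N *\<^sub>R m)) = 2 * pi * of_int z" using assms by (simp add: z)
  then have "ee N k (real N *\<^sub>R m) = 1" unfolding ee_def by (simp only: cis_multiple_2pi Ints_of_int)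
  then show "ee N k (x + real N *\<^sub>R m) = ee N k x" by (simp add: ee_simps)
qed

lemma fc_tor: "fc N f k = (LINT x|tor N. f x * ee N (- k) x) / (real N) ^ DIM('a)" for f :: "'a::euclidean_space \<Rightarrow> complex"
  unfolding fc_def set_integral_tor by (simp add: ee_def)

lemma integral_ee:
  fixes k :: "'a::euclidean_space"
  assumes N: "N \<ge> 1" and k: "k \<in> latt"
  shows "(LINT x|tor N. ee N k x) = (if k = 0 then of_real (real N ^ DIM('a)) else 0)"
proof (cases "k = 0")
  case True
  then show ?thesis using integral_tor_const[where 'a='a and c="1::complex" and N=N] by (simp add: ee_simps scaleR_conv_of_real)
next
  case False
  then obtain b where b: "b \<in> Basis" "k \<bullet> b \<noteq> 0" using euclidean_eq_iff[of k 0] by auto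
  \<comment> \<open>Translation by \<open>a\<close> changes the phase by \<open>pi\<close> and turns
    the character into its negative, so by translation invariance the integral is its own
    negative.\<close>
  define a where "a = (real N / (2 * (k \<bullet> b))) *\<^sub>R b"
  have "ee N k a = cis pi" using b N by (simp add: ee_def a_def field_simps)
  then have ea: "ee N k (x + a) = - ee N k x" for x by (simp add: ee_simps)
  have "(LINT x|tor N. ee N k (x + a)) = (LINT x|tor N. ee N k x)"
    using tor_shift[OF N ee_measurable ee_per[OF N k] integrable_tor_continuous[OF ee_continuous]] by blast
  then have "(LINT x|tor N. ee N k x) = 0" unfolding ea by simp
  then show ?thesis using False by simp
qed

lemma integrable_tor_mult_bounded:
  fixes f h :: "'a::euclidean_space \<Rightarrow> complex"
  assumes "integrable (tor N) f" "h \<in> borel_measurable borel" "\<And>x. cmod (h x) \<le> C"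
  shows "integrable (tor N) (\<lambda>x. f x * h x)"
proof (rule Bochner_Integration.integrable_bound)
  show "integrable (tor N) (\<lambda>x. C * norm (f x))" using assms(1) by (intro integrable_mult_right) auto
  show "(\<lambda>x. f x * h x) \<in> borel_measurable (tor N)"
    using borel_measurable_integrable[OF assms(1)] borel_measurable_tor[OF assms(2)] by (rule borel_measurable_times)
  show "AE x in tor N. norm (f x * h x) \<le> norm (C * norm (f x))"
  proof (rule AE_I2)
    fix x
    have "0 \<le> C" using order_trans[OF norm_ge_zero assms(3)] by blast
    then show "norm (f x * h x) \<le> norm (C * norm (f x))"
      using mult_right_mono[OF assms(3), of "norm (f x)" x] by (simp add: norm_mult mult.commute)
  qed
qed

lemma L2_iff: "L2 N f \<longleftrightarrow> f \<in> borel_measurable borel \<and> integrable (tor N) (\<lambda>x. (norm (f x))\<^sup>2)"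
  unfolding L2_def set_integrable_tor by simp

lemma L2_measurable: "L2 N f \<Longrightarrow> f \<in> borel_measurable borel"
  by (simp add: L2_def)

lemma L2_dominated:
  assumes "f \<in> borel_measurable borel" "integrable (tor N) g" "\<And>x. (cmod (f x))\<^sup>2 \<le> g x"
  shows "L2 N f"
  unfolding L2_iff
proof (intro conjI assms(1) Bochner_Integration.integrable_bound[OF assms(2)] AE_I2)
  show "(\<lambda>x. (norm (f x))\<^sup>2) \<in> borel_measurable (tor N)"
    using borel_measurable_tor[OF assms(1)] by measurable
  show "norm ((norm (f x))\<^sup>2) \<le> norm (g x)" for x
    using assms(3)[of x] by simp
qed

lemma L2_add: assumes "L2 N f" "L2 N g" shows "L2 N (\<lambda>x. f x + g x :: complex)"
proof (rule L2_dominated)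
  show "(\<lambda>x. f x + g x) \<in> borel_measurable borel" using assms by (auto simp: L2_iff)
  show "integrable (tor N) (\<lambda>x. 2 * (norm (f x))\<^sup>2 + 2 * (norm (g x))\<^sup>2)"
    using assms by (auto simp: L2_iff)
  fix x
  have "(cmod (f x + g x))\<^sup>2 \<le> (cmod (f x) + cmod (g x))\<^sup>2"
    by (intro power_mono norm_triangle_ineq) auto
  also have "\<dots> \<le> 2 * (cmod (f x))\<^sup>2 + 2 * (cmod (g x))\<^sup>2"
    using sum_squares_ge_zero[of "cmod (f x) - cmod (g x)" 0] by (simp add: power2_eq_square algebra_simps)
  finally show "(cmod (f x + g x))\<^sup>2 \<le> 2 * (cmod (f x))\<^sup>2 + 2 * (cmod (g x))\<^sup>2" .
qed

lemma L2_mult_bounded: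
  assumes "L2 N f" "h \<in> borel_measurable borel" "\<And>x. cmod (h x) \<le> C"
  shows "L2 N (\<lambda>x. h x * f x :: complex)"
proof (rule L2_dominated)
  show "(\<lambda>x. h x * f x) \<in> borel_measurable borel" using assms by (auto simp: L2_iff)
  show "integrable (tor N) (\<lambda>x. C\<^sup>2 * (norm (f x))\<^sup>2)" using assms by (auto simp: L2_iff)
  show "(cmod (h x * f x))\<^sup>2 \<le> C\<^sup>2 * (cmod (f x))\<^sup>2" for x
    by (simp add: norm_mult power_mult_distrib mult_right_mono power_mono assms)
qed

lemma L2_cmult: "L2 N f \<Longrightarrow> L2 N (\<lambda>x. c * f x :: complex)"
  by (rule L2_mult_bounded[where C="cmod c"]) auto

lemma L2_diff: assumes "L2 N f" "L2 N g" shows "L2 N (\<lambda>x. f x - g x :: complex)"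
  using L2_add[OF assms(1) L2_cmult[OF assms(2), of "-1"]] by simp

lemma borel_measurable_cnj [measurable]:
  "f \<in> borel_measurable M \<Longrightarrow> (\<lambda>x. cnj (f x)) \<in> borel_measurable M"
  by (rule measurable_compose[OF _ borel_measurable_continuous_onI[OF continuous_on_cnj[OF continuous_on_id]]])

lemma L2_cnj: "L2 N f \<Longrightarrow> L2 N (\<lambda>x. cnj (f x))"
  by (auto simp: L2_iff)

lemma L2_bounded: "f \<in> borel_measurable borel \<Longrightarrow> (\<And>x. cmod (f x) \<le> C) \<Longrightarrow> L2 N f"
  by (rule L2_dominated[where g="\<lambda>_. C\<^sup>2"]) (auto intro!: power_mono integrable_tor_bounded[where C="C\<^sup>2"])

lemma L2_mult_integrable:
  assumes "L2 N f" "L2 N g" shows "integrable (tor N) (\<lambda>x. f x * g x :: complex)"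
proof (rule Bochner_Integration.integrable_bound)
  show "integrable (tor N) (\<lambda>x. (norm (f x))\<^sup>2 + (norm (g x))\<^sup>2)"
    using assms by (auto simp: L2_iff)
  show "(\<lambda>x. f x * g x) \<in> borel_measurable (tor N)"
    using assms by (intro borel_measurable_tor) (auto simp: L2_iff)
  show "AE x in tor N. norm (f x * g x) \<le> norm ((norm (f x))\<^sup>2 + (norm (g x))\<^sup>2)"
  proof (rule AE_I2)
    fix x
    have "0 \<le> (cmod (f x) - cmod (g x))\<^sup>2 + ((cmod (f x))\<^sup>2 + (cmod (g x))\<^sup>2)" by simp
    then show "norm (f x * g x) \<le> norm ((norm (f x))\<^sup>2 + (norm (g x))\<^sup>2)"
      by (simp add: norm_mult power2_eq_square algebra_simps)
  qed
qed

lemma L2_integrable: "L2 N f \<Longrightarrow> integrable (tor N) (f :: _ \<Rightarrow> complex)"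
  using L2_mult_integrable[of N f "\<lambda>_. 1"] L2_bounded[of "\<lambda>_. 1" 1 N] by simp

lemma fc_linear:
  assumes "integrable (tor N) f" "integrable (tor N) g"
  shows "fc N (\<lambda>x. f x + g x) k = fc N f k + fc N g k" "fc N (\<lambda>x. f x - g x) k = fc N f k - fc N g k"
    "fc N (\<lambda>x. c * f x) k = c * fc N f k"
proof -
  have i: "integrable (tor N) (\<lambda>x. h x * ee N (- k) x)" if "integrable (tor N) h" for h
    by (rule integrable_tor_mult_bounded[OF that, where C=1]) (auto simp: ee_simps)
  show "fc N (\<lambda>x. f x + g x) k = fc N f k + fc N g k" "fc N (\<lambda>x. f x - g x) k = fc N f k - fc N g k"
    using i[OF assms(1)] i[OF assms(2)] by (simp_all add: fc_tor algebra_simps add_divide_distrib diff_divide_distrib)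
  show "fc N (\<lambda>x. c * f x) k = c * fc N f k" by (simp add: fc_tor mult.assoc)
qed

lemma fc_sum:
  assumes "\<And>i. i \<in> I \<Longrightarrow> integrable (tor N) (f i)"
  shows "fc N (\<lambda>x. \<Sum>i\<in>I. f i x) k = (\<Sum>i\<in>I. fc N (f i) k)"
proof -
  have i: "integrable (tor N) (\<lambda>x. f i x * ee N (- k) x)" if "i \<in> I" for i
    by (rule integrable_tor_mult_bounded[OF assms[OF that], where C=1]) (auto simp: ee_simps)
  then show ?thesis by (simp add: fc_tor sum_distrib_right sum_divide_distrib)
qed

lemma fc_cnj: "fc N (\<lambda>x. cnj (f x)) k = cnj (fc N f (- k))"
proof -
  have "cnj (f x) * ee N (- k) x = cnj (f x * ee N k x)" for x by (simp add: ee_simps)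
  then have "(LINT x|tor N. cnj (f x) * ee N (- k) x) = cnj (LINT x|tor N. f x * ee N k x)"
    by (simp only: Bochner_Integration.integral_cnj)
  then show ?thesis by (simp add: fc_tor)
qed

lemma fc_mult_ee: "fc N (\<lambda>x. f x * ee N l x) k = fc N f (k - l)"
  unfolding fc_tor by (simp add: mult.assoc ee_simps(2)[symmetric])

lemma fc_cong_AE:
  assumes "AE x in tor N. f x = g x" "f \<in> borel_measurable borel" "g \<in> borel_measurable borel"
  shows "fc N f k = fc N g k"
proof -
  have "(LINT x|tor N. f x * ee N (- k) x) = (LINT x|tor N. g x * ee N (- k) x)"
  proof (rule integral_cong_AE)
    show "(\<lambda>x. f x * ee N (- k) x) \<in> borel_measurable (tor N)" "(\<lambda>x. g x * ee N (- k) x) \<in> borel_measurable (tor N)"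
      by (rule borel_measurable_tor, use assms in measurable)+
    show "AE x in tor N. f x * ee N (- k) x = g x * ee N (- k) x" using assms(1) by eventually_elim simp
  qed
  then show ?thesis by (simp add: fc_tor)
qed

definition tp :: "nat \<Rightarrow> 'a::euclidean_space set \<Rightarrow> ('a \<Rightarrow> complex) \<Rightarrow> 'a \<Rightarrow> complex" where
  "tp N A c x = (\<Sum>k\<in>A. c k * ee N k x)"

lemma tp_continuous: "continuous_on B (tp N A c)"
  unfolding tp_def[abs_def] by (intro continuous_intros ee_continuous)

lemma tp_measurable [measurable]: "tp N A c \<in> borel_measurable borel"
  by (rule borel_measurable_continuous_onI[OF tp_continuous])

lemma tp_L2: "L2 N (tp N A c)"
proof (rule L2_bounded[where C="\<Sum>k\<in>A. cmod (c k)"])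
  show "cmod (tp N A c x) \<le> (\<Sum>k\<in>A. cmod (c k))" for x
    unfolding tp_def by (rule sum_norm_le) (simp add: norm_mult ee_simps)
qed simp

lemma tp_per: assumes "N \<ge> 1" "A \<subseteq> latt" shows "per N (tp N A c)"
  unfolding per_def tp_def
  by (intro allI ballI sum.cong refl) (simp add: perD[OF ee_per[OF assms(1) subsetD[OF assms(2)]]])

lemma fc_ee:
  fixes k :: "'a::euclidean_space"
  assumes N: "N \<ge> 1" and "k \<in> latt" "l \<in> latt"
  shows "fc N (ee N l) k = (if k = l then 1 else 0)"
proof -
  have "ee N l x * ee N (- k) x = ee N (l - k) x" for x by (simp add: ee_simps(2)[symmetric])
  then show ?thesis
    unfolding fc_tor using integral_ee[OF N latt_closed(3)[OF assms(3,2)]] N by auto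
qed

lemma fc_tp:
  assumes N: "N \<ge> 1" and A: "finite A" "A \<subseteq> latt" and k: "k \<in> latt"
  shows "fc N (tp N A c) k = (if k \<in> A then c k else 0)"
proof -
  have "fc N (tp N A c) k = (\<Sum>l\<in>A. fc N (\<lambda>x. c l * ee N l x) k)"
    unfolding tp_def[abs_def] by (rule fc_sum) (intro integrable_tor_continuous continuous_intros ee_continuous)
  also have "\<dots> = (\<Sum>l\<in>A. c l * (if k = l then 1 else 0))"
    by (intro sum.cong refl)
       (use A k in \<open>auto simp: fc_linear(3)[OF integrable_tor_continuous[OF ee_continuous] integrable_tor_continuous[OF ee_continuous]] fc_ee[OF N]\<close>)
  also have "\<dots> = (\<Sum>l\<in>A. if k = l then c l else 0)" by (intro sum.cong) auto
  also have "\<dots> = (if k \<in> A then c k else 0)" using A by simp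
  finally show ?thesis .
qed

lemma integral_mult_cnj_tp:
  fixes f :: "'a::euclidean_space \<Rightarrow> complex"
  assumes N: "N \<ge> 1" and A: "finite A" and f: "integrable (tor N) f"
  shows "(LINT x|tor N. f x * cnj (tp N A c x)) = of_real (real N ^ DIM('a)) * (\<Sum>k\<in>A. fc N f k * cnj (c k))"
proof -
  have i: "integrable (tor N) (\<lambda>x. f x * ee N (- k) x)" for k
    by (rule integrable_tor_mult_bounded[OF f, where C=1]) (auto simp: ee_simps)
  have "(LINT x|tor N. f x * cnj (tp N A c x)) = (LINT x|tor N. (\<Sum>k\<in>A. cnj (c k) * (f x * ee N (- k) x)))"
    by (intro Bochner_Integration.integral_cong refl) (simp add: tp_def sum_distrib_left ee_simps(4) mult_ac)
  also have "\<dots> = (\<Sum>k\<in>A. cnj (c k) * (LINT x|tor N. f x * ee N (- k) x))" using i by simp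
  also have "\<dots> = of_real (real N ^ DIM('a)) * (\<Sum>k\<in>A. fc N f k * cnj (c k))"
    unfolding sum_distrib_left fc_tor using N by (intro sum.cong refl) auto
  finally show ?thesis .
qed

lemma norm_tp:
  fixes c :: "'a::euclidean_space \<Rightarrow> complex"
  assumes N: "N \<ge> 1" and A: "finite A" "A \<subseteq> latt"
  shows "(LINT x|tor N. (cmod (tp N A c x))\<^sup>2) = real N ^ DIM('a) * (\<Sum>k\<in>A. (cmod (c k))\<^sup>2)"
proof -
  have "complex_of_real (LINT x|tor N. (cmod (tp N A c x))\<^sup>2) = (LINT x|tor N. tp N A c x * cnj (tp N A c x))"
    unfolding integral_complex_of_real[symmetric] by (simp only: complex_norm_square)
  also have "\<dots> = of_real (real N ^ DIM('a)) * (\<Sum>k\<in>A. fc N (tp N A c) k * cnj (c k))"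
    by (rule integral_mult_cnj_tp[OF N A(1)]) (rule L2_integrable[OF tp_L2])
  also have "\<dots> = of_real (real N ^ DIM('a)) * (\<Sum>k\<in>A. of_real ((cmod (c k))\<^sup>2))"
    by (intro arg_cong2[where f="(*)"] refl sum.cong)
       (simp add: fc_tp[OF N A subsetD[OF A(2)]] complex_norm_square del: of_real_power)
  also have "\<dots> = complex_of_real (real N ^ DIM('a) * (\<Sum>k\<in>A. (cmod (c k))\<^sup>2))" by simp
  finally show ?thesis using of_real_eq_iff by blast
qed

lemma bessel_finite:
  fixes f :: "'a::euclidean_space \<Rightarrow> complex"
  assumes N: "N \<ge> 1" and A: "finite A" "A \<subseteq> latt" and f: "L2 N f"
  shows "real N ^ DIM('a) * (\<Sum>k\<in>A. (cmod (fc N f k))\<^sup>2) \<le> (LINT x|tor N. (cmod (f x))\<^sup>2)"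
proof -
  let ?p = "tp N A (fc N f)" and ?S = "real N ^ DIM('a) * (\<Sum>k\<in>A. (cmod (fc N f k))\<^sup>2)"
  have "of_real (real N ^ DIM('a)) * (\<Sum>k\<in>A. fc N f k * cnj (fc N f k)) = complex_of_real ?S"
    by (simp only: complex_norm_square of_real_mult of_real_sum)
  then have ip: "(LINT x|tor N. f x * cnj (?p x)) = complex_of_real ?S"
    using integral_mult_cnj_tp[OF N A(1) L2_integrable[OF f], of "fc N f"] by simp
  have i1: "integrable (tor N) (\<lambda>x. (cmod (f x))\<^sup>2)" "integrable (tor N) (\<lambda>x. (cmod (?p x))\<^sup>2)"
    using f tp_L2[of N A "fc N f"] by (auto simp: L2_iff)
  have i2: "integrable (tor N) (\<lambda>x. f x * cnj (?p x))" by (rule L2_mult_integrable[OF f L2_cnj[OF tp_L2]])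
  define R where "R x = Re (f x * cnj (?p x))" for x
  have R: "integrable (tor N) R" "(LINT x|tor N. R x) = Re (LINT x|tor N. f x * cnj (?p x))"
    unfolding R_def using integral_Re[OF i2] integrable_Re[OF i2] by auto
  have "(cmod (f x - ?p x))\<^sup>2 = (cmod (f x))\<^sup>2 - 2 * R x + (cmod (?p x))\<^sup>2" for x
    unfolding cmod_power2 R_def by (simp add: power2_eq_square algebra_simps)
  then have "(LINT x|tor N. (cmod (f x - ?p x))\<^sup>2)
    = (LINT x|tor N. (cmod (f x))\<^sup>2) - 2 * Re (LINT x|tor N. f x * cnj (?p x)) + (LINT x|tor N. (cmod (?p x))\<^sup>2)"
    using i1 R by simp
  also have "\<dots> = (LINT x|tor N. (cmod (f x))\<^sup>2) - ?S"
    unfolding ip norm_tp[OF N A] by simp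
  finally show ?thesis
    using Bochner_Integration.integral_nonneg[of "tor N" "\<lambda>x. (cmod (f x - ?p x))\<^sup>2"] by simp
qed

section \<open>Trigonometric polynomials and uniqueness of Fourier coefficients\<close>

inductive trigp :: "nat \<Rightarrow> ('a::euclidean_space \<Rightarrow> complex) \<Rightarrow> bool" for N where
  mono: "k \<in> latt \<Longrightarrow> trigp N (\<lambda>x. c * ee N k x)"
| add: "trigp N f \<Longrightarrow> trigp N g \<Longrightarrow> trigp N (\<lambda>x. f x + g x)"

lemma trigp_const: "trigp N (\<lambda>x. c)"
  using trigp.mono[OF latt_closed(1), of N c] by (simp add: ee_simps)

lemma trigp_mult:
  assumes "trigp N f" "trigp N g" shows "trigp N (\<lambda>x. f x * g x)"
  using assms(1)
proof induction
  case (mono k c)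
  show ?case using assms(2)
  proof induction
    case (mono l d)
    have "(\<lambda>x. c * ee N k x * (d * ee N l x)) = (\<lambda>x. (c * d) * ee N (k + l) x)"
      by (auto simp: ee_simps)
    then show ?case using trigp.mono[OF latt_closed(2)[OF \<open>k \<in> latt\<close> mono], of N "c * d"] by simp
  next
    case (add f g)
    then show ?case using trigp.add[OF add.IH] by (simp add: algebra_simps)
  qed
next
  case (add f1 f2)
  then show ?case using trigp.add[OF add.IH] by (simp add: algebra_simps)
qed

lemma trigp_sum: "(\<And>i. i \<in> I \<Longrightarrow> trigp N (f i)) \<Longrightarrow> trigp N (\<lambda>x. \<Sum>i\<in>I. f i x)"
  by (induction I rule: infinite_finite_induct) (auto intro!: trigp_const trigp.add)

lemma trigp_bounded_measurable:
  "trigp N h \<Longrightarrow> h \<in> borel_measurable borel \<and> (\<exists>C. \<forall>x. cmod (h x) \<le> C)"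
proof (induction rule: trigp.induct)
  case (mono k c)
  then show ?case by (auto simp: norm_mult ee_simps)
next
  case (add f g)
  then obtain C D where "\<And>x. cmod (f x) \<le> C" "\<And>x. cmod (g x) \<le> D" by blast
  then have "cmod (f x + g x) \<le> C + D" for x using norm_triangle_ineq[of "f x" "g x"] by (meson add_mono order_trans)
  then show ?case using add by auto
qed

text \<open>Cosine and sine of every coordinate embed the torus in a Euclidean space. Polynomials
  restricted to the image are trigonometric polynomials, so the polynomial form of the
  Stone-Weierstrass theorem becomes applicable.\<close>

definition tmap :: "nat \<Rightarrow> 'a::euclidean_space \<Rightarrow> 'a \<times> 'a" where
  "tmap N x = (\<Sum>b\<in>Basis. cos ((2 * pi / real N) * (x \<bullet> b)) *\<^sub>R b, \<Sum>b\<in>Basis. sin ((2 * pi / real N) * (x \<bullet> b)) *\<^sub>R b)"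

lemma tmap_continuous: "continuous_on A (tmap N)"
  unfolding tmap_def[abs_def] by (intro continuous_intros)

lemma trigp_polynomial:
  assumes "real_polynomial_function p" shows "trigp N (\<lambda>x. complex_of_real (p (tmap N x)))"
  using assms
proof induction
  case (linear f)
  interpret bounded_linear f by fact
  have c: "trigp N (\<lambda>x. complex_of_real (cos ((2 * pi / real N) * (x \<bullet> b))))"
    and s: "trigp N (\<lambda>x. complex_of_real (sin ((2 * pi / real N) * (x \<bullet> b))))" if b: "b \<in> Basis" for b :: 'a
  proof -
    note l = latt_closed(5)[OF b] latt_closed(4)[OF latt_closed(5)[OF b]]
    have "(\<lambda>x. complex_of_real (cos ((2 * pi / real N) * (x \<bullet> b)))) = (\<lambda>x. (1/2) * ee N b x + (1/2) * ee N (- b) x)"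
      by (auto simp: ee_def complex_eq_iff inner_commute)
    then show "trigp N (\<lambda>x. complex_of_real (cos ((2 * pi / real N) * (x \<bullet> b))))"
      using trigp.add[OF trigp.mono[OF l(1)] trigp.mono[OF l(2)]] by metis
    have "(\<lambda>x. complex_of_real (sin ((2 * pi / real N) * (x \<bullet> b)))) = (\<lambda>x. (- \<i>/2) * ee N b x + (\<i>/2) * ee N (- b) x)"
      by (auto simp: ee_def complex_eq_iff inner_commute)
    then show "trigp N (\<lambda>x. complex_of_real (sin ((2 * pi / real N) * (x \<bullet> b))))"
      using trigp.add[OF trigp.mono[OF l(1)] trigp.mono[OF l(2)]] by metis
  qed
  have "complex_of_real (f (tmap N x)) = (\<Sum>b\<in>Basis. of_real (f (b, 0)) * complex_of_real (cos ((2 * pi / real N) * (x \<bullet> b))))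
      + (\<Sum>b\<in>Basis. of_real (f (0, b)) * complex_of_real (sin ((2 * pi / real N) * (x \<bullet> b))))" for x
  proof -
    have "tmap N x = (\<Sum>b\<in>Basis. cos ((2 * pi / real N) * (x \<bullet> b)) *\<^sub>R (b, 0)) + (\<Sum>b\<in>Basis. sin ((2 * pi / real N) * (x \<bullet> b)) *\<^sub>R (0, b))"
      by (simp add: tmap_def prod_eq_iff fst_sum snd_sum)
    then show ?thesis by (simp only: add sum scaleR of_real_add of_real_sum real_scaleR_def of_real_mult mult.commute)
  qed
  then show ?case
    by (simp only:) (intro trigp.add trigp_sum trigp_mult trigp_const c s)
next
  case (const c) show ?case by (rule trigp_const)
next
  case (add f g) then show ?case using trigp.add[OF add.IH] by simp
next
  case (mult f g) then show ?case using trigp_mult[OF mult.IH] by simp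
qed

text \<open>Opposite faces of the closed box have the same image, so one of the two points has to be
  interior.\<close>

lemma tmap_inj:
  assumes N: "N \<ge> 1" and x: "x \<in> box 0 (real N *\<^sub>R One)" and y: "y \<in> Tb N" and eq: "tmap N x = tmap N y"
  shows "x = (y :: 'a::euclidean_space)"
proof (rule euclidean_eqI)
  fix b :: 'a assume b: "b \<in> Basis"
  have "fst (tmap N z) \<bullet> b = cos ((2 * pi / real N) * (z \<bullet> b))" "snd (tmap N z) \<bullet> b = sin ((2 * pi / real N) * (z \<bullet> b))" for z
    using b by (simp_all add: tmap_def)
  then have "sin ((2 * pi / real N) * (x \<bullet> b)) = sin ((2 * pi / real N) * (y \<bullet> b)) \<and> cos ((2 * pi / real N) * (x \<bullet> b)) = cos ((2 * pi / real N) * (y \<bullet> b))"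
    using eq by metis
  then obtain n :: int where n: "(2 * pi / real N) * (x \<bullet> b) = (2 * pi / real N) * (y \<bullet> b) + 2 * pi * n"
    by (auto simp: sin_cos_eq_iff)
  have "x \<bullet> b = y \<bullet> b + real N * n"
  proof -
    have "(2 * pi / real N) * (x \<bullet> b) = (2 * pi / real N) * (y \<bullet> b + real N * n)"
      using n N by (simp add: algebra_simps)
    then show ?thesis using N pi_gt_zero by (simp only: mult_cancel_left) auto
  qed
  moreover have "0 < x \<bullet> b" "x \<bullet> b < real N" "0 \<le> y \<bullet> b" "y \<bullet> b \<le> real N"
    using x y b by (auto simp: Tb_def mem_box)
  ultimately have lt: "real N * n < real N * 1" "real N * (-1) < real N * n" by linarith+
  have Np: "0 < real N" using N by simp
  have "real_of_int n < 1" "-1 < real_of_int n"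
    using iffD1[OF mult_less_cancel_left_pos[OF Np] lt(1)] iffD1[OF mult_less_cancel_left_pos[OF Np] lt(2)] by auto
  then have "n = 0" by linarith
  then show "x \<bullet> b = y \<bullet> b" using \<open>x \<bullet> b = y \<bullet> b + real N * n\<close> by simp
qed

lemma AE_tor_interior: "AE x in tor N. x \<in> box 0 (real N *\<^sub>R One :: 'a::euclidean_space)"
proof -
  have "AE x in lborel. \<forall>b\<in>Basis. x \<bullet> b \<noteq> 0 \<and> x \<bullet> (b::'a) \<noteq> real N"
    by (rule AE_finite_allI) (auto intro: AE_hyperplane AE_conjI)
  then show ?thesis
    unfolding AE_tor_iff by eventually_elim (auto simp: Tb_def mem_box order_less_le)
qed

text \<open>Orthogonality to trigonometric polynomials extends by uniform approximation to
  continuous functions of \<open>tmap N x\<close>, then by dominated convergence to indicators. An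
  integrable function whose integral over every Borel set vanishes is zero almost
  everywhere.\<close>

theorem fourier_unique:
  fixes f :: "'a::euclidean_space \<Rightarrow> complex"
  assumes N: "N \<ge> 1" and f: "integrable (tor N) f" and z: "\<And>k. k \<in> latt \<Longrightarrow> fc N f k = 0"
  shows "AE x in tor N. f x = 0"
proof -
  have s1: "(LINT x|tor N. f x * h x) = 0" if "trigp N h" for h
    using that
  proof induction
    case (mono k c)
    have "(LINT x|tor N. f x * ee N k x) = 0"
      using z[OF latt_closed(4)[OF mono]] N by (simp add: fc_tor)
    then have "(LINT x|tor N. c * (f x * ee N k x)) = 0" by simp
    then show ?case by (simp add: mult_ac)
  next
    case (add g h)
    have "integrable (tor N) (\<lambda>x. f x * g x)" "integrable (tor N) (\<lambda>x. f x * h x)"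
      using trigp_bounded_measurable[OF add.hyps(1)] trigp_bounded_measurable[OF add.hyps(2)]
      by (auto intro: integrable_tor_mult_bounded[OF f])
    then show ?case using add.IH by (simp add: distrib_left)
  qed
  have s2: "(LINT x|tor N. f x * of_real (g (tmap N x))) = 0" if g: "continuous_on UNIV g" for g :: "'a \<times> 'a \<Rightarrow> real"
  proof -
    have cS: "compact (tmap N ` Tb N :: ('a \<times> 'a) set)"
      by (intro compact_continuous_image tmap_continuous) (auto simp: Tb_def)
    have bnd: "cmod (LINT x|tor N. f x * of_real (g (tmap N x))) \<le> e * (LINT x|tor N. norm (f x))" if e: "e > 0" for e
    proof -
      obtain p where p: "real_polynomial_function p" "\<And>y. y \<in> tmap N ` Tb N \<Longrightarrow> \<bar>g y - p y\<bar> < e"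
        using Stone_Weierstrass_real_polynomial_function[OF cS continuous_on_subset[OF g] e] by blast
      have pt: "trigp N (\<lambda>x. complex_of_real (p (tmap N x)))" by (rule trigp_polynomial[OF p(1)])
      have ip: "integrable (tor N) (\<lambda>x. f x * of_real (p (tmap N x)))"
      proof -
        obtain C where "\<And>x. cmod (complex_of_real (p (tmap N x))) \<le> C"
          using trigp_bounded_measurable[OF pt] by blast
        then show ?thesis
          using trigp_bounded_measurable[OF pt] by (intro integrable_tor_mult_bounded[OF f, where C=C]) auto
      qed
      have mgt: "(\<lambda>x. complex_of_real (g (tmap N x))) \<in> borel_measurable borel"
        by (intro borel_measurable_continuous_onI continuous_intros continuous_on_compose2[OF g tmap_continuous]) auto
      have ig: "integrable (tor N) (\<lambda>x. f x * of_real (g (tmap N x)))"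
      proof -
        have "bounded (g ` (tmap N ` Tb N))"
          by (intro compact_imp_bounded compact_continuous_image[OF continuous_on_subset[OF g] cS]) auto
        then obtain C where C: "\<And>x. x \<in> Tb N \<Longrightarrow> \<bar>g (tmap N x)\<bar> \<le> C" unfolding bounded_iff by auto
        have "integrable (tor N) (\<lambda>x. f x * (if x \<in> Tb N then of_real (g (tmap N x)) else 0))"
          by (rule integrable_tor_mult_bounded[OF f, where C="\<bar>C\<bar>"])
             (use mgt C in \<open>auto intro!: measurable_If simp: order_trans[OF C]\<close>)
        then show ?thesis by (rule Bochner_Integration.integrable_cong[THEN iffD1, rotated -1]) auto
      qed
      have "(LINT x|tor N. f x * of_real (g (tmap N x))) = (LINT x|tor N. f x * of_real (g (tmap N x)) - f x * of_real (p (tmap N x)))"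
        using ig ip s1[OF pt] by simp
      also have "cmod \<dots> \<le> (LINT x|tor N. e * norm (f x))"
      proof (rule Bochner_Integration.integral_norm_bound_integral)
        fix x assume "x \<in> space (tor N :: 'a measure)"
        then have "\<bar>g (tmap N x) - p (tmap N x)\<bar> \<le> e" using p(2)[of "tmap N x"] by fastforce
        then have "norm (f x) * \<bar>g (tmap N x) - p (tmap N x)\<bar> \<le> norm (f x) * e" by (intro mult_left_mono) auto
        then show "norm (f x * of_real (g (tmap N x)) - f x * of_real (p (tmap N x))) \<le> e * norm (f x)"
          unfolding right_diff_distrib[symmetric] norm_mult of_real_diff[symmetric] norm_of_real by (simp add: mult.commute)
      qed (use ig ip f in auto)
      finally show ?thesis by simp
    qed
    show ?thesis
    proof (rule ccontr)
      assume a: "\<not> ?thesis"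
      define J where "J = (LINT x|tor N. norm (f x))"
      define d where "d = cmod (LINT x|tor N. f x * of_real (g (tmap N x)))"
      have J: "J \<ge> 0" unfolding J_def by (rule Bochner_Integration.integral_nonneg) auto
      have d: "d > 0" using a by (simp add: d_def)
      \<comment> \<open>The tolerance is chosen to make the error at most \<open>d / 2\<close>; the
        added 1 avoids a division by zero when \<open>J = 0\<close>.\<close>
      have "d \<le> d / (2 * (J + 1)) * J"
        using bnd[of "d / (2 * (J + 1))"] J d by (simp add: J_def[symmetric] d_def[symmetric])
      also have "\<dots> \<le> d / 2" using J d by (simp add: field_simps)
      finally show False using d by simp
    qed
  qed
  \<comment> \<open>Continuous functions of the distance to \<open>C\<close> decrease to its
    indicator. \<open>C\<close> must be nonempty for \<open>infdist\<close> to be positive off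
    \<open>C\<close>.\<close>
  have s3: "(LINT x|tor N. f x * of_real (indicator C (tmap N x))) = 0" if C: "closed C" "C \<noteq> {}" for C :: "('a \<times> 'a) set"
  proof -
    define g where "g n y = max 0 (1 - real n * infdist y C)" for n y
    have gc: "continuous_on UNIV (g n)" for n
      unfolding g_def[abs_def] by (intro continuous_intros)
    have "(\<lambda>n. LINT x|tor N. f x * of_real (g n (tmap N x))) \<longlonglongrightarrow> (LINT x|tor N. f x * of_real (indicator C (tmap N x)))"
    proof (rule integral_dominated_convergence[where w="\<lambda>x. norm (f x)"])
      have fm: "f \<in> borel_measurable (tor N)" using f by simp
      have tm: "tmap N \<in> borel_measurable (tor N)"
        by (intro borel_measurable_tor borel_measurable_continuous_onI tmap_continuous)
      have "(\<lambda>y. indicator C y :: real) \<in> borel_measurable borel" using borel_closed[OF C(1)] by simp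
      from measurable_compose[OF tm this]
      show "(\<lambda>x. f x * of_real (indicator C (tmap N x))) \<in> borel_measurable (tor N)" using fm by simp
      show "(\<lambda>x. f x * of_real (g n (tmap N x))) \<in> borel_measurable (tor N)" for n
        using measurable_compose[OF tm borel_measurable_continuous_onI[OF gc]] fm by simp
      show "integrable (tor N) (\<lambda>x. norm (f x))" using f by simp
      show "AE x in tor N. norm (f x * of_real (g n (tmap N x))) \<le> norm (f x)" for n
      proof (rule AE_I2)
        fix x
        have "\<bar>g n (tmap N x)\<bar> \<le> 1" using infdist_nonneg[of "tmap N x" C] by (auto simp: g_def)
        then show "norm (f x * of_real (g n (tmap N x))) \<le> norm (f x)"
          by (simp add: norm_mult mult_left_le)
      qed
      show "AE x in tor N. (\<lambda>n. f x * of_real (g n (tmap N x))) \<longlonglongrightarrow> f x * of_real (indicator C (tmap N x))"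
      proof (rule AE_I2)
        fix x
        have "(\<lambda>n. g n y) \<longlonglongrightarrow> indicator C y" for y
        proof (cases "y \<in> C")
          case True
          then show ?thesis by (simp add: g_def infdist_zero)
        next
          case False
          then have d: "infdist y C > 0" using C by (simp add: infdist_pos_not_in_closed)
          obtain n0 :: nat where n0: "1 / infdist y C < real n0" using reals_Archimedean2 by blast
          have "g n y = 0" if "n \<ge> n0" for n
          proof -
            have "1 < real n0 * infdist y C" using n0 d by (simp add: field_simps)
            also have "\<dots> \<le> real n * infdist y C" using that d by (intro mult_right_mono) auto
            finally show ?thesis by (simp add: g_def)
          qed
          then have "\<forall>\<^sub>F n in sequentially. g n y = indicator C y"
            using False by (auto simp: eventually_sequentially intro!: exI[of _ n0])
          then show ?thesis by (rule tendsto_eventually)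
        qed
        then show "(\<lambda>n. f x * of_real (g n (tmap N x))) \<longlonglongrightarrow> f x * of_real (indicator C (tmap N x))"
          by (intro tendsto_intros)
      qed
    qed
    then show ?thesis using s2[OF gc] by (simp add: LIMSEQ_const_iff)
  qed
  have i0: "(LINT x|tor N. f x) = 0" using z[OF latt_closed(1)] N by (simp add: fc_tor ee_simps)
  have fB: "integrable (tor N) (\<lambda>x. indicator A x *\<^sub>R f x)" if "A \<in> sets borel" for A
  proof -
    have "A \<inter> Tb N \<in> sets (tor N)" using that by (auto simp: tor_def sets_restrict_space)
    then have "integrable (tor N) (\<lambda>x. indicator (A \<inter> Tb N) x *\<^sub>R f x)" using f by (rule integrable_mult_indicator)
    then show ?thesis by (rule Bochner_Integration.integrable_cong[THEN iffD1, rotated -1]) (auto simp: indicator_def)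
  qed
  \<comment> \<open>For open \<open>U\<close> in the interior of the box, the complement of
    \<open>U\<close> in the box has a compact image, and \<open>tmap_inj\<close> allows the
    indicator of this image to be pulled back to the indicator of the complement.\<close>
  have s4: "(LINT x|tor N. indicator U x *\<^sub>R f x) = 0" if U: "open U" "U \<subseteq> box 0 (real N *\<^sub>R One)" for U
  proof -
    have cC: "compact (Tb N - U)" using U by (intro compact_diff) (auto simp: Tb_def)
    have ne: "Tb N - U \<noteq> {}"
    proof -
      have "0 \<in> Tb N - U" using U(2) by (auto simp: Tb_def mem_box inner_Basis box_def)
      then show ?thesis by blast
    qed
    have "closed (tmap N ` (Tb N - U))" by (intro compact_imp_closed compact_continuous_image tmap_continuous cC)
    then have "(LINT x|tor N. f x * of_real (indicator (tmap N ` (Tb N - U)) (tmap N x))) = 0"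
      by (rule s3) (use ne in auto)
    also have "(LINT x|tor N. f x * of_real (indicator (tmap N ` (Tb N - U)) (tmap N x))) = (LINT x|tor N. f x - indicator U x *\<^sub>R f x)"
    proof (rule Bochner_Integration.integral_cong[OF refl])
      fix x :: 'a assume "x \<in> space (tor N)"
      then have x: "x \<in> Tb N" by simp
      show "f x * of_real (indicator (tmap N ` (Tb N - U)) (tmap N x)) = f x - indicator U x *\<^sub>R f x"
      proof (cases "x \<in> U")
        case True
        have "tmap N x \<notin> tmap N ` (Tb N - U)"
        proof
          assume "tmap N x \<in> tmap N ` (Tb N - U)"
          then obtain y where "y \<in> Tb N - U" "tmap N x = tmap N y" by auto
          then have "x = y" using tmap_inj[OF N, of x y] U(2) True by auto
          then show False using True \<open>y \<in> Tb N - U\<close> by auto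
        qed
        then show ?thesis using True by simp
      next
        case False
        then have "tmap N x \<in> tmap N ` (Tb N - U)" using x by auto
        then show ?thesis using False by simp
      qed
    qed
    finally show ?thesis using f fB[OF borel_open[OF U(1)]] i0 by simp
  qed
  \<comment> \<open>Boxes are stable under intersection and generate the Borel sets. A general box
    is replaced by its part in the open fundamental box, which changes nothing up to a null set of
    the torus.\<close>
  have s5: "(LINT x|tor N. indicator A x *\<^sub>R f x) = 0" if "A \<in> sets borel" for A
  proof -
    let ?G = "range (\<lambda>(a, b). box a b :: 'a set)"
    have G: "Int_stable ?G" "?G \<subseteq> Pow UNIV" by (auto simp: Int_stable_def box_Int_box)
    have "A \<in> sigma_sets UNIV ?G" using that by (simp add: borel_eq_box)
    with G show ?thesis
    proof (induction rule: sigma_sets_induct_disjoint)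
      case (basic A)
      then obtain a b where A: "A = box a b" by auto
      have "(LINT x|tor N. indicator A x *\<^sub>R f x) = (LINT x|tor N. indicator (A \<inter> box 0 (real N *\<^sub>R One)) x *\<^sub>R f x)"
      proof (rule integral_cong_AE)
        show "AE x in tor N. indicator A x *\<^sub>R f x = indicator (A \<inter> box 0 (real N *\<^sub>R One)) x *\<^sub>R f x"
          using AE_tor_interior by eventually_elim (auto simp: indicator_def)
      qed (use fB[of A] fB[of "A \<inter> box 0 (real N *\<^sub>R One)"] A in auto)
      also have "\<dots> = 0" by (rule s4) (auto simp: A)
      finally show ?case .
    next
      case empty then show ?case by simp
    next
      case (compl A)
      have A: "A \<in> sets borel" using compl by (simp add: borel_eq_box)
      have "(LINT x|tor N. indicator (UNIV - A) x *\<^sub>R f x) = (LINT x|tor N. f x - indicator A x *\<^sub>R f x)"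
        by (rule Bochner_Integration.integral_cong) (auto simp: indicator_def)
      then show ?case using fB[OF A] f i0 compl by simp
    next
      case (union A)
      have A: "A i \<in> sets borel" for i using union by (auto simp: borel_eq_box)
      have "(\<lambda>n. LINT x|tor N. indicator (\<Union>i<n. A i) x *\<^sub>R f x) \<longlonglongrightarrow> (LINT x|tor N. indicator (\<Union>i. A i) x *\<^sub>R f x)"
      proof (rule integral_dominated_convergence[where w="\<lambda>x. norm (f x)"])
        show "AE x in tor N. (\<lambda>n. indicator (\<Union>i<n. A i) x *\<^sub>R f x) \<longlonglongrightarrow> indicator (\<Union>i. A i) x *\<^sub>R f x"
          by (intro AE_I2 tendsto_intros LIMSEQ_indicator_UN)
      qed (use f fB[of "\<Union>i. A i"] fB[of "\<Union>i<n. A i" for n] A in \<open>auto simp: indicator_def intro!: AE_I2\<close>)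
      moreover have "(LINT x|tor N. indicator (\<Union>i<n. A i) x *\<^sub>R f x) = 0" for n :: nat
      proof -
        have "(indicator (\<Union>i<n. A i) x :: real) = (\<Sum>i<n. indicator (A i) x)" for x
          by (rule indicator_UN_disjoint) (use union(1) in \<open>auto simp: disjoint_family_on_def\<close>)
        then have "indicator (\<Union>i<n. A i) x *\<^sub>R f x = (\<Sum>i<n. indicator (A i) x *\<^sub>R f x)" for x
          by (simp only: scaleR_sum_left)
        then have "(LINT x|tor N. indicator (\<Union>i<n. A i) x *\<^sub>R f x) = (LINT x|tor N. (\<Sum>i<n. indicator (A i) x *\<^sub>R f x))"
          by (simp only:)
        also have "\<dots> = (\<Sum>i<n. LINT x|tor N. indicator (A i) x *\<^sub>R f x)"
          by (rule Bochner_Integration.integral_sum) (rule fB[OF A])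
        also have "\<dots> = 0" using union by simp
        finally show ?thesis .
      qed
      ultimately show ?case by (simp add: LIMSEQ_const_iff)
    qed
  qed
  show ?thesis
  proof (rule sigma_finite_measure.density_zero[OF finite_measure.axioms(1)[OF finite_measure_tor] f])
    fix A assume "A \<in> sets (tor N :: 'a measure)"
    then have "A \<in> sets borel" by (auto simp: tor_def sets_restrict_space)
    from s5[OF this] show "set_lebesgue_integral (tor N) A f = 0"
      by (simp add: set_lebesgue_integral_def)
  qed
qed

text \<open>The limit is taken along partial sums so sparse that they converge almost everywhere;
  Fatou's lemma bounds its norm, which together with uniqueness and Bessel's inequality yields
  Parseval's identity without completeness of \<open>L\<^sup>2\<close>.\<close>

lemma riesz_fischer:
  fixes c :: "'a::euclidean_space \<Rightarrow> complex"
  assumes N: "N \<ge> 1" and c: "(\<lambda>k. (cmod (c k))\<^sup>2) summable_on latt"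
  obtains g where "L2 N g" "per N g" "\<And>k. k \<in> latt \<Longrightarrow> fc N g k = c k"
    "(LINT x|tor N. (cmod (g x))\<^sup>2) \<le> real N ^ DIM('a) * (\<Sum>\<^sub>\<infinity>k\<in>latt. (cmod (c k))\<^sup>2)"
proof -
  define V where "V = real N ^ DIM('a)"
  have V: "V > 0" using N by (simp add: V_def)
  define s where "s = (\<Sum>\<^sub>\<infinity>k\<in>latt. (cmod (c k))\<^sup>2)"
  have ub: "(\<Sum>k\<in>A. (cmod (c k))\<^sup>2) \<le> s" if "finite A" "A \<subseteq> latt" for A
    unfolding s_def by (rule finite_sum_le_infsum[OF c that]) simp
  have s0: "s \<ge> 0" using ub[of "{}"] by simp
  \<comment> \<open>The decay \<open>(1/4)^j\<close> concerns squares; its square root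
    \<open>(1/2)^j\<close> will bound the L^1 norms of the increments, which are then
    summable.\<close>
  have "\<exists>A. finite A \<and> A \<subseteq> latt \<and> s - (\<Sum>k\<in>A. (cmod (c k))\<^sup>2) \<le> (1/4)^j" for j :: nat
  proof -
    obtain A where "finite A" "A \<subseteq> latt" "dist (\<Sum>k\<in>A. (cmod (c k))\<^sup>2) s \<le> (1/4)^j"
      using infsum_finite_approximation[OF c, of "(1/4)^j"] by (auto simp: s_def)
    then show ?thesis by (intro exI[of _ A]) (auto simp: dist_real_def)
  qed
  then obtain A where A: "\<And>j. finite (A j)" "\<And>j. A j \<subseteq> latt" "\<And>j. s - (\<Sum>k\<in>A j. (cmod (c k))\<^sup>2) \<le> (1/4)^j"
    by metis
  define B where "B j = (\<Union>i\<le>j. A i)" for j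
  have B: "finite (B j)" "B j \<subseteq> latt" "B j \<subseteq> B (Suc j)" for j
  proof -
    show "finite (B j)" "B j \<subseteq> latt" using A(1,2) by (auto simp: B_def)
    show "B j \<subseteq> B (Suc j)" unfolding B_def by (intro UN_mono) auto
  qed
  have Bs: "s - (\<Sum>k\<in>B j. (cmod (c k))\<^sup>2) \<le> (1/4)^j" for j
  proof -
    have "(\<Sum>k\<in>A j. (cmod (c k))\<^sup>2) \<le> (\<Sum>k\<in>B j. (cmod (c k))\<^sup>2)"
      by (rule sum_mono2[OF B(1)]) (auto simp: B_def)
    then show ?thesis using A(3)[of j] by linarith
  qed
  define D where "D j = B (Suc j) - B j" for j
  have D: "finite (D j)" "D j \<subseteq> latt" for j using B by (auto simp: D_def)
  define d where "d j = tp N (D j) c" for j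
  have dn: "(LINT x|tor N. (cmod (d j x))\<^sup>2) \<le> V * (1/4)^j" for j
  proof -
    have "(\<Sum>k\<in>D j. (cmod (c k))\<^sup>2) = (\<Sum>k\<in>B (Suc j). (cmod (c k))\<^sup>2) - (\<Sum>k\<in>B j. (cmod (c k))\<^sup>2)"
      unfolding D_def by (rule sum_diff[OF B(1,3)])
    also have "\<dots> \<le> (1/4)^j" using ub[OF B(1,2), of "Suc j"] Bs[of j] by linarith
    finally show ?thesis unfolding d_def norm_tp[OF N D] V_def[symmetric] using V by simp
  qed
  have d1: "(LINT x|tor N. cmod (d j x)) \<le> V * (1/2)^j" for j
  proof -
    have i: "integrable (tor N) (\<lambda>x. (cmod (d j x))\<^sup>2)" using tp_L2[of N "D j" c] by (auto simp: d_def L2_iff)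
    \<comment> \<open>The arithmetic-geometric mean inequality replaces Cauchy-Schwarz: with the
      weight \<open>2^j\<close> each of the two terms integrates to at most half of
      \<open>V * (1/2)^j\<close>.\<close>
    have "cmod (d j x) \<le> (1/2) * (1/2)^j + (1/2) * 2^j * (cmod (d j x))\<^sup>2" for x
    proof -
      define a where "a = (2::real)^j"
      have a: "a > 0" "(1/2)^j = 1 / a" by (auto simp: a_def power_one_over)
      have "0 \<le> (a * cmod (d j x) - 1)\<^sup>2" by simp
      then have "2 * a * cmod (d j x) \<le> 1 + a * a * (cmod (d j x))\<^sup>2"
        by (simp add: power2_eq_square algebra_simps)
      then have "2 * a * cmod (d j x) / (2 * a) \<le> (1 + a * a * (cmod (d j x))\<^sup>2) / (2 * a)"
        using a by (intro divide_right_mono) auto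
      also have "(1 + a * a * (cmod (d j x))\<^sup>2) / (2 * a) = (1/2) * (1 / a) + (1/2) * a * (cmod (d j x))\<^sup>2"
        using a by (simp add: field_simps)
      finally show ?thesis using a by (simp add: a_def[symmetric])
    qed
    then have "(LINT x|tor N. cmod (d j x)) \<le> (LINT x|(tor N::'a measure). (1/2) * (1/2)^j + (1/2) * 2^j * (cmod (d j x))\<^sup>2)"
      using i L2_integrable[OF tp_L2[of N "D j" c]]
      by (intro integral_mono) (auto simp: d_def finite_measure.integrable_const[OF finite_measure_tor])
    also have "\<dots> = V * ((1/2) * (1/2)^j) + (1/2) * 2^j * (LINT x|tor N. (cmod (d j x))\<^sup>2)"
      using i by (subst Bochner_Integration.integral_add)
         (auto simp: finite_measure.integrable_const[OF finite_measure_tor] measure_tor V_def)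
    also have "\<dots> \<le> V * ((1/2) * (1/2)^j) + (1/2) * 2^j * (V * (1/4)^j)"
      using dn[of j] by (intro add_left_mono mult_left_mono) auto
    also have "\<dots> = V * (1/2)^j"
    proof -
      have "(2::real)^j * (1/4)^j = (1/2)^j" unfolding power_mult_distrib[symmetric] by simp
      then have "(1/2) * 2^j * (V * (1/4)^j) = V * ((1/2) * (1/2)^j)" by (simp add: algebra_simps)
      then show ?thesis by (simp only:)
    qed
    finally show ?thesis .
  qed
  have dint: "integrable (tor N) (d j)" for j unfolding d_def by (rule L2_integrable[OF tp_L2])
  have sum1: "summable (\<lambda>j. LINT x|tor N. norm (d j x))"
    by (rule summable_comparison_test'[OF summable_mult[OF summable_geometric[of "1/2::real"], of V]])
       (use d1 in \<open>auto\<close>)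
  have AEs: "AE x in tor N. summable (\<lambda>j. norm (d j x))"
  proof -
    have "(\<integral>\<^sup>+x. (\<Sum>j. ennreal (norm (d j x))) \<partial>tor N) = (\<Sum>j. \<integral>\<^sup>+x. ennreal (norm (d j x)) \<partial>tor N)"
      by (rule nn_integral_suminf) (use dint in simp)
    also have "\<dots> = (\<Sum>j. ennreal (LINT x|tor N. norm (d j x)))"
      by (intro suminf_cong nn_integral_eq_integral) (use dint in auto)
    also have "\<dots> \<noteq> \<infinity>"
      using sum1 by (simp add: ennreal_suminf_neq_top)
    finally have "AE x in tor N. (\<Sum>j. ennreal (norm (d j x))) \<noteq> \<infinity>"
      by (intro nn_integral_noteq_infinite) (use dint in auto)
    then show ?thesis
      by eventually_elim (rule summable_suminf_not_top, auto)
  qed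
  define g where "g x = tp N (B 0) c x + (\<Sum>j. d j x)" for x
  have part: "tp N (B n) c x = tp N (B 0) c x + (\<Sum>j<n. d j x)" for n x
  proof (induction n)
    case (Suc n)
    have "tp N (B (Suc n)) c x = tp N (B n) c x + d n x"
      using sum.subset_diff[OF B(3) B(1), of "\<lambda>k. c k * ee N k x" n] by (simp add: tp_def d_def D_def)
    then show ?case using Suc by simp
  qed simp
  have lim: "AE x in tor N. (\<lambda>n. tp N (B n) c x) \<longlonglongrightarrow> g x"
    using AEs
  proof eventually_elim
    case (elim x)
    have "(\<lambda>n. \<Sum>j<n. d j x) \<longlonglongrightarrow> (\<Sum>j. d j x)"
      using summable_LIMSEQ[OF summable_norm_cancel[OF elim]] .
    then have "(\<lambda>n. tp N (B 0) c x + (\<Sum>j<n. d j x)) \<longlonglongrightarrow> g x"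
      unfolding g_def by (intro tendsto_intros)
    then show ?case by (simp only: part[symmetric])
  qed
  have gm: "g \<in> borel_measurable borel"
    unfolding g_def[abs_def] d_def by (intro borel_measurable_add borel_measurable_suminf tp_measurable)
  have gi: "integrable (tor N) g"
    unfolding g_def[abs_def] using L2_integrable[OF tp_L2] integrable_suminf[OF dint AEs sum1] by (rule Bochner_Integration.integrable_add)
  have gfc: "fc N g k = c k" if k: "k \<in> latt" for k
  proof -
    have e: "integrable (tor N) (\<lambda>x. d j x * ee N (- k) x)" for j
      by (rule integrable_tor_mult_bounded[OF dint, where C=1]) (auto simp: ee_simps)
    have "(\<lambda>j. LINT x|tor N. d j x * ee N (- k) x) sums (LINT x|tor N. (\<Sum>j. d j x * ee N (- k) x))"
      by (rule sums_integral[OF e]) (use AEs sum1 in \<open>auto simp: norm_mult ee_simps\<close>)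
    also have "(LINT x|tor N. (\<Sum>j. d j x * ee N (- k) x)) = (LINT x|tor N. (\<Sum>j. d j x) * ee N (- k) x)"
    proof (rule integral_cong_AE)
      show "AE x in tor N. (\<Sum>j. d j x * ee N (- k) x) = (\<Sum>j. d j x) * ee N (- k) x"
        using AEs by eventually_elim (rule suminf_mult2[symmetric, OF summable_norm_cancel])
      show "(\<lambda>x. (\<Sum>j. d j x * ee N (- k) x)) \<in> borel_measurable (tor N)"
        by (rule borel_measurable_suminf) (use e in auto)
      show "(\<lambda>x. (\<Sum>j. d j x) * ee N (- k) x) \<in> borel_measurable (tor N)"
        by (intro borel_measurable_times borel_measurable_suminf borel_measurable_integrable[OF dint] borel_measurable_tor ee_measurable)
    qed
    finally have "(\<lambda>n. (\<Sum>j<n. LINT x|tor N. d j x * ee N (- k) x)) \<longlonglongrightarrow> (LINT x|tor N. (\<Sum>j. d j x) * ee N (- k) x)"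
      by (simp add: sums_def)
    then have "(\<lambda>n. ((LINT x|tor N. tp N (B 0) c x * ee N (- k) x) + (\<Sum>j<n. LINT x|tor N. d j x * ee N (- k) x)) / V)
      \<longlonglongrightarrow> ((LINT x|tor N. tp N (B 0) c x * ee N (- k) x) + (LINT x|tor N. (\<Sum>j. d j x) * ee N (- k) x)) / V"
      using V by (intro tendsto_intros) auto
    also have "(\<lambda>n. ((LINT x|tor N. tp N (B 0) c x * ee N (- k) x) + (\<Sum>j<n. LINT x|tor N. d j x * ee N (- k) x)) / V)
        = (\<lambda>n. fc N (tp N (B n) c) k)"
    proof
      fix n
      have i0: "integrable (tor N) (\<lambda>x. tp N (B 0) c x * ee N (- k) x)"
        by (rule integrable_tor_mult_bounded[OF L2_integrable[OF tp_L2], where C=1]) (auto simp: ee_simps)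
      show "((LINT x|tor N. tp N (B 0) c x * ee N (- k) x) + (\<Sum>j<n. LINT x|tor N. d j x * ee N (- k) x)) / V = fc N (tp N (B n) c) k"
        unfolding fc_tor part[of n] V_def using i0 e by (simp add: distrib_right sum_distrib_right)
    qed
    also have "((LINT x|tor N. tp N (B 0) c x * ee N (- k) x) + (LINT x|tor N. (\<Sum>j. d j x) * ee N (- k) x)) / V = fc N g k"
    proof -
      have "integrable (tor N) (\<lambda>x. tp N (B 0) c x * ee N (- k) x)"
        by (rule integrable_tor_mult_bounded[OF L2_integrable[OF tp_L2], where C=1]) (auto simp: ee_simps)
      moreover have "integrable (tor N) (\<lambda>x. (\<Sum>j. d j x) * ee N (- k) x)"
        by (rule integrable_tor_mult_bounded[OF integrable_suminf[OF dint AEs sum1], where C=1]) (auto simp: ee_simps)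
      ultimately show ?thesis unfolding fc_tor g_def V_def by (simp add: distrib_right)
    qed
    finally have l1: "(\<lambda>n. fc N (tp N (B n) c) k) \<longlonglongrightarrow> fc N g k" .
    have "(\<lambda>n. fc N (tp N (B n) c) k) \<longlonglongrightarrow> c k"
    proof (cases "\<exists>n0. k \<in> B n0")
      case True
      then obtain n0 where "k \<in> B n0" by blast
      then have "k \<in> B n" if "n \<ge> n0" for n
        using that lift_Suc_mono_le[of B, OF B(3)] by blast
      then have "\<forall>\<^sub>F n in sequentially. fc N (tp N (B n) c) k = c k"
        unfolding eventually_sequentially using fc_tp[OF N B(1,2) k] by (intro exI[of _ n0]) auto
      then show ?thesis by (rule tendsto_eventually)
    next
      \<comment> \<open>An index contained in no \<open>B n\<close> has coefficient 0, since
        \<open>B n\<close> already exhausts the total sum of squares up to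
        \<open>(1/4)^n\<close>.\<close>
      case False
      have "(cmod (c k))\<^sup>2 \<le> (1/4)^n" for n
        using ub[of "insert k (B n)"] B[of n] False k Bs[of n] by auto
      moreover have "(\<lambda>n. (1/4::real)^n) \<longlonglongrightarrow> 0" by (intro LIMSEQ_power_zero) auto
      ultimately have "(cmod (c k))\<^sup>2 \<le> 0" by (intro LIMSEQ_le_const) auto
      then have "c k = 0" by simp
      moreover have "fc N (tp N (B n) c) k = 0" for n using fc_tp[OF N B(1,2) k] False by auto
      ultimately show ?thesis by simp
    qed
    with l1 show ?thesis by (rule LIMSEQ_unique)
  qed
  have fat: "(\<integral>\<^sup>+x. ennreal ((cmod (g x))\<^sup>2) \<partial>tor N) \<le> ennreal (V * s)"
  proof -
    have "(\<integral>\<^sup>+x. ennreal ((cmod (g x))\<^sup>2) \<partial>tor N) = (\<integral>\<^sup>+x. liminf (\<lambda>n. ennreal ((cmod (tp N (B n) c x))\<^sup>2)) \<partial>tor N)"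
    proof (rule nn_integral_cong_AE)
      show "AE x in tor N. ennreal ((cmod (g x))\<^sup>2) = liminf (\<lambda>n. ennreal ((cmod (tp N (B n) c x))\<^sup>2))"
        using lim
      proof eventually_elim
        case (elim x)
        have "(\<lambda>n. ennreal ((cmod (tp N (B n) c x))\<^sup>2)) \<longlonglongrightarrow> ennreal ((cmod (g x))\<^sup>2)"
          by (intro tendsto_ennrealI tendsto_intros elim)
        then show ?case by (intro lim_imp_Liminf[symmetric]) auto
      qed
    qed
    also have "\<dots> \<le> liminf (\<lambda>n. \<integral>\<^sup>+x. ennreal ((cmod (tp N (B n) c x))\<^sup>2) \<partial>tor N)"
      by (rule nn_integral_liminf) (intro borel_measurable_tor, measurable)
    also have "\<dots> \<le> ennreal (V * s)"
    proof (rule Liminf_le)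
      have "(\<integral>\<^sup>+x. ennreal ((cmod (tp N (B n) c x))\<^sup>2) \<partial>tor N) \<le> ennreal (V * s)" for n
      proof -
        have "(\<integral>\<^sup>+x. ennreal ((cmod (tp N (B n) c x))\<^sup>2) \<partial>tor N) = ennreal (LINT x|tor N. (cmod (tp N (B n) c x))\<^sup>2)"
          by (rule nn_integral_eq_integral) (use tp_L2[of N "B n" c] in \<open>auto simp: L2_iff\<close>)
        also have "\<dots> \<le> ennreal (V * s)"
          unfolding norm_tp[OF N B(1,2)] V_def[symmetric] using V ub[OF B(1,2)] by (intro ennreal_leI mult_left_mono) auto
        finally show ?thesis .
      qed
      then show "\<forall>\<^sub>F n in sequentially. (\<integral>\<^sup>+x. ennreal ((cmod (tp N (B n) c x))\<^sup>2) \<partial>tor N) \<le> ennreal (V * s)" by simp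
    qed simp
    finally show ?thesis .
  qed
  have g2: "integrable (tor N) (\<lambda>x. (cmod (g x))\<^sup>2)"
  proof (rule integrableI_nonneg)
    show "(\<lambda>x. (cmod (g x))\<^sup>2) \<in> borel_measurable (tor N)" using borel_measurable_tor[OF gm] by measurable
    show "(\<integral>\<^sup>+x. ennreal ((cmod (g x))\<^sup>2) \<partial>tor N) < \<infinity>" using fat by (simp add: le_less_trans)
  qed simp
  show thesis
  proof (rule that[of g])
    show "L2 N g" using gm g2 by (simp add: L2_iff)
    show "per N g"
      unfolding per_def
    proof (intro allI ballI)
      fix x m :: 'a assume m: "m \<in> latt"
      show "g (x + real N *\<^sub>R m) = g x"
        unfolding g_def d_def using perD[OF tp_per[OF N D(2)] m] perD[OF tp_per[OF N B(2)] m] by simp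
    qed
    show "(LINT x|tor N. (cmod (g x))\<^sup>2) \<le> real N ^ DIM('a) * (\<Sum>\<^sub>\<infinity>k\<in>latt. (cmod (c k))\<^sup>2)"
      unfolding V_def[symmetric] s_def[symmetric]
      using fat nn_integral_eq_integral[OF g2] V s0 by (simp add: ennreal_le_iff)
  qed (rule gfc)
qed

section \<open>Parseval's identity\<close>

lemma fourier_eq_AE:
  fixes f g :: "'a::euclidean_space \<Rightarrow> complex"
  assumes N: "N \<ge> 1" and "integrable (tor N) f" "integrable (tor N) g" "\<And>k. k \<in> latt \<Longrightarrow> fc N f k = fc N g k"
  shows "AE x in tor N. f x = g x"
proof -
  have "AE x in tor N. f x - g x = 0"
    by (rule fourier_unique[OF N]) (use assms in \<open>auto simp: fc_linear\<close>)
  then show ?thesis by simp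
qed

lemma parseval:
  fixes f :: "'a::euclidean_space \<Rightarrow> complex"
  assumes N: "N \<ge> 1" and f: "L2 N f"
  shows "(\<lambda>k. (cmod (fc N f k))\<^sup>2) summable_on latt"
    and "(LINT x|tor N. (cmod (f x))\<^sup>2) = real N ^ DIM('a) * (\<Sum>\<^sub>\<infinity>k\<in>latt. (cmod (fc N f k))\<^sup>2)"
proof -
  have V: "real N ^ DIM('a) > 0" using N by simp
  have b: "(\<Sum>k\<in>A. (cmod (fc N f k))\<^sup>2) \<le> (LINT x|tor N. (cmod (f x))\<^sup>2) / real N ^ DIM('a)" if "finite A" "A \<subseteq> latt" for A
    using bessel_finite[OF N that f] V by (simp add: field_simps)
  show s: "(\<lambda>k. (cmod (fc N f k))\<^sup>2) summable_on latt"
    by (rule nonneg_summable_on_bound(1)[OF _ b]) auto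
  have le: "(\<Sum>\<^sub>\<infinity>k\<in>latt. (cmod (fc N f k))\<^sup>2) \<le> (LINT x|tor N. (cmod (f x))\<^sup>2) / real N ^ DIM('a)"
    by (rule nonneg_summable_on_bound(2)[OF _ b]) auto
  obtain g where g: "L2 N g" "per N g" "\<And>k. k \<in> latt \<Longrightarrow> fc N g k = fc N f k"
    "(LINT x|tor N. (cmod (g x))\<^sup>2) \<le> real N ^ DIM('a) * (\<Sum>\<^sub>\<infinity>k\<in>latt. (cmod (fc N f k))\<^sup>2)"
    using riesz_fischer[OF N s] by blast
  have eq: "AE x in tor N. f x = g x"
    by (rule fourier_eq_AE[OF N L2_integrable[OF f] L2_integrable[OF g(1)]]) (simp add: g(3))
  have "(LINT x|tor N. (cmod (f x))\<^sup>2) = (LINT x|tor N. (cmod (g x))\<^sup>2)"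
  proof (rule integral_cong_AE)
    show "AE x in tor N. (cmod (f x))\<^sup>2 = (cmod (g x))\<^sup>2" using eq by eventually_elim simp
  qed (use f g(1) in \<open>auto simp: L2_iff\<close>)
  with g(4) le V show "(LINT x|tor N. (cmod (f x))\<^sup>2) = real N ^ DIM('a) * (\<Sum>\<^sub>\<infinity>k\<in>latt. (cmod (fc N f k))\<^sup>2)"
    by (simp add: field_simps)
qed

lemma polarization_complex:
  "4 * (z * cnj w) = complex_of_real ((cmod (z + w))\<^sup>2) - complex_of_real ((cmod (z - w))\<^sup>2)
     + \<i> * complex_of_real ((cmod (z + \<i> * w))\<^sup>2) - \<i> * complex_of_real ((cmod (z - \<i> * w))\<^sup>2)"
  by (simp only: complex_norm_square) (simp add: algebra_simps)

text \<open>Polarization reduces the sesquilinear identity to four norms. As a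
  \<open>has_sum\<close> statement it carries the convergence together with the value.\<close>

lemma parseval_inner:
  fixes f g :: "'a::euclidean_space \<Rightarrow> complex"
  assumes N: "N \<ge> 1" and f: "L2 N f" and g: "L2 N g"
  shows "((\<lambda>k. fc N f k * cnj (fc N g k)) has_sum ((LINT x|tor N. f x * cnj (g x)) / real N ^ DIM('a))) latt"
proof -
  have V: "real N ^ DIM('a) \<noteq> 0" using N by simp
  have hs: "((\<lambda>k. complex_of_real ((cmod (fc N h k))\<^sup>2)) has_sum (complex_of_real (LINT x|tor N. (cmod (h x))\<^sup>2) / real N ^ DIM('a))) latt"
    if h: "L2 N h" for h :: "'a \<Rightarrow> complex"
  proof -
    have "((\<lambda>k. (cmod (fc N h k))\<^sup>2) has_sum ((LINT x|tor N. (cmod (h x))\<^sup>2) / real N ^ DIM('a))) latt"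
      using has_sum_infsum[OF parseval(1)[OF N h]] parseval(2)[OF N h] V by simp
    then have "((\<lambda>k. complex_of_real ((cmod (fc N h k))\<^sup>2)) has_sum complex_of_real ((LINT x|tor N. (cmod (h x))\<^sup>2) / real N ^ DIM('a))) latt"
      by (rule has_sum_of_real)
    then show ?thesis by simp
  qed
  note L = L2_add[OF f g] L2_diff[OF f g] L2_add[OF f L2_cmult[OF g, of \<i>]] L2_diff[OF f L2_cmult[OF g, of \<i>]]
  define I where "I h = complex_of_real (LINT x|tor N. (cmod (h x))\<^sup>2)" for h :: "'a \<Rightarrow> complex"
  have If: "I h = (LINT x|tor N. complex_of_real ((cmod (h x))\<^sup>2))" for h
    unfolding I_def integral_complex_of_real ..
  have ci: "integrable (tor N) (\<lambda>x. complex_of_real ((cmod (h x))\<^sup>2))" if "L2 N h" for h :: "'a \<Rightarrow> complex"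
    using that by (intro integrable_of_real) (simp add: L2_iff)
  have int: "4 * (LINT x|tor N. f x * cnj (g x)) = I (\<lambda>x. f x + g x) - I (\<lambda>x. f x - g x)
     + \<i> * I (\<lambda>x. f x + \<i> * g x) - \<i> * I (\<lambda>x. f x - \<i> * g x)"
  proof -
    have "4 * (LINT x|tor N. f x * cnj (g x)) = (LINT x|tor N. 4 * (f x * cnj (g x)))" by simp
    also have "\<dots> = I (\<lambda>x. f x + g x) - I (\<lambda>x. f x - g x)
     + \<i> * I (\<lambda>x. f x + \<i> * g x) - \<i> * I (\<lambda>x. f x - \<i> * g x)"
      unfolding polarization_complex If using ci[OF L(1)] ci[OF L(2)] ci[OF L(3)] ci[OF L(4)]
      by (simp del: of_real_power)
    finally show ?thesis .
  qed
  have fcs: "fc N (\<lambda>x. f x + g x) k = fc N f k + fc N g k" "fc N (\<lambda>x. f x - g x) k = fc N f k - fc N g k"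
    "fc N (\<lambda>x. f x + \<i> * g x) k = fc N f k + \<i> * fc N g k" "fc N (\<lambda>x. f x - \<i> * g x) k = fc N f k - \<i> * fc N g k" for k
    using fc_linear[OF L2_integrable[OF f] L2_integrable[OF g]] fc_linear[OF L2_integrable[OF f] L2_integrable[OF L2_cmult[OF g, of \<i>]]]
      fc_linear(3)[OF L2_integrable[OF g] L2_integrable[OF g]] by auto
  have "((\<lambda>k. complex_of_real ((cmod (fc N f k + fc N g k))\<^sup>2) + (-1) * complex_of_real ((cmod (fc N f k - fc N g k))\<^sup>2)
     + \<i> * complex_of_real ((cmod (fc N f k + \<i> * fc N g k))\<^sup>2) + (-\<i>) * complex_of_real ((cmod (fc N f k - \<i> * fc N g k))\<^sup>2))
     has_sum (I (\<lambda>x. f x + g x) / real N ^ DIM('a) + (-1) * (I (\<lambda>x. f x - g x) / real N ^ DIM('a))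
     + \<i> * (I (\<lambda>x. f x + \<i> * g x) / real N ^ DIM('a)) + (-\<i>) * (I (\<lambda>x. f x - \<i> * g x) / real N ^ DIM('a)))) latt"
    unfolding I_def fcs[symmetric] by (intro has_sum_add has_sum_cmult_right hs L)
  then have "((\<lambda>k. (1/4) * (4 * (fc N f k * cnj (fc N g k)))) has_sum ((1/4) * (4 * (LINT x|tor N. f x * cnj (g x)) / real N ^ DIM('a)))) latt"
    unfolding int polarization_complex
    by (intro has_sum_cmult_right) (simp add: algebra_simps add_divide_distrib diff_divide_distrib del: of_real_power)
  then show ?thesis by simp
qed

section \<open>Bilinear operators on weighted coefficients\<close>

definition wt :: "nat \<Rightarrow> 'a::euclidean_space \<Rightarrow> real" where
  "wt N k = sqrt (1 + (2 * pi / real N)\<^sup>2 * (norm k)\<^sup>2)"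

lemma wt_ge1: "wt N k \<ge> 1"
  by (simp add: wt_def)

lemma wt_pos: "wt N k > 0"
  using wt_ge1[of N k] by simp

lemma wt_sq: "(wt N k)\<^sup>2 = 1 + (2 * pi / real N)\<^sup>2 * (norm k)\<^sup>2"
  by (simp add: wt_def add_nonneg_nonneg)

lemma wt_mono: "norm k \<le> norm l \<Longrightarrow> wt N k \<le> wt N l"
  unfolding wt_def by (intro real_sqrt_le_mono add_left_mono mult_left_mono power_mono) auto

lemma wt_uminus [simp]: "wt N (- k) = wt N k"
  by (simp add: wt_def)

lemma wt_add_le: "wt N (k + l) \<le> (2 * pi / real N) * norm l + wt N k"
proof -
  define c where "c = 2 * pi / real N"
  have c: "c \<ge> 0" by (simp add: c_def)
  have w: "(wt N x)\<^sup>2 = 1 + c\<^sup>2 * (norm x)\<^sup>2" for x :: 'a unfolding wt_sq c_def ..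
  have "(c * norm k)\<^sup>2 \<le> (wt N k)\<^sup>2" unfolding w by (simp add: power_mult_distrib)
  then have kw: "c * norm k \<le> wt N k" using wt_pos[of N k] by (intro power2_le_imp_le[of "c * norm k"]) auto
  have "(wt N (k + l))\<^sup>2 \<le> 1 + c\<^sup>2 * (norm k + norm l)\<^sup>2"
    unfolding w by (intro add_left_mono mult_left_mono power_mono norm_triangle_ineq) auto
  also have "\<dots> = (1 + c\<^sup>2 * (norm k)\<^sup>2) + 2 * (c * norm k) * (c * norm l) + (c * norm l)\<^sup>2"
    by (simp add: power2_eq_square algebra_simps)
  also have "\<dots> \<le> (wt N k)\<^sup>2 + 2 * wt N k * (c * norm l) + (c * norm l)\<^sup>2"
    unfolding w[symmetric] using kw c by (intro add_mono order_refl mult_right_mono mult_left_mono) auto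
  also have "\<dots> = (c * norm l + wt N k)\<^sup>2" by (simp add: power2_eq_square algebra_simps)
  finally show ?thesis
    unfolding c_def[symmetric]
    by (rule power2_le_imp_le) (use c wt_pos[of N k] in \<open>auto intro!: add_nonneg_nonneg mult_nonneg_nonneg\<close>)
qed

lemma wt_component: "wt N (a $ j) \<le> wt N (a :: real^3^'n)"
  by (rule wt_mono) (rule Finite_Cartesian_Product.norm_nth_le)

text \<open>The exponent is a third of the power \<open>-2\<close> that occurs in three dimensions;
  along one axis it still gives decay of order \<open>n powr (-4/3)\<close>, which is
  summable.\<close>

lemma int_power_sum_bound:
  assumes "c > 0"
  obtains S where "S \<ge> 0" "\<And>A. finite A \<Longrightarrow> A \<subseteq> \<int> \<Longrightarrow> (\<Sum>x\<in>A. (1 + c * x\<^sup>2) powr (-2/3)) \<le> (S::real)"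
proof -
  define f where "f n = (1 + c * (real n)\<^sup>2) powr (-2/3)" for n
  have f0: "f n \<ge> 0" for n by (simp add: f_def)
  have sf: "summable f"
  proof (rule summable_comparison_test')
    show "summable (\<lambda>n. c powr (-2/3) * real n powr (-4/3))"
      by (intro summable_mult) (simp add: summable_real_powr_iff)
    fix n :: nat assume n: "n \<ge> 1"
    have "f n \<le> (c * (real n)\<^sup>2) powr (-2/3)"
      unfolding f_def using assms n by (intro powr_mono2') auto
    also have "\<dots> = c powr (-2/3) * ((real n) powr 2) powr (-2/3)"
      using assms n by (simp add: powr_mult)
    also have "\<dots> = c powr (-2/3) * real n powr (-4/3)" by (simp only: powr_powr) simp
    finally show "norm (f n) \<le> c powr (-2/3) * real n powr (-4/3)" using f0 by simp
  qed
  show thesis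
  proof (rule that[of "2 * suminf f"])
    show "0 \<le> 2 * suminf f" using suminf_nonneg[OF sf] f0 by simp
    fix A :: "real set" assume A: "finite A" "A \<subseteq> \<int>"
    define B where "B = (\<lambda>x. nat \<lfloor>\<bar>x\<bar>\<rfloor>) ` A"
    have B: "finite B" using A by (simp add: B_def)
    let ?h = "\<lambda>x. (1 + c * x\<^sup>2) powr (-2/3)"
    have "A \<subseteq> real ` B \<union> (\<lambda>n. - real n) ` B"
    proof
      fix x assume x: "x \<in> A"
      then obtain z where z: "x = of_int z" using A by (auto elim: Ints_cases)
      have "nat \<bar>z\<bar> \<in> B" unfolding B_def by (rule image_eqI[OF _ x]) (simp add: z flip: of_int_abs)
      moreover have "x = real (nat \<bar>z\<bar>) \<or> x = - real (nat \<bar>z\<bar>)" by (auto simp: z)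
      ultimately show "x \<in> real ` B \<union> (\<lambda>n. - real n) ` B" by blast
    qed
    then have "sum ?h A \<le> sum ?h (real ` B \<union> (\<lambda>n. - real n) ` B)"
      using B by (intro sum_mono2) auto
    also have "\<dots> \<le> sum ?h (real ` B) + sum ?h ((\<lambda>n. - real n) ` B)"
      using sum_Un[of "real ` B" "(\<lambda>n. - real n) ` B" ?h] B sum_nonneg[of "real ` B \<inter> (\<lambda>n. - real n) ` B" ?h] by simp
    also have "\<dots> = 2 * sum f B"
      by (subst (1 2) sum.reindex) (auto simp: inj_on_def f_def)
    also have "\<dots> \<le> 2 * suminf f" using sum_le_suminf[OF sf B] f0 by simp
    finally show "sum ?h A \<le> 2 * suminf f" .
  qed
qed

text \<open>\<open>wt ^ 4\<close> is the square of \<open>1 + c * (norm m)^2\<close>. Giving each of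
  the three coordinates a third of the exponent bounds the sum by a product of one-dimensional
  sums.\<close>

lemma wt_power4_sum:
  assumes N: "N \<ge> 1"
  obtains C where "C \<ge> 1" "\<And>F. finite F \<Longrightarrow> F \<subseteq> latt \<Longrightarrow> (\<Sum>m\<in>F. 1 / (wt N (m :: real^3)) ^ 4) \<le> C"
proof -
  define c where "c = (2 * pi / real N)\<^sup>2"
  have c: "c > 0" using N by (simp add: c_def)
  define h where "h x = (1 + c * x\<^sup>2) powr (-2/3)" for x :: real
  obtain S where S: "S \<ge> 0" "\<And>A. finite A \<Longrightarrow> A \<subseteq> \<int> \<Longrightarrow> sum h A \<le> S"
    using int_power_sum_bound[OF c] unfolding h_def by blast
  have pt: "1 / (wt N m) ^ 4 \<le> h (m $ 1) * h (m $ 2) * h (m $ 3)" for m :: "real^3"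
  proof -
    define P where "P = 1 + c * (norm m)\<^sup>2"
    have P: "P \<ge> 1" using c by (simp add: P_def)
    have hi: "P powr (-2/3) \<le> h (m $ i)" for i
    proof -
      have "(m $ i)\<^sup>2 \<le> (norm m)\<^sup>2" using component_le_norm_cart[of m i] by (metis abs_norm_cancel abs_le_square_iff)
      then have "1 + c * (m $ i)\<^sup>2 \<le> P" using c by (simp add: P_def)
      then show ?thesis unfolding h_def using c by (intro powr_mono2') (auto intro: add_pos_nonneg)
    qed
    have "(wt N m) ^ 4 = P\<^sup>2"
      using wt_sq[of N m] by (simp add: P_def c_def power4_eq_xxxx power2_eq_square mult.assoc)
    then have "1 / (wt N m) ^ 4 = P powr (-2)"
      using P by (simp add: powr_minus powr_numeral divide_inverse)
    also have "\<dots> = P powr (-2/3) * P powr (-2/3) * P powr (-2/3)"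
      by (simp add: powr_add[symmetric])
    also have "\<dots> \<le> h (m $ 1) * h (m $ 2) * h (m $ 3)"
      by (intro mult_mono hi mult_nonneg_nonneg) (auto simp: h_def)
    finally show ?thesis .
  qed
  show thesis
  proof (rule that[of "max 1 (S * S * S)"])
    fix F :: "(real^3) set" assume F: "finite F" "F \<subseteq> latt"
    define A where "A = (\<lambda>m. m $ 1) ` F \<union> (\<lambda>m. m $ 2) ` F \<union> (\<lambda>m. m $ 3) ` F"
    have li: "m $ i \<in> \<int>" if "m \<in> F" for m i
    proof -
      have "m \<in> latt" using F that by auto
      then have "m \<bullet> axis i 1 \<in> \<int>" by (auto simp: latt_def axis_in_Basis_iff)
      then show ?thesis by (simp add: inner_axis)
    qed
    have A: "finite A" "A \<subseteq> \<int>" using F li by (auto simp: A_def)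
    have inj: "inj_on (\<lambda>m :: real^3. (m $ 1, m $ 2, m $ 3)) F"
      by (auto simp: inj_on_def vec_eq_iff forall_3)
    have "(\<Sum>m\<in>F. 1 / (wt N m) ^ 4) \<le> (\<Sum>m\<in>F. h (m $ 1) * h (m $ 2) * h (m $ 3))"
      by (intro sum_mono pt)
    also have "\<dots> = (\<Sum>(x, y, z)\<in>(\<lambda>m. (m $ 1, m $ 2, m $ 3)) ` F. h x * h y * h z)"
      by (subst sum.reindex[OF inj]) (simp add: o_def)
    also have "\<dots> \<le> (\<Sum>(x, y, z)\<in>A \<times> A \<times> A. h x * h y * h z)"
      by (rule sum_mono2) (use A in \<open>auto simp: A_def h_def intro!: mult_nonneg_nonneg\<close>)
    also have "\<dots> = sum h A * sum h A * sum h A"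
      unfolding sum.cartesian_product[symmetric]
      by (simp only: sum_distrib_left[symmetric] sum_distrib_right[symmetric])
    also have "\<dots> \<le> S * S * S"
      using S(2)[OF A] S(1) sum_nonneg[of A h] by (intro mult_mono) (auto simp: h_def intro!: mult_nonneg_nonneg sum_nonneg)
    finally show "(\<Sum>m\<in>F. 1 / (wt N m) ^ 4) \<le> max 1 (S * S * S)" by simp
  qed simp
qed

section \<open>Cauchy-Schwarz estimates for the trilinear form\<close>

lemma cauchy_schwarz_bound:
  fixes X Y :: "'i \<Rightarrow> real"
  assumes "(\<Sum>i\<in>P. (X i)\<^sup>2) \<le> A\<^sup>2" "(\<Sum>i\<in>P. (Y i)\<^sup>2) \<le> B\<^sup>2" "A \<ge> 0" "B \<ge> 0"
  shows "(\<Sum>i\<in>P. X i * Y i) \<le> A * B"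
proof -
  have "(\<Sum>i\<in>P. X i * Y i)\<^sup>2 \<le> (\<Sum>i\<in>P. (X i)\<^sup>2) * (\<Sum>i\<in>P. (Y i)\<^sup>2)" by (rule Cauchy_Schwarz_ineq_sum)
  also have "\<dots> \<le> A\<^sup>2 * B\<^sup>2" using assms by (intro mult_mono) (auto intro!: sum_nonneg)
  finally have "(\<Sum>i\<in>P. X i * Y i)\<^sup>2 \<le> (A * B)\<^sup>2" by (simp add: power_mult_distrib)
  from power2_le_imp_le[OF this] show ?thesis using assms by simp
qed

lemma sum_le_norm_ell2_inj:
  assumes "finite F" "inj_on \<phi> F" shows "(\<Sum>k\<in>F. (cmod (cf u (\<phi> k)))\<^sup>2) \<le> (norm u)\<^sup>2"
  using sum_le_norm_ell2[of "\<phi> ` F" u] assms by (simp add: sum.reindex)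

lemma latt_nth: "a \<in> latt \<Longrightarrow> a $ j \<in> latt"
  for a :: "real^3^'n::finite"
proof -
  assume a: "a \<in> latt"
  have "a $ j \<bullet> b \<in> \<int>" if "b \<in> Basis" for b
  proof -
    have "axis j b \<in> (Basis :: (real^3^'n) set)" using that by (simp add: axis_in_Basis_iff)
    then have "a \<bullet> axis j b \<in> \<int>" using a by (auto simp: latt_def)
    then show ?thesis by (simp add: inner_axis)
  qed
  then show ?thesis by (simp add: latt_def)
qed

lemma latt_axis: "m \<in> latt \<Longrightarrow> (axis j m :: real^3^'n) \<in> latt"
proof -
  assume m: "m \<in> latt"
  have "axis j m \<bullet> b \<in> \<int>" if b: "b \<in> Basis" for b :: "real^3^'n"
  proof -
    obtain i c where "b = axis i c" "c \<in> Basis" using b unfolding Basis_vec_def by blast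
    then show ?thesis using m by (auto simp: inner_axis_axis latt_def)
  qed
  then show ?thesis by (simp add: latt_def)
qed

text \<open>The weight \<open>1 / wt^2\<close> in a three-dimensional frequency is square-summable
  and can be grouped with any one of the three factors; \<open>tri1\<close>, \<open>tri2\<close> and
  \<open>tri3\<close> are the three groupings, with the weight attached to \<open>G\<close>,
  \<open>F\<close> and \<open>h\<close>. Finite index sets keep questions of convergence
  out.\<close>

context
  fixes N :: nat and C :: real and h :: "(real^3) ell2" and F G :: "(real^3^'n::finite) ell2" and j :: 'n
    and M :: "(real^3) set" and S :: "(real^3^'n) set"
  assumes C: "C \<ge> 1" "\<And>F. finite F \<Longrightarrow> F \<subseteq> latt \<Longrightarrow> (\<Sum>m\<in>F. 1 / (wt N (m :: real^3)) ^ 4) \<le> C"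
    and M: "finite M" "M \<subseteq> latt" and S: "finite S" "S \<subseteq> latt"
begin

abbreviation "ch m \<equiv> cmod (cf h m)"
abbreviation "cF a \<equiv> cmod (cf F a)"
abbreviation "cG b \<equiv> cmod (cf G b)"

lemma shifted_sum4: assumes "x \<in> latt"
  shows "(\<Sum>m\<in>M. 1 / (wt N (x + m)) ^ 4) \<le> C" "(\<Sum>m\<in>M. 1 / (wt N (x - m)) ^ 4) \<le> C"
proof -
  have "(\<Sum>m\<in>(+) x ` M. 1 / (wt N m) ^ 4) \<le> C" "(\<Sum>m\<in>(-) x ` M. 1 / (wt N m) ^ 4) \<le> C"
    by (rule C(2); use M assms in \<open>auto intro!: latt_closed(2,3)\<close>)+
  then show "(\<Sum>m\<in>M. 1 / (wt N (x + m)) ^ 4) \<le> C" "(\<Sum>m\<in>M. 1 / (wt N (x - m)) ^ 4) \<le> C"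
    by (simp_all add: sum.reindex inj_on_def)
qed

lemma tri1: "(\<Sum>(m,b)\<in>M\<times>S. ch m * cF (b + axis j m) * (cG b * (1 / (wt N (b $ j + m))\<^sup>2))) \<le> (norm h * norm F) * (sqrt C * norm G)"
proof -
  have "(\<Sum>p\<in>M\<times>S. (ch (fst p) * cF (snd p + axis j (fst p))) * (cG (snd p) * (1 / (wt N (snd p $ j + fst p))\<^sup>2))) \<le> (norm h * norm F) * (sqrt C * norm G)"
  proof (rule cauchy_schwarz_bound)
    have "(\<Sum>p\<in>M\<times>S. (ch (fst p) * cF (snd p + axis j (fst p)))\<^sup>2) = (\<Sum>m\<in>M. (ch m)\<^sup>2 * (\<Sum>b\<in>S. (cF (b + axis j m))\<^sup>2))"
      unfolding sum_distrib_left sum.cartesian_product by (intro sum.cong) (auto simp: power_mult_distrib)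
    also have "\<dots> \<le> (\<Sum>m\<in>M. (ch m)\<^sup>2 * (norm F)\<^sup>2)"
      by (intro sum_mono mult_left_mono sum_le_norm_ell2_inj[OF S(1)]) (auto simp: inj_on_def)
    also have "\<dots> \<le> (norm h)\<^sup>2 * (norm F)\<^sup>2"
      unfolding sum_distrib_right[symmetric] by (intro mult_right_mono sum_le_norm_ell2 M) auto
    finally show "(\<Sum>p\<in>M\<times>S. (ch (fst p) * cF (snd p + axis j (fst p)))\<^sup>2) \<le> (norm h * norm F)\<^sup>2" by (simp add: power_mult_distrib)
    have "(\<Sum>p\<in>M\<times>S. (cG (snd p) * (1 / (wt N (snd p $ j + fst p))\<^sup>2))\<^sup>2) = (\<Sum>(m,b)\<in>M\<times>S. (cG b)\<^sup>2 * (1 / (wt N (b $ j + m)) ^ 4))"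
      by (intro sum.cong) (auto simp: power_mult_distrib power_divide simp flip: power_mult)
    also have "\<dots> = (\<Sum>b\<in>S. (cG b)\<^sup>2 * (\<Sum>m\<in>M. 1 / (wt N (b $ j + m)) ^ 4))"
      unfolding sum_distrib_left by (subst sum.swap) (simp add: sum.cartesian_product)
    also have "\<dots> \<le> (\<Sum>b\<in>S. (cG b)\<^sup>2 * C)"
      using S by (intro sum_mono mult_left_mono shifted_sum4 latt_nth) auto
    also have "\<dots> \<le> (norm G)\<^sup>2 * C"
      unfolding sum_distrib_right[symmetric] using C(1) by (intro mult_right_mono sum_le_norm_ell2 S) auto
    finally show "(\<Sum>p\<in>M\<times>S. (cG (snd p) * (1 / (wt N (snd p $ j + fst p))\<^sup>2))\<^sup>2) \<le> (sqrt C * norm G)\<^sup>2"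
      using C(1) by (simp add: power_mult_distrib mult.commute)
  qed (use C(1) in auto)
  then show ?thesis by (simp add: case_prod_unfold)
qed

lemma tri2: "(\<Sum>(m,b)\<in>M\<times>S. ch m * cG b * (cF (b + axis j m) * (1 / (wt N (b $ j))\<^sup>2))) \<le> (norm h * norm G) * (sqrt C * norm F)"
proof -
  have "(\<Sum>p\<in>M\<times>S. (ch (fst p) * cG (snd p)) * (cF (snd p + axis j (fst p)) * (1 / (wt N (snd p $ j))\<^sup>2))) \<le> (norm h * norm G) * (sqrt C * norm F)"
  proof (rule cauchy_schwarz_bound)
    have "(\<Sum>p\<in>M\<times>S. (ch (fst p) * cG (snd p))\<^sup>2) = (\<Sum>m\<in>M. (ch m)\<^sup>2 * (\<Sum>b\<in>S. (cG b)\<^sup>2))"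
      unfolding sum_distrib_left sum.cartesian_product by (intro sum.cong) (auto simp: power_mult_distrib)
    also have "\<dots> \<le> (\<Sum>m\<in>M. (ch m)\<^sup>2 * (norm G)\<^sup>2)"
      by (intro sum_mono mult_left_mono sum_le_norm_ell2[OF S(1)]) auto
    also have "\<dots> \<le> (norm h)\<^sup>2 * (norm G)\<^sup>2"
      unfolding sum_distrib_right[symmetric] by (intro mult_right_mono sum_le_norm_ell2 M) auto
    finally show "(\<Sum>p\<in>M\<times>S. (ch (fst p) * cG (snd p))\<^sup>2) \<le> (norm h * norm G)\<^sup>2" by (simp add: power_mult_distrib)
    \<comment> \<open>The index of \<open>F\<close> moves with \<open>m\<close>. Collecting all
      translates of \<open>S\<close> in the common set \<open>S'\<close> allows the order of
      summation to be exchanged.\<close>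
    define S' where "S' = (\<Union>m\<in>M. (\<lambda>b. b + axis j m) ` S)"
    have S': "finite S'" "S' \<subseteq> latt" using M S latt_axis by (auto simp: S'_def intro!: latt_closed(2))
    have "(\<Sum>p\<in>M\<times>S. (cF (snd p + axis j (fst p)) * (1 / (wt N (snd p $ j))\<^sup>2))\<^sup>2)
      = (\<Sum>m\<in>M. \<Sum>b\<in>S. (cF (b + axis j m))\<^sup>2 * (1 / (wt N (b $ j)) ^ 4))"
      unfolding sum.cartesian_product by (intro sum.cong) (auto simp: power_mult_distrib power_divide simp flip: power_mult)
    also have "\<dots> = (\<Sum>m\<in>M. \<Sum>a\<in>(\<lambda>b. b + axis j m) ` S. (cF a)\<^sup>2 * (1 / (wt N (a $ j - m)) ^ 4))"
      by (rule sum.cong[OF refl], subst sum.reindex) (auto simp: inj_on_def)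
    also have "\<dots> \<le> (\<Sum>m\<in>M. \<Sum>a\<in>S'. (cF a)\<^sup>2 * (1 / (wt N (a $ j - m)) ^ 4))"
      by (intro sum_mono sum_mono2 S') (auto simp: S'_def less_imp_le[OF wt_pos])
    also have "\<dots> = (\<Sum>a\<in>S'. (cF a)\<^sup>2 * (\<Sum>m\<in>M. 1 / (wt N (a $ j - m)) ^ 4))"
      unfolding sum_distrib_left by (rule sum.swap)
    also have "\<dots> \<le> (\<Sum>a\<in>S'. (cF a)\<^sup>2 * C)"
      using S' by (intro sum_mono mult_left_mono shifted_sum4 latt_nth) auto
    also have "\<dots> \<le> (norm F)\<^sup>2 * C"
      unfolding sum_distrib_right[symmetric] using C(1) by (intro mult_right_mono sum_le_norm_ell2 S') auto
    finally show "(\<Sum>p\<in>M\<times>S. (cF (snd p + axis j (fst p)) * (1 / (wt N (snd p $ j))\<^sup>2))\<^sup>2) \<le> (sqrt C * norm F)\<^sup>2"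
      using C(1) by (simp add: power_mult_distrib mult.commute)
  qed (use C(1) in auto)
  then show ?thesis by (simp add: case_prod_unfold)
qed

lemma tri3: "(\<Sum>(m,b)\<in>M\<times>S. ch m * (1 / (wt N m)\<^sup>2) * (cF (b + axis j m) * cG b)) \<le> (norm h * sqrt C) * (norm F * norm G)"
proof -
  have "(\<Sum>(m,b)\<in>M\<times>S. ch m * (1 / (wt N m)\<^sup>2) * (cF (b + axis j m) * cG b))
    = (\<Sum>m\<in>M. ch m * (1 / (wt N m)\<^sup>2) * (\<Sum>b\<in>S. cF (b + axis j m) * cG b))"
    unfolding sum_distrib_left sum.cartesian_product by simp
  also have "\<dots> \<le> (\<Sum>m\<in>M. ch m * (1 / (wt N m)\<^sup>2) * (norm F * norm G))"
    by (intro sum_mono mult_left_mono cauchy_schwarz_bound sum_le_norm_ell2_inj[OF S(1)] sum_le_norm_ell2 S)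
       (auto simp: inj_on_def)
  also have "\<dots> = (\<Sum>m\<in>M. ch m * (1 / (wt N m)\<^sup>2)) * (norm F * norm G)" by (simp add: sum_distrib_right)
  also have "\<dots> \<le> (norm h * sqrt C) * (norm F * norm G)"
  proof (intro mult_right_mono cauchy_schwarz_bound sum_le_norm_ell2 M)
    have "(\<Sum>m\<in>M. (1 / (wt N m)\<^sup>2)\<^sup>2) = (\<Sum>m\<in>M. 1 / (wt N m) ^ 4)"
      by (intro sum.cong) (auto simp: power_divide simp flip: power_mult)
    then show "(\<Sum>m\<in>M. (1 / (wt N m)\<^sup>2)\<^sup>2) \<le> (sqrt C)\<^sup>2" using C(2)[OF M] C(1) by simp
  qed (use C(1) in auto)
  finally show ?thesis .
qed

end

section \<open>Bounded bilinear operators from trilinear forms\<close>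

lemma sq_summable_finite_support:
  assumes "finite F" "\<And>k. k \<notin> F \<Longrightarrow> f k = 0" shows "sq_summable f"
  unfolding sq_summable_def using assms
  by (subst summable_on_cong_neutral[of F UNIV _ "\<lambda>k. (cmod (f k))\<^sup>2"]) auto

lemma norm_Ell2_finite_support:
  assumes "finite F" "\<And>k. k \<notin> F \<Longrightarrow> f k = 0" shows "(norm (Ell2 f))\<^sup>2 = (\<Sum>k\<in>F. (cmod (f k))\<^sup>2)"
proof -
  have cf: "cf (Ell2 f) = f" by (rule cf_Ell2[OF sq_summable_finite_support[OF assms]])
  show ?thesis
    unfolding norm_ell2_sq cf
    by (subst infsum_cong_neutral[of F UNIV _ "\<lambda>k. (cmod (f k))\<^sup>2"]) (use assms in auto)
qed

text \<open>A nonnegative kernel that is bounded as a trilinear form defines, by duality in the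
  first factor, a bounded bilinear operator \<open>bop\<close>. The index maps \<open>al\<close> and
  \<open>be\<close> are parameters so that the density and the potential operators are two instances
  of one construction.\<close>

locale trilin =
  fixes X :: "'i set" and Y :: "'p set" and om :: "'i \<Rightarrow> 'p \<Rightarrow> real"
    and al :: "'i \<Rightarrow> 'p \<Rightarrow> 'q" and be :: "'i \<Rightarrow> 'p \<Rightarrow> 'r" and K :: real
  assumes om0: "\<And>x y. 0 \<le> om x y" and K0: "0 \<le> K"
    and tri: "\<And>P (f::'i ell2) (u::'q ell2) (v::'r ell2). finite P \<Longrightarrow> P \<subseteq> X \<times> Y \<Longrightarrow>
      (\<Sum>(x,y)\<in>P. om x y * cmod (cf f x) * cmod (cf u (al x y)) * cmod (cf v (be x y))) \<le> K * norm f * norm u * norm v"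
begin

definition tt :: "'q ell2 \<Rightarrow> 'r ell2 \<Rightarrow> 'i \<Rightarrow> 'p \<Rightarrow> complex" where
  "tt u v x y = of_real (om x y) * cf u (al x y) * cf v (be x y)"

definition op :: "'q ell2 \<Rightarrow> 'r ell2 \<Rightarrow> 'i \<Rightarrow> complex" where
  "op u v x = (if x \<in> X then \<Sum>\<^sub>\<infinity>y\<in>Y. tt u v x y else 0)"

definition bop :: "'q ell2 \<Rightarrow> 'r ell2 \<Rightarrow> 'i ell2" where
  "bop u v = Ell2 (op u v)"

lemma tri_sum:
  assumes "finite P" "P \<subseteq> X \<times> Y"
  shows "(\<Sum>(x,y)\<in>P. cmod (cf f x) * cmod (tt u v x y)) \<le> K * norm f * norm u * norm v"
proof -
  have "(\<Sum>(x,y)\<in>P. cmod (cf f x) * cmod (tt u v x y)) = (\<Sum>(x,y)\<in>P. om x y * cmod (cf f x) * cmod (cf u (al x y)) * cmod (cf v (be x y)))"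
    by (intro sum.cong) (auto simp: tt_def norm_mult om0)
  then show ?thesis using tri[OF assms] by simp
qed

lemma tri_summable:
  "(\<lambda>(x,y). cmod (cf f x) * cmod (tt u v x y)) summable_on X \<times> Y"
  "infsum (\<lambda>(x,y). cmod (cf f x) * cmod (tt u v x y)) (X \<times> Y) \<le> K * norm f * norm u * norm v"
  by (rule nonneg_summable_on_bound[OF _ tri_sum]; auto)+

lemma tt_summable:
  assumes x: "x \<in> X" shows "(\<lambda>y. cmod (tt u v x y)) summable_on Y"
proof (rule nonneg_summable_on_bound(1))
  \<comment> \<open>Testing the form with a unit vector isolates the single row \<open>x\<close> of
    the kernel.\<close>
  define f where "f = Ell2 (\<lambda>k. if k = x then 1 else 0 :: complex)"
  have cf: "cf f x = 1" unfolding f_def by (subst cf_Ell2[OF sq_summable_finite_support[of "{x}"]]) auto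
  fix G assume G: "finite G" "G \<subseteq> Y"
  have "(\<Sum>(z,y)\<in>{x} \<times> G. cmod (cf f z) * cmod (tt u v z y)) \<le> K * norm f * norm u * norm v"
    by (rule tri_sum) (use G x in auto)
  then show "(\<Sum>y\<in>G. cmod (tt u v x y)) \<le> K * norm f * norm u * norm v"
    unfolding sum.cartesian_product[symmetric] by (simp add: cf)
qed auto

lemma tt_summable': "x \<in> X \<Longrightarrow> (\<lambda>y. tt u v x y) summable_on Y"
  by (rule abs_summable_summable[OF tt_summable])

text \<open>Duality: the form is tested with the moduli of the operator's own values on a finite
  set. This bounds \<open>(norm f)^2\<close> by \<open>norm f\<close> times the desired bound, and
  one factor cancels.\<close>

lemma op_bound:
  assumes F: "finite F" shows "(\<Sum>x\<in>F. (cmod (op u v x))\<^sup>2) \<le> (K * norm u * norm v)\<^sup>2"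
proof -
  define F' where "F' = F \<inter> X"
  have F': "finite F'" "F' \<subseteq> X" using F by (auto simp: F'_def)
  define f where "f = Ell2 (\<lambda>x. if x \<in> F' then complex_of_real (cmod (op u v x)) else 0)"
  have cff: "cf f x = (if x \<in> F' then complex_of_real (cmod (op u v x)) else 0)" for x
    unfolding f_def by (subst cf_Ell2[OF sq_summable_finite_support[OF F'(1)]]) auto
  have nf: "(norm f)\<^sup>2 = (\<Sum>x\<in>F'. (cmod (op u v x))\<^sup>2)"
    unfolding f_def by (subst norm_Ell2_finite_support[OF F'(1)]) auto
  have "(\<Sum>x\<in>F'. (cmod (op u v x))\<^sup>2) \<le> (\<Sum>x\<in>F'. cmod (op u v x) * (\<Sum>\<^sub>\<infinity>y\<in>Y. cmod (tt u v x y)))"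
  proof (rule sum_mono)
    fix x assume "x \<in> F'"
    then have x: "x \<in> X" using F' by auto
    have "cmod (op u v x) \<le> (\<Sum>\<^sub>\<infinity>y\<in>Y. cmod (tt u v x y))"
      using norm_infsum_bound[OF tt_summable[OF x]] x by (simp add: op_def)
    then show "(cmod (op u v x))\<^sup>2 \<le> cmod (op u v x) * (\<Sum>\<^sub>\<infinity>y\<in>Y. cmod (tt u v x y))"
      unfolding power2_eq_square by (intro mult_left_mono) auto
  qed
  also have "\<dots> = (\<Sum>\<^sub>\<infinity>x\<in>F'. \<Sum>\<^sub>\<infinity>y\<in>Y. cmod (cf f x) * cmod (tt u v x y))"
    using F'(1) by (simp add: cff infsum_cmult_right')
  also have "\<dots> = infsum (\<lambda>(x,y). cmod (cf f x) * cmod (tt u v x y)) (F' \<times> Y)"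
    by (rule infsum_Sigma'_banach) (rule summable_on_subset_banach[OF tri_summable(1)], use F' in auto)
  also have "\<dots> \<le> K * norm f * norm u * norm v"
    by (rule nonneg_summable_on_bound(2)[OF _ tri_sum]) (use F' in auto)
  finally have *: "(norm f)\<^sup>2 \<le> norm f * (K * norm u * norm v)" unfolding nf by (simp add: mult_ac)
  have "norm f \<le> K * norm u * norm v"
  proof (cases "norm f = 0")
    case True then show ?thesis using K0 by simp
  next
    case False
    then have "norm f > 0" by simp
    then show ?thesis using * unfolding power2_eq_square by (rule mult_left_le_imp_le[rotated])
  qed
  then have "(norm f)\<^sup>2 \<le> (K * norm u * norm v)\<^sup>2" by (intro power_mono) auto
  moreover have "(\<Sum>x\<in>F. (cmod (op u v x))\<^sup>2) = (\<Sum>x\<in>F'. (cmod (op u v x))\<^sup>2)"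
    by (rule sum.mono_neutral_right[OF F]) (auto simp: F'_def op_def)
  ultimately show ?thesis using nf by simp
qed

lemma cf_bop: "cf (bop u v) x = op u v x"
  unfolding bop_def by (subst cf_Ell2[OF sq_summableI[OF op_bound]]) auto

lemma norm_bop: "norm (bop u v) \<le> K * norm u * norm v"
  by (rule norm_ell2_le) (use K0 op_bound in \<open>auto simp: cf_bop\<close>)

lemma bounded_bilinear_bop: "bounded_bilinear bop"
proof
  note s = infsum_add[OF tt_summable' tt_summable', symmetric]
  show "bop (a + a') b = bop a b + bop a' b" for a a' b
    by (rule ell2_eqI) (auto simp: cf_bop op_def s intro!: infsum_cong, simp add: tt_def algebra_simps)
  show "bop a (b + b') = bop a b + bop a b'" for a b b'
    by (rule ell2_eqI) (auto simp: cf_bop op_def s intro!: infsum_cong, simp add: tt_def algebra_simps)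
  show "bop (r *\<^sub>R a) b = r *\<^sub>R bop a b" for r a b
    by (rule ell2_eqI) (auto simp: cf_bop op_def infsum_scaleR_right[symmetric] intro!: infsum_cong, simp add: tt_def scaleR_conv_of_real algebra_simps)
  show "bop a (r *\<^sub>R b) = r *\<^sub>R bop a b" for r a b
    by (rule ell2_eqI) (auto simp: cf_bop op_def infsum_scaleR_right[symmetric] intro!: infsum_cong, simp add: tt_def scaleR_conv_of_real algebra_simps)
  show "\<exists>K. \<forall>a b. norm (bop a b) \<le> norm a * norm b * K"
    using norm_bop by (intro exI[of _ K]) (auto simp: mult_ac)
qed

text \<open>Absolute convergence lets the iterated sum be read as a sum over pairs, which the change
  of variables in \<open>Dop_Bop_adjoint\<close> requires.\<close>

lemma inner_bop:
  "inner (bop u v) f = Re (\<Sum>\<^sub>\<infinity>(x,y)\<in>X \<times> Y. tt u v x y * cnj (cf f x))"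
proof -
  have ns: "(\<lambda>(x,y). tt u v x y * cnj (cf f x)) summable_on X \<times> Y"
    by (rule abs_summable_summable)
       (use tri_summable(1)[of f u v] in \<open>simp add: case_prod_unfold norm_mult mult.commute\<close>)
  have e1: "(\<Sum>\<^sub>\<infinity>(x,y)\<in>X \<times> Y. tt u v x y * cnj (cf f x)) = (\<Sum>\<^sub>\<infinity>x\<in>X. \<Sum>\<^sub>\<infinity>y\<in>Y. tt u v x y * cnj (cf f x))"
    by (rule infsum_Sigma'_banach[OF ns, symmetric])
  have e2: "\<dots> = (\<Sum>\<^sub>\<infinity>x\<in>X. op u v x * cnj (cf f x))"
    by (intro infsum_cong) (simp add: op_def infsum_cmult_left')
  have s3: "(\<lambda>x. op u v x * cnj (cf f x)) summable_on UNIV"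
    using abs_summable_summable[OF sq_summable_product[of "cf (bop u v)" "\<lambda>x. cnj (cf f x)"]] by (simp add: cf_bop)
  have "inner (bop u v) f = Re (\<Sum>\<^sub>\<infinity>x. op u v x * cnj (cf f x))"
    unfolding inner_ell2_def cf_bop by (rule infsum_Re[OF s3])
  also have "(\<Sum>\<^sub>\<infinity>x. op u v x * cnj (cf f x)) = (\<Sum>\<^sub>\<infinity>x\<in>X. op u v x * cnj (cf f x))"
    by (rule infsum_cong_neutral) (auto simp: op_def)
  finally show ?thesis using e1 e2 by simp
qed

end

section \<open>Kernels of the Coulomb potential and of the electron density\<close>

definition gam :: "nat \<Rightarrow> real^3 \<Rightarrow> real" where
  "gam N m = (if m = 0 \<or> m \<notin> latt then 0 else 1 / ((2 * pi / real N)\<^sup>2 * (norm m)\<^sup>2))"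

definition gamC :: "nat \<Rightarrow> real" where
  "gamC N = 1 + 1 / (2 * pi / real N)\<^sup>2"

lemma gam_nonneg: "0 \<le> gam N m"
  by (simp add: gam_def)

lemma gam_uminus [simp]: "gam N (- m) = gam N m"
  using latt_closed(4)[of m] latt_closed(4)[of "- m"] by (auto simp: gam_def)

lemma latt_norm_ge1: assumes "k \<in> latt" "k \<noteq> 0" shows "norm k \<ge> 1"
proof -
  obtain b where b: "b \<in> Basis" "k \<bullet> b \<noteq> 0" using assms(2) euclidean_eq_iff[of k 0] by auto
  then have "\<bar>k \<bullet> b\<bar> \<ge> 1" using assms(1) by (intro Ints_nonzero_abs_ge1) (auto simp: latt_def)
  then show ?thesis using Basis_le_norm[OF b(1), of k] by linarith
qed

text \<open>A nonzero lattice vector has norm at least 1, so its frequency is at least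
  \<open>2 * pi / N\<close> and the Coulomb multiplier is comparable to \<open>1 / wt^2\<close>. The
  constant \<open>gamC\<close> is the ratio of the two at norm 1, where it is largest.\<close>

lemma gam_bounds:
  assumes N: "N \<ge> 1"
  shows "gam N m \<le> gamC N * (1 / (wt N m)\<^sup>2)" "gam N m * ((2 * pi / real N) * norm m) \<le> gamC N * (1 / wt N m)"
    "gam N m \<le> gamC N" "gam N m * ((2 * pi / real N) * norm m) \<le> gamC N" "gamC N \<ge> 1"
proof -
  define c where "c = 2 * pi / real N"
  have c: "c > 0" using N by (simp add: c_def)
  have g1: "gamC N \<ge> 1" by (simp add: gamC_def)
  have w: "0 < wt N m" "1 / (wt N m)\<^sup>2 \<le> 1" "1 / wt N m \<le> 1"
    using wt_pos[of N m] wt_ge1[of N m] power_mono[of 1 "wt N m" 2] by auto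
  have A: "gam N m \<le> gamC N * (1 / (wt N m)\<^sup>2) \<and> gam N m * (c * norm m) \<le> gamC N * (1 / wt N m)"
  proof (cases "m = 0 \<or> m \<notin> latt")
    case True then show ?thesis using g1 w by (simp add: gam_def)
  next
    case False
    define s where "s = c * norm m"
    have n1: "norm m \<ge> 1" using False by (intro latt_norm_ge1) auto
    then have n0: "norm m > 0" by linarith
    have s: "s > 0" "c\<^sup>2 \<le> s\<^sup>2" using c n1 n0 by (auto simp: s_def power_mult_distrib intro!: mult_pos_pos)
    have "gam N m = 1 / (c\<^sup>2 * (norm m)\<^sup>2)" using False unfolding gam_def c_def by simp
    then have g: "gam N m = 1 / s\<^sup>2" unfolding s_def power_mult_distrib .
    have W: "(wt N m)\<^sup>2 = 1 + s\<^sup>2" unfolding wt_sq s_def power_mult_distrib c_def ..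
    have G: "gamC N = 1 + 1 / c\<^sup>2" by (simp add: gamC_def c_def)
    have key: "1 + s\<^sup>2 \<le> gamC N * s\<^sup>2"
      using s c by (simp add: G field_simps)
    have 1: "gam N m \<le> gamC N * (1 / (wt N m)\<^sup>2)"
      unfolding g W using key s by (simp add: field_simps add_pos_nonneg)
    have "wt N m \<le> gamC N * s"
    proof (rule power2_le_imp_le)
      have "(wt N m)\<^sup>2 \<le> gamC N * s\<^sup>2" using key W by simp
      also have "\<dots> \<le> gamC N * (gamC N * s\<^sup>2)"
        using g1 by (intro mult_left_mono) (auto simp: mult_le_cancel_right1)
      finally show "(wt N m)\<^sup>2 \<le> (gamC N * s)\<^sup>2" by (simp add: power2_eq_square mult_ac)
      show "0 \<le> gamC N * s" using g1 s by simp
    qed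
    then have "gam N m * s \<le> gamC N * (1 / wt N m)"
      unfolding g using w s by (simp add: field_simps power2_eq_square)
    with 1 show ?thesis by (simp add: s_def)
  qed
  then show "gam N m \<le> gamC N * (1 / (wt N m)\<^sup>2)" "gam N m * ((2 * pi / real N) * norm m) \<le> gamC N * (1 / wt N m)"
    by (auto simp: c_def)
  have "gamC N * (1 / (wt N m)\<^sup>2) \<le> gamC N * 1" "gamC N * (1 / wt N m) \<le> gamC N * 1"
    using w g1 by (intro mult_left_mono; simp)+
  with A show "gam N m \<le> gamC N" "gam N m * ((2 * pi / real N) * norm m) \<le> gamC N" by (auto simp: c_def)
qed (simp add: gamC_def)

definition latC :: "nat \<Rightarrow> real" where
  "latC N = (SOME C. C \<ge> 1 \<and> (\<forall>F. finite F \<longrightarrow> F \<subseteq> latt \<longrightarrow> (\<Sum>m\<in>F. 1 / (wt N (m :: real^3)) ^ 4) \<le> C))"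

lemma latC:
  assumes "N \<ge> 1"
  shows "latC N \<ge> 1" "\<And>F. finite F \<Longrightarrow> F \<subseteq> latt \<Longrightarrow> (\<Sum>m\<in>F. 1 / (wt N (m :: real^3)) ^ 4) \<le> latC N"
proof -
  have "\<exists>C. C \<ge> 1 \<and> (\<forall>F. finite F \<longrightarrow> F \<subseteq> latt \<longrightarrow> (\<Sum>m\<in>F. 1 / (wt N (m :: real^3)) ^ 4) \<le> C)"
    using wt_power4_sum[OF assms] by metis
  from someI_ex[OF this] show "latC N \<ge> 1" "\<And>F. finite F \<Longrightarrow> F \<subseteq> latt \<Longrightarrow> (\<Sum>m\<in>F. 1 / (wt N (m :: real^3)) ^ 4) \<le> latC N"
    by (auto simp: latC_def)
qed

text \<open>The vectors on which the bilinear operators act are already multiplied by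
  \<open>wt\<close>. The kernels divide it out of the wave functions, and \<open>omB\<close>
  restores it on its result.\<close>

definition omD :: "nat \<Rightarrow> 'n::finite \<Rightarrow> real^3 \<Rightarrow> real^3^'n \<Rightarrow> real" where
  "omD N j m b = 1 / (wt N (b + axis j m) * wt N b)"

definition omB :: "nat \<Rightarrow> 'n::finite \<Rightarrow> real^3^'n \<Rightarrow> real^3 \<Rightarrow> real" where
  "omB N j a m = gam N m * wt N a / wt N (a - axis j m)"

lemma amgm: "x > 0 \<Longrightarrow> y > 0 \<Longrightarrow> 1 / (x * y) \<le> (1 / x\<^sup>2 + 1 / y\<^sup>2) / (2::real)"
proof -
  assume "x > 0" "y > 0"
  have "0 \<le> (1 / x - 1 / y)\<^sup>2" by simp
  then show ?thesis by (simp add: power2_diff power_divide)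
qed

lemma finite_pair_box:
  assumes "finite P" "P \<subseteq> A \<times> B"
  obtains M S where "finite M" "M \<subseteq> A" "finite S" "S \<subseteq> B" "P \<subseteq> M \<times> S"
proof (rule that[of "fst ` P" "snd ` P"])
  show "P \<subseteq> fst ` P \<times> snd ` P" by force
qed (use assms in auto)

text \<open>The weight of a frequency of all particles dominates the weight of its
  \<open>j\<close>-th component, so only three-dimensional frequencies remain. The mean inequality
  \<open>amgm\<close> separates the product of two such weights into the groupings of
  \<open>tri1\<close> and \<open>tri2\<close>.\<close>

lemma triD_sum:
  fixes u v :: "(real^3^'n::finite) ell2"
  assumes N: "N \<ge> 1" and P: "finite P" "P \<subseteq> latt \<times> latt"
  shows "(\<Sum>(m,b)\<in>P. omD N j m b * cmod (cf f m) * cmod (cf u (b + axis j m)) * cmod (cf v b)) \<le> sqrt (latC N) * norm f * norm u * norm v"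
proof -
  obtain M S where MS: "finite M" "M \<subseteq> latt" "finite S" "S \<subseteq> latt" "P \<subseteq> M \<times> S"
    using finite_pair_box[OF P] by blast
  note t = latC[OF N] MS(1-4)
  let ?g1 = "\<lambda>(m,b). cmod (cf f m) * cmod (cf u (b + axis j m)) * (cmod (cf v b) * (1 / (wt N (b $ j + m))\<^sup>2))"
  let ?g2 = "\<lambda>(m,b). cmod (cf f m) * cmod (cf v b) * (cmod (cf u (b + axis j m)) * (1 / (wt N (b $ j))\<^sup>2))"
  have le: "omD N j m b * x \<le> ((1 / (wt N (b $ j + m))\<^sup>2 + 1 / (wt N (b $ j))\<^sup>2) / 2) * x" if "x \<ge> 0" for x m and b :: "real^3^'n"
  proof (rule mult_right_mono[OF _ that])
    have "wt N (b $ j + m) \<le> wt N (b + axis j m)" using wt_component[of N "b + axis j m" j] by simp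
    then have "omD N j m b \<le> 1 / (wt N (b $ j + m) * wt N (b $ j))"
      unfolding omD_def
      by (intro divide_left_mono mult_mono wt_component mult_pos_pos wt_pos less_imp_le[OF wt_pos]) auto
    also have "\<dots> \<le> (1 / (wt N (b $ j + m))\<^sup>2 + 1 / (wt N (b $ j))\<^sup>2) / 2" by (rule amgm) (rule wt_pos)+
    finally show "omD N j m b \<le> (1 / (wt N (b $ j + m))\<^sup>2 + 1 / (wt N (b $ j))\<^sup>2) / 2" .
  qed
  have "(\<Sum>(m,b)\<in>P. omD N j m b * cmod (cf f m) * cmod (cf u (b + axis j m)) * cmod (cf v b))
    \<le> (\<Sum>(m,b)\<in>M\<times>S. omD N j m b * cmod (cf f m) * cmod (cf u (b + axis j m)) * cmod (cf v b))"
    using MS by (intro sum_mono2) (auto simp: omD_def wt_pos less_imp_le)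
  also have "\<dots> \<le> (\<Sum>p\<in>M\<times>S. (1/2) * ?g1 p + (1/2) * ?g2 p)"
  proof (rule sum_mono)
    fix p assume "p \<in> M \<times> S"
    obtain m b where p: "p = (m, b)" by (cases p)
    show "(\<lambda>(m,b). omD N j m b * cmod (cf f m) * cmod (cf u (b + axis j m)) * cmod (cf v b)) p \<le> (1/2) * ?g1 p + (1/2) * ?g2 p"
      unfolding p using le[of "cmod (cf f m) * cmod (cf u (b + axis j m)) * cmod (cf v b)" m b]
      by (simp add: algebra_simps add_divide_distrib)
  qed
  also have "\<dots> = (1/2) * (\<Sum>p\<in>M\<times>S. ?g1 p) + (1/2) * (\<Sum>p\<in>M\<times>S. ?g2 p)"
    by (simp only: sum.distrib sum_distrib_left)
  also have "\<dots> \<le> (1/2) * ((norm f * norm u) * (sqrt (latC N) * norm v)) + (1/2) * ((norm f * norm v) * (sqrt (latC N) * norm u))"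
    by (intro add_mono mult_left_mono tri1[OF t] tri2[OF t]) auto
  finally show ?thesis by (simp add: mult_ac)
qed

text \<open>By \<open>wt_add_le\<close> the weight on the result is distributed: a derivative falls
  either on the potential, where \<open>gam\<close> absorbs it, or on the wave function. The 2 in
  the constant is \<open>3/2 + 1/2\<close>, from the weights treated by \<open>tri3\<close> and
  \<open>tri2\<close>.\<close>

lemma triB_sum:
  fixes F v :: "(real^3^'n::finite) ell2"
  assumes N: "N \<ge> 1" and P: "finite P" "P \<subseteq> latt \<times> latt"
  shows "(\<Sum>(a,m)\<in>P. omB N j a m * cmod (cf F a) * cmod (cf h m) * cmod (cf v (a - axis j m)))
    \<le> (2 * gamC N * sqrt (latC N)) * norm F * norm h * norm v"
proof -
  \<comment> \<open>The change of variables \<open>a = b + axis j m\<close> brings the indices into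
    the form of the trilinear estimates.\<close>
  define Q where "Q = (\<lambda>(a,m). (m, a - axis j m)) ` P"
  have inj: "inj_on (\<lambda>(a,m). (m, a - axis j m)) P" by (auto simp: inj_on_def)
  have Q: "finite Q" "Q \<subseteq> latt \<times> latt" using P latt_axis latt_closed(3) by (auto simp: Q_def) blast
  obtain M S where MS: "finite M" "M \<subseteq> latt" "finite S" "S \<subseteq> latt" "Q \<subseteq> M \<times> S"
    using finite_pair_box[OF Q] by blast
  note t = latC[OF N] MS(1-4)
  let ?w = "\<lambda>m b. omB N j (b + axis j m) m"
  let ?g3 = "\<lambda>(m,b). cmod (cf h m) * (1 / (wt N m)\<^sup>2) * (cmod (cf F (b + axis j m)) * cmod (cf v b))"
  let ?g2 = "\<lambda>(m,b). cmod (cf h m) * cmod (cf v b) * (cmod (cf F (b + axis j m)) * (1 / (wt N (b $ j))\<^sup>2))"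
  have lin: "(A + B) / 2 + A = (3/2) * A + (1/2) * B" for A B :: real by (simp add: field_simps)
  have le: "?w m b \<le> gamC N * ((3/2) * (1 / (wt N m)\<^sup>2) + (1/2) * (1 / (wt N (b $ j))\<^sup>2))" for m b
  proof -
    have "?w m b = gam N m * wt N (b + axis j m) / wt N b" by (simp add: omB_def)
    also have "\<dots> \<le> gam N m * ((2 * pi / real N) * norm m + wt N b) / wt N b"
      using wt_add_le[of N b "axis j m"] wt_pos[of N b] gam_nonneg[of N m]
      by (intro divide_right_mono mult_left_mono) (auto simp: norm_eq_sqrt_inner inner_axis_axis)
    also have "\<dots> = (gam N m * ((2 * pi / real N) * norm m)) * (1 / wt N b) + gam N m"
      using wt_pos[of N b] by (simp add: distrib_left add_divide_distrib)
    also have "\<dots> \<le> (gamC N * (1 / wt N m)) * (1 / wt N (b $ j)) + gamC N * (1 / (wt N m)\<^sup>2)"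
    proof (rule add_mono[OF mult_mono[OF gam_bounds(2)[OF N]] gam_bounds(1)[OF N]])
      show "1 / wt N b \<le> 1 / wt N (b $ j)"
        using wt_component[of N b j] wt_pos[of N "b $ j"] by (intro divide_left_mono mult_pos_pos wt_pos) auto
      show "0 \<le> gamC N * (1 / wt N m)" "0 \<le> 1 / wt N b"
        using gam_bounds(5)[OF N] wt_pos[of N m] wt_pos[of N b] by auto
    qed
    also have "\<dots> = gamC N * (1 / (wt N m * wt N (b $ j)) + 1 / (wt N m)\<^sup>2)" by (simp add: algebra_simps)
    also have "\<dots> \<le> gamC N * ((1 / (wt N m)\<^sup>2 + 1 / (wt N (b $ j))\<^sup>2) / 2 + 1 / (wt N m)\<^sup>2)"
      using gam_bounds(5)[OF N] by (intro mult_left_mono add_right_mono amgm wt_pos) auto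
    finally show ?thesis
      by (simp only: lin)
  qed
  have "(\<Sum>(a,m)\<in>P. omB N j a m * cmod (cf F a) * cmod (cf h m) * cmod (cf v (a - axis j m)))
    = (\<Sum>(m,b)\<in>Q. ?w m b * cmod (cf F (b + axis j m)) * cmod (cf h m) * cmod (cf v b))"
    unfolding Q_def by (subst sum.reindex[OF inj]) (simp add: case_prod_unfold)
  also have "\<dots> \<le> (\<Sum>(m,b)\<in>M\<times>S. ?w m b * cmod (cf F (b + axis j m)) * cmod (cf h m) * cmod (cf v b))"
    using MS by (intro sum_mono2) (auto simp: omB_def gam_nonneg less_imp_le[OF wt_pos] intro!: mult_nonneg_nonneg divide_nonneg_nonneg)
  also have "\<dots> \<le> (\<Sum>p\<in>M\<times>S. gamC N * ((3/2) * ?g3 p + (1/2) * ?g2 p))"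
  proof (rule sum_mono)
    fix p assume "p \<in> M \<times> S"
    obtain m b where p: "p = (m, b)" by (cases p)
    have "?w m b * (cmod (cf F (b + axis j m)) * cmod (cf h m) * cmod (cf v b))
       \<le> (gamC N * ((3/2) * (1 / (wt N m)\<^sup>2) + (1/2) * (1 / (wt N (b $ j))\<^sup>2))) * (cmod (cf F (b + axis j m)) * cmod (cf h m) * cmod (cf v b))"
      by (intro mult_right_mono le) auto
    then show "(\<lambda>(m,b). ?w m b * cmod (cf F (b + axis j m)) * cmod (cf h m) * cmod (cf v b)) p \<le> gamC N * ((3/2) * ?g3 p + (1/2) * ?g2 p)"
      unfolding p by (simp add: algebra_simps)
  qed
  also have "\<dots> = gamC N * ((3/2) * (\<Sum>p\<in>M\<times>S. ?g3 p) + (1/2) * (\<Sum>p\<in>M\<times>S. ?g2 p))"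
    by (simp only: sum.distrib sum_distrib_left distrib_left)
  also have "\<dots> \<le> gamC N * ((3/2) * ((norm h * sqrt (latC N)) * (norm F * norm v)) + (1/2) * ((norm h * norm v) * (sqrt (latC N) * norm F)))"
    using gam_bounds(5)[OF N] by (intro mult_left_mono add_mono tri3[OF t] tri2[OF t]) auto
  finally show ?thesis by (simp add: algebra_simps)
qed

abbreviation bD where
  "bD N j \<equiv> trilin.bop latt latt (omD N j) (\<lambda>m b. b + axis j m) (\<lambda>m b. b)"
abbreviation bB where
  "bB N j \<equiv> trilin.bop latt latt (omB N j) (\<lambda>a m. m) (\<lambda>a m. a - axis j m)"

lemma trilin_D: "N \<ge> 1 \<Longrightarrow> trilin latt latt (omD N (j::'n::finite)) (\<lambda>m b. b + axis j m) (\<lambda>m b. b) (sqrt (latC N))"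
  by unfold_locales (use latC(1)[of N] triD_sum[of N] in \<open>auto simp: omD_def wt_pos less_imp_le\<close>)

lemma trilin_B: "N \<ge> 1 \<Longrightarrow> trilin latt latt (omB N (j::'n::finite)) (\<lambda>a m. m) (\<lambda>a m. a - axis j m) (2 * gamC N * sqrt (latC N))"
  by unfold_locales
     (use latC(1)[of N] gam_bounds(5)[of N] triB_sum[of N] in \<open>auto simp: omB_def gam_nonneg less_imp_le[OF wt_pos] intro!: divide_nonneg_nonneg mult_nonneg_nonneg\<close>)

definition cnjE :: "'a ell2 \<Rightarrow> 'a ell2" where "cnjE u = Ell2 (\<lambda>k. cnj (cf u k))"

lemma cf_cnjE [simp]: "cf (cnjE u) k = cnj (cf u k)"
  by (simp add: cnjE_def cf_Ell2)

lemma norm_cnjE [simp]: "norm (cnjE u) = norm u"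
proof -
  have "(norm (cnjE u))\<^sup>2 = (norm u)\<^sup>2" by (simp add: norm_ell2_sq)
  then show ?thesis by simp
qed

lemma bounded_linear_cnjE: "bounded_linear cnjE"
  by (rule bounded_linear_intro[where K=1]) (auto intro!: ell2_eqI)

text \<open>On weighted coefficients these are, up to normalization, the coefficients of the
  one-particle densities summed over the particles. Conjugating the second argument makes the
  bilinear \<open>bD\<close> sesquilinear.\<close>

definition Dop :: "nat \<Rightarrow> (real^3^'n::finite) ell2 \<Rightarrow> (real^3^'n) ell2 \<Rightarrow> (real^3) ell2" where
  "Dop N u v = (\<Sum>j\<in>UNIV. bD N j u (cnjE v))"

text \<open>Multiplication of the wave function by the sum over the particles of the potential
  generated by the charge \<open>h\<close>; the Coulomb multiplier is part of the kernel.\<close>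

definition Bop :: "nat \<Rightarrow> (real^3) ell2 \<Rightarrow> (real^3^'n::finite) ell2 \<Rightarrow> (real^3^'n) ell2" where
  "Bop N h v = (\<Sum>j\<in>UNIV. bB N j h v)"

lemma bounded_bilinear_plus:
  assumes f: "bounded_bilinear f" and g: "bounded_bilinear g"
  shows "bounded_bilinear (\<lambda>x y. f x y + g x y)"
proof
  obtain K where K: "\<And>a b. norm (f a b) \<le> norm a * norm b * K" using bounded_bilinear.bounded[OF f] by blast
  obtain L where L: "\<And>a b. norm (g a b) \<le> norm a * norm b * L" using bounded_bilinear.bounded[OF g] by blast
  have "norm (f a b + g a b) \<le> norm a * norm b * (K + L)" for a b
    using norm_triangle_ineq[of "f a b" "g a b"] K[of a b] L[of a b] unfolding distrib_left by linarith
  then show "\<exists>K. \<forall>a b. norm (f a b + g a b) \<le> norm a * norm b * K" by blast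
qed (simp_all add: bounded_bilinear.add_left[OF f] bounded_bilinear.add_left[OF g] bounded_bilinear.add_right[OF f]
  bounded_bilinear.add_right[OF g] bounded_bilinear.scaleR_left[OF f] bounded_bilinear.scaleR_left[OF g]
  bounded_bilinear.scaleR_right[OF f] bounded_bilinear.scaleR_right[OF g] scaleR_add_right)

lemma bounded_bilinear_sum:
  fixes f :: "'i \<Rightarrow> 'a::real_normed_vector \<Rightarrow> 'b::real_normed_vector \<Rightarrow> 'c::real_normed_vector"
  assumes "finite I" "\<And>i. i \<in> I \<Longrightarrow> bounded_bilinear (f i)"
  shows "bounded_bilinear (\<lambda>x y. \<Sum>i\<in>I. f i x y)"
  using assms
proof (induction I rule: finite_induct)
  case empty
  show ?case by standard (auto intro: exI[of _ 0])
next
  case (insert i I)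
  then show ?case by (simp add: bounded_bilinear_plus)
qed

lemma bounded_bilinear_Dop: assumes "N \<ge> 1" shows "bounded_bilinear (Dop N :: (real^3^'n::finite) ell2 \<Rightarrow> _)"
proof -
  have "bounded_bilinear (\<lambda>(u::(real^3^'n) ell2) v. bD N j u (cnjE v))" for j
    by (rule bounded_bilinear.comp[OF trilin.bounded_bilinear_bop[OF trilin_D[OF assms]] bounded_linear_ident bounded_linear_cnjE])
  then show ?thesis unfolding Dop_def[abs_def] by (intro bounded_bilinear_sum) auto
qed

lemma bounded_bilinear_Bop: assumes "N \<ge> 1" shows "bounded_bilinear (Bop N :: _ \<Rightarrow> (real^3^'n::finite) ell2 \<Rightarrow> _)"
  unfolding Bop_def[abs_def]
  by (intro bounded_bilinear_sum trilin.bounded_bilinear_bop[OF trilin_B[OF assms]]) auto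

lemma cf_Dop:
  fixes u v :: "(real^3^'n::finite) ell2"
  assumes N: "N \<ge> 1" and m: "m \<in> latt"
  shows "cf (Dop N u v) m = (\<Sum>j\<in>UNIV. \<Sum>\<^sub>\<infinity>b\<in>latt. (cf u (b + axis j m) / wt N (b + axis j m)) * cnj (cf v b / wt N b))"
  unfolding Dop_def cf_sum trilin.cf_bop[OF trilin_D[OF N]] trilin.op_def[OF trilin_D[OF N]] trilin.tt_def[OF trilin_D[OF N]]
  using m by (simp add: omD_def)

lemma cf_Dop_outside: "N \<ge> 1 \<Longrightarrow> m \<notin> latt \<Longrightarrow> cf (Dop N (u::(real^3^'n::finite) ell2) v) m = 0"
  unfolding Dop_def cf_sum by (simp add: trilin.cf_bop[OF trilin_D] trilin.op_def[OF trilin_D])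

lemma cf_Bop:
  fixes v :: "(real^3^'n::finite) ell2"
  assumes N: "N \<ge> 1" and a: "a \<in> latt"
  shows "cf (Bop N h v) a = (\<Sum>j\<in>UNIV. \<Sum>\<^sub>\<infinity>m\<in>latt. of_real (wt N a) * (of_real (gam N m) * cf h m * (cf v (a - axis j m) / wt N (a - axis j m))))"
  unfolding Bop_def cf_sum trilin.cf_bop[OF trilin_B[OF N]] trilin.op_def[OF trilin_B[OF N]] trilin.tt_def[OF trilin_B[OF N]]
  using a by (simp add: omB_def mult_ac)

lemma cf_Bop_outside: "N \<ge> 1 \<Longrightarrow> a \<notin> latt \<Longrightarrow> cf (Bop N h (v::(real^3^'n::finite) ell2)) a = 0"
  unfolding Bop_def cf_sum by (simp add: trilin.cf_bop[OF trilin_B] trilin.op_def[OF trilin_B])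

text \<open>Shifting the summation index by \<open>axis j m\<close> exchanges the two factors. For
  \<open>u = v\<close> this says that the density is real.\<close>

lemma Dop_hermitian:
  fixes u v :: "(real^3^'n::finite) ell2"
  assumes N: "N \<ge> 1"
  shows "cf (Dop N u v) (- m) = cnj (cf (Dop N v u) m)"
proof (cases "m \<in> latt")
  case False
  then have "- m \<notin> latt" using latt_closed(4)[of "- m"] by auto
  then show ?thesis using False by (simp add: cf_Dop_outside[OF N])
next
  case True
  have ax: "axis j (- m) = - (axis j m :: real^3^'n)" for j by (simp add: vec_eq_iff axis_def)
  have bij: "bij_betw (\<lambda>b. b + axis j m) latt (latt :: (real^3^'n) set)" for j
    by (rule bij_betwI[where g="\<lambda>b. b - axis j m"]) (auto intro: latt_closed(2,3) latt_axis[OF True])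
  have "(\<Sum>\<^sub>\<infinity>b\<in>latt. (cf u (b + axis j (- m)) / wt N (b + axis j (- m))) * cnj (cf v b / wt N b))
    = cnj (\<Sum>\<^sub>\<infinity>b\<in>latt. (cf v (b + axis j m) / wt N (b + axis j m)) * cnj (cf u b / wt N b))" for j
    unfolding ax
    by (subst infsum_reindex_bij_betw[OF bij[of j], symmetric], subst infsum_cnj[symmetric], rule infsum_cong)
       (simp add: mult.commute)
  then show ?thesis
    unfolding cf_Dop[OF N True] cf_Dop[OF N latt_closed(4)[OF True]] by (simp only: cnj_sum)
qed

lemma adjoint_factor:
  assumes "A * complex_of_real w = complex_of_real d * complex_of_real g"
  shows "A * h * v * cnj (complex_of_real w * u) = cnj (complex_of_real d * u * cnj v * cnj (complex_of_real g * h))"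
proof -
  have "A * h * v * cnj (complex_of_real w * u) = (A * complex_of_real w) * (h * v * cnj u)"
    by (simp add: mult_ac)
  also have "\<dots> = cnj (complex_of_real d * u * cnj v * cnj (complex_of_real g * h))"
    unfolding assms by (simp add: mult_ac)
  finally show ?thesis .
qed

text \<open>Both sides are the same triple sum: the energy of the density of \<open>u\<close> and
  \<open>v\<close> in the potential of \<open>h\<close> equals the L^2 pairing of that potential
  times \<open>v\<close> with \<open>u\<close>. The factor \<open>1 / wt^2\<close> converts the H^1
  inner product into that of L^2.\<close>

lemma Dop_Bop_adjoint:
  fixes u v :: "(real^3^'n::finite) ell2"
  assumes N: "N \<ge> 1"
  shows "inner (Dop N u v) (diag (\<lambda>m. of_real (gam N m)) h) = inner (Bop N h v) (diag (\<lambda>a. of_real (1 / (wt N a)\<^sup>2)) u)"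
proof -
  have b1: "cmod (complex_of_real (gam N m)) \<le> gamC N" for m
    using gam_bounds(3)[OF N, of m] gam_nonneg[of N m] by simp
  have b2: "cmod (complex_of_real (1 / (wt N a)\<^sup>2)) \<le> 1" for a :: "real^3^'n"
    using power_mono[OF wt_ge1[of N a], of 2] wt_pos[of N a] by (simp only: norm_of_real) simp
  have "inner (bD N j u (cnjE v)) (diag (\<lambda>m. of_real (gam N m)) h) = inner (bB N j h v) (diag (\<lambda>a. of_real (1 / (wt N a)\<^sup>2)) u)" for j
  proof -
    have bij: "bij_betw (\<lambda>(m,b). (b + axis j m, m)) (latt \<times> latt) (latt \<times> (latt :: (real^3) set))"
      by (rule bij_betwI[where g="\<lambda>(a,m). (m, a - axis j m)"]) (auto intro: latt_closed(2,3) latt_axis)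
    have "(\<Sum>\<^sub>\<infinity>(a,m)\<in>latt \<times> latt. of_real (omB N j a m) * cf h m * cf v (a - axis j m) * cnj (of_real (1 / (wt N a)\<^sup>2) * cf u a))
      = (\<Sum>\<^sub>\<infinity>(m,b)\<in>latt \<times> latt. cnj (of_real (omD N j m b) * cf u (b + axis j m) * cnj (cf v b) * cnj (of_real (gam N m) * cf h m)))"
    proof (subst infsum_reindex_bij_betw[OF bij, symmetric], rule infsum_cong)
      fix p :: "(real^3) \<times> (real^3^'n)" assume "p \<in> latt \<times> latt"
      obtain m b where p: "p = (m, b)" by (cases p)
      have "wt N (b + axis j m) > 0" "wt N b > 0" by (rule wt_pos)+
      then have "omB N j (b + axis j m) m * (1 / (wt N (b + axis j m))\<^sup>2) = omD N j m b * gam N m"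
        by (simp add: omB_def omD_def field_simps power2_eq_square)
      then have "complex_of_real (omB N j (b + axis j m) m) * of_real (1 / (wt N (b + axis j m))\<^sup>2) = of_real (omD N j m b) * of_real (gam N m)"
        unfolding of_real_mult[symmetric] by (simp only:)
      note eq = adjoint_factor[OF this, of "cf h m" "cf v b" "cf u (b + axis j m)"]
      show "(\<lambda>(a,m). of_real (omB N j a m) * cf h m * cf v (a - axis j m) * cnj (of_real (1 / (wt N a)\<^sup>2) * cf u a)) ((\<lambda>(m,b). (b + axis j m, m)) p)
        = (\<lambda>(m,b). cnj (of_real (omD N j m b) * cf u (b + axis j m) * cnj (cf v b) * cnj (of_real (gam N m) * cf h m))) p"
        unfolding p prod.case add_diff_cancel_right' by (rule eq)
    qed
    also have "\<dots> = cnj (\<Sum>\<^sub>\<infinity>(m,b)\<in>latt \<times> latt. of_real (omD N j m b) * cf u (b + axis j m) * cnj (cf v b) * cnj (of_real (gam N m) * cf h m))"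
      by (simp add: case_prod_unfold flip: infsum_cnj)
    finally show ?thesis
      unfolding trilin.inner_bop[OF trilin_D[OF N]] trilin.inner_bop[OF trilin_B[OF N]]
        trilin.tt_def[OF trilin_D[OF N]] trilin.tt_def[OF trilin_B[OF N]] cf_diag[OF b1] cf_diag[OF b2] by simp
  qed
  then show ?thesis unfolding Dop_def Bop_def inner_sum_left by simp
qed

section \<open>The vector field in the interaction picture\<close>

text \<open>Continuity is required along curves only: \<open>t \<mapsto> exp(it\<Delta>/2)\<close> is strongly but not norm continuous.\<close>

definition adm :: "('y::real_normed_vector \<Rightarrow> real) \<Rightarrow> (real \<Rightarrow> 'y \<Rightarrow> 'z::real_normed_vector) \<Rightarrow> bool" where
  "adm nu f \<longleftrightarrow> (\<forall>y. continuous_on UNIV y \<longrightarrow> continuous_on UNIV (\<lambda>s. f s (y s))) \<and>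
     (\<forall>R. \<exists>L. \<forall>t x y. nu x \<le> R \<longrightarrow> nu y \<le> R \<longrightarrow> norm (f t x - f t y) \<le> L * norm (x - y) \<and> norm (f t x) \<le> L)"

lemma admI:
  assumes "\<And>y. continuous_on UNIV y \<Longrightarrow> continuous_on UNIV (\<lambda>s. f s (y s))"
    "\<And>R. \<exists>L. \<forall>t x y. nu x \<le> R \<longrightarrow> nu y \<le> R \<longrightarrow> norm (f t x - f t y) \<le> L * norm (x - y) \<and> norm (f t x) \<le> L"
  shows "adm nu f"
  using assms by (simp add: adm_def)

lemma adm_cont: "adm nu f \<Longrightarrow> continuous_on UNIV y \<Longrightarrow> continuous_on UNIV (\<lambda>s. f s (y s))"
  by (simp add: adm_def)

lemma adm_lip:
  assumes "adm nu f"
  obtains L where "L \<ge> 0" "\<And>t x y. nu x \<le> R \<Longrightarrow> nu y \<le> R \<Longrightarrow> norm (f t x - f t y) \<le> L * norm (x - y)"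
    "\<And>t x. nu x \<le> R \<Longrightarrow> norm (f t x) \<le> L"
proof -
  obtain L where L: "\<And>t x y. nu x \<le> R \<Longrightarrow> nu y \<le> R \<Longrightarrow> norm (f t x - f t y) \<le> L * norm (x - y) \<and> norm (f t x) \<le> L"
    using assms unfolding adm_def by blast
  show thesis
  proof (rule that[of "\<bar>L\<bar>"])
    show "norm (f t x - f t y) \<le> \<bar>L\<bar> * norm (x - y)" if "nu x \<le> R" "nu y \<le> R" for t x y
      by (rule order_trans[OF conjunct1[OF L[OF that]] mult_right_mono[OF abs_ge_self norm_ge_zero]])
    show "norm (f t x) \<le> \<bar>L\<bar>" if "nu x \<le> R" for t x using L[OF that that, of t] by auto
  qed simp
qed

lemma adm_const: "adm nu (\<lambda>t y. c)"
  by (rule admI) (auto intro: exI[of _ "norm c"])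

lemma adm_add:
  assumes "adm nu f" "adm nu g" shows "adm nu (\<lambda>t y. f t y + g t y)"
proof (rule admI)
  show "continuous_on UNIV (\<lambda>s. f s (y s) + g s (y s))" if "continuous_on UNIV y" for y
    by (rule continuous_on_add[OF adm_cont[OF assms(1) that] adm_cont[OF assms(2) that]])
  fix R
  obtain L where L: "L \<ge> 0" "\<And>t x y. nu x \<le> R \<Longrightarrow> nu y \<le> R \<Longrightarrow> norm (f t x - f t y) \<le> L * norm (x - y)" "\<And>t x. nu x \<le> R \<Longrightarrow> norm (f t x) \<le> L"
    by (rule adm_lip[OF assms(1), where R=R]) (rule that)
  obtain K where K: "K \<ge> 0" "\<And>t x y. nu x \<le> R \<Longrightarrow> nu y \<le> R \<Longrightarrow> norm (g t x - g t y) \<le> K * norm (x - y)" "\<And>t x. nu x \<le> R \<Longrightarrow> norm (g t x) \<le> K"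
    by (rule adm_lip[OF assms(2), where R=R]) (rule that)
  have "norm (f t x + g t x - (f t y + g t y)) \<le> (L + K) * norm (x - y) \<and> norm (f t x + g t x) \<le> L + K"
    if "nu x \<le> R" "nu y \<le> R" for t x y
  proof
    have "norm (f t x + g t x - (f t y + g t y)) = norm ((f t x - f t y) + (g t x - g t y))" by (simp add: algebra_simps)
    also have "\<dots> \<le> L * norm (x - y) + K * norm (x - y)"
      by (rule order_trans[OF norm_triangle_ineq add_mono]) (use L(2) K(2) that in auto)
    finally show "norm (f t x + g t x - (f t y + g t y)) \<le> (L + K) * norm (x - y)" by (simp add: distrib_right)
    show "norm (f t x + g t x) \<le> L + K"
      by (rule order_trans[OF norm_triangle_ineq add_mono]) (use L(3) K(3) that in auto)
  qed
  then show "\<exists>L. \<forall>t x y. nu x \<le> R \<longrightarrow> nu y \<le> R \<longrightarrow> norm (f t x + g t x - (f t y + g t y)) \<le> L * norm (x - y) \<and> norm (f t x + g t x) \<le> L"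
    by blast
qed

lemma adm_bilinear:
  assumes B: "bounded_bilinear B" and "adm nu f" "adm nu g"
  shows "adm nu (\<lambda>t y. B (f t y) (g t y))"
proof (rule admI)
  interpret B: bounded_bilinear B by fact
  show "continuous_on UNIV (\<lambda>s. B (f s (y s)) (g s (y s)))" if "continuous_on UNIV y" for y
    by (rule B.continuous_on[OF adm_cont[OF assms(2) that] adm_cont[OF assms(3) that]])
  fix R
  obtain L where L: "L \<ge> 0" "\<And>t x y. nu x \<le> R \<Longrightarrow> nu y \<le> R \<Longrightarrow> norm (f t x - f t y) \<le> L * norm (x - y)" "\<And>t x. nu x \<le> R \<Longrightarrow> norm (f t x) \<le> L"
    by (rule adm_lip[OF assms(2), where R=R]) (rule that)
  obtain K where K: "K \<ge> 0" "\<And>t x y. nu x \<le> R \<Longrightarrow> nu y \<le> R \<Longrightarrow> norm (g t x - g t y) \<le> K * norm (x - y)" "\<And>t x. nu x \<le> R \<Longrightarrow> norm (g t x) \<le> K"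
    by (rule adm_lip[OF assms(3), where R=R]) (rule that)
  obtain b where b: "b \<ge> 0" "\<And>x y. norm (B x y) \<le> norm x * norm y * b" using B.nonneg_bounded by blast
  \<comment> \<open>A single constant serves both parts of \<open>adm\<close>:
    \<open>2 * L * K * b\<close> is for the Lipschitz estimate, the extra \<open>L * K * b\<close>
    for the bound.\<close>
  have "norm (B (f t x) (g t x) - B (f t y) (g t y)) \<le> (2 * L * K * b + L * K * b) * norm (x - y) \<and> norm (B (f t x) (g t x)) \<le> 2 * L * K * b + L * K * b"
    if xy: "nu x \<le> R" "nu y \<le> R" for t x y
  proof
    have "norm (B (f t x) (g t x) - B (f t y) (g t y)) = norm (B (f t x - f t y) (g t x) + B (f t y) (g t x - g t y))"
      by (simp add: B.diff_left B.diff_right)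
    also have "\<dots> \<le> (L * norm (x - y)) * K * b + L * (K * norm (x - y)) * b"
      using L K b(1) xy by (intro order_trans[OF norm_triangle_ineq] add_mono order_trans[OF b(2)] mult_mono) (auto intro!: mult_nonneg_nonneg)
    also have "\<dots> \<le> (2 * L * K * b + L * K * b) * norm (x - y)"
      using L(1) K(1) b(1) mult_nonneg_nonneg[OF mult_nonneg_nonneg[OF mult_nonneg_nonneg[OF L(1) K(1)] b(1)] norm_ge_zero[of "x - y"]]
      by (simp add: algebra_simps)
    finally show "norm (B (f t x) (g t x) - B (f t y) (g t y)) \<le> (2 * L * K * b + L * K * b) * norm (x - y)" .
    have "norm (B (f t x) (g t x)) \<le> L * K * b"
      using L K b(1) xy by (intro order_trans[OF b(2)] mult_mono) (auto intro!: mult_nonneg_nonneg)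
    moreover have "0 \<le> 2 * L * K * b" using L K b by auto
    ultimately show "norm (B (f t x) (g t x)) \<le> 2 * L * K * b + L * K * b" by linarith
  qed
  then show "\<exists>L. \<forall>t x y. nu x \<le> R \<longrightarrow> nu y \<le> R \<longrightarrow> norm (B (f t x) (g t x) - B (f t y) (g t y)) \<le> L * norm (x - y) \<and> norm (B (f t x) (g t x)) \<le> L"
    by blast
qed

lemma adm_bounded_linear:
  assumes h: "bounded_linear h" and f: "adm nu f" shows "adm nu (\<lambda>t y. h (f t y))"
  using adm_bilinear[OF bounded_bilinear.comp[OF bounded_bilinear_scaleR bounded_linear_ident h] adm_const[of nu 1] f] by simp

lemma adm_sum: "finite I \<Longrightarrow> (\<And>i. i \<in> I \<Longrightarrow> adm nu (f i)) \<Longrightarrow> adm nu (\<lambda>t y. \<Sum>i\<in>I. f i t y)"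
  by (induction I rule: finite_induct) (auto intro: adm_const adm_add)

lemma adm_Pair: 
  assumes "adm nu f" "adm nu g" shows "adm nu (\<lambda>t y. (f t y, g t y))"
proof -
  have "adm nu (\<lambda>t y. (f t y, 0) + (0, g t y))"
    by (intro adm_add adm_bounded_linear[OF _ assms(1)] adm_bounded_linear[OF _ assms(2)] bounded_linear_Pair bounded_linear_ident bounded_linear_zero)
  then show ?thesis by simp
qed

lemma norm_axis_eq: "norm (axis i x :: 'b::real_inner^'n::finite) = norm x"
  by (simp add: norm_eq_sqrt_inner inner_axis_axis)

lemma bounded_linear_axis: "bounded_linear (axis i :: 'b::real_inner \<Rightarrow> 'b^'n::finite)"
proof (rule bounded_linear_intro[where K=1])
  show "norm (axis i x :: 'b^'n) \<le> norm x * 1" for x by (simp add: norm_axis_eq)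
qed (auto simp: vec_eq_iff axis_def)

lemma vec_sum_axis: "(\<chi> n. f n) = (\<Sum>n\<in>UNIV. axis n (f n))" for f :: "'n::finite \<Rightarrow> 'b::real_inner"
  by (simp add: vec_eq_iff axis_def)

lemma adm_vec: "(\<And>n. adm nu (f n)) \<Longrightarrow> adm nu (\<lambda>t y. \<chi> n. f n t y)" for f :: "'n::finite \<Rightarrow> real \<Rightarrow> _ \<Rightarrow> 'b::real_inner"
  unfolding vec_sum_axis by (intro adm_sum adm_bounded_linear[OF bounded_linear_axis]) auto

text \<open>Continuity of each coefficient of the multiplier gives strong continuity along curves,
  while the uniform bound \<open>C\<close> makes the Lipschitz constant independent of time.\<close>

lemma adm_diag:
  assumes f: "adm nu f" and c: "\<And>t k. cmod (c t k) \<le> C" "\<And>k. continuous_on UNIV (\<lambda>t. c t k)"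
  shows "adm nu (\<lambda>t y. diag (c t) (f t y))"
proof (rule admI)
  show "continuous_on UNIV (\<lambda>s. diag (c s) (f s (y s)))" if y: "continuous_on UNIV y" for y
    unfolding continuous_on_def
  proof (intro ballI diag_tendsto[where C=C] c(1))
    fix x :: real and k
    show "((\<lambda>x. c x k) \<longlongrightarrow> c x k) (at x within UNIV)" using c(2)[of k] by (auto simp: continuous_on_def)
    show "((\<lambda>x. f x (y x)) \<longlongrightarrow> f x (y x)) (at x within UNIV)" using adm_cont[OF f y] by (auto simp: continuous_on_def)
  qed
  fix R
  obtain L where L: "L \<ge> 0" "\<And>t x y. nu x \<le> R \<Longrightarrow> nu y \<le> R \<Longrightarrow> norm (f t x - f t y) \<le> L * norm (x - y)" "\<And>t x. nu x \<le> R \<Longrightarrow> norm (f t x) \<le> L"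
    by (rule adm_lip[OF f, where R=R]) (rule that)
  have C: "0 \<le> C" using order_trans[OF norm_ge_zero c(1)] by blast
  have "norm (diag (c t) (f t x) - diag (c t) (f t y)) \<le> (C * L) * norm (x - y) \<and> norm (diag (c t) (f t x)) \<le> C * L"
    if xy: "nu x \<le> R" "nu y \<le> R" for t x y
  proof
    have "norm (diag (c t) (f t x) - diag (c t) (f t y)) = norm (diag (c t) (f t x - f t y))"
      by (simp add: linear_diff[OF bounded_linear.linear[OF bounded_linear_diag[OF c(1)]]])
    also have "\<dots> \<le> C * norm (f t x - f t y)" by (rule norm_diag_le[OF c(1)])
    also have "\<dots> \<le> C * (L * norm (x - y))" using L xy C by (intro mult_left_mono) auto
    finally show "norm (diag (c t) (f t x) - diag (c t) (f t y)) \<le> (C * L) * norm (x - y)" by (simp add: mult.assoc)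
    show "norm (diag (c t) (f t x)) \<le> C * L"
      by (rule order_trans[OF norm_diag_le[OF c(1)] mult_left_mono[OF L(3)[OF xy(1)] C]])
  qed
  then show "\<exists>L. \<forall>t x y. nu x \<le> R \<longrightarrow> nu y \<le> R \<longrightarrow> norm (diag (c t) (f t x) - diag (c t) (f t y)) \<le> L * norm (x - y) \<and> norm (diag (c t) (f t x)) \<le> L"
    by blast
qed

section \<open>Phases, difference quotients and real densities\<close>

lemma cis_diff_le: "cmod (cis a - cis b) \<le> \<bar>a - b\<bar>"
proof -
  have "cmod (cis a - cis b) \<le> 1 * norm (a - b)"
  proof (rule differentiable_bound[of UNIV cis "\<lambda>x h. h *\<^sub>R (\<i> * cis x)"])
    show "(cis has_derivative (\<lambda>h. h *\<^sub>R (\<i> * cis x))) (at x within UNIV)" for x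
      by (rule has_derivative_cis[OF has_derivative_ident])
    show "onorm (\<lambda>h. h *\<^sub>R (\<i> * cis x)) \<le> 1" for x
      by (rule onorm_le) (simp add: norm_mult)
  qed auto
  then show ?thesis by simp
qed

text \<open>The quotient form of a derivative can be combined with multipliers that converge only
  strongly, where the product rule for norm differentiable operators does not apply.\<close>

lemma vector_derivative_quotient:
  assumes "(f has_vector_derivative f') (at t)"
  shows "((\<lambda>s. (f s - f t) /\<^sub>R (s - t)) \<longlongrightarrow> f') (at t)"
proof -
  have "((\<lambda>s. norm (f s - f t - (s - t) *\<^sub>R f') / norm (s - t)) \<longlongrightarrow> 0) (at t)"
    using assms unfolding has_vector_derivative_def has_derivative_iff_norm by simp
  moreover have "\<forall>\<^sub>F s in at t. norm (f s - f t - (s - t) *\<^sub>R f') / norm (s - t) = norm ((f s - f t) /\<^sub>R (s - t) - f')"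
  proof (rule eventually_at_topological[THEN iffD2, OF exI[of _ UNIV]], intro conjI ballI impI)
    fix s assume s: "s \<noteq> t"
    have "(f s - f t) /\<^sub>R (s - t) - f' = (f s - f t - (s - t) *\<^sub>R f') /\<^sub>R (s - t)"
      using s by (simp add: scaleR_diff_right)
    then show "norm (f s - f t - (s - t) *\<^sub>R f') / norm (s - t) = norm ((f s - f t) /\<^sub>R (s - t) - f')"
      by (simp add: divide_inverse mult.commute)
  qed auto
  ultimately have "((\<lambda>s. norm ((f s - f t) /\<^sub>R (s - t) - f')) \<longlongrightarrow> 0) (at t)"
    by (rule Lim_transform_eventually)
  then show ?thesis by (simp only: tendsto_norm_zero_iff LIM_zero_iff)
qed

lemma cis_linear_quotient:
  "((\<lambda>s. (cis (s * a) - cis (t * a)) /\<^sub>R (s - t)) \<longlongrightarrow> \<i> * of_real a * cis (t * a)) (at t)"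
proof -
  have "((\<lambda>s. cis (s * a)) has_derivative (\<lambda>h. (h * a) *\<^sub>R (\<i> * cis (t * a)))) (at t)"
    by (rule has_derivative_cis) (auto intro!: derivative_eq_intros)
  moreover have "(\<lambda>h. (h * a) *\<^sub>R (\<i> * cis (t * a))) = (\<lambda>h. h *\<^sub>R (\<i> * of_real a * cis (t * a)))"
    by (auto simp: scaleR_conv_of_real)
  ultimately show ?thesis
    by (intro vector_derivative_quotient) (simp add: has_vector_derivative_def)
qed

lemma norm_fst_le': "norm (fst p) \<le> norm p" and norm_snd_le': "norm (snd p) \<le> norm p"
  using norm_fst_le[of "fst p" "snd p"] norm_snd_le[of "snd p" "fst p"] by simp_all

text \<open>The symmetry of the coefficients of real-valued functions.\<close>

definition herm :: "(real^3) ell2 \<Rightarrow> bool" where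
  "herm h \<longleftrightarrow> (\<forall>m. cf h (- m) = cnj (cf h m))"

lemma herm_add: "herm h \<Longrightarrow> herm k \<Longrightarrow> herm (h + k)" and herm_diff: "herm h \<Longrightarrow> herm k \<Longrightarrow> herm (h - k)"
  and herm_scaleR: "herm h \<Longrightarrow> herm (r *\<^sub>R h)" and herm_zero: "herm 0"
  by (auto simp: herm_def)

lemma herm_sum: "(\<And>i. i \<in> I \<Longrightarrow> herm (f i)) \<Longrightarrow> herm (sum f I)"
  by (induction I rule: infinite_finite_induct) (auto intro: herm_add herm_zero)

text \<open>The contributions of \<open>m\<close> and \<open>-m\<close> cancel: a real density is
  orthogonal to \<i> times a real density.\<close>

lemma herm_inner_imaginary:
  assumes h: "herm h" and k: "herm k" and g: "\<And>m. cmod (complex_of_real (g m)) \<le> C" "\<And>m. g (- m) = g m"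
  shows "inner k (diag (\<lambda>m. of_real (g m)) (diag (\<lambda>_. \<i>) h)) = 0"
proof -
  have i1: "cmod \<i> \<le> 1" by simp
  let ?f = "\<lambda>m. Re (cf k m * cnj (of_real (g m) * (\<i> * cf h m)))"
  have "inner k (diag (\<lambda>m. of_real (g m)) (diag (\<lambda>_. \<i>) h)) = (\<Sum>\<^sub>\<infinity>m. ?f m)"
    unfolding inner_ell2_def cf_diag[OF g(1)] cf_diag[OF i1] ..
  moreover have "(\<Sum>\<^sub>\<infinity>m. ?f m) = (\<Sum>\<^sub>\<infinity>m. ?f (- m))"
    by (rule infsum_reindex_bij_betw[symmetric]) (rule bij_uminus)
  moreover have "?f (- m) = - ?f m" for m
    using h k unfolding herm_def by (simp add: g(2) algebra_simps)
  then have "(\<Sum>\<^sub>\<infinity>m. ?f (- m)) = - (\<Sum>\<^sub>\<infinity>m. ?f m)" by (simp only: infsum_uminus)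
  ultimately show ?thesis by simp
qed

lemma inner_diag_imaginary_self:
  assumes "\<And>k. cmod (complex_of_real (g k)) \<le> C"
  shows "inner u (diag (\<lambda>k. of_real (g k)) (diag (\<lambda>_. \<i>) u)) = 0"
proof -
  have i1: "cmod \<i> \<le> 1" by simp
  have "Re (cf u k * cnj (of_real (g k) * (\<i> * cf u k))) = 0" for k by (simp add: algebra_simps)
  then show ?thesis unfolding inner_ell2_def cf_diag[OF assms] cf_diag[OF i1] by simp
qed

text \<open>Reflecting \<open>m\<close> conjugates the coefficients of \<open>h\<close> and, by
  \<open>Dop_hermitian\<close>, those of the density up to exchanging \<open>u\<close> and
  \<open>v\<close>; real parts are unaffected by conjugation.\<close>

lemma herm_inner_swap:
  fixes u v :: "(real^3^'n::finite) ell2"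
  assumes N: "N \<ge> 1" and h: "herm h" and g: "\<And>m. cmod (complex_of_real (g m)) \<le> C" "\<And>m. g (- m) = g m"
  shows "inner (Dop N u v) (diag (\<lambda>m. of_real (g m)) h) = inner (Dop N v u) (diag (\<lambda>m. of_real (g m)) h)"
proof -
  let ?f = "\<lambda>u v m. Re (cf (Dop N u v) m * cnj (of_real (g m) * cf h m))"
  have "(\<Sum>\<^sub>\<infinity>m. ?f u v m) = (\<Sum>\<^sub>\<infinity>m. ?f u v (- m))"
    by (rule infsum_reindex_bij_betw[symmetric]) (rule bij_uminus)
  also have "\<dots> = (\<Sum>\<^sub>\<infinity>m. ?f v u m)"
    by (intro infsum_cong) (use h in \<open>simp add: Dop_hermitian[OF N] g(2) herm_def\<close>)
  finally show ?thesis unfolding inner_ell2_def cf_diag[OF g(1)] .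
qed

lemma herm_Dop: "N \<ge> 1 \<Longrightarrow> herm (Dop N (u::(real^3^'n::finite) ell2) u)"
  by (simp add: herm_def Dop_hermitian)

lemma Bop_imaginary:
  fixes v :: "(real^3^'n::finite) ell2"
  assumes N: "N \<ge> 1" shows "diag (\<lambda>_. \<i>) (Bop N h v) = Bop N (diag (\<lambda>_. \<i>) h) v"
proof (rule ell2_eqI)
  have i1: "cmod \<i> \<le> 1" by simp
  fix a :: "real^3^'n"
  show "cf (diag (\<lambda>_. \<i>) (Bop N h v)) a = cf (Bop N (diag (\<lambda>_. \<i>) h) v) a"
  proof (cases "a \<in> latt")
    case True
    show ?thesis
      unfolding cf_diag[OF i1] cf_Bop[OF N True] sum_distrib_left infsum_cmult_right'[symmetric]
      by (intro sum.cong infsum_cong refl) (simp add: mult_ac)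
  qed (simp add: cf_diag[OF i1] cf_Bop_outside[OF N])
qed

text \<open>The type \<open>'n\<close> indexes electrons and ions alike, their numbers being equal.
  \<open>s n\<close> stands for the coefficients of the ion profile at the site of \<open>n\<close>,
  multiplied by \<open>wt\<close>.\<close>

locale spn =
  fixes N :: nat and e M :: real and s :: "'n::finite \<Rightarrow> (real^3) ell2"
  assumes N: "N \<ge> 1" and M: "M > 0" and s: "\<And>n. herm (s n)"
begin

definition kap :: real where "kap = 2 * pi / real N"

definition Uop :: "real \<Rightarrow> (real^3^'n) ell2 \<Rightarrow> (real^3^'n) ell2" where
  "Uop t = diag (\<lambda>k. cis (- t * omega N k))"

text \<open>\<open>Wm\<close> and \<open>Am\<close> split the H^1 inner product into its L^2 part
  and its gradient part.\<close>

definition Wm :: "(real^3^'n) ell2 \<Rightarrow> (real^3^'n) ell2" where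
  "Wm = diag (\<lambda>k. of_real (1 / (wt N k)\<^sup>2))"

definition Am :: "(real^3^'n) ell2 \<Rightarrow> (real^3^'n) ell2" where
  "Am = diag (\<lambda>k. of_real (1 - 1 / (wt N k)\<^sup>2))"

definition Gm :: "(real^3) ell2 \<Rightarrow> (real^3) ell2" where
  "Gm = diag (\<lambda>m. of_real (gam N m))"

definition Ii :: "'k ell2 \<Rightarrow> 'k ell2" where "Ii = diag (\<lambda>_. \<i>)"

definition Eph :: "real^3 \<Rightarrow> (real^3) ell2 \<Rightarrow> (real^3) ell2" where
  "Eph q = diag (\<lambda>m. cis (- kap * (m \<bullet> q)) * of_real (1 / wt N m))"

text \<open>The derivative in direction \<open>b\<close> of the Coulomb potential of a
  charge.\<close>

definition Gb :: "real^3 \<Rightarrow> (real^3) ell2 \<Rightarrow> (real^3) ell2" where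
  "Gb b = diag (\<lambda>m. \<i> * of_real (kap * (m \<bullet> b) * gam N m))"

definition Sq :: "real^3^'n \<Rightarrow> (real^3) ell2" where
  "Sq q = (\<Sum>n\<in>UNIV. Eph (q $ n) (s n))"

text \<open>This is \<open>N ^ 3\<close> times the coefficients of the total charge, because
  \<open>Dop\<close> also integrates over the coordinate that is replaced. The factor is returned by
  \<open>c3\<close>.\<close>

definition rr :: "(real^3^'n) ell2 \<Rightarrow> real^3^'n \<Rightarrow> (real^3) ell2" where
  "rr u q = Sq q - e *\<^sub>R Dop N u u"

definition c3 :: real where "c3 = 1 / real N ^ 3"

definition frc :: "(real^3) ell2 \<Rightarrow> real^3^'n \<Rightarrow> 'n \<Rightarrow> real^3" where
  "frc r q n = (\<Sum>b\<in>Basis. (c3 * inner (Gb b r) (Eph (q $ n) (s n))) *\<^sub>R b)"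

definition Fld :: "real \<Rightarrow> (real^3^'n) ell2 \<times> (real^3^'n) \<times> (real^3^'n) \<Rightarrow> (real^3^'n) ell2 \<times> (real^3^'n) \<times> (real^3^'n)" where
  "Fld t y = ((e * c3) *\<^sub>R Ii (Uop (- t) (Bop N (rr (Uop t (fst y)) (fst (snd y))) (Uop t (fst y)))),
     (1 / M) *\<^sub>R snd (snd y), \<chi> n. - frc (rr (Uop t (fst y)) (fst (snd y))) (fst (snd y)) n)"

text \<open>The quasinorm of the phase space. Positions are left out because the conservation laws
  do not bound them, and the field depends on them only through bounded, globally Lipschitz
  phases.\<close>

definition nu :: "(real^3^'n) ell2 \<times> (real^3^'n) \<times> (real^3^'n) \<Rightarrow> real" where
  "nu y = norm (fst y) + norm (snd (snd y))"

lemma Uop_multiplier_le: "cmod (cis (- t * omega N k)) \<le> 1" by simp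
lemma Wm_multiplier_le: "cmod (complex_of_real (1 / (wt N (k::'k::euclidean_space))\<^sup>2)) \<le> 1"
  using power_mono[OF wt_ge1[of N k], of 2] wt_pos[of N k] by (simp only: norm_of_real) simp
lemma Am_multiplier_le: "cmod (complex_of_real (1 - 1 / (wt N (k::'k::euclidean_space))\<^sup>2)) \<le> 1"
  using power_mono[OF wt_ge1[of N k], of 2] wt_pos[of N k] by (simp only: norm_of_real) simp
lemma Gm_multiplier_le: "cmod (complex_of_real (gam N m)) \<le> gamC N"
  using gam_bounds(3)[OF N, of m] gam_nonneg[of N m] by simp
lemma Ii_multiplier_le: "cmod \<i> \<le> 1" by simp
lemma Eph_multiplier_le: "cmod (cis (- kap * (m \<bullet> q)) * of_real (1 / wt N m)) \<le> 1"
  using wt_ge1[of N m] by (simp add: norm_mult norm_divide)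

lemma kap_norm_le: "kap * norm (m::'k::euclidean_space) \<le> wt N m"
proof -
  have "(kap * norm m)\<^sup>2 \<le> (wt N m)\<^sup>2" unfolding wt_sq kap_def power_mult_distrib by simp
  then show ?thesis by (rule power2_le_imp_le) (rule less_imp_le[OF wt_pos])
qed

lemma kap_pos: "kap > 0" using N by (simp add: kap_def)

lemma Gb_multiplier_le: assumes "norm b \<le> 1" shows "cmod (\<i> * of_real (kap * (m \<bullet> b) * gam N m)) \<le> gamC N"
proof -
  have "\<bar>m \<bullet> b\<bar> \<le> norm m * 1"
    using Cauchy_Schwarz_ineq2[of m b] mult_left_mono[OF assms norm_ge_zero[of m]] by linarith
  then have "\<bar>kap * (m \<bullet> b) * gam N m\<bar> \<le> gam N m * (kap * norm m)"
    using kap_pos gam_nonneg[of N m] by (simp add: abs_mult mult_mono mult.commute mult_left_mono)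
  also have "\<dots> \<le> gamC N" using gam_bounds(4)[OF N, of m] by (simp add: kap_def)
  finally show ?thesis by (simp only: norm_mult norm_of_real norm_ii mult_1)
qed

lemma norm_Basis3: "b \<in> Basis \<Longrightarrow> norm b \<le> 1" by simp

text \<open>Differentiating the phase in \<open>q\<close> costs a factor of the size of the
  frequency, which the division by \<open>wt\<close> in \<open>Eph\<close> absorbs.\<close>

lemma Eph_lip: "norm (Eph q x - Eph q' x) \<le> norm (q - q') * norm x"
proof -
  have b: "cmod ((cis (- kap * (m \<bullet> q)) - cis (- kap * (m \<bullet> q'))) * of_real (1 / wt N m)) \<le> norm (q - q')" for m
  proof -
    have "cmod (cis (- kap * (m \<bullet> q)) - cis (- kap * (m \<bullet> q'))) \<le> \<bar>- kap * (m \<bullet> q) - - kap * (m \<bullet> q')\<bar>"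
      by (rule cis_diff_le)
    also have "\<dots> = kap * \<bar>m \<bullet> (q - q')\<bar>"
      using kap_pos by (simp add: inner_diff_right abs_mult flip: right_diff_distrib)
    also have "\<dots> \<le> kap * (norm m * norm (q - q'))"
      using kap_pos by (intro mult_left_mono Cauchy_Schwarz_ineq2) auto
    also have "\<dots> \<le> wt N m * norm (q - q')"
      using mult_right_mono[OF kap_norm_le[of m], of "norm (q - q')"] by (simp add: mult_ac)
    finally have "cmod (cis (- kap * (m \<bullet> q)) - cis (- kap * (m \<bullet> q'))) / wt N m \<le> norm (q - q')"
      using wt_pos[of N m] by (simp add: divide_le_eq mult.commute)
    then show ?thesis using wt_pos[of N m] by (simp add: norm_mult norm_divide)
  qed
  have "Eph q x - Eph q' x = diag (\<lambda>m. (cis (- kap * (m \<bullet> q)) - cis (- kap * (m \<bullet> q'))) * of_real (1 / wt N m)) x"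
    by (rule ell2_eqI) (unfold Eph_def cf_diff cf_diag[OF Eph_multiplier_le] cf_diag[OF b], simp only: left_diff_distrib)
  then show ?thesis using norm_diag_le[OF b] by simp
qed

lemma adm_fst: "adm nu (\<lambda>t y. fst y)" and adm_p: "adm nu (\<lambda>t y. snd (snd y))"
proof -
  show "adm nu (\<lambda>t y. fst y)"
  proof (rule admI)
    fix R
    have "norm (fst x - fst y) \<le> max 1 R * norm (x - y) \<and> norm (fst x) \<le> max 1 R" if "nu x \<le> R" for x y
    proof
      have "norm (fst x - fst y) \<le> 1 * norm (x - y)" using norm_fst_le'[of "x - y"] by simp
      also have "\<dots> \<le> max 1 R * norm (x - y)" by (intro mult_right_mono) auto
      finally show "norm (fst x - fst y) \<le> max 1 R * norm (x - y)" .
      show "norm (fst x) \<le> max 1 R" using that norm_ge_zero[of "snd (snd x)"] unfolding nu_def by linarith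
    qed
    then show "\<exists>L. \<forall>t x y. nu x \<le> R \<longrightarrow> nu y \<le> R \<longrightarrow> norm (fst x - fst y) \<le> L * norm (x - y) \<and> norm (fst x) \<le> L"
      by blast
  qed (intro continuous_intros)
  show "adm nu (\<lambda>t y. snd (snd y))"
  proof (rule admI)
    fix R
    have "norm (snd (snd x) - snd (snd y)) \<le> max 1 R * norm (x - y) \<and> norm (snd (snd x)) \<le> max 1 R" if "nu x \<le> R" for x y
    proof
      have "norm (snd (snd (x - y))) \<le> norm (x - y)"
        by (rule order_trans[OF norm_snd_le' norm_snd_le'])
      then have "norm (snd (snd x) - snd (snd y)) \<le> 1 * norm (x - y)" by simp
      also have "\<dots> \<le> max 1 R * norm (x - y)" by (intro mult_right_mono) auto
      finally show "norm (snd (snd x) - snd (snd y)) \<le> max 1 R * norm (x - y)" .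
      show "norm (snd (snd x)) \<le> max 1 R" using that norm_ge_zero[of "fst x"] unfolding nu_def by linarith
    qed
    then show "\<exists>L. \<forall>t x y. nu x \<le> R \<longrightarrow> nu y \<le> R \<longrightarrow> norm (snd (snd x) - snd (snd y)) \<le> L * norm (x - y) \<and> norm (snd (snd x)) \<le> L"
      by blast
  qed (intro continuous_intros)
qed

lemma Eph_tendsto:
  assumes "(q \<longlongrightarrow> q0) L" shows "((\<lambda>x. Eph (q x) z) \<longlongrightarrow> Eph q0 z) L"
  unfolding Eph_def by (rule diag_tendsto_strong[OF _ Eph_multiplier_le Eph_multiplier_le]) (intro tendsto_intros assms)

lemma adm_Eph: "adm nu (\<lambda>t y. Eph (fst (snd y) $ n) x)"
proof (rule admI)
  show "continuous_on UNIV (\<lambda>s. Eph (fst (snd (y s)) $ n) x)" if y: "continuous_on UNIV y"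
    for y :: "real \<Rightarrow> (real^3^'n) ell2 \<times> (real^3^'n) \<times> (real^3^'n)"
    unfolding continuous_on_def
  proof (intro ballI Eph_tendsto)
    fix t :: real
    have "continuous_on UNIV (\<lambda>s. fst (snd (y s)) $ n)" using y by (intro continuous_intros)
    then show "((\<lambda>s. fst (snd (y s)) $ n) \<longlongrightarrow> fst (snd (y t)) $ n) (at t within UNIV)" by (auto simp: continuous_on_def)
  qed
  fix R
  have "norm (Eph (fst (snd z) $ n) x - Eph (fst (snd y) $ n) x) \<le> norm x * norm (z - y) \<and> norm (Eph (fst (snd z) $ n) x) \<le> norm x" for z y :: "(real^3^'n) ell2 \<times> (real^3^'n) \<times> (real^3^'n)"
  proof
    have "norm (fst (snd z) $ n - fst (snd y) $ n) \<le> norm (fst (snd (z - y)))"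
      using Finite_Cartesian_Product.norm_nth_le[of "fst (snd (z - y))" n] by simp
    also have "\<dots> \<le> norm (z - y)"
      by (rule order_trans[OF norm_fst_le' norm_snd_le'])
    finally have "norm (fst (snd z) $ n - fst (snd y) $ n) * norm x \<le> norm (z - y) * norm x" by (intro mult_right_mono) auto
    then show "norm (Eph (fst (snd z) $ n) x - Eph (fst (snd y) $ n) x) \<le> norm x * norm (z - y)"
      using Eph_lip[of "fst (snd z) $ n" x "fst (snd y) $ n"] by (simp add: mult.commute)
    show "norm (Eph (fst (snd z) $ n) x) \<le> norm x" using norm_diag_le[OF Eph_multiplier_le] by (simp add: Eph_def)
  qed
  then show "\<exists>L. \<forall>t z y. nu z \<le> R \<longrightarrow> nu y \<le> R \<longrightarrow> norm (Eph (fst (snd z) $ n) x - Eph (fst (snd y) $ n) x) \<le> L * norm (z - y) \<and> norm (Eph (fst (snd z) $ n) x) \<le> L"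
    by blast
qed

lemma adm_U: "adm nu f \<Longrightarrow> adm nu (\<lambda>t y. Uop t (f t y))" and adm_U': "adm nu f \<Longrightarrow> adm nu (\<lambda>t y. Uop (- t) (f t y))"
  unfolding Uop_def by (rule adm_diag[where C=1]; auto intro!: continuous_intros)+

lemma adm_rr: "adm nu (\<lambda>t y. rr (Uop t (fst y)) (fst (snd y)))"
proof -
  have "adm nu (\<lambda>t y. (\<Sum>n\<in>UNIV. Eph (fst (snd y) $ n) (s n)) + (- e) *\<^sub>R Dop N (Uop t (fst y)) (Uop t (fst y)))"
    by (intro adm_add adm_sum adm_Eph adm_bounded_linear[OF bounded_linear_scaleR_right] adm_bilinear[OF bounded_bilinear_Dop[OF N]] adm_U adm_fst) auto
  then show ?thesis by (simp add: rr_def Sq_def)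
qed

lemma adm_Fld: "adm nu Fld"
proof -
  have "adm nu (\<lambda>t y. ((e * c3) *\<^sub>R Ii (Uop (- t) (Bop N (rr (Uop t (fst y)) (fst (snd y))) (Uop t (fst y)))),
     (1 / M) *\<^sub>R snd (snd y), \<chi> n. (- 1) *\<^sub>R (\<Sum>b\<in>Basis. (c3 * inner (Gb b (rr (Uop t (fst y)) (fst (snd y)))) (Eph (fst (snd y) $ n) (s n))) *\<^sub>R b)))"
    unfolding Ii_def Gb_def
    by (intro adm_Pair adm_vec adm_sum adm_bounded_linear[OF bounded_linear_scaleR_right]
        adm_bounded_linear[OF bounded_linear_scaleR_left] adm_bounded_linear[OF bounded_linear_mult_right]
        adm_bounded_linear[OF bounded_linear_diag[OF Ii_multiplier_le]] adm_U' adm_bilinear[OF bounded_bilinear_Bop[OF N]] adm_rr adm_U adm_fst adm_p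
        adm_bilinear[OF bounded_bilinear_inner] adm_bounded_linear[OF bounded_linear_diag[OF Gb_multiplier_le]] adm_Eph)
       auto
  then show ?thesis by (simp add: Fld_def[abs_def] frc_def)
qed

lemma nu_lip: "\<bar>nu x - nu y\<bar> \<le> 2 * norm (x - y)"
proof -
  have "\<bar>norm (fst x) - norm (fst y)\<bar> \<le> norm (x - y)"
    using norm_triangle_ineq3[of "fst x" "fst y"] norm_fst_le'[of "x - y"] by simp
  moreover have "\<bar>norm (snd (snd x)) - norm (snd (snd y))\<bar> \<le> norm (x - y)"
    using norm_triangle_ineq3[of "snd (snd x)" "snd (snd y)"] order_trans[OF norm_snd_le' norm_snd_le', of "x - y"] by simp
  ultimately show ?thesis unfolding nu_def by linarith
qed

end

section \<open>Conservation of charge and energy\<close>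

context spn
begin

lemma Uop_inverse: "Uop t (Uop (- t) u) = u" "Uop (- t) (Uop t u) = u"
  by (rule ell2_eqI, unfold Uop_def cf_diag[OF Uop_multiplier_le], simp add: cis_mult mult.assoc[symmetric])+

lemma inner_Uop_Ii:
  assumes f: "\<And>k. cmod (complex_of_real (f k)) \<le> C"
  shows "inner (diag (\<lambda>k. of_real (f k)) v) (Ii (Uop (- t) x)) = inner (diag (\<lambda>k. of_real (f k)) (Uop t v)) (Ii x)"
  unfolding inner_ell2_def Ii_def Uop_def cf_diag[OF f] cf_diag[OF Ii_multiplier_le] cf_diag[OF Uop_multiplier_le]
  by (intro infsum_cong) (simp add: algebra_simps cis_cnj)

lemma inner_Ii_antisym: "inner u (Ii v) = - inner (Ii u) v"
proof -
  have "inner u (Ii v) = inner (diag (\<lambda>_. cnj \<i>) u) v"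
    unfolding Ii_def by (metis inner_commute inner_diag[OF Ii_multiplier_le])
  also have "diag (\<lambda>_. cnj \<i>) u = - Ii u"
    unfolding Ii_def by (rule ell2_eqI) (simp add: cf_diag[where C=1])
  finally show ?thesis by simp
qed

lemma inner_Gm: "inner (Gm x) y = inner x (Gm y)"
  unfolding Gm_def by (subst inner_diag[OF Gm_multiplier_le]) simp

lemma Gm_nonneg: "inner (Gm x) x \<ge> 0"
proof -
  have "Re (of_real (gam N m) * cf x m * cnj (cf x m)) = gam N m * (cmod (cf x m))\<^sup>2" for m
    by (simp only: mult.assoc complex_norm_square[symmetric]) simp
  then show ?thesis unfolding inner_ell2_def Gm_def cf_diag[OF Gm_multiplier_le] by (auto intro!: infsum_nonneg simp: gam_nonneg)
qed

lemma bounded_linear_ops: "bounded_linear Wm" "bounded_linear Am" "bounded_linear Gm" "bounded_linear Ii" "bounded_linear (Uop t)"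
  unfolding Wm_def Am_def Gm_def Ii_def Uop_def
  by (rule bounded_linear_diag, rule Wm_multiplier_le Am_multiplier_le Gm_multiplier_le Ii_multiplier_le Uop_multiplier_le)+

lemma herm_Sq: "herm (Sq q)"
proof -
  have "herm (Eph p (s n))" for p n
    using s[of n] unfolding herm_def Eph_def cf_diag[OF Eph_multiplier_le] by (simp add: cis_cnj)
  then show ?thesis unfolding Sq_def by (intro herm_sum)
qed

lemma herm_rr: "herm (rr u q)"
  unfolding rr_def by (intro herm_diff herm_scaleR herm_Sq herm_Dop[OF N])

text \<open>The potential of a real charge is real, so \<i> times the potential times
  \<open>u\<close> is orthogonal to \<open>u\<close> in L^2. By adjointness this is the
  orthogonality of a real and an imaginary density.\<close>

lemma inner_Wm_Ii_Bop:
  assumes "herm r" shows "inner (Wm u) (Ii (Bop N r u)) = 0"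
proof -
  have "inner (Wm u) (Ii (Bop N r u)) = inner (Bop N (Ii r) u) (Wm u)"
    unfolding Ii_def by (simp add: Bop_imaginary[OF N] inner_commute)
  also have "\<dots> = inner (Dop N u u) (Gm (Ii r))"
    unfolding Wm_def Gm_def by (rule Dop_Bop_adjoint[OF N, symmetric])
  also have "\<dots> = 0"
    unfolding Gm_def Ii_def
    by (rule herm_inner_imaginary[where C="gamC N"], rule assms, rule herm_Dop[OF N], rule Gm_multiplier_le, rule gam_uminus)
  finally show ?thesis .
qed

definition dE :: "real^3 \<Rightarrow> real^3 \<Rightarrow> (real^3) ell2 \<Rightarrow> (real^3) ell2" where
  "dE q d = diag (\<lambda>m. - \<i> * of_real (kap * (m \<bullet> d)) * (cis (- kap * (m \<bullet> q)) * of_real (1 / wt N m)))"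

lemma bdE: "cmod (- \<i> * of_real (kap * (m \<bullet> d)) * (cis (- kap * (m \<bullet> q)) * of_real (1 / wt N m))) \<le> norm d"
proof -
  have "\<bar>kap * (m \<bullet> d)\<bar> \<le> kap * (norm m * norm d)"
    using kap_pos Cauchy_Schwarz_ineq2[of m d] by (simp add: abs_mult)
  also have "\<dots> \<le> wt N m * norm d" using mult_right_mono[OF kap_norm_le[of m], of "norm d"] by (simp add: mult.assoc)
  finally have "\<bar>kap * (m \<bullet> d)\<bar> * (1 / wt N m) \<le> norm d" using wt_pos[of N m] by (simp add: divide_le_eq mult.commute)
  then show ?thesis using wt_pos[of N m] by (simp add: norm_mult norm_divide abs_mult)
qed

text \<open>The normalized remainder is a multiplier bounded by 2 that tends to 0 at every
  \<open>m\<close>, so it tends to 0 on the fixed vector \<open>x\<close>. The weight in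
  \<open>Eph\<close> pays for exactly this one derivative.\<close>

lemma Eph_has_derivative: "((\<lambda>q. Eph q x) has_derivative (\<lambda>d. dE q d x)) (at q)"
  unfolding has_derivative_iff_norm
proof
  show "bounded_linear (\<lambda>d. dE q d x)"
  proof (rule bounded_linear_intro[where K="norm x"])
    show "dE q (d + d') x = dE q d x + dE q d' x" for d d'
      unfolding dE_def by (rule ell2_eqI, unfold cf_simps cf_diag[OF bdE], simp add: inner_add_right algebra_simps)
    show "dE q (c *\<^sub>R d) x = c *\<^sub>R dE q d x" for c d
      unfolding dE_def by (rule ell2_eqI, unfold cf_simps cf_diag[OF bdE], simp add: inner_scaleR_right scaleR_conv_of_real[where 'a=complex] mult_ac)
    show "norm (dE q d x) \<le> norm d * norm x" for d unfolding dE_def by (rule norm_diag_le[OF bdE])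
  qed
  define h where "h q' m = ((cis (- kap * (m \<bullet> q')) - cis (- kap * (m \<bullet> q)) - ((- kap * (m \<bullet> (q' - q))) *\<^sub>R (\<i> * cis (- kap * (m \<bullet> q))))) * of_real (1 / wt N m)) /\<^sub>R norm (q' - q)" for q' m
  have hb: "cmod (h q' m) \<le> 2" for q' m
  proof (cases "q' = q")
    case True then show ?thesis by (simp add: h_def)
  next
    case False
    have "\<bar>- kap * (m \<bullet> (q' - q))\<bar> \<le> kap * (norm m * norm (q' - q))"
      using kap_pos Cauchy_Schwarz_ineq2[of m "q' - q"] by (simp add: abs_mult)
    also have "\<dots> \<le> wt N m * norm (q' - q)" using mult_right_mono[OF kap_norm_le[of m], of "norm (q' - q)"] by (simp add: mult.assoc)
    finally have k: "\<bar>- kap * (m \<bullet> (q' - q))\<bar> \<le> wt N m * norm (q' - q)" .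
    have "cmod (cis (- kap * (m \<bullet> q')) - cis (- kap * (m \<bullet> q))) \<le> \<bar>- kap * (m \<bullet> q') - - kap * (m \<bullet> q)\<bar>" by (rule cis_diff_le)
    also have "- kap * (m \<bullet> q') - - kap * (m \<bullet> q) = - kap * (m \<bullet> (q' - q))" by (simp add: inner_diff_right algebra_simps)
    finally have "cmod (cis (- kap * (m \<bullet> q')) - cis (- kap * (m \<bullet> q)) - ((- kap * (m \<bullet> (q' - q))) *\<^sub>R (\<i> * cis (- kap * (m \<bullet> q))))) \<le> 2 * (wt N m * norm (q' - q))"
      using k norm_triangle_ineq4[of "cis (- kap * (m \<bullet> q')) - cis (- kap * (m \<bullet> q))" "(- kap * (m \<bullet> (q' - q))) *\<^sub>R (\<i> * cis (- kap * (m \<bullet> q)))"]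
      by (simp add: norm_mult)
    then have "cmod (cis (- kap * (m \<bullet> q')) - cis (- kap * (m \<bullet> q)) - ((- kap * (m \<bullet> (q' - q))) *\<^sub>R (\<i> * cis (- kap * (m \<bullet> q))))) * (1 / wt N m) / norm (q' - q) \<le> 2"
      using wt_pos[of N m] False by (simp add: divide_le_eq mult_ac)
    then show ?thesis
      unfolding h_def using wt_pos[of N m] by (simp only: norm_mult norm_scaleR norm_of_real) (simp add: divide_inverse mult_ac)
  qed
  have hl: "((\<lambda>q'. h q' m) \<longlongrightarrow> 0) (at q)" for m
  proof -
    have "((\<lambda>q'. - kap * (m \<bullet> q')) has_derivative (\<lambda>d. - kap * (m \<bullet> d))) (at q)"
      by (auto intro!: derivative_eq_intros)
    from has_derivative_cis[OF this]
    have "((\<lambda>q'. norm (cis (- kap * (m \<bullet> q')) - cis (- kap * (m \<bullet> q)) - ((- kap * (m \<bullet> (q' - q))) *\<^sub>R (\<i> * cis (- kap * (m \<bullet> q))))) / norm (q' - q)) \<longlongrightarrow> 0) (at q)"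
      unfolding has_derivative_iff_norm by blast
    then have "((\<lambda>q'. (1 / wt N m) * (norm (cis (- kap * (m \<bullet> q')) - cis (- kap * (m \<bullet> q)) - ((- kap * (m \<bullet> (q' - q))) *\<^sub>R (\<i> * cis (- kap * (m \<bullet> q))))) / norm (q' - q))) \<longlongrightarrow> (1 / wt N m) * 0) (at q)"
      by (intro tendsto_mult tendsto_const)
    then have "((\<lambda>q'. norm (h q' m)) \<longlongrightarrow> 0) (at q)"
      unfolding h_def using wt_pos[of N m] by (simp add: norm_mult norm_divide norm_inverse divide_inverse mult_ac)
    then show ?thesis by (rule tendsto_norm_zero_cancel)
  qed
  have z: "cmod 0 \<le> 2" by simp
  have "((\<lambda>q'. diag (h q') x) \<longlongrightarrow> diag (\<lambda>_. 0) x) (at q)"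
    by (rule diag_tendsto_strong[OF hl hb z])
  then have "((\<lambda>q'. norm (diag (h q') x)) \<longlongrightarrow> norm (diag (\<lambda>_. 0 :: complex) x)) (at q)" by (rule tendsto_norm)
  moreover have "diag (\<lambda>_. 0) x = 0" by (rule ell2_eqI) (simp add: cf_diag[OF z])
  moreover have "norm (diag (h q') x) = norm (Eph q' x - Eph q x - dE q (q' - q) x) / norm (q' - q)" for q'
  proof (cases "q' = q")
    case True
    have "diag (h q') x = 0" by (rule ell2_eqI) (simp add: cf_diag[OF hb], simp add: h_def True)
    then show ?thesis using True by simp
  next
    case False
    have "diag (h q') x = (Eph q' x - Eph q x - dE q (q' - q) x) /\<^sub>R norm (q' - q)"
      unfolding Eph_def dE_def
      by (rule ell2_eqI, unfold cf_simps cf_diff cf_diag[OF bdE] cf_diag[OF Eph_multiplier_le] cf_diag[OF hb])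
         (simp add: h_def scaleR_conv_of_real algebra_simps)
    then show ?thesis by (simp add: divide_inverse mult.commute)
  qed
  ultimately show "((\<lambda>q'. norm (Eph q' x - Eph q x - dE q (q' - q) x) / norm (q' - q)) \<longlongrightarrow> 0) (at q)" by simp
qed

text \<open>Integration by parts on the Fourier side: the derivative moves from the ion profile to
  the potential, which turns the change of potential energy under a displacement into a
  force.\<close>

lemma inner_Gm_dE: "inner (Gm r) (dE q d x) = (\<Sum>b\<in>Basis. (d \<bullet> b) * inner (Gb b r) (Eph q x))"
proof -
  have bb: "cmod (\<i> * of_real (kap * (m \<bullet> d) * gam N m)) \<le> norm d * gamC N" for m
  proof -
    have "\<bar>kap * (m \<bullet> d) * gam N m\<bar> = kap * \<bar>m \<bullet> d\<bar> * gam N m"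
      using kap_pos gam_nonneg[of N m] by (simp add: abs_mult)
    also have "\<dots> \<le> kap * (norm m * norm d) * gam N m"
      using kap_pos gam_nonneg[of N m] by (intro mult_right_mono mult_left_mono Cauchy_Schwarz_ineq2) auto
    also have "\<dots> = norm d * (gam N m * (kap * norm m))" by (simp only: mult_ac)
    also have "\<dots> \<le> norm d * gamC N"
      using gam_bounds(4)[OF N, of m] by (intro mult_left_mono) (auto simp: kap_def)
    finally show ?thesis by (simp only: norm_mult norm_of_real norm_ii mult_1)
  qed
  have "(\<Sum>b\<in>Basis. (d \<bullet> b) *\<^sub>R Gb b r) = diag (\<lambda>m. \<i> * of_real (kap * (m \<bullet> d) * gam N m)) r"
  proof (rule ell2_eqI)
    fix m
    have "cf (\<Sum>b\<in>Basis. (d \<bullet> b) *\<^sub>R Gb b r) m = (\<Sum>b\<in>Basis. (\<i> * of_real (kap * gam N m) * cf r m) * of_real ((m \<bullet> b) * (d \<bullet> b)))"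
      unfolding cf_sum cf_simps Gb_def
      by (rule sum.cong[OF refl], subst cf_diag[OF Gb_multiplier_le[OF norm_Basis3]], assumption, simp add: scaleR_conv_of_real mult_ac)
    also have "\<dots> = (\<i> * of_real (kap * gam N m) * cf r m) * of_real (m \<bullet> d)"
      unfolding sum_distrib_left[symmetric] euclidean_inner[of m d] by simp
    also have "\<dots> = cf (diag (\<lambda>m. \<i> * of_real (kap * (m \<bullet> d) * gam N m)) r) m"
      unfolding cf_diag[OF bb] by (simp add: mult_ac)
    finally show "cf (\<Sum>b\<in>Basis. (d \<bullet> b) *\<^sub>R Gb b r) m = cf (diag (\<lambda>m. \<i> * of_real (kap * (m \<bullet> d) * gam N m)) r) m" .
  qed
  note eq = this
  have "(\<Sum>b\<in>Basis. (d \<bullet> b) * inner (Gb b r) (Eph q x)) = inner (\<Sum>b\<in>Basis. (d \<bullet> b) *\<^sub>R Gb b r) (Eph q x)"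
    by (simp add: inner_sum_left)
  also have "\<dots> = inner (diag (\<lambda>m. \<i> * of_real (kap * (m \<bullet> d) * gam N m)) r) (Eph q x)"
    by (simp only: eq)
  also have "\<dots> = inner (Gm r) (dE q d x)"
    unfolding inner_ell2_def Gm_def dE_def Eph_def cf_diag[OF bb] cf_diag[OF Eph_multiplier_le] cf_diag[OF bdE] cf_diag[OF Gm_multiplier_le]
    by (intro infsum_cong) (simp add: algebra_simps)
  finally show ?thesis by simp
qed

definition Qf :: "(real^3^'n) ell2 \<Rightarrow> real" where "Qf u = inner (Wm u) u"

definition Ef :: "(real^3^'n) ell2 \<Rightarrow> real^3^'n \<Rightarrow> real^3^'n \<Rightarrow> real" where
  "Ef u q p = 1/2 * inner (Am u) u + c3/2 * inner (Gm (rr u q)) (rr u q) + inner p p / (2 * M)"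

lemma Qf_Uop: "Qf (Uop t u) = Qf u" and Am_Uop: "inner (Am (Uop t u)) (Uop t u) = inner (Am u) u"
proof -
  have c: "cis x * z * cnj (cis x * w) = z * cnj w" for x z w
    by (simp add: cis_cnj) (simp add: mult.assoc[symmetric] mult.commute[of _ "cis (- x)"] cis_mult)
  have d: "Re (a * (cis x * z) * cnj (cis x * z)) = Re (a * z * cnj z)" for a x z
    using c[of x z z] by (metis mult.assoc)
  show "Qf (Uop t u) = Qf u" "inner (Am (Uop t u)) (Uop t u) = inner (Am u) u"
    unfolding Qf_def inner_ell2_def Am_def Wm_def Uop_def cf_diag[OF Uop_multiplier_le] cf_diag[OF Wm_multiplier_le] cf_diag[OF Am_multiplier_le] d by simp_all
qed

text \<open>The generator of \<open>Uop\<close> is unbounded, so \<open>Uop\<close> applied to a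
  differentiable curve need not be differentiable. It becomes so after \<open>Wm\<close>, since
  \<open>omega / wt^2\<close> is bounded; and \<open>omega = (wt^2 - 1) / 2\<close> turns the
  generator times \<open>Wm\<close> into half of \<open>Am\<close>.\<close>

lemma Wm_U_quotient:
  fixes \<phi> :: "real \<Rightarrow> (real^3^'n) ell2"
  assumes "(\<phi> has_vector_derivative \<phi>') (at t)"
  shows "((\<lambda>s. (Wm (Uop s (\<phi> s)) - Wm (Uop t (\<phi> t))) /\<^sub>R (s - t)) \<longlongrightarrow> Wm (Uop t \<phi>') - (1/2) *\<^sub>R Ii (Am (Uop t (\<phi> t)))) (at t)"
proof -
  define h where "h s k = ((cis (s * - omega N k) - cis (t * - omega N k)) /\<^sub>R (s - t)) * of_real (1 / (wt N k)\<^sup>2)" for s and k :: "real^3^'n"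
  define h0 where "h0 k = (\<i> * of_real (- omega N k) * cis (t * - omega N k)) * of_real (1 / (wt N k)\<^sup>2)" for k :: "real^3^'n"
  have alg: "A * (c1 * (r *\<^sub>R (x - y))) + (r *\<^sub>R (c1 - c2)) * A * y = r *\<^sub>R (A * (c1 * x) - A * (c2 * y))" for A c1 c2 x y :: complex and r
    by (simp add: scaleR_conv_of_real algebra_simps)
  have om: "omega N k = ((wt N k)\<^sup>2 - 1) / 2" for k :: "real^3^'n" by (simp add: wt_sq omega_def)
  have ow: "0 \<le> omega N k" "omega N k * (1 / (wt N k)\<^sup>2) \<le> 1" for k :: "real^3^'n"
    using power_mono[OF wt_ge1[of N k], of 2] by (auto simp: om divide_le_eq_1)
  have hb: "cmod (h s k) \<le> 1" for s k
  proof (cases "s = t")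
    case False
    have "cmod (cis (s * - omega N k) - cis (t * - omega N k)) \<le> \<bar>s * - omega N k - t * - omega N k\<bar>" by (rule cis_diff_le)
    also have "s * - omega N k - t * - omega N k = - ((s - t) * omega N k)" by (simp add: algebra_simps)
    also have "\<bar>- ((s - t) * omega N k)\<bar> = \<bar>s - t\<bar> * omega N k" using ow(1)[of k] by (simp add: abs_mult)
    finally have "inverse \<bar>s - t\<bar> * cmod (cis (s * - omega N k) - cis (t * - omega N k)) \<le> inverse \<bar>s - t\<bar> * (\<bar>s - t\<bar> * omega N k)"
      by (intro mult_left_mono) auto
    then have "cmod ((cis (s * - omega N k) - cis (t * - omega N k)) /\<^sub>R (s - t)) \<le> omega N k"
      using False by (simp add: mult.assoc[symmetric])
    then have "cmod ((cis (s * - omega N k) - cis (t * - omega N k)) /\<^sub>R (s - t)) * (1 / (wt N k)\<^sup>2) \<le> omega N k * (1 / (wt N k)\<^sup>2)"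
      by (intro mult_right_mono) auto
    then show ?thesis unfolding h_def using ow(2)[of k] by (simp only: norm_mult norm_of_real) simp
  qed (simp add: h_def)
  have h0b: "cmod (h0 k) \<le> 1" for k
    unfolding h0_def using ow[of k] by (simp only: norm_mult norm_of_real norm_cis norm_ii) simp
  have l1: "((\<lambda>s. diag (h s) (\<phi> t)) \<longlongrightarrow> diag h0 (\<phi> t)) (at t)"
    by (rule diag_tendsto_strong[OF _ hb h0b])
       (unfold h_def h0_def, intro tendsto_mult tendsto_const cis_linear_quotient)
  have l2: "((\<lambda>s. Uop s ((\<phi> s - \<phi> t) /\<^sub>R (s - t))) \<longlongrightarrow> Uop t \<phi>') (at t)"
    unfolding Uop_def
    by (rule diag_tendsto[OF _ Uop_multiplier_le Uop_multiplier_le vector_derivative_quotient[OF assms]]) (intro tendsto_intros)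
  \<comment> \<open>A product rule for quotients: the first term carries the increment of
    \<open>\<phi>\<close>, the second that of the free evolution on the fixed vector
    \<open>\<phi> t\<close>, so that strong convergence suffices for both.\<close>
  have "((\<lambda>s. Wm (Uop s ((\<phi> s - \<phi> t) /\<^sub>R (s - t))) + diag (h s) (\<phi> t)) \<longlongrightarrow> Wm (Uop t \<phi>') + diag h0 (\<phi> t)) (at t)"
    by (intro tendsto_add l1 bounded_linear.tendsto[OF bounded_linear_ops(1)] l2)
  moreover have "Wm (Uop s ((\<phi> s - \<phi> t) /\<^sub>R (s - t))) + diag (h s) (\<phi> t) = (Wm (Uop s (\<phi> s)) - Wm (Uop t (\<phi> t))) /\<^sub>R (s - t)" for s
    unfolding Wm_def Uop_def
    by (rule ell2_eqI, unfold cf_simps cf_diff cf_diag[OF Uop_multiplier_le] cf_diag[OF Wm_multiplier_le] cf_diag[OF hb])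
       (unfold h_def mult_minus_right[of _ "omega N _"] mult_minus_left[of _ "omega N _"], rule alg)
  moreover have "diag h0 (\<phi> t) = - ((1/2) *\<^sub>R Ii (Am (Uop t (\<phi> t))))"
  proof -
    have key: "complex_of_real (- omega N k) * of_real (1 / (wt N k)\<^sup>2) = - (1/2) * of_real (1 - 1 / (wt N k)\<^sup>2)" for k :: "real^3^'n"
    proof -
      have "- omega N k * (1 / (wt N k)\<^sup>2) = - (1/2) * (1 - 1 / (wt N k)\<^sup>2)"
        using wt_pos[of N k] by (simp add: om field_simps)
      then have "complex_of_real (- omega N k * (1 / (wt N k)\<^sup>2)) = complex_of_real (- (1/2) * (1 - 1 / (wt N k)\<^sup>2))" by (simp only:)
      then show ?thesis by (simp only: of_real_mult of_real_minus of_real_divide of_real_1 of_real_numeral)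
    qed
    have eq: "h0 k = - (1/2) * (\<i> * (of_real (1 - 1 / (wt N k)\<^sup>2) * cis (- t * omega N k)))" for k
      unfolding h0_def
    proof -
      have "\<i> * of_real (- omega N k) * cis (t * - omega N k) * of_real (1 / (wt N k)\<^sup>2)
        = (\<i> * cis (- t * omega N k)) * (of_real (- omega N k) * of_real (1 / (wt N k)\<^sup>2))"
        by (simp only: mult_ac mult_minus_left mult_minus_right)
      also have "\<dots> = - (1/2) * (\<i> * (of_real (1 - 1 / (wt N k)\<^sup>2) * cis (- t * omega N k)))"
        unfolding key by (simp only: mult_ac)
      finally show "\<i> * of_real (- omega N k) * cis (t * - omega N k) * of_real (1 / (wt N k)\<^sup>2)
        = - (1/2) * (\<i> * (of_real (1 - 1 / (wt N k)\<^sup>2) * cis (- t * omega N k)))" .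
    qed
    show ?thesis
      unfolding Ii_def Am_def Uop_def
      by (rule ell2_eqI, unfold cf_simps cf_diag[OF Uop_multiplier_le] cf_diag[OF Am_multiplier_le] cf_diag[OF h0b] cf_diag[OF Ii_multiplier_le])
         (simp only: eq, simp add: scaleR_conv_of_real mult_ac)
  qed
  ultimately show ?thesis by simp
qed

end

context spn
begin

context
  fixes y :: "real \<Rightarrow> (real^3^'n) ell2 \<times> (real^3^'n) \<times> (real^3^'n)" and t :: real
  assumes dy: "(y has_vector_derivative Fld t (y t)) (at t)"
begin

abbreviation "ph z \<equiv> fst (y z)"
abbreviation "qq z \<equiv> fst (snd (y z))"
abbreviation "pp z \<equiv> snd (snd (y z))"
abbreviation "uu z \<equiv> Uop z (ph z)"
abbreviation "rh z \<equiv> rr (uu z) (qq z)"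
abbreviation "Bv \<equiv> Bop N (rh t) (uu t)"
abbreviation "ph' \<equiv> (e * c3) *\<^sub>R Ii (Uop (- t) Bv)"
abbreviation "qq' \<equiv> (1 / M) *\<^sub>R pp t"
abbreviation "pp' \<equiv> \<chi> n. - frc (rh t) (qq t) n"

lemma derivs:
  "(ph has_vector_derivative ph') (at t)" "(qq has_vector_derivative qq') (at t)" "(pp has_vector_derivative pp') (at t)"
  using bounded_linear.has_vector_derivative[OF bounded_linear_fst dy]
    bounded_linear.has_vector_derivative[OF bounded_linear_compose[OF bounded_linear_fst bounded_linear_snd] dy]
    bounded_linear.has_vector_derivative[OF bounded_linear_compose[OF bounded_linear_snd bounded_linear_snd] dy]
  unfolding Fld_def by simp_all

lemma charge_derivative: "((\<lambda>z. Qf (ph z)) has_vector_derivative 0) (at t)"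
proof -
  have F1: "((\<lambda>z. inner (Wm (ph z)) (ph z)) has_vector_derivative inner (Wm (ph t)) ph' + inner (Wm ph') (ph t)) (at t)"
    by (rule bounded_bilinear.has_vector_derivative[OF bounded_bilinear_inner
          bounded_linear.has_vector_derivative[OF bounded_linear_ops(1) derivs(1)] derivs(1)])
  have F2: "inner (Wm ph') (ph t) = inner (Wm (ph t)) ph'"
    unfolding Wm_def by (subst inner_diag[OF Wm_multiplier_le]) (simp add: inner_commute)
  have F3: "inner (Wm (ph t)) ph' = 0"
    using inner_Uop_Ii[where f="\<lambda>k. 1 / (wt N k)\<^sup>2" and C=1, OF Wm_multiplier_le, of "ph t" t Bv] inner_Wm_Ii_Bop[OF herm_rr[of "uu t" "qq t"], of "uu t"]
    by (simp add: Wm_def)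
  show ?thesis using F1 unfolding F2 F3 Qf_def by (simp only: add_0)
qed

text \<open>\<open>Am\<close> commutes with the free evolution, so the kinetic energy may be
  computed on the curve of the interaction picture, which is differentiable.\<close>

lemma kinetic_derivative:
  "((\<lambda>z. 1/2 * inner (Am (ph z)) (ph z)) has_vector_derivative e * c3 * inner (Am (uu t)) (Ii Bv)) (at t)"
proof -
  have F1: "((\<lambda>z. inner (Am (ph z)) (ph z)) has_vector_derivative inner (Am (ph t)) ph' + inner (Am ph') (ph t)) (at t)"
    by (rule bounded_bilinear.has_vector_derivative[OF bounded_bilinear_inner
          bounded_linear.has_vector_derivative[OF bounded_linear_ops(2) derivs(1)] derivs(1)])
  have F2: "inner (Am ph') (ph t) = inner (Am (ph t)) ph'"
    unfolding Am_def by (subst inner_diag[OF Am_multiplier_le]) (simp add: inner_commute)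
  have F3: "inner (Am (ph t)) ph' = e * c3 * inner (Am (uu t)) (Ii Bv)"
    using inner_Uop_Ii[where f="\<lambda>k. 1 - 1 / (wt N k)\<^sup>2" and C=1, OF Am_multiplier_le, of "ph t" t Bv] by (simp add: Am_def)
  have "((\<lambda>z. inner (Am (ph z)) (ph z)) has_vector_derivative 2 * (e * c3 * inner (Am (uu t)) (Ii Bv))) (at t)"
    using F1 unfolding F2 F3 by (simp only: mult_2)
  from has_vector_derivative_mult_right[OF this, of "1/2"] show ?thesis by simp
qed

lemma potential_derivative:
  "((\<lambda>z. c3/2 * inner (Gm (rh z)) (rh z)) has_vector_derivative
     (\<Sum>n\<in>UNIV. inner (qq' $ n) (frc (rh t) (qq t) n)) - e * c3 * inner (Am (uu t)) (Ii Bv)) (at t)"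
proof -
  have cph: "(ph \<longlongrightarrow> ph t) (at t)" and cqq: "(qq \<longlongrightarrow> qq t) (at t)"
    using has_vector_derivative_continuous[OF derivs(1)] has_vector_derivative_continuous[OF derivs(2)]
    by (auto simp: continuous_within)
  have cu: "(uu \<longlongrightarrow> uu t) (at t)"
    unfolding Uop_def by (rule diag_tendsto[OF _ Uop_multiplier_le Uop_multiplier_le cph]) (intro tendsto_intros)
  have cS: "((\<lambda>z. Sq (qq z)) \<longlongrightarrow> Sq (qq t)) (at t)"
    unfolding Sq_def by (intro tendsto_sum Eph_tendsto tendsto_vec_nth cqq)
  have cr: "(rh \<longlongrightarrow> rh t) (at t)"
    unfolding rr_def by (intro tendsto_diff cS tendsto_scaleR tendsto_const bounded_bilinear.tendsto[OF bounded_bilinear_Dop[OF N]] cu)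
  define S' where "S' = (\<Sum>n\<in>UNIV. dE (qq t $ n) (qq' $ n) (s n))"
  have "((\<lambda>z. Sq (qq z)) has_vector_derivative S') (at t)"
    unfolding Sq_def S'_def
  proof (rule has_vector_derivative_sum)
    fix n :: 'n
    have "((\<lambda>z. qq z $ n) has_derivative (\<lambda>h. h *\<^sub>R (qq' $ n))) (at t)"
      using bounded_linear.has_vector_derivative[OF bounded_linear_vec_nth derivs(2), of n]
      unfolding has_vector_derivative_def by simp
    from has_derivative_compose[OF this Eph_has_derivative[of "s n"]]
    have "((\<lambda>z. Eph (qq z $ n) (s n)) has_derivative (\<lambda>h. dE (qq t $ n) (h *\<^sub>R (qq' $ n)) (s n))) (at t)" .
    moreover have "dE (qq t $ n) (h *\<^sub>R (qq' $ n)) (s n) = h *\<^sub>R dE (qq t $ n) (qq' $ n) (s n)" for h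
      by (rule linear_scale[OF has_derivative_linear[OF Eph_has_derivative]])
    ultimately show "((\<lambda>z. Eph (qq z $ n) (s n)) has_vector_derivative dE (qq t $ n) (qq' $ n) (s n)) (at t)"
      unfolding has_vector_derivative_def by (simp only:)
  qed
  note qS = vector_derivative_quotient[OF this]
  define z' where "z' = Wm (Uop t ph') - (1/2) *\<^sub>R Ii (Am (uu t))"
  have qU: "((\<lambda>z. (Wm (uu z) - Wm (uu t)) /\<^sub>R (z - t)) \<longlongrightarrow> z') (at t)"
    unfolding z'_def by (rule Wm_U_quotient[OF derivs(1)])
  interpret D: bounded_bilinear "Dop N :: (real^3^'n) ell2 \<Rightarrow> _" by (rule bounded_bilinear_Dop[OF N])
  interpret B: bounded_bilinear "Bop N :: _ \<Rightarrow> (real^3^'n) ell2 \<Rightarrow> _" by (rule bounded_bilinear_Bop[OF N])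
  \<comment> \<open>A quadratic form increases by the pairing of the sum with the difference. The
    electron charge is itself quadratic, and \<open>herm_inner_swap\<close> brings both terms of its
    increment to the form with the difference in the first slot, where the adjointness puts
    \<open>Wm\<close> on it.\<close>
  have diff: "inner (Gm (rh z)) (rh z) - inner (Gm (rh t)) (rh t)
    = inner (Gm (rh z + rh t)) (Sq (qq z) - Sq (qq t)) - e * inner (Bop N (rh z + rh t) (uu z + uu t)) (Wm (uu z) - Wm (uu t))" for z
  proof -
    define x where "x = rh z + rh t"
    have hx: "herm x" unfolding x_def by (intro herm_add herm_rr)
    have "inner (Gm (rh z)) (rh z) - inner (Gm (rh t)) (rh t) = inner (Gm x) (rh z - rh t)"
      using inner_Gm[of "rh t" "rh z"]
      by (simp add: x_def linear_add[OF bounded_linear.linear[OF bounded_linear_ops(3)]] inner_add_left inner_diff_right inner_diff_left inner_add_right inner_commute)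
    also have "\<dots> = inner (Gm x) (Sq (qq z) - Sq (qq t)) - e * inner (Gm x) (Dop N (uu z) (uu z) - Dop N (uu t) (uu t))"
      by (simp add: rr_def inner_diff_right inner_scaleR_right algebra_simps)
    also have "Dop N (uu z) (uu z) - Dop N (uu t) (uu t) = Dop N (uu z - uu t) (uu t) + Dop N (uu z) (uu z - uu t)"
      by (simp add: D.diff_left D.diff_right)
    also have "inner (Gm x) \<dots> = inner (Dop N (uu z - uu t) (uu t)) (Gm x) + inner (Dop N (uu z - uu t) (uu z)) (Gm x)"
      using herm_inner_swap[OF N hx, of "gam N" "gamC N" "uu z" "uu z - uu t"] Gm_multiplier_le
      by (simp add: inner_add_right inner_commute Gm_def)
    also have "\<dots> = inner (Bop N x (uu t)) (Wm (uu z - uu t)) + inner (Bop N x (uu z)) (Wm (uu z - uu t))"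
      unfolding Wm_def Gm_def by (simp only: Dop_Bop_adjoint[OF N])
    also have "\<dots> = inner (Bop N x (uu z + uu t)) (Wm (uu z) - Wm (uu t))"
      by (simp add: B.add_right inner_add_left linear_diff[OF bounded_linear.linear[OF bounded_linear_ops(1)]] add.commute)
    finally show ?thesis by (simp add: x_def)
  qed
  have "((\<lambda>z. inner (Gm (rh z + rh t)) ((Sq (qq z) - Sq (qq t)) /\<^sub>R (z - t)) - e * inner (Bop N (rh z + rh t) (uu z + uu t)) ((Wm (uu z) - Wm (uu t)) /\<^sub>R (z - t)))
    \<longlongrightarrow> inner (Gm (rh t + rh t)) S' - e * inner (Bop N (rh t + rh t) (uu t + uu t)) z') (at t)"
    by (intro tendsto_diff tendsto_mult tendsto_const tendsto_inner bounded_linear.tendsto[OF bounded_linear_ops(3)] B.tendsto tendsto_add cr cu qS qU)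
  moreover have "inner (Gm (rh z + rh t)) ((Sq (qq z) - Sq (qq t)) /\<^sub>R (z - t)) - e * inner (Bop N (rh z + rh t) (uu z + uu t)) ((Wm (uu z) - Wm (uu t)) /\<^sub>R (z - t))
    = (inner (Gm (rh z)) (rh z) - inner (Gm (rh t)) (rh t)) / (z - t)" for z
    unfolding diff inner_scaleR_right by (simp add: divide_inverse algebra_simps)
  ultimately have "((\<lambda>z. (inner (Gm (rh z)) (rh z) - inner (Gm (rh t)) (rh t)) / (z - t)) \<longlongrightarrow> inner (Gm (rh t + rh t)) S' - e * inner (Bop N (rh t + rh t) (uu t + uu t)) z') (at t)"
    by simp
  then have d: "((\<lambda>z. inner (Gm (rh z)) (rh z)) has_real_derivative (inner (Gm (rh t + rh t)) S' - e * inner (Bop N (rh t + rh t) (uu t + uu t)) z')) (at t)"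
    by (simp add: has_field_derivative_iff)
  have v1: "c3 * inner (Gm (rh t)) S' = (\<Sum>n\<in>UNIV. inner (qq' $ n) (frc (rh t) (qq t) n))"
    unfolding S'_def inner_sum_right inner_Gm_dE sum_distrib_left frc_def by (simp add: mult_ac)
  \<comment> \<open>The contribution of the field to the derivative drops out, because a vector is
    orthogonal to \<i> times itself under \<open>Wm\<close>; only the free generator
    remains.\<close>
  have v2: "inner Bv z' = 1/2 * inner (Am (uu t)) (Ii Bv)"
  proof -
    have "Uop t ph' = (e * c3) *\<^sub>R Ii Bv"
    proof -
      have "Uop t (Ii x) = Ii (Uop t x)" for x
        unfolding Uop_def Ii_def by (rule ell2_eqI, unfold cf_diag[OF Uop_multiplier_le] cf_diag[OF Ii_multiplier_le], simp)
      then show ?thesis by (simp add: linear_scale[OF bounded_linear.linear[OF bounded_linear_ops(5)]] Uop_inverse)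
    qed
    moreover have "inner Bv (Wm (Ii Bv)) = 0" unfolding Wm_def Ii_def by (rule inner_diag_imaginary_self) (rule Wm_multiplier_le)
    ultimately have "inner Bv z' = - (1/2 * inner Bv (Ii (Am (uu t))))"
      by (simp add: z'_def inner_diff_right linear_scale[OF bounded_linear.linear[OF bounded_linear_ops(1)]])
    then show ?thesis using inner_Ii_antisym[of "Am (uu t)" Bv] by (simp add: inner_commute)
  qed
  have "inner (Gm (rh t + rh t)) S' = 2 * inner (Gm (rh t)) S'"
    by (simp add: linear_add[OF bounded_linear.linear[OF bounded_linear_ops(3)]] inner_add_left)
  moreover have "inner (Bop N (rh t + rh t) (uu t + uu t)) z' = 4 * inner Bv z'"
    by (simp add: B.add_left B.add_right inner_add_left)
  ultimately have "((\<lambda>z. inner (Gm (rh z)) (rh z)) has_real_derivative (2 * inner (Gm (rh t)) S' - e * (2 * inner (Am (uu t)) (Ii Bv)))) (at t)"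
    using d v2 by simp
  from DERIV_cmult[OF this, of "c3/2"]
  have "((\<lambda>z. c3/2 * inner (Gm (rh z)) (rh z)) has_real_derivative (c3 * inner (Gm (rh t)) S' - e * c3 * inner (Am (uu t)) (Ii Bv))) (at t)"
    by (rule DERIV_cong) (simp add: algebra_simps)
  then show ?thesis unfolding v1 by (simp only: has_real_derivative_iff_has_vector_derivative)
qed

text \<open>The work of the field on the electrons cancels between their kinetic and the potential
  energy, the work on the ions between the potential and the ionic kinetic energy.\<close>

lemma energy_derivative: "((\<lambda>z. Ef (uu z) (qq z) (pp z)) has_vector_derivative 0) (at t)"
proof -
  have "((\<lambda>z. inner (pp z) (pp z)) has_vector_derivative inner (pp t) pp' + inner pp' (pp t)) (at t)"
    by (rule bounded_bilinear.has_vector_derivative[OF bounded_bilinear_inner derivs(3) derivs(3)])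
  from has_vector_derivative_mult_right[OF this, of "1 / (2 * M)"]
  have p: "((\<lambda>z. inner (pp z) (pp z) / (2 * M)) has_vector_derivative inner (pp t) pp' / M) (at t)"
    using M by (simp add: inner_commute field_simps)
  have v: "inner (pp t) pp' / M = - (\<Sum>n\<in>UNIV. inner (qq' $ n) (frc (rh t) (qq t) n))"
    by (simp add: inner_vec_def sum_negf sum_divide_distrib)
  from has_vector_derivative_add[OF has_vector_derivative_add[OF kinetic_derivative potential_derivative] p]
  show ?thesis unfolding Ef_def Am_Uop v by simp
qed

end

text \<open>Stated on a segment, because the a priori bound has to be derived for curves that
  satisfy the equation only up to \<open>\<tau>\<close>.\<close>

lemma conserved:
  assumes "\<And>z. z \<in> closed_segment 0 \<tau> \<Longrightarrow> (y has_vector_derivative Fld z (y z)) (at z)"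
  shows "Qf (fst (y \<tau>)) = Qf (fst (y 0))"
    "Ef (Uop \<tau> (fst (y \<tau>))) (fst (snd (y \<tau>))) (snd (snd (y \<tau>))) = Ef (Uop 0 (fst (y 0))) (fst (snd (y 0))) (snd (snd (y 0)))"
proof -
  have const: "f \<tau> = f 0" if "\<And>z. z \<in> closed_segment 0 \<tau> \<Longrightarrow> (f has_vector_derivative 0) (at z)" for f :: "real \<Rightarrow> real"
  proof -
    have "\<exists>c. \<forall>x\<in>closed_segment 0 \<tau>. f x = c"
      by (rule has_derivative_zero_constant)
         (use that in \<open>auto simp: has_vector_derivative_def intro: has_derivative_at_withinI\<close>)
    then show ?thesis by (metis ends_in_segment)
  qed
  show "Qf (fst (y \<tau>)) = Qf (fst (y 0))" by (rule const) (rule charge_derivative[OF assms])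
  show "Ef (Uop \<tau> (fst (y \<tau>))) (fst (snd (y \<tau>))) (snd (snd (y \<tau>))) = Ef (Uop 0 (fst (y 0))) (fst (snd (y 0))) (snd (snd (y 0)))"
    by (rule const[of "\<lambda>z. Ef (Uop z (fst (y z))) (fst (snd (y z))) (snd (snd (y z)))"]) (rule energy_derivative[OF assms])
qed

text \<open>\<open>Am + Wm\<close> is the identity, so twice the energy plus the charge dominates
  the squared norm of the wave function; the momentum is bounded by the ionic term alone. Only
  conserved quantities appear on the right.\<close>

lemma nu_le_energy:
  "nu y \<le> sqrt (2 * Ef (Uop t (fst y)) (fst (snd y)) (snd (snd y)) + Qf (fst y)) + sqrt (2 * M * Ef (Uop t (fst y)) (fst (snd y)) (snd (snd y)))"
proof -
  let ?E = "Ef (Uop t (fst y)) (fst (snd y)) (snd (snd y))"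
  have dec: "(norm u)\<^sup>2 = inner (Am u) u + Qf u" for u :: "(real^3^'n) ell2"
  proof -
    have "Am u + Wm u = u"
      unfolding Am_def Wm_def by (rule ell2_eqI, unfold cf_simps cf_diag[OF Am_multiplier_le] cf_diag[OF Wm_multiplier_le]) (simp add: algebra_simps)
    then show ?thesis by (metis Qf_def inner_add_left power2_norm_eq_inner)
  qed
  have A0: "inner (Am u) u \<ge> 0" for u :: "(real^3^'n) ell2"
  proof -
    have "Re (of_real a * z * cnj z) = a * (cmod z)\<^sup>2" for a z
      by (simp only: mult.assoc complex_norm_square[symmetric]) simp
    moreover have "1 / (wt N k)\<^sup>2 \<le> 1" for k :: "real^3^'n" using power_mono[OF wt_ge1[of N k], of 2] by (auto simp: divide_le_eq_1)
    ultimately show ?thesis unfolding inner_ell2_def Am_def cf_diag[OF Am_multiplier_le] by (auto intro!: infsum_nonneg)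
  qed
  have c: "c3 \<ge> 0" by (simp add: c3_def)
  have G0: "c3 / 2 * inner (Gm (rr (Uop t (fst y)) (fst (snd y)))) (rr (Uop t (fst y)) (fst (snd y))) \<ge> 0"
    by (intro mult_nonneg_nonneg Gm_nonneg) (use c in auto)
  have p0: "inner (snd (snd y)) (snd (snd y)) / (2 * M) \<ge> 0" using M by simp
  define a where "a = inner (Am (fst y)) (fst y)"
  define g where "g = c3 / 2 * inner (Gm (rr (Uop t (fst y)) (fst (snd y)))) (rr (Uop t (fst y)) (fst (snd y)))"
  define d where "d = inner (snd (snd y)) (snd (snd y)) / (2 * M)"
  have E: "?E = 1/2 * a + g + d" unfolding Ef_def Am_Uop a_def g_def d_def ..
  have "(norm (fst y))\<^sup>2 \<le> 2 * ?E + Qf (fst y)"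
  proof -
    have "2 * ?E = a + 2 * g + 2 * d" unfolding E by simp
    moreover have "g \<ge> 0" "d \<ge> 0" using G0 p0 by (simp_all only: g_def d_def)
    ultimately show ?thesis unfolding dec[of "fst y"] a_def[symmetric] by simp
  qed
  then have 1: "norm (fst y) \<le> sqrt (2 * ?E + Qf (fst y))" by (rule real_le_rsqrt)
  have "a \<ge> 0" "g \<ge> 0" using A0[of "fst y"] G0 by (simp_all only: a_def g_def)
  then have "d \<le> ?E" unfolding E by simp
  then have "inner (snd (snd y)) (snd (snd y)) / (2 * M) \<le> ?E" by (simp only: d_def)
  then have "(norm (snd (snd y)))\<^sup>2 \<le> 2 * M * ?E" using M by (simp add: power2_norm_eq_inner divide_le_eq mult.commute)
  then have "norm (snd (snd y)) \<le> sqrt (2 * M * ?E)" by (rule real_le_rsqrt)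
  with 1 show ?thesis unfolding nu_def by linarith
qed

lemma dyn_exists: "\<exists>y. y 0 = y0 \<and> (\<forall>t. (y has_vector_derivative Fld t (y t)) (at t))"
proof (rule ode_global_apriori[where nu=nu and C=2])
  show "continuous_on UNIV (\<lambda>s. Fld s (y s))" if "continuous_on UNIV y" for y by (rule adm_cont[OF adm_Fld that])
  show "\<exists>L. \<forall>t x y. nu x \<le> R \<longrightarrow> nu y \<le> R \<longrightarrow> norm (Fld t x - Fld t y) \<le> L * norm (x - y) \<and> norm (Fld t x) \<le> L" for R
    using adm_Fld unfolding adm_def by blast
  show "\<bar>nu x - nu y\<bar> \<le> 2 * norm (x - y)" for x y by (rule nu_lip)
  fix y \<tau> assume y: "y 0 = y0" "\<And>s. s \<in> closed_segment 0 \<tau> \<Longrightarrow> (y has_vector_derivative Fld s (y s)) (at s)"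
  show "nu (y \<tau>) \<le> sqrt (2 * Ef (Uop 0 (fst y0)) (fst (snd y0)) (snd (snd y0)) + Qf (fst y0)) + sqrt (2 * M * Ef (Uop 0 (fst y0)) (fst (snd y0)) (snd (snd y0)))"
    using nu_le_energy[of "y \<tau>" \<tau>] conserved[OF y(2)] y(1) by simp
qed

lemma dyn_unique:
  assumes "\<And>t. (y has_vector_derivative Fld t (y t)) (at t)" "\<And>t. (z has_vector_derivative Fld t (z t)) (at t)" "y 0 = z 0"
  shows "y t = z t"
proof (rule ode_unique[where nu=nu and F=Fld])
  show "\<exists>L. \<forall>t x y. nu x \<le> R \<longrightarrow> nu y \<le> R \<longrightarrow> norm (Fld t x - Fld t y) \<le> L * norm (x - y)" for R
    using adm_Fld unfolding adm_def by meson
  show "continuous_on UNIV nu" unfolding nu_def[abs_def] by (intro continuous_intros)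
qed (use assms in auto)

end

section \<open>Antisymmetry\<close>

definition prm :: "('n \<Rightarrow> 'n) \<Rightarrow> 'b^'n::finite \<Rightarrow> 'b^'n" where
  "prm \<pi> x = (\<chi> j. x $ \<pi> j)"

lemma prm_add: "prm \<pi> (x + y) = prm \<pi> x + prm \<pi> y" and prm_diff: "prm \<pi> (a - b) = prm \<pi> a - prm \<pi> b"
  for x y :: "'b::ab_group_add^'n::finite"
  by (simp_all add: prm_def vec_eq_iff)

lemma prm_axis: "\<pi> permutes UNIV \<Longrightarrow> prm \<pi> (axis j m) = axis (inv \<pi> j) m"
  by (auto simp: prm_def vec_eq_iff axis_def permutes_inverses permutes_inv_eq)

lemma inner_prm: "\<pi> permutes UNIV \<Longrightarrow> inner (prm \<pi> x) (prm \<pi> y) = inner x y" for x y :: "'b::real_inner^'n::finite"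
  using sum.permute[of \<pi> UNIV "\<lambda>j. inner (x $ j) (y $ j)"] by (simp add: prm_def inner_vec_def o_def)

lemma norm_prm: "\<pi> permutes UNIV \<Longrightarrow> norm (prm \<pi> x) = norm x" for x :: "'b::real_inner^'n::finite"
  by (simp add: norm_eq_sqrt_inner inner_prm)

lemma prm_inv: "\<pi> permutes UNIV \<Longrightarrow> prm \<pi> (prm (inv \<pi>) x) = x" "\<pi> permutes UNIV \<Longrightarrow> prm (inv \<pi>) (prm \<pi> x) = x"
  by (auto simp: prm_def vec_eq_iff permutes_inverses)

lemma latt_iff_nth: "k \<in> latt \<longleftrightarrow> (\<forall>j. k $ j \<in> latt)" for k :: "real^3^'n::finite"
proof
  assume k: "\<forall>j. k $ j \<in> latt"
  have "k \<bullet> b \<in> \<int>" if b: "b \<in> Basis" for b :: "real^3^'n"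
  proof -
    obtain i c where "b = axis i c" "c \<in> Basis" using b unfolding Basis_vec_def by blast
    then show ?thesis using k by (auto simp: inner_axis latt_def)
  qed
  then show "k \<in> latt" by (simp add: latt_def)
qed (auto intro: latt_nth)

lemma latt_prm: "\<pi> permutes UNIV \<Longrightarrow> prm \<pi> k \<in> latt \<longleftrightarrow> k \<in> latt" for k :: "real^3^'n::finite"
  unfolding latt_iff_nth prm_def by (metis permutes_inverses(1) vec_lambda_beta)

lemma bij_prm: assumes "\<pi> permutes UNIV" shows "bij_betw (prm \<pi>) latt (latt :: (real^3^'n::finite) set)"
  by (rule bij_betwI[where g="prm (inv \<pi>)"]) (auto simp: latt_prm assms permutes_inv prm_inv)

lemma wt_prm: "\<pi> permutes UNIV \<Longrightarrow> wt N (prm \<pi> k) = wt N k" for k :: "real^3^'n::finite"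
  by (simp add: wt_def norm_prm)

lemma omega_prm: "\<pi> permutes UNIV \<Longrightarrow> omega N (prm \<pi> k) = omega N k" for k :: "real^3^'n::finite"
  by (simp add: omega_def norm_prm)

text \<open>The sign is built in, so that antisymmetric wave functions are the common fixed points
  of all \<open>Pop \<pi>\<close> and antisymmetry becomes an invariance.\<close>

definition Pop :: "('n \<Rightarrow> 'n) \<Rightarrow> (real^3^'n::finite) ell2 \<Rightarrow> (real^3^'n) ell2" where
  "Pop \<pi> u = Ell2 (\<lambda>k. of_int (sign \<pi>) * cf u (prm \<pi> k))"

context
  fixes \<pi> :: "'n::finite \<Rightarrow> 'n"
  assumes p: "\<pi> permutes UNIV"
begin

lemma inj_prm: "inj_on (prm \<pi> :: real^3^'n \<Rightarrow> _) A"
  by (rule inj_on_inverseI[of _ "prm (inv \<pi>)"]) (simp add: prm_inv p)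

lemma cmod_sign: "cmod (of_int (sign \<pi>) * z) = cmod z"
  by (simp add: sign_def)

lemma cf_Pop: "cf (Pop \<pi> u) k = of_int (sign \<pi>) * cf u (prm \<pi> k)"
proof -
  have "sq_summable (\<lambda>k. of_int (sign \<pi>) * cf u (prm \<pi> k))"
    by (rule sq_summableI[where C="(norm u)\<^sup>2"]) (simp add: cmod_sign sum_le_norm_ell2_inj inj_prm)
  then show ?thesis by (simp add: Pop_def cf_Ell2)
qed

lemma bounded_linear_Pop: "bounded_linear (Pop \<pi>)"
proof (rule bounded_linear_intro[where K=1])
  show "norm (Pop \<pi> u) \<le> norm u * 1" for u
    by (rule norm_ell2_le) (simp_all add: cf_Pop cmod_sign sum_le_norm_ell2_inj inj_prm)
qed (auto intro!: ell2_eqI simp: cf_Pop algebra_simps)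

lemma sign_sq: "complex_of_int (sign \<pi>) * cnj (of_int (sign \<pi>)) = 1"
  by (simp add: sign_def)

text \<open>The sign cancels against its conjugate, and permuting the coordinates merely permutes
  the summands belonging to the particles.\<close>

lemma Dop_Pop: assumes N: "N \<ge> 1" shows "Dop N (Pop \<pi> u) (Pop \<pi> v) = Dop N u v"
proof (rule ell2_eqI)
  fix m
  show "cf (Dop N (Pop \<pi> u) (Pop \<pi> v)) m = cf (Dop N u v) m"
  proof (cases "m \<in> latt")
    case True
    let ?f = "\<lambda>j b. (cf u (b + axis j m) / wt N (b + axis j m)) * cnj (cf v b / wt N b)"
    have "(cf (Pop \<pi> u) (b + axis j m) / wt N (b + axis j m)) * cnj (cf (Pop \<pi> v) b / wt N b) = ?f (inv \<pi> j) (prm \<pi> b)" for j b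
    proof -
      have "wt N (b + axis j m) = wt N (prm \<pi> b + axis (inv \<pi> j) m)"
        by (metis p prm_add prm_axis wt_prm)
      moreover have "wt N b = wt N (prm \<pi> b)" by (simp add: wt_prm p)
      ultimately have "(cf (Pop \<pi> u) (b + axis j m) / wt N (b + axis j m)) * cnj (cf (Pop \<pi> v) b / wt N b)
        = (of_int (sign \<pi>) * cnj (of_int (sign \<pi>))) * ?f (inv \<pi> j) (prm \<pi> b)"
        by (simp add: cf_Pop prm_add prm_axis p)
      then show ?thesis unfolding sign_sq by simp
    qed
    then have "cf (Dop N (Pop \<pi> u) (Pop \<pi> v)) m = (\<Sum>j\<in>UNIV. \<Sum>\<^sub>\<infinity>b\<in>latt. ?f (inv \<pi> j) (prm \<pi> b))"
      unfolding cf_Dop[OF N True] by (simp only:)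
    also have "\<dots> = (\<Sum>j\<in>UNIV. \<Sum>\<^sub>\<infinity>b\<in>latt. ?f (inv \<pi> j) b)"
      by (intro sum.cong refl infsum_reindex_bij_betw[OF bij_prm[OF p]])
    also have "\<dots> = (\<Sum>j\<in>UNIV. \<Sum>\<^sub>\<infinity>b\<in>latt. ?f j b)"
      using sum.permute[OF permutes_inv[OF p], of "\<lambda>j. \<Sum>\<^sub>\<infinity>b\<in>latt. ?f j b"] by (simp add: o_def)
    also have "\<dots> = cf (Dop N u v) m" by (rule cf_Dop[OF N True, symmetric])
    finally show ?thesis .
  qed (simp add: cf_Dop_outside[OF N])
qed

text \<open>The potential acts on all particles alike, so the sum over \<open>j\<close> absorbs the
  permutation, and the sign factors out.\<close>

lemma Bop_Pop: assumes N: "N \<ge> 1" shows "Bop N h (Pop \<pi> v) = Pop \<pi> (Bop N h v)"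
proof (rule ell2_eqI)
  fix a :: "real^3^'n"
  show "cf (Bop N h (Pop \<pi> v)) a = cf (Pop \<pi> (Bop N h v)) a"
  proof (cases "a \<in> latt")
    case True
    then have a': "prm \<pi> a \<in> latt" by (simp add: latt_prm p)
    let ?g = "\<lambda>j m. of_real (wt N (prm \<pi> a)) * (of_real (gam N m) * cf h m * (cf v (prm \<pi> a - axis j m) / wt N (prm \<pi> a - axis j m)))"
    have "of_real (wt N a) * (of_real (gam N m) * cf h m * (cf (Pop \<pi> v) (a - axis j m) / wt N (a - axis j m))) = of_int (sign \<pi>) * ?g (inv \<pi> j) m" for j m
    proof -
      have "wt N (a - axis j m) = wt N (prm \<pi> a - axis (inv \<pi> j) m)"
        by (metis p prm_diff prm_axis wt_prm)
      then show ?thesis by (simp add: cf_Pop prm_diff prm_axis p wt_prm mult_ac)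
    qed
    then have "cf (Bop N h (Pop \<pi> v)) a = (\<Sum>j\<in>UNIV. \<Sum>\<^sub>\<infinity>m\<in>latt. of_int (sign \<pi>) * ?g (inv \<pi> j) m)"
      unfolding cf_Bop[OF N True] by (simp only:)
    also have "\<dots> = of_int (sign \<pi>) * (\<Sum>j\<in>UNIV. \<Sum>\<^sub>\<infinity>m\<in>latt. ?g (inv \<pi> j) m)"
      by (simp only: infsum_cmult_right' sum_distrib_left)
    also have "(\<Sum>j\<in>UNIV. \<Sum>\<^sub>\<infinity>m\<in>latt. ?g (inv \<pi> j) m) = (\<Sum>j\<in>UNIV. \<Sum>\<^sub>\<infinity>m\<in>latt. ?g j m)"
      using sum.permute[OF permutes_inv[OF p], of "\<lambda>j. \<Sum>\<^sub>\<infinity>m\<in>latt. ?g j m"] by (simp add: o_def)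
    also have "\<dots> = cf (Bop N h v) (prm \<pi> a)" by (rule cf_Bop[OF N a', symmetric])
    finally show ?thesis by (simp add: cf_Pop)
  next
    case False
    then show ?thesis by (simp add: cf_Pop cf_Bop_outside[OF N] latt_prm p)
  qed
qed

end

context spn
begin

lemma Uop_Pop: assumes p: "\<pi> permutes UNIV" shows "Uop t (Pop \<pi> u) = Pop \<pi> (Uop t u)"
  by (rule ell2_eqI, unfold Uop_def cf_diag[OF Uop_multiplier_le] cf_Pop[OF p], simp add: omega_prm p)

lemma Ii_Pop: assumes p: "\<pi> permutes UNIV" shows "Ii (Pop \<pi> u) = Pop \<pi> (Ii u)"
  by (rule ell2_eqI, unfold Ii_def cf_diag[OF Ii_multiplier_le] cf_Pop[OF p], simp)

lemma Fld_Pop: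
  assumes p: "\<pi> permutes UNIV"
  shows "Fld t (Pop \<pi> (fst y), snd y) = (Pop \<pi> (fst (Fld t y)), snd (Fld t y))"
  unfolding Fld_def fst_conv snd_conv rr_def
  by (simp add: Uop_Pop[OF p] Dop_Pop[OF p N] Bop_Pop[OF p N] Ii_Pop[OF p] linear_scale[OF bounded_linear.linear[OF bounded_linear_Pop[OF p]]])

lemma solution_Pop:
  assumes p: "\<pi> permutes UNIV" and y: "\<And>t. (y has_vector_derivative Fld t (y t)) (at t)" and y0: "Pop \<pi> (fst (y 0)) = fst (y 0)"
  shows "Pop \<pi> (fst (y t)) = fst (y t)"
proof -
  have "((\<lambda>t. (Pop \<pi> (fst (y t)), snd (y t))) has_vector_derivative Fld t (Pop \<pi> (fst (y t)), snd (y t))) (at t)" for t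
    unfolding Fld_Pop[OF p]
    by (intro has_vector_derivative_Pair bounded_linear.has_vector_derivative[OF bounded_linear_Pop[OF p]]
          bounded_linear.has_vector_derivative[OF bounded_linear_fst] bounded_linear.has_vector_derivative[OF bounded_linear_snd] y)
  from dyn_unique[OF this y, of t] y0 have "(Pop \<pi> (fst (y t)), snd (y t)) = y t" by simp
  then show ?thesis by (metis fst_conv)
qed

end

section \<open>Weak derivatives and Sobolev spaces\<close>

text \<open>Coinduction needs a class closed under directional derivatives, and differentiating only
  changes the linear map \<open>L\<close>. With \<open>L\<close> the identity, the real part or the
  imaginary part, characters and their real components become admissible test functions.\<close>

lemma smooth_linear_cis:
  fixes K :: "'a::euclidean_space"
  assumes "bounded_linear L"
  shows "smooth (\<lambda>x. L (cis (K \<bullet> x)) :: 'b::real_normed_vector)"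
proof -
  have "\<exists>L. bounded_linear L \<and> f = (\<lambda>x. L (cis (K \<bullet> x))) \<Longrightarrow> smooth f" for f :: "'a \<Rightarrow> 'b"
  proof (coinduction arbitrary: f rule: smooth.coinduct)
    case smooth
    then obtain L where L: "bounded_linear L" and f: "f = (\<lambda>x. L (cis (K \<bullet> x)))" by blast
    have "continuous_on UNIV f" unfolding f
      by (intro bounded_linear.continuous_on[OF L] continuous_intros)
    moreover have "\<exists>g. (\<forall>x. ((\<lambda>t. f (x + t *\<^sub>R v)) has_vector_derivative g x) (at 0)) \<and>
        ((\<exists>L. bounded_linear L \<and> g = (\<lambda>x. L (cis (K \<bullet> x)))) \<or> smooth g)" for v
    proof (intro exI conjI allI disjI1)
      define L' where "L' z = L ((K \<bullet> v) *\<^sub>R (\<i> * z))" for z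
      show "bounded_linear L'" unfolding L'_def
        by (rule bounded_linear_compose[OF L bounded_linear_compose[OF bounded_linear_scaleR_right bounded_linear_mult_right]])
      show "(\<lambda>x. L' (cis (K \<bullet> x))) = (\<lambda>x. L' (cis (K \<bullet> x)))" ..
      fix x
      have "((\<lambda>t. cis (K \<bullet> (x + t *\<^sub>R v))) has_derivative (\<lambda>t. (t * (K \<bullet> v)) *\<^sub>R (\<i> * cis (K \<bullet> (x + 0 *\<^sub>R v))))) (at 0)"
        by (rule has_derivative_cis) (auto intro!: derivative_eq_intros simp: inner_simps)
      then have "((\<lambda>t. cis (K \<bullet> (x + t *\<^sub>R v))) has_vector_derivative (K \<bullet> v) *\<^sub>R (\<i> * cis (K \<bullet> x))) (at 0)"
        by (simp add: has_vector_derivative_def)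
      from bounded_linear.has_vector_derivative[OF L this]
      show "((\<lambda>t. f (x + t *\<^sub>R v)) has_vector_derivative L' (cis (K \<bullet> x))) (at 0)"
        by (simp add: f L'_def)
    qed
    ultimately show ?case by simp
  qed
  then show ?thesis using assms by blast
qed

lemma ee_eq_cis: "ee N k x = cis (((2 * pi / real N) *\<^sub>R k) \<bullet> x)"
  by (simp add: ee_def)

lemma cis_dir_derivative:
  "((\<lambda>t. cis (K \<bullet> (x + t *\<^sub>R v))) has_vector_derivative (\<i> * of_real (K \<bullet> v)) * cis (K \<bullet> x)) (at 0)"
proof -
  have "((\<lambda>t. cis (K \<bullet> (x + t *\<^sub>R v))) has_derivative (\<lambda>t. (t * (K \<bullet> v)) *\<^sub>R (\<i> * cis (K \<bullet> (x + 0 *\<^sub>R v))))) (at 0)"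
    by (rule has_derivative_cis) (auto intro!: derivative_eq_intros simp: inner_simps)
  then show ?thesis unfolding has_vector_derivative_def by (simp add: scaleR_conv_of_real mult_ac)
qed

lemma ee_dir_derivative:
  "((\<lambda>t. ee N k (x + t *\<^sub>R v)) has_vector_derivative (\<i> * of_real ((2 * pi / real N) * (k \<bullet> v))) * ee N k x) (at 0)"
  unfolding ee_eq_cis inner_scaleR_left[symmetric, of "2 * pi / real N" k v] by (rule cis_dir_derivative)

lemma weak_derivD:
  assumes "weak_deriv N f v g" "smooth \<phi>" "per N \<phi>" "\<And>x. ((\<lambda>t. \<phi> (x + t *\<^sub>R v)) has_vector_derivative \<phi>' x) (at 0)"
  shows "(LINT x|tor N. f x * \<phi>' x) = - (LINT x|tor N. g x * \<phi> x)"
  using assms by (simp add: weak_deriv_def set_integral_tor)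

lemma smooth_derivative_continuous:
  assumes "smooth f" "\<And>x. ((\<lambda>t. f (x + t *\<^sub>R v)) has_vector_derivative f' x) (at 0)"
  shows "continuous_on UNIV f" "continuous_on UNIV f'"
proof -
  obtain g where c: "continuous_on UNIV f" and g: "\<And>x. ((\<lambda>t. f (x + t *\<^sub>R v)) has_vector_derivative g x) (at 0)" "smooth g"
    using assms(1) by (cases rule: smooth.cases) metis
  have "f' = g" using vector_derivative_unique_at[OF assms(2) g(1)] by blast
  moreover have "continuous_on UNIV g" using g(2) by (cases rule: smooth.cases) auto
  ultimately show "continuous_on UNIV f" "continuous_on UNIV f'" using c by auto
qed

text \<open>The Leibniz rule used next concerns the gauge integral.\<close>

lemma integral_tor_eq_HK:
  fixes f :: "'a::euclidean_space \<Rightarrow> complex"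
  assumes "continuous_on UNIV f" shows "(LINT x|tor N. f x) = integral (Tb N) f"
  using set_borel_integral_eq_integral(2)[of "Tb N" f] integrable_tor_continuous[OF assms, of N]
  by (simp add: set_integral_tor set_integrable_tor)

text \<open>The integral of a translate does not depend on the translation; differentiating this
  under the integral sign at 0 gives the claim.\<close>

lemma integral_dir_derivative_zero:
  fixes g :: "'a::euclidean_space \<Rightarrow> complex"
  assumes N: "N \<ge> 1" and g: "continuous_on UNIV g" "per N g" and g': "continuous_on UNIV g'"
    and d: "\<And>x. ((\<lambda>t. g (x + t *\<^sub>R v)) has_vector_derivative g' x) (at 0)"
  shows "(LINT x|tor N. g' x) = 0"
proof -
  have "((\<lambda>t. integral (Tb N) (\<lambda>x. g (x + t *\<^sub>R v))) has_vector_derivative integral (Tb N) (\<lambda>x. g' (x + 0 *\<^sub>R v))) (at 0 within UNIV)"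
    unfolding Tb_def
  proof (rule leibniz_rule_vector_derivative)
    fix t :: real and x :: 'a
    have "((\<lambda>s. g ((x + t *\<^sub>R v) + s *\<^sub>R v)) has_vector_derivative g' (x + t *\<^sub>R v)) (at (t - t))" using d[of "x + t *\<^sub>R v"] by simp
    then have "((\<lambda>s. g ((x + t *\<^sub>R v) + s *\<^sub>R v)) \<circ> (\<lambda>s. s - t) has_vector_derivative 1 *\<^sub>R g' (x + t *\<^sub>R v)) (at t)"
      by (intro vector_diff_chain_at) (auto intro!: derivative_eq_intros)
    then show "((\<lambda>s. g (x + s *\<^sub>R v)) has_vector_derivative g' (x + t *\<^sub>R v)) (at t within UNIV)"
      by (simp add: o_def algebra_simps)
    show "(\<lambda>x. g (x + t *\<^sub>R v)) integrable_on cbox 0 (real N *\<^sub>R One)"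
      by (intro integrable_continuous continuous_on_compose2[OF g(1)] continuous_intros) auto
  next
    show "continuous_on (UNIV \<times> cbox 0 (real N *\<^sub>R One)) (\<lambda>(t, x). g' (x + t *\<^sub>R v))"
      unfolding case_prod_unfold by (intro continuous_on_compose2[OF g'] continuous_intros) auto
  qed auto
  moreover have "integral (Tb N) (\<lambda>x. g (x + t *\<^sub>R v)) = (LINT x|tor N. g x)" for t
  proof -
    have "continuous_on UNIV (\<lambda>x. g (x + t *\<^sub>R v))"
      by (intro continuous_on_compose2[OF g(1)] continuous_intros) auto
    from integral_tor_eq_HK[OF this, of N] show ?thesis
      using tor_shift[OF N borel_measurable_continuous_onI[OF g(1)] g(2) integrable_tor_continuous[OF g(1)], of "t *\<^sub>R v"] by simp
  qed
  ultimately have "((\<lambda>t::real. LINT x|tor N. g x) has_vector_derivative integral (Tb N) g') (at 0)" by simp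
  then have "integral (Tb N) g' = 0"
    using vector_derivative_unique_at has_vector_derivative_const by blast
  then show ?thesis by (simp add: integral_tor_eq_HK[OF g'])
qed

text \<open>The product of \<open>f\<close> with a conjugate character is periodic, so its
  derivative integrates to 0.\<close>

lemma fc_dir_derivative:
  fixes f :: "'a::euclidean_space \<Rightarrow> complex"
  assumes N: "N \<ge> 1" and k: "k \<in> latt" and f: "continuous_on UNIV f" "per N f" and f': "continuous_on UNIV f'"
    and d: "\<And>x. ((\<lambda>t. f (x + t *\<^sub>R v)) has_vector_derivative f' x) (at 0)"
  shows "fc N f' k = \<i> * of_real ((2 * pi / real N) * (k \<bullet> v)) * fc N f k"
proof -
  let ?c = "\<i> * of_real ((2 * pi / real N) * (k \<bullet> v))"
  have mk: "- k \<in> latt" by (rule latt_closed(4)[OF k])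
  have "(LINT x|tor N. f x * (- ?c * ee N (- k) x) + f' x * ee N (- k) x) = 0"
  proof (rule integral_dir_derivative_zero[OF N, where g="\<lambda>x. f x * ee N (- k) x" and v=v])
    show "continuous_on UNIV (\<lambda>x. f x * ee N (- k) x)" by (intro continuous_intros f ee_continuous)
    show "per N (\<lambda>x. f x * ee N (- k) x)" using f(2) ee_per[OF N mk] by (simp add: per_def)
    show "continuous_on UNIV (\<lambda>x. f x * (- ?c * ee N (- k) x) + f' x * ee N (- k) x)" by (intro continuous_intros f f' ee_continuous)
    fix x
    have "((\<lambda>t. ee N (- k) (x + t *\<^sub>R v)) has_vector_derivative (- ?c) * ee N (- k) x) (at 0)"
      using ee_dir_derivative[of N "- k" x v] by (simp add: inner_simps)
    from has_vector_derivative_mult[OF d this]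
    show "((\<lambda>t. f (x + t *\<^sub>R v) * ee N (- k) (x + t *\<^sub>R v)) has_vector_derivative f x * (- ?c * ee N (- k) x) + f' x * ee N (- k) x) (at 0)"
      by simp
  qed
  moreover have "integrable (tor N) (\<lambda>x. f x * ee N (- k) x)" "integrable (tor N) (\<lambda>x. f' x * ee N (- k) x)"
    by (intro integrable_tor_continuous continuous_intros f f' ee_continuous)+
  moreover have "f x * (- ?c * ee N (- k) x) = - ?c * (f x * ee N (- k) x)" for x by (simp only: mult_ac)
  ultimately have "- ?c * (LINT x|tor N. f x * ee N (- k) x) + (LINT x|tor N. f' x * ee N (- k) x) = 0"
    by (simp only: Bochner_Integration.integral_add integrable_mult_right Bochner_Integration.integral_mult_right)
  then show ?thesis by (simp add: fc_tor algebra_simps)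
qed

lemma weak_deriv_fc:
  fixes f :: "'a::euclidean_space \<Rightarrow> complex"
  assumes N: "N \<ge> 1" and w: "weak_deriv N f v g" and k: "k \<in> latt"
  shows "fc N g k = \<i> * of_real ((2 * pi / real N) * (k \<bullet> v)) * fc N f k"
proof -
  let ?c = "\<i> * of_real ((2 * pi / real N) * (k \<bullet> v))"
  have mk: "- k \<in> latt" by (rule latt_closed(4)[OF k])
  have "smooth (ee N (- k))" unfolding ee_eq_cis[abs_def] by (rule smooth_linear_cis) (rule bounded_linear_ident)
  moreover have "per N (ee N (- k))" by (rule ee_per[OF N mk])
  moreover have "((\<lambda>t. ee N (- k) (x + t *\<^sub>R v)) has_vector_derivative (- ?c) * ee N (- k) x) (at 0)" for x
    using ee_dir_derivative[of N "- k" x v] by (simp add: inner_simps)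
  ultimately have "(LINT x|tor N. f x * ((- ?c) * ee N (- k) x)) = - (LINT x|tor N. g x * ee N (- k) x)"
    by (rule weak_derivD[OF w])
  moreover have "f x * ((- ?c) * ee N (- k) x) = (- ?c) * (f x * ee N (- k) x)" for x by (simp only: mult_ac)
  ultimately have "(- ?c) * (LINT x|tor N. f x * ee N (- k) x) = - (LINT x|tor N. g x * ee N (- k) x)"
    by (simp only: Bochner_Integration.integral_mult_right_zero)
  then show ?thesis by (simp add: fc_tor)
qed

text \<open>For real \<open>f\<close> the definition admits only real test functions, so the
  character is tested through its real and imaginary parts separately.\<close>

lemma weak_deriv_real_fc:
  fixes f :: "'a::euclidean_space \<Rightarrow> real"
  assumes N: "N \<ge> 1" and w: "weak_deriv N f v g" and f: "integrable (tor N) f" and k: "k \<in> latt"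
  shows "fc N (\<lambda>x. of_real (g x)) k = \<i> * of_real ((2 * pi / real N) * (k \<bullet> v)) * fc N (\<lambda>x. of_real (f x)) k"
proof -
  let ?c = "\<i> * of_real ((2 * pi / real N) * (k \<bullet> v))"
  have mk: "- k \<in> latt" by (rule latt_closed(4)[OF k])
  have d: "((\<lambda>t. ee N (- k) (x + t *\<^sub>R v)) has_vector_derivative (- ?c) * ee N (- k) x) (at 0)" for x
    using ee_dir_derivative[of N "- k" x v] by (simp add: inner_simps)
  have key: "(LINT x|tor N. f x * L ((- ?c) * ee N (- k) x)) = - (LINT x|tor N. g x * L (ee N (- k) x))" if L: "bounded_linear L" for L :: "complex \<Rightarrow> real"
  proof -
    have "smooth (\<lambda>x. L (ee N (- k) x))" unfolding ee_eq_cis by (rule smooth_linear_cis[OF L])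
    moreover have "per N (\<lambda>x. L (ee N (- k) x))" using ee_per[OF N mk] by (simp add: per_def)
    moreover have "((\<lambda>t. L (ee N (- k) (x + t *\<^sub>R v))) has_vector_derivative L ((- ?c) * ee N (- k) x)) (at 0)" for x
      by (rule bounded_linear.has_vector_derivative[OF L d])
    ultimately show ?thesis by (rule weak_derivD[OF w])
  qed
  have g: "integrable (tor N) g" using w by (simp add: weak_deriv_def set_integrable_tor)
  have cplx: "(LINT x|tor N. of_real (h x) * z x) = Complex (LINT x|tor N. h x * Re (z x)) (LINT x|tor N. h x * Im (z x))"
    if h: "integrable (tor N) h" and z: "z \<in> borel_measurable borel" "\<And>x. cmod (z x) \<le> C" for h :: "'a \<Rightarrow> real" and z C
  proof -
    have i: "integrable (tor N) (\<lambda>x. of_real (h x) * z x)"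
      by (rule integrable_tor_mult_bounded[OF _ z]) (use h in simp)
    show ?thesis using integral_Re[OF i] integral_Im[OF i] by (simp add: complex_eq_iff)
  qed
  have zb: "cmod (- ?c * ee N (- k) x) \<le> cmod ?c" "cmod (ee N (- k) x) \<le> 1" for x
    by (simp_all only: norm_mult norm_minus_cancel ee_simps(5) mult_1_right order_refl)
  have "(LINT x|tor N. of_real (f x) * (- ?c * ee N (- k) x)) = - (LINT x|tor N. of_real (g x) * ee N (- k) x)"
  proof -
    have c1: "(LINT x|tor N. of_real (f x) * (- ?c * ee N (- k) x)) = Complex (LINT x|tor N. f x * Re (- ?c * ee N (- k) x)) (LINT x|tor N. f x * Im (- ?c * ee N (- k) x))"
      by (rule cplx[OF f _ zb(1)]) measurable
    have c2: "(LINT x|tor N. of_real (g x) * ee N (- k) x) = Complex (LINT x|tor N. g x * Re (ee N (- k) x)) (LINT x|tor N. g x * Im (ee N (- k) x))"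
      by (rule cplx[OF g _ zb(2)]) measurable
    show ?thesis
      unfolding c1 c2 key[OF bounded_linear_Re] key[OF bounded_linear_Im]
      by (simp only: complex_eq_iff complex.sel uminus_complex.sel simp_thms)
  qed
  moreover have "of_real (f x) * ((- ?c) * ee N (- k) x) = (- ?c) * (of_real (f x) * ee N (- k) x)" for x by (simp only: mult_ac)
  ultimately have "(- ?c) * (LINT x|tor N. of_real (f x) * ee N (- k) x) = - (LINT x|tor N. of_real (g x) * ee N (- k) x)"
    by (simp only: Bochner_Integration.integral_mult_right_zero)
  then show ?thesis by (simp add: fc_tor)
qed

text \<open>Parseval turns both integrals into lattice sums whose terms agree up to sign, because on
  either side a derivative is multiplication by \<i> times a component of the frequency.\<close>

lemma integration_by_parts_L2:
  fixes f g :: "'a::euclidean_space \<Rightarrow> complex"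
  assumes N: "N \<ge> 1" and f: "L2 N f" and g: "L2 N g"
    and fg: "\<And>k. k \<in> latt \<Longrightarrow> fc N g k = \<i> * of_real ((2 * pi / real N) * (k \<bullet> v)) * fc N f k"
    and p: "continuous_on UNIV \<phi>" "per N \<phi>" "continuous_on UNIV \<phi>'" "\<And>x. ((\<lambda>t. \<phi> (x + t *\<^sub>R v)) has_vector_derivative \<phi>' x) (at 0)"
  shows "(LINT x|tor N. f x * \<phi>' x) = - (LINT x|tor N. g x * \<phi> x)"
proof -
  have Lc: "L2 N h" if "continuous_on UNIV h" for h :: "'a \<Rightarrow> complex"
    unfolding L2_iff using that
    by (auto intro!: borel_measurable_continuous_onI integrable_tor_continuous continuous_on_power continuous_on_norm)
  have V: "real N ^ DIM('a) \<noteq> 0" using N by simp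
  have h1: "((\<lambda>k. fc N f k * cnj (fc N (\<lambda>x. cnj (\<phi>' x)) k)) has_sum ((LINT x|tor N. f x * \<phi>' x) / real N ^ DIM('a))) latt"
    using parseval_inner[OF N f L2_cnj[OF Lc[OF p(3)]]] by simp
  have h2: "((\<lambda>k. fc N g k * cnj (fc N (\<lambda>x. cnj (\<phi> x)) k)) has_sum ((LINT x|tor N. g x * \<phi> x) / real N ^ DIM('a))) latt"
    using parseval_inner[OF N g L2_cnj[OF Lc[OF p(1)]]] by simp
  have "fc N f k * cnj (fc N (\<lambda>x. cnj (\<phi>' x)) k) = - (fc N g k * cnj (fc N (\<lambda>x. cnj (\<phi> x)) k))" if k: "k \<in> latt" for k
    using fc_dir_derivative[OF N latt_closed(4)[OF k] p(1,2,3,4)] fg[OF k]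
    by (simp add: fc_cnj inner_simps mult_ac)
  then have "((\<lambda>k. fc N f k * cnj (fc N (\<lambda>x. cnj (\<phi>' x)) k)) has_sum (- ((LINT x|tor N. g x * \<phi> x) / real N ^ DIM('a)))) latt"
    using has_sum_uminusI[OF h2] by (subst has_sum_cong) auto
  from has_sum_unique[OF h1 this]
  have "(LINT x|tor N. f x * \<phi>' x) / complex_of_real (real N ^ DIM('a)) = (- (LINT x|tor N. g x * \<phi> x)) / complex_of_real (real N ^ DIM('a))"
    by (simp only: minus_divide_left)
  then show ?thesis using V by (simp only: divide_cancel_right of_real_eq_0_iff) simp
qed

lemma L2_cong_AE:
  assumes "f \<in> borel_measurable borel" "L2 N g" "AE x in tor N. f x = g x"
  shows "L2 N (f :: _ \<Rightarrow> complex)"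
proof -
  have "integrable (tor N) (\<lambda>x. (cmod (f x))\<^sup>2)"
  proof (subst integrable_cong_AE[where g="\<lambda>x. (cmod (g x))\<^sup>2"])
    show "AE x in tor N. (cmod (f x))\<^sup>2 = (cmod (g x))\<^sup>2" using assms(3) by eventually_elim simp
    show "(\<lambda>x. (cmod (f x))\<^sup>2) \<in> borel_measurable (tor N)" using borel_measurable_tor[OF assms(1)] by measurable
  qed (use assms(2) in \<open>auto simp: L2_iff\<close>)
  then show ?thesis using assms(1) by (simp add: L2_iff)
qed

text \<open>An integrable function agrees almost everywhere with the Riesz-Fischer function of its
  coefficients. In this way charge densities, potentials and their weak gradients are recognized as
  square integrable.\<close>

lemma L2_of_coefficients:
  fixes f :: "'a::euclidean_space \<Rightarrow> complex"
  assumes N: "N \<ge> 1" and f: "f \<in> borel_measurable borel" "integrable (tor N) f" and s: "(\<lambda>k. (cmod (fc N f k))\<^sup>2) summable_on latt"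
  shows "L2 N f"
proof -
  obtain g where g: "L2 N g" "\<And>k. k \<in> latt \<Longrightarrow> fc N g k = fc N f k" using riesz_fischer[OF N s] by metis
  have "AE x in tor N. f x = g x" by (rule fourier_eq_AE[OF N f(2) L2_integrable[OF g(1)]]) (simp add: g(2))
  then show ?thesis by (rule L2_cong_AE[OF f(1) g(1)])
qed

lemma weak_deriv_exists:
  fixes f :: "'a::euclidean_space \<Rightarrow> complex"
  assumes N: "N \<ge> 1" and f: "L2 N f" and s: "(\<lambda>k. (cmod (\<i> * of_real ((2 * pi / real N) * (k \<bullet> v)) * fc N f k))\<^sup>2) summable_on latt"
  obtains g where "weak_deriv N f v g" "L2 N g"
proof -
  obtain g where g: "L2 N g" "per N g" "\<And>k. k \<in> latt \<Longrightarrow> fc N g k = \<i> * of_real ((2 * pi / real N) * (k \<bullet> v)) * fc N f k"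
    using riesz_fischer[OF N s] by metis
  have "weak_deriv N f v g"
    unfolding weak_deriv_def set_integral_tor set_integrable_tor
    using integration_by_parts_L2[OF N f g(1,3)] smooth_derivative_continuous L2_measurable[OF g(1)] g(2) L2_integrable[OF g(1)] by blast
  then show thesis using g(1) that by blast
qed

text \<open>\<open>wd\<close> is an arbitrary choice among the weak derivatives. All of them have
  the same coefficients and hence agree almost everywhere, so square integrability of one passes to
  the chosen one.\<close>

lemma wd_L2:
  fixes f :: "'a::euclidean_space \<Rightarrow> complex"
  assumes N: "N \<ge> 1" and ex: "\<exists>g. weak_deriv N f v g \<and> L2 N g"
  shows "weak_deriv N f v (wd N f v)" "L2 N (wd N f v)"
    "k \<in> latt \<Longrightarrow> fc N (wd N f v) k = \<i> * of_real ((2 * pi / real N) * (k \<bullet> v)) * fc N f k"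
proof -
  obtain g where g: "weak_deriv N f v g" "L2 N g" using ex by blast
  show w: "weak_deriv N f v (wd N f v)" unfolding wd_def by (rule someI[of "weak_deriv N f v", OF g(1)])
  show "k \<in> latt \<Longrightarrow> fc N (wd N f v) k = \<i> * of_real ((2 * pi / real N) * (k \<bullet> v)) * fc N f k"
    by (rule weak_deriv_fc[OF N w])
  have m: "wd N f v \<in> borel_measurable borel" "integrable (tor N) (wd N f v)"
    using w by (auto simp: weak_deriv_def set_integrable_tor)
  have "AE x in tor N. wd N f v x = g x"
    by (rule fourier_eq_AE[OF N m(2) L2_integrable[OF g(2)]]) (simp add: weak_deriv_fc[OF N w] weak_deriv_fc[OF N g(1)])
  then show "L2 N (wd N f v)" by (rule L2_cong_AE[OF m(1) g(2)])
qed

section \<open>The H^1 norm in terms of Fourier coefficients\<close>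

lemma norm_sq_Basis: "(norm k)\<^sup>2 = (\<Sum>b\<in>Basis. (k \<bullet> b)\<^sup>2)" for k :: "'a::euclidean_space"
  using euclidean_inner[of k k] by (simp only: power2_norm_eq_inner power2_eq_square[of "_ \<bullet> _"])

lemma gradient_parseval:
  fixes f :: "'a::euclidean_space \<Rightarrow> complex"
  assumes N: "N \<ge> 1" and f: "H1 N f"
  shows "(\<lambda>k. (2 * pi / real N)\<^sup>2 * (norm k)\<^sup>2 * (cmod (fc N f k))\<^sup>2) summable_on latt"
    "(LINT x|tor N. (\<Sum>b\<in>Basis. (cmod (wd N f b x))\<^sup>2)) = real N ^ DIM('a) * (\<Sum>\<^sub>\<infinity>k\<in>latt. (2 * pi / real N)\<^sup>2 * (norm k)\<^sup>2 * (cmod (fc N f k))\<^sup>2)"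
proof -
  have ex: "\<exists>g. weak_deriv N f b g \<and> L2 N g" if "b \<in> Basis" for b using f that by (auto simp: H1_def)
  have eq: "(cmod (fc N (wd N f b) k))\<^sup>2 = (2 * pi / real N)\<^sup>2 * (k \<bullet> b)\<^sup>2 * (cmod (fc N f k))\<^sup>2" if "b \<in> Basis" "k \<in> latt" for b k
    unfolding wd_L2(3)[OF N ex[OF that(1)] that(2)]
    by (simp only: norm_mult norm_of_real norm_ii power_mult_distrib power2_abs mult_1)
  have sb: "(\<lambda>k. (2 * pi / real N)\<^sup>2 * (k \<bullet> b)\<^sup>2 * (cmod (fc N f k))\<^sup>2) summable_on latt" if b: "b \<in> Basis" for b
    using parseval(1)[OF N wd_L2(2)[OF N ex[OF b]]] by (subst (asm) summable_on_cong[OF eq[OF b]]) auto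
  have hs: "((\<lambda>k. (2 * pi / real N)\<^sup>2 * (k \<bullet> b)\<^sup>2 * (cmod (fc N f k))\<^sup>2) has_sum ((LINT x|tor N. (cmod (wd N f b x))\<^sup>2) / real N ^ DIM('a))) latt"
    if b: "b \<in> Basis" for b
  proof -
    have "(\<Sum>\<^sub>\<infinity>k\<in>latt. (2 * pi / real N)\<^sup>2 * (k \<bullet> b)\<^sup>2 * (cmod (fc N f k))\<^sup>2) = (\<Sum>\<^sub>\<infinity>k\<in>latt. (cmod (fc N (wd N f b) k))\<^sup>2)"
      by (intro infsum_cong) (simp add: eq[OF b])
    then show ?thesis using has_sum_infsum[OF sb[OF b]] parseval(2)[OF N wd_L2(2)[OF N ex[OF b]]] N by simp
  qed
  have "((\<lambda>k. \<Sum>b\<in>Basis. (2 * pi / real N)\<^sup>2 * (k \<bullet> b)\<^sup>2 * (cmod (fc N f k))\<^sup>2) has_sum (\<Sum>b\<in>Basis. (LINT x|tor N. (cmod (wd N f b x))\<^sup>2) / real N ^ DIM('a))) latt"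
  proof -
    have "finite B \<Longrightarrow> B \<subseteq> Basis \<Longrightarrow> ((\<lambda>k. \<Sum>b\<in>B. (2 * pi / real N)\<^sup>2 * (k \<bullet> b)\<^sup>2 * (cmod (fc N f k))\<^sup>2) has_sum (\<Sum>b\<in>B. (LINT x|tor N. (cmod (wd N f b x))\<^sup>2) / real N ^ DIM('a))) latt" for B
      by (induction B rule: finite_induct) (auto intro!: has_sum_add hs)
    then show ?thesis by simp
  qed
  moreover have "(\<Sum>b\<in>Basis. (2 * pi / real N)\<^sup>2 * (k \<bullet> b)\<^sup>2 * (cmod (fc N f k))\<^sup>2) = (2 * pi / real N)\<^sup>2 * (norm k)\<^sup>2 * (cmod (fc N f k))\<^sup>2" for k
    unfolding norm_sq_Basis[of k] sum_distrib_left sum_distrib_right ..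
  moreover have "(LINT x|tor N. (\<Sum>b\<in>Basis. (cmod (wd N f b x))\<^sup>2)) = (\<Sum>b\<in>Basis. LINT x|tor N. (cmod (wd N f b x))\<^sup>2)"
    by (rule Bochner_Integration.integral_sum) (use wd_L2(2)[OF N ex] in \<open>auto simp: L2_iff\<close>)
  ultimately have "((\<lambda>k. (2 * pi / real N)\<^sup>2 * (norm k)\<^sup>2 * (cmod (fc N f k))\<^sup>2) has_sum ((LINT x|tor N. (\<Sum>b\<in>Basis. (cmod (wd N f b x))\<^sup>2)) / real N ^ DIM('a))) latt"
    by (simp only: sum_divide_distrib)
  then show "(\<lambda>k. (2 * pi / real N)\<^sup>2 * (norm k)\<^sup>2 * (cmod (fc N f k))\<^sup>2) summable_on latt"
    "(LINT x|tor N. (\<Sum>b\<in>Basis. (cmod (wd N f b x))\<^sup>2)) = real N ^ DIM('a) * (\<Sum>\<^sub>\<infinity>k\<in>latt. (2 * pi / real N)\<^sup>2 * (norm k)\<^sup>2 * (cmod (fc N f k))\<^sup>2)"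
    using N by (auto simp: has_sum_iff)
qed

text \<open>The square root of the volume, taken from Parseval's identity, makes this an isometry
  from \<open>Fnorm\<close> to the norm of \<open>ell2\<close>.\<close>

definition Cf :: "nat \<Rightarrow> ('a::euclidean_space \<Rightarrow> complex) \<Rightarrow> 'a ell2" where
  "Cf N f = Ell2 (\<lambda>k. if k \<in> latt then of_real (sqrt (real N ^ DIM('a)) * wt N k) * fc N f k else 0)"

lemma sq_summable_latt:
  assumes "(\<lambda>k. (cmod (c k))\<^sup>2) summable_on latt" shows "sq_summable (\<lambda>k. if k \<in> latt then c k else 0)"
proof -
  have "(\<lambda>k. (cmod (c k))\<^sup>2) summable_on latt \<longleftrightarrow> (\<lambda>k. (cmod (if k \<in> latt then c k else 0))\<^sup>2) summable_on UNIV"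
    by (rule summable_on_cong_neutral) auto
  then show ?thesis using assms by (simp add: sq_summable_def)
qed

lemma cmod_Cf_sq: "(cmod (of_real (sqrt (real N ^ n) * wt N k) * z))\<^sup>2 = real N ^ n * ((cmod z)\<^sup>2 + (2 * pi / real N)\<^sup>2 * (norm k)\<^sup>2 * (cmod z)\<^sup>2)"
proof -
  have "(cmod (of_real (sqrt (real N ^ n) * wt N k) * z))\<^sup>2 = (sqrt (real N ^ n))\<^sup>2 * (wt N k)\<^sup>2 * (cmod z)\<^sup>2"
    by (simp only: norm_mult norm_of_real power_mult_distrib power2_abs)
  also have "(sqrt (real N ^ n))\<^sup>2 = real N ^ n" by simp
  finally show ?thesis unfolding wt_sq by (simp add: algebra_simps)
qed

lemma Cf_summable:
  fixes f :: "'a::euclidean_space \<Rightarrow> complex"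
  assumes N: "N \<ge> 1" and f: "H1 N f"
  shows "(\<lambda>k. (cmod (of_real (sqrt (real N ^ DIM('a)) * wt N k) * fc N f k))\<^sup>2) summable_on latt"
  unfolding cmod_Cf_sq
  by (intro summable_on_cmult_right summable_on_add parseval(1)[OF N] gradient_parseval(1)[OF N f]) (use f in \<open>simp add: H1_def\<close>)

lemma cf_Cf:
  fixes f :: "'a::euclidean_space \<Rightarrow> complex"
  assumes N: "N \<ge> 1" and f: "H1 N f"
  shows "cf (Cf N f) k = (if k \<in> latt then of_real (sqrt (real N ^ DIM('a)) * wt N k) * fc N f k else 0)"
  unfolding Cf_def by (subst cf_Ell2[OF sq_summable_latt[OF Cf_summable[OF N f]]]) simp

lemma infsum_latt_UNIV: "(\<And>k. k \<notin> latt \<Longrightarrow> f k = 0) \<Longrightarrow> infsum f UNIV = infsum f latt"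
  by (rule infsum_cong_neutral) auto

lemma Fnorm_Cf:
  fixes f :: "'a::euclidean_space \<Rightarrow> complex"
  assumes N: "N \<ge> 1" and f: "H1 N f"
  shows "Fnorm N f = norm (Cf N f)"
proof -
  have L: "L2 N f" using f by (simp add: H1_def)
  have "(norm (Cf N f))\<^sup>2 = (\<Sum>\<^sub>\<infinity>k\<in>latt. (cmod (cf (Cf N f) k))\<^sup>2)"
    unfolding norm_ell2_sq by (rule infsum_latt_UNIV) (simp add: cf_Cf[OF N f])
  also have "\<dots> = (\<Sum>\<^sub>\<infinity>k\<in>latt. real N ^ DIM('a) * ((cmod (fc N f k))\<^sup>2 + (2 * pi / real N)\<^sup>2 * (norm k)\<^sup>2 * (cmod (fc N f k))\<^sup>2))"
    by (intro infsum_cong) (simp only: cf_Cf[OF N f] if_True cmod_Cf_sq)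
  also have "\<dots> = (LINT x|tor N. (\<Sum>b\<in>Basis. (cmod (wd N f b x))\<^sup>2)) + (LINT x|tor N. (cmod (f x))\<^sup>2)"
    unfolding infsum_cmult_right' infsum_add[OF parseval(1)[OF N L] gradient_parseval(1)[OF N f]] gradient_parseval(2)[OF N f] parseval(2)[OF N L]
    by (simp add: algebra_simps)
  finally show ?thesis unfolding Fnorm_def set_integral_tor by (metis norm_ge_zero real_sqrt_unique)
qed

lemma H1_of_coefficients:
  fixes f :: "'a::euclidean_space \<Rightarrow> complex"
  assumes N: "N \<ge> 1" and f: "per N f" "L2 N f" and s: "(\<lambda>k. (cmod (of_real (wt N k) * fc N f k))\<^sup>2) summable_on latt"
  shows "H1 N f"
  unfolding H1_def
proof (intro conjI f ballI)
  fix b :: 'a assume b: "b \<in> Basis"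
  have "(\<lambda>k. (cmod (\<i> * of_real ((2 * pi / real N) * (k \<bullet> b)) * fc N f k))\<^sup>2) summable_on latt"
  proof (rule summable_on_comparison_test[OF s])
    fix k :: 'a
    have "\<bar>(2 * pi / real N) * (k \<bullet> b)\<bar> \<le> wt N k"
    proof (rule abs_le_square_iff[THEN iffD2, of _ "wt N k", simplified abs_of_pos[OF wt_pos]])
      have "((2 * pi / real N) * (k \<bullet> b))\<^sup>2 = (2 * pi / real N)\<^sup>2 * (k \<bullet> b)\<^sup>2" by (rule power_mult_distrib)
      also have "\<dots> \<le> (2 * pi / real N)\<^sup>2 * (norm k)\<^sup>2"
        using Basis_le_norm[OF b, of k] by (intro mult_left_mono) (auto simp: abs_le_square_iff[symmetric])
      also have "\<dots> \<le> (wt N k)\<^sup>2" unfolding wt_sq by simp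
      finally show "((2 * pi / real N) * (k \<bullet> b))\<^sup>2 \<le> (wt N k)\<^sup>2" .
    qed
    then have "cmod (\<i> * of_real ((2 * pi / real N) * (k \<bullet> b)) * fc N f k) \<le> cmod (of_real (wt N k) * fc N f k)"
      using wt_pos[of N k] by (simp only: norm_mult norm_of_real norm_ii mult_1 abs_of_pos mult_right_mono norm_ge_zero)
    then show "(cmod (\<i> * of_real ((2 * pi / real N) * (k \<bullet> b)) * fc N f k))\<^sup>2 \<le> (cmod (of_real (wt N k) * fc N f k))\<^sup>2"
      by (intro power_mono) auto
  qed auto
  from weak_deriv_exists[OF N f(2) this] show "\<exists>g. weak_deriv N f b g \<and> L2 N g" by metis
qed

lemma H1_diff:
  fixes f g :: "'a::euclidean_space \<Rightarrow> complex"
  assumes N: "N \<ge> 1" and f: "H1 N f" and g: "H1 N g"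
  shows "H1 N (\<lambda>x. f x - g x)" "Cf N (\<lambda>x. f x - g x) = Cf N f - Cf N g"
proof -
  have L: "L2 N f" "L2 N g" using f g by (auto simp: H1_def)
  have fcd: "fc N (\<lambda>x. f x - g x) k = fc N f k - fc N g k" for k
    by (rule fc_linear(2)[OF L2_integrable[OF L(1)] L2_integrable[OF L(2)]])
  have V: "sqrt (real N ^ DIM('a)) \<ge> 1" using N by simp
  show h: "H1 N (\<lambda>x. f x - g x)"
  proof (rule H1_of_coefficients[OF N])
    show "per N (\<lambda>x. f x - g x)" using f g by (simp add: H1_def per_def)
    show "L2 N (\<lambda>x. f x - g x)" by (rule L2_diff[OF L])
    have s: "(\<lambda>k. (cmod (cf (Cf N f - Cf N g) k))\<^sup>2) summable_on latt"
      using cf_norm_summable[of "Cf N f - Cf N g"] by (rule summable_on_subset_banach) simp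
    show "(\<lambda>k. (cmod (of_real (wt N k) * fc N (\<lambda>x. f x - g x) k))\<^sup>2) summable_on latt"
    proof (rule summable_on_comparison_test[OF s])
      fix k :: 'a assume k: "k \<in> latt"
      have "cf (Cf N f - Cf N g) k = of_real (sqrt (real N ^ DIM('a))) * (of_real (wt N k) * fc N (\<lambda>x. f x - g x) k)"
        using k by (simp only: cf_diff cf_Cf[OF N f] cf_Cf[OF N g] fcd if_True of_real_mult right_diff_distrib mult.assoc)
      then have "cmod (of_real (wt N k) * fc N (\<lambda>x. f x - g x) k) \<le> cmod (cf (Cf N f - Cf N g) k)"
        using mult_right_mono[OF V norm_ge_zero[of "of_real (wt N k) * fc N (\<lambda>x. f x - g x) k"]] V
        by (simp only: norm_mult norm_of_real)
      then show "(cmod (of_real (wt N k) * fc N (\<lambda>x. f x - g x) k))\<^sup>2 \<le> (cmod (cf (Cf N f - Cf N g) k))\<^sup>2"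
        by (intro power_mono) auto
    qed auto
  qed
  show "Cf N (\<lambda>x. f x - g x) = Cf N f - Cf N g"
    by (rule ell2_eqI) (simp add: cf_Cf[OF N f] cf_Cf[OF N g] cf_Cf[OF N h] fcd right_diff_distrib)
qed

section \<open>Partial integration over one particle\<close>

text \<open>A permutation of the coordinates maps boxes to boxes with the same edge lengths. It
  serves both for permutations of the particles and for \<open>swp\<close>.\<close>

lemma lborel_basis_permutation:
  fixes P :: "'c::euclidean_space \<Rightarrow> 'c"
  assumes m: "P \<in> borel_measurable borel" and t: "bij_betw t Basis Basis" and P: "\<And>x b. b \<in> Basis \<Longrightarrow> P x \<bullet> b = x \<bullet> t b"
  shows "distr lborel borel P = lborel"
proof (rule lborel_eqI[symmetric])
  fix l u :: 'c assume lu: "\<And>b. b \<in> Basis \<Longrightarrow> l \<bullet> b \<le> u \<bullet> b"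
  define s where "s = inv_into Basis t"
  have s: "s c \<in> Basis" "t (s c) = c" if "c \<in> Basis" for c
    using t that bij_betw_inv_into_right[OF t] bij_betw_imp_surj_on[OF bij_betw_inv_into[OF t]] by (auto simp: s_def)
  have s': "s (t b) = b" "t b \<in> Basis" if "b \<in> Basis" for b
    using t that bij_betw_inv_into_left[OF t] by (auto simp: s_def bij_betwE)
  define sh where "sh z = (\<Sum>c\<in>Basis. (z \<bullet> s c) *\<^sub>R c)" for z :: 'c
  have sh: "sh z \<bullet> c = z \<bullet> s c" if "c \<in> Basis" for z c using that by (simp add: sh_def)
  have "P -` box l u = box (sh l) (sh u)"
  proof (intro set_eqI iffI)
    fix x assume "x \<in> P -` box l u"
    then have "l \<bullet> s c < P x \<bullet> s c \<and> P x \<bullet> s c < u \<bullet> s c" if "c \<in> Basis" for c using s(1)[OF that] by (auto simp: mem_box)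
    then show "x \<in> box (sh l) (sh u)" by (auto simp: mem_box sh P[OF s(1)] s(2))
  next
    fix x assume x: "x \<in> box (sh l) (sh u)"
    have "l \<bullet> b < P x \<bullet> b \<and> P x \<bullet> b < u \<bullet> b" if b: "b \<in> Basis" for b
    proof -
      have "sh l \<bullet> t b < x \<bullet> t b" "x \<bullet> t b < sh u \<bullet> t b" using x s'(2)[OF b] by (auto simp: mem_box)
      then show ?thesis by (simp add: P[OF b] sh[OF s'(2)[OF b]] s'(1)[OF b])
    qed
    then show "x \<in> P -` box l u" by (auto simp: mem_box)
  qed
  moreover have "emeasure (distr lborel borel P) (box l u) = emeasure lborel (P -` box l u)"
    using m by (subst emeasure_distr) auto
  moreover have "sh l \<bullet> b \<le> sh u \<bullet> b" if "b \<in> Basis" for b using lu[OF s(1)[OF that]] sh[OF that] by simp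
  ultimately have "emeasure (distr lborel borel P) (box l u) = (\<Prod>b\<in>Basis. (sh u - sh l) \<bullet> b)"
    by (simp add: emeasure_lborel_box)
  also have "(\<Prod>c\<in>Basis. (sh u - sh l) \<bullet> c) = (\<Prod>c\<in>Basis. (u - l) \<bullet> s c)"
    by (intro prod.cong) (auto simp: inner_diff_left sh)
  also have "\<dots> = (\<Prod>b\<in>Basis. (u - l) \<bullet> b)"
    unfolding s_def by (rule prod.reindex_bij_betw[OF bij_betw_inv_into[OF t]])
  finally show "emeasure (distr lborel borel P) (box l u) = (\<Prod>b\<in>Basis. (u - l) \<bullet> b)" .
qed simp

lemma axis_in_Basis_vec: "b \<in> Basis \<Longrightarrow> axis j b \<in> (Basis :: (real^3^'n::finite) set)"
  by (simp add: axis_in_Basis_iff)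

lemma prm_continuous: "continuous_on A (prm \<pi> :: real^3^'n::finite \<Rightarrow> _)"
  unfolding prm_def[abs_def] by (intro continuous_intros)

lemma distr_prm:
  assumes p: "\<pi> permutes UNIV"
  shows "distr lborel borel (prm \<pi>) = (lborel :: (real^3^'n::finite) measure)"
proof (rule lborel_basis_permutation[where t="prm (inv \<pi>)"])
  show "prm \<pi> \<in> borel_measurable (borel :: (real^3^'n) measure)" by (rule borel_measurable_continuous_onI[OF prm_continuous])
  have B: "prm \<rho> b \<in> Basis" if r: "\<rho> permutes UNIV" and b: "b \<in> Basis" for \<rho> and b :: "real^3^'n"
  proof -
    obtain i c where "b = axis i c" "c \<in> Basis" using b unfolding Basis_vec_def by blast
    then show ?thesis by (simp add: prm_axis[OF r] axis_in_Basis_vec)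
  qed
  show "bij_betw (prm (inv \<pi>)) Basis (Basis :: (real^3^'n) set)"
    by (rule bij_betwI[where g="prm \<pi>"]) (auto simp: prm_inv p intro!: B permutes_inv)
  show "prm \<pi> x \<bullet> b = x \<bullet> prm (inv \<pi>) b" for x b :: "real^3^'n"
    using inner_prm[OF p, of x "prm (inv \<pi>) b"] by (simp add: prm_inv p)
qed

lemma Tb_iff_nth: "x \<in> Tb N \<longleftrightarrow> (\<forall>j. x $ j \<in> Tb N)" for x :: "real^3^'n::finite"
proof -
  have "x \<in> Tb N \<longleftrightarrow> (\<forall>b\<in>Basis. 0 \<le> x \<bullet> b \<and> x \<bullet> b \<le> real N)" by (simp add: Tb_def mem_box)
  also have "\<dots> \<longleftrightarrow> (\<forall>j. \<forall>c\<in>Basis. 0 \<le> x $ j \<bullet> c \<and> x $ j \<bullet> c \<le> real N)"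
  proof safe
    fix j :: 'n and c :: "real^3" assume a: "\<forall>b\<in>Basis. 0 \<le> x \<bullet> b \<and> x \<bullet> b \<le> real N" and c: "c \<in> Basis"
    show "0 \<le> x $ j \<bullet> c" "x $ j \<bullet> c \<le> real N" using bspec[OF a axis_in_Basis_vec[OF c, of j]] by (simp_all add: inner_axis)
  next
    fix b :: "real^3^'n" assume a: "\<forall>j. \<forall>c\<in>Basis. 0 \<le> x $ j \<bullet> c \<and> x $ j \<bullet> c \<le> real N" and b: "b \<in> Basis"
    obtain i c where "b = axis i c" "c \<in> Basis" using b unfolding Basis_vec_def by blast
    with a show "0 \<le> x \<bullet> b" "x \<bullet> b \<le> real N" by (auto simp: inner_axis)
  qed
  also have "\<dots> \<longleftrightarrow> (\<forall>j. x $ j \<in> Tb N)" by (simp add: Tb_def mem_box)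
  finally show ?thesis .
qed

lemma fc_prm:
  fixes f :: "real^3^'n::finite \<Rightarrow> complex"
  assumes p: "\<pi> permutes UNIV" and f: "f \<in> borel_measurable borel"
  shows "fc N (\<lambda>x. f (prm \<pi> x)) k = fc N f (prm \<pi> k)"
proof -
  have m: "prm \<pi> \<in> lborel \<rightarrow>\<^sub>M (borel :: (real^3^'n) measure)"
    using borel_measurable_continuous_onI[OF prm_continuous] by simp
  have T: "prm \<pi> x \<in> Tb N \<longleftrightarrow> x \<in> Tb N" for x :: "real^3^'n"
    unfolding Tb_iff_nth prm_def by (metis p permutes_inverses(1) vec_lambda_beta)
  have e: "ee N (- prm \<pi> k) (prm \<pi> x) = ee N (- k) x" for x by (simp add: ee_def inner_prm[OF p])
  have g: "(\<lambda>x. indicator (Tb N) x *\<^sub>R (f x * ee N (- prm \<pi> k) x)) \<in> borel_measurable borel" using f by measurable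
  have "(LINT x|tor N. f x * ee N (- prm \<pi> k) x) = (LINT x|distr lborel borel (prm \<pi>). indicator (Tb N) x *\<^sub>R (f x * ee N (- prm \<pi> k) x))"
    unfolding distr_prm[OF p] set_integral_tor[symmetric] set_lebesgue_integral_def ..
  also have "\<dots> = (LINT x|lborel. indicator (Tb N) (prm \<pi> x) *\<^sub>R (f (prm \<pi> x) * ee N (- prm \<pi> k) (prm \<pi> x)))"
    by (rule integral_distr[OF m g])
  also have "\<dots> = (LINT x|tor N. f (prm \<pi> x) * ee N (- k) x)"
    unfolding set_integral_tor[symmetric] set_lebesgue_integral_def e by (simp add: indicator_def T)
  finally show ?thesis by (simp add: fc_tor)
qed

text \<open>Antisymmetry is demanded almost everywhere in space, whereas coefficients determine a
  function on the box only. Periodicity bridges the two, as \<open>prm \<pi>\<close> preserves the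
  lattice.\<close>

lemma antisymm_iff_fc:
  fixes f :: "real^3^'n::finite \<Rightarrow> complex"
  assumes N: "N \<ge> 1" and f: "L2 N f" "per N f"
  shows "antisymm_wf f \<longleftrightarrow> (\<forall>\<pi>. \<pi> permutes UNIV \<longrightarrow> (\<forall>k\<in>latt. fc N f (prm \<pi> k) = of_int (sign \<pi>) * fc N f k))"
proof -
  note fm = L2_measurable[OF f(1)]
  have pm: "(\<lambda>x. f (prm \<pi> x)) \<in> borel_measurable borel" for \<pi>
    by (rule measurable_compose[OF borel_measurable_continuous_onI[OF prm_continuous] fm])
  have fi: "integrable (tor N) f" by (rule L2_integrable[OF f(1)])
  have one: "(AE x in lborel. f (prm \<pi> x) = of_int (sign \<pi>) * f x) \<longleftrightarrow> (\<forall>k\<in>latt. fc N f (prm \<pi> k) = of_int (sign \<pi>) * fc N f k)"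
    if p: "\<pi> permutes UNIV" for \<pi>
  proof
    assume a: "AE x in lborel. f (prm \<pi> x) = of_int (sign \<pi>) * f x"
    then have "AE x in tor N. f (prm \<pi> x) = of_int (sign \<pi>) * f x" unfolding AE_tor_iff by eventually_elim simp
    from fc_cong_AE[OF this pm] fm
    have "fc N (\<lambda>x. f (prm \<pi> x)) k = fc N (\<lambda>x. of_int (sign \<pi>) * f x) k" for k by simp
    then show "\<forall>k\<in>latt. fc N f (prm \<pi> k) = of_int (sign \<pi>) * fc N f k"
      by (simp add: fc_prm[OF p fm] fc_linear(3)[OF fi fi])
  next
    assume a: "\<forall>k\<in>latt. fc N f (prm \<pi> k) = of_int (sign \<pi>) * fc N f k"
    have pi: "integrable (tor N) (\<lambda>x. f (prm \<pi> x))"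
    proof -
      have m: "prm \<pi> \<in> lborel \<rightarrow>\<^sub>M (borel :: (real^3^'n) measure)"
        using borel_measurable_continuous_onI[OF prm_continuous] by simp
      have T: "prm \<pi> x \<in> Tb N \<longleftrightarrow> x \<in> Tb N" for x :: "real^3^'n"
        unfolding Tb_iff_nth prm_def by (metis p permutes_inverses(1) vec_lambda_beta)
      have g: "(\<lambda>x. indicator (Tb N) x *\<^sub>R f x) \<in> borel_measurable borel" using fm by measurable
      have "integrable (distr lborel borel (prm \<pi>)) (\<lambda>x. indicator (Tb N) x *\<^sub>R f x)"
        unfolding distr_prm[OF p] using fi by (simp add: set_integrable_tor[symmetric] set_integrable_def)
      then have "integrable lborel (\<lambda>x. indicator (Tb N) (prm \<pi> x) *\<^sub>R f (prm \<pi> x))"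
        using integrable_distr_eq[OF m g] by simp
      then show ?thesis unfolding set_integrable_tor[symmetric] set_integrable_def by (simp add: indicator_def T)
    qed
    have "AE x in tor N. f (prm \<pi> x) = of_int (sign \<pi>) * f x"
      by (rule fourier_eq_AE[OF N pi]) (use fi a in \<open>simp_all add: fc_prm[OF p fm] fc_linear(3)[OF fi fi]\<close>)
    then show "AE x in lborel. f (prm \<pi> x) = of_int (sign \<pi>) * f x"
    proof (rule AE_lborel_of_tor[OF N, rotated])
      fix x m :: "real^3^'n" assume m: "m \<in> latt"
      have "prm \<pi> (x + real N *\<^sub>R m) = prm \<pi> x + real N *\<^sub>R prm \<pi> m" by (simp add: prm_def vec_eq_iff)
      then show "(f (prm \<pi> (x + real N *\<^sub>R m)) = of_int (sign \<pi>) * f (x + real N *\<^sub>R m)) \<longleftrightarrow> (f (prm \<pi> x) = of_int (sign \<pi>) * f x)"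
        using perD[OF f(2) m] perD[OF f(2), of "prm \<pi> m"] m by (simp add: latt_prm p)
    qed
  qed
  show ?thesis unfolding antisymm_wf_def using one unfolding prm_def by auto
qed

definition upd :: "'n \<Rightarrow> real^3 \<Rightarrow> real^3^'n::finite \<Rightarrow> real^3^'n" where
  "upd j x y = (\<chi> l. if l = j then x else y $ l)"

lemma upd_nth: "upd j x y $ l = (if l = j then x else y $ l)"
  by (simp add: upd_def)

lemma upd_continuous: "continuous_on A (\<lambda>z :: (real^3) \<times> (real^3^'a::finite). upd j (fst z) (snd z))"
  unfolding upd_def
proof (rule continuous_on_vec_lambda)
  show "continuous_on A (\<lambda>z :: (real^3) \<times> (real^3^'a). if l = j then fst z else snd z $ l)" for l
    by (cases "l = j") (auto intro!: continuous_intros)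
qed

text \<open>Exchanging \<open>x\<close> with the \<open>j\<close>-th component of \<open>y\<close> preserves Lebesgue measure; this reduces
  integrals of the slices \<open>upd j x y\<close> to product integrals.\<close>

definition swp :: "'n \<Rightarrow> (real^3) \<times> (real^3^'n::finite) \<Rightarrow> (real^3) \<times> (real^3^'n)" where
  "swp j z = (snd z $ j, upd j (fst z) (snd z))"

lemma swp_swp: "swp j (swp j z) = z"
  by (simp add: swp_def upd_def prod_eq_iff vec_eq_iff)

lemma swp_measurable: "swp j \<in> borel_measurable borel"
  unfolding swp_def[abs_def]
  by (intro borel_measurable_continuous_onI continuous_on_Pair upd_continuous continuous_intros)

lemma distr_swp: "distr lborel borel (swp (j :: 'n::finite)) = lborel"
proof (rule lborel_basis_permutation[OF swp_measurable, where t="swp j"])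
  have B: "swp j b \<in> Basis" if b: "b \<in> Basis" for b :: "(real^3) \<times> (real^3^'n)"
  proof -
    consider c where "b = (c, 0)" "c \<in> Basis" | d where "b = (0, d)" "d \<in> Basis" using b unfolding Basis_prod_def by auto
    then show ?thesis
    proof cases
      case 1
      then have "swp j b = (0, axis j c)" by (auto simp: swp_def upd_def axis_def vec_eq_iff)
      then show ?thesis using axis_in_Basis_vec[OF 1(2), of j] by (simp add: Basis_prod_def)
    next
      case 2
      obtain l v where d: "d = axis l v" "v \<in> Basis" using 2(2) unfolding Basis_vec_def by blast
      have "swp j b = (if l = j then (v, 0) else (0, axis l v))"
        unfolding 2 d by (auto simp: swp_def upd_def axis_def vec_eq_iff)
      then show ?thesis using axis_in_Basis_vec[OF d(2), of l] d(2) by (simp add: Basis_prod_def)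
    qed
  qed
  show "bij_betw (swp j) Basis Basis" by (rule bij_betwI[where g="swp j"]) (auto simp: swp_swp B)
  show "swp j x \<bullet> b = x \<bullet> swp j b" for x b :: "(real^3) \<times> (real^3^'n)"
  proof -
    have split: "upd j y z \<bullet> d = y \<bullet> d $ j + (\<Sum>l\<in>UNIV - {j}. z $ l \<bullet> d $ l)" for y and z d :: "real^3^'n"
      unfolding inner_vec_def by (subst sum.remove[of UNIV j]) (auto simp: upd_def intro!: sum.cong)
    show ?thesis
      using split[of "fst b" "snd b" "snd x"]
      by (simp add: swp_def inner_prod_def split inner_commute[of "snd x" "upd j (fst b) (snd b)"] inner_commute[of "snd b $ _"] inner_commute[of "fst b"])
  qed
qed

lemma swp_Tb: "swp j z \<in> Tb N \<times> Tb N \<longleftrightarrow> z \<in> Tb N \<times> Tb N"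
proof -
  have "fst (swp j z) \<in> Tb N \<and> snd (swp j z) \<in> Tb N \<longleftrightarrow> fst z \<in> Tb N \<and> snd z \<in> Tb N"
    unfolding swp_def fst_conv snd_conv Tb_iff_nth upd_nth by (metis (full_types))
  then show ?thesis by (auto simp: mem_Times_iff)
qed

lemma product_tor:
  fixes g :: "'a::euclidean_space \<Rightarrow> complex" and h :: "'b::euclidean_space \<Rightarrow> complex"
  assumes "g \<in> borel_measurable borel" "integrable (tor N) g" "h \<in> borel_measurable borel" "integrable (tor N) h"
  shows "integrable lborel (\<lambda>z. indicator (Tb N \<times> Tb N) z *\<^sub>R (g (fst z) * h (snd z)))"
    "(LINT z|lborel. indicator (Tb N \<times> Tb N) z *\<^sub>R (g (fst z) * h (snd z))) = (LINT x|tor N. g x) * (LINT x|tor N. h x)"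
proof -
  let ?g = "\<lambda>x. indicator (Tb N) x *\<^sub>R g x" and ?h = "\<lambda>y. indicator (Tb N) y *\<^sub>R h y"
  have ig: "integrable lborel ?g" and ih: "integrable lborel ?h"
    using assms by (auto simp: set_integrable_tor[symmetric] set_integrable_def)
  have eq: "indicator (Tb N \<times> Tb N) z *\<^sub>R (g (fst z) * h (snd z)) = ?g (fst z) * ?h (snd z)" for z :: "'a \<times> 'b"
    by (cases z) (auto simp: indicator_def)
  have meas: "(\<lambda>z. ?g (fst z) * ?h (snd z)) \<in> borel_measurable (lborel \<Otimes>\<^sub>M lborel)"
    using assms(1,3) by measurable
  have i: "integrable (lborel \<Otimes>\<^sub>M lborel) (\<lambda>z. ?g (fst z) * ?h (snd z))"
  proof (rule lborel_pair.Fubini_integrable[OF meas])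
    have "integrable lborel (\<lambda>x. norm (?g x) * (LINT y|lborel. norm (?h y)))" by (intro integrable_mult_left integrable_norm ig)
    then show "integrable lborel (\<lambda>x. LINT y|lborel. norm (?g (fst (x, y)) * ?h (snd (x, y))))"
      unfolding norm_mult[of "?g _"] fst_conv snd_conv integral_mult_right_zero .
    show "AE x in lborel. integrable lborel (\<lambda>y. ?g (fst (x, y)) * ?h (snd (x, y)))"
      unfolding fst_conv snd_conv using integrable_mult_right[OF ih] by blast
  qed
  then show "integrable lborel (\<lambda>z. indicator (Tb N \<times> Tb N) z *\<^sub>R (g (fst z) * h (snd z)))"
    unfolding eq lborel_prod .
  have "(LINT z|lborel. indicator (Tb N \<times> Tb N) z *\<^sub>R (g (fst z) * h (snd z))) = (LINT z|(lborel \<Otimes>\<^sub>M lborel). ?g (fst z) * ?h (snd z))"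
    unfolding eq lborel_prod ..
  also have "\<dots> = (LINT x|lborel. LINT y|lborel. ?g (fst (x, y)) * ?h (snd (x, y)))"
    using lborel_pair.integral_fst'[OF i] by simp
  also have "\<dots> = (LINT x|lborel. ?g x) * (LINT y|lborel. ?h y)"
    unfolding fst_conv snd_conv integral_mult_right_zero integral_mult_left_zero ..
  finally show "(LINT z|lborel. indicator (Tb N \<times> Tb N) z *\<^sub>R (g (fst z) * h (snd z))) = (LINT x|tor N. g x) * (LINT x|tor N. h x)"
    by (simp add: set_integral_tor[symmetric] set_lebesgue_integral_def)
qed

text \<open>A product integral becomes, after \<open>swp\<close>, an integral over slices. Taking
  one of the two factors constant yields the integration over slices and the integrability of
  functions of a single particle.\<close>

lemma product_tor_swp:
  fixes g :: "real^3 \<Rightarrow> complex" and h :: "real^3^'n::finite \<Rightarrow> complex"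
  assumes "g \<in> borel_measurable borel" "integrable (tor N) g" "h \<in> borel_measurable borel" "integrable (tor N) h"
  shows "integrable (lborel \<Otimes>\<^sub>M lborel) (\<lambda>z. indicator (Tb N \<times> Tb N) z *\<^sub>R (g (snd z $ j) * h (upd j (fst z) (snd z))))"
    "(LINT z|(lborel \<Otimes>\<^sub>M lborel). indicator (Tb N \<times> Tb N) z *\<^sub>R (g (snd z $ j) * h (upd j (fst z) (snd z)))) = (LINT x|tor N. g x) * (LINT x|tor N. h x)"
proof -
  let ?G = "\<lambda>z. indicator (Tb N \<times> Tb N) z *\<^sub>R (g (fst z) * h (snd z))"
  have T: "Tb N \<times> Tb N \<in> sets (borel :: ((real^3) \<times> (real^3^'n)) measure)" by (intro borel_Times) auto
  have gm: "?G \<in> borel_measurable borel"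
    using assms(1,3) T by (intro borel_measurable_scaleR borel_measurable_times measurable_compose[OF _ assms(1)] measurable_compose[OF _ assms(3)]) (auto intro!: borel_measurable_indicator borel_measurable_continuous_onI continuous_intros)
  have e: "?G (swp j z) = indicator (Tb N \<times> Tb N) z *\<^sub>R (g (snd z $ j) * h (upd j (fst z) (snd z)))" for z
    using swp_Tb[of j z N] by (simp add: indicator_def) (simp add: swp_def)
  have m: "swp j \<in> lborel \<rightarrow>\<^sub>M (borel :: ((real^3) \<times> (real^3^'n)) measure)" using swp_measurable[of j] by simp
  show "integrable (lborel \<Otimes>\<^sub>M lborel) (\<lambda>z. indicator (Tb N \<times> Tb N) z *\<^sub>R (g (snd z $ j) * h (upd j (fst z) (snd z))))"
    using integrable_distr_eq[OF m gm] product_tor(1)[OF assms] unfolding distr_swp e lborel_prod by blast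
  show "(LINT z|(lborel \<Otimes>\<^sub>M lborel). indicator (Tb N \<times> Tb N) z *\<^sub>R (g (snd z $ j) * h (upd j (fst z) (snd z)))) = (LINT x|tor N. g x) * (LINT x|tor N. h x)"
    using integral_distr[OF m gm] product_tor(2)[OF assms] unfolding distr_swp e lborel_prod by simp
qed

text \<open>The coordinate overwritten by \<open>upd j\<close> is still integrated, which produces
  the factor \<open>N ^ 3\<close> that the definition of \<open>rho_e\<close> divides out.\<close>

lemma slice_integral:
  fixes f :: "real^3^'n::finite \<Rightarrow> complex"
  assumes f: "f \<in> borel_measurable borel" "integrable (tor N) f"
  shows "integrable (tor N) (\<lambda>x. LINT y|tor N. f (upd j x y))"
    "(LINT x|tor N. LINT y|tor N. f (upd j x y)) = of_real (real N ^ 3) * (LINT y|tor N. f y)"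
proof -
  have o: "(\<lambda>x. 1 :: complex) \<in> borel_measurable (borel :: (real^3) measure)" "integrable (tor N :: (real^3) measure) (\<lambda>x. 1 :: complex)"
    by (auto intro: integrable_tor_bounded[where C=1])
  note p = product_tor_swp[OF o f, of j]
  have e: "(LINT y|lborel. indicator (Tb N \<times> Tb N) (x, y) *\<^sub>R (1 * f (upd j x y))) = indicator (Tb N) x *\<^sub>R (LINT y|tor N. f (upd j x y))" for x :: "real^3"
    unfolding set_integral_tor[symmetric] set_lebesgue_integral_def by (cases "x \<in> Tb N") (auto simp: indicator_def intro!: Bochner_Integration.integral_cong)
  have "integrable lborel (\<lambda>x. indicator (Tb N) x *\<^sub>R (LINT y|tor N. f (upd j x y)))"
    using lborel_pair.integrable_fst'[OF p(1)] by (simp add: e[simplified])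
  then show "integrable (tor N) (\<lambda>x. LINT y|tor N. f (upd j x y))"
    by (simp add: set_integrable_tor[symmetric] set_integrable_def)
  have "(LINT x|tor N. LINT y|tor N. f (upd j x y)) = (LINT x|lborel. indicator (Tb N) x *\<^sub>R (LINT y|tor N. f (upd j x y)))"
    unfolding set_integral_tor[symmetric] set_lebesgue_integral_def ..
  also have "\<dots> = (LINT x|(tor N :: (real^3) measure). 1) * (LINT x|tor N. f x)"
    using lborel_pair.integral_fst'[OF p(1)] unfolding p(2) fst_conv snd_conv e .
  also have "(LINT x|(tor N :: (real^3) measure). 1 :: complex) = of_real (real N ^ 3)"
    using integral_tor_const[where 'a="real^3" and c="1::complex" and N=N] by (simp add: scaleR_conv_of_real)
  finally show "(LINT x|tor N. LINT y|tor N. f (upd j x y)) = of_real (real N ^ 3) * (LINT y|tor N. f y)" .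
qed

lemma slice_measurable:
  fixes f :: "real^3^'n::finite \<Rightarrow> complex"
  assumes f: "f \<in> borel_measurable borel"
  shows "(\<lambda>x. LINT y|tor N. f (upd j x y)) \<in> borel_measurable borel"
proof -
  have u: "(\<lambda>z. f (upd j (fst z) (snd z))) \<in> borel_measurable borel"
    by (rule measurable_compose[OF borel_measurable_continuous_onI[OF upd_continuous] f])
  have "(\<lambda>z :: (real^3) \<times> (real^3^'n). indicator (Tb N) (snd z) *\<^sub>R f (upd j (fst z) (snd z))) \<in> borel_measurable (borel \<Otimes>\<^sub>M lborel)"
  proof -
    have "(\<lambda>z :: (real^3) \<times> (real^3^'n). indicator (Tb N) (snd z) *\<^sub>R f (upd j (fst z) (snd z))) \<in> borel_measurable (borel \<Otimes>\<^sub>M borel)"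
      using u unfolding borel_prod[symmetric] by measurable
    then show ?thesis by (subst measurable_cong_sets[OF sets_pair_measure_cong[OF refl sets_lborel] refl])
  qed
  then have "(\<lambda>x. LINT y|lborel. indicator (Tb N) y *\<^sub>R f (upd j x y)) \<in> borel_measurable borel"
    by (intro lborel.borel_measurable_lebesgue_integral) (simp add: case_prod_unfold)
  then show ?thesis unfolding set_integral_tor[symmetric] set_lebesgue_integral_def .
qed

lemma component_integrable:
  fixes g :: "real^3 \<Rightarrow> complex"
  assumes N: "N \<ge> 1" and g: "g \<in> borel_measurable borel" "integrable (tor N) g"
  shows "integrable (tor N) (\<lambda>y :: real^3^'n::finite. g (y $ j))"
proof -
  have o: "(\<lambda>x. 1 :: complex) \<in> borel_measurable (borel :: (real^3^'n) measure)" "integrable (tor N :: (real^3^'n) measure) (\<lambda>x. 1 :: complex)"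
    by (auto intro: integrable_tor_bounded[where C=1])
  have "integrable lborel (\<lambda>y. LINT x|lborel. indicator (Tb N \<times> Tb N) (x :: real^3, y) *\<^sub>R (g (y $ j) * 1))"
    using lborel_pair.integrable_snd[of "\<lambda>(x :: real^3) y. indicator (Tb N \<times> Tb N) (x, y) *\<^sub>R (g (y $ j) * 1)"] product_tor_swp(1)[OF g o, of j] by (simp add: case_prod_unfold)
  moreover have "(LINT x|lborel. indicator (Tb N \<times> Tb N) (x :: real^3, y) *\<^sub>R (g (y $ j) * 1)) = (real N ^ 3) *\<^sub>R (indicator (Tb N) y *\<^sub>R g (y $ j))" for y :: "real^3^'n"
  proof -
    have "(LINT x|lborel. indicator (Tb N \<times> Tb N) (x :: real^3, y) *\<^sub>R (g (y $ j) * 1)) = (LINT x|(lborel :: (real^3) measure). indicator (Tb N) x *\<^sub>R (indicator (Tb N) y *\<^sub>R g (y $ j)))"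
      by (intro Bochner_Integration.integral_cong) (auto simp: indicator_def)
    also have "\<dots> = (LINT x|(tor N :: (real^3) measure). indicator (Tb N) y *\<^sub>R g (y $ j))"
      unfolding set_integral_tor[symmetric] set_lebesgue_integral_def ..
    also have "\<dots> = (real N ^ 3) *\<^sub>R (indicator (Tb N) y *\<^sub>R g (y $ j))"
      by (simp only: integral_tor_const DIM_cart DIM_real) simp
    finally show ?thesis .
  qed
  ultimately have "integrable lborel (\<lambda>y. (real N ^ 3) *\<^sub>R (indicator (Tb N) y *\<^sub>R g (y $ j)))" by simp
  then have "integrable lborel (\<lambda>y :: real^3^'n. indicator (Tb N) y *\<^sub>R g (y $ j))"
    using N integrable_scaleR_right[of "1 / real N ^ 3" lborel "\<lambda>y. (real N ^ 3) *\<^sub>R (indicator (Tb N) y *\<^sub>R g (y $ j))"]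
    by (simp add: mult.assoc[symmetric])
  then show ?thesis by (simp add: set_integrable_tor[symmetric] set_integrable_def)
qed

text \<open>The character splits into a factor in the coordinate \<open>j\<close> and a factor of
  frequency \<open>k'\<close> in the others. The latter integrates to 0 unless
  \<open>k' = 0\<close>, so the coefficients live on one axis.\<close>

lemma fc_component:
  fixes g :: "real^3 \<Rightarrow> complex" and k :: "real^3^'n::finite"
  assumes N: "N \<ge> 1" and g: "g \<in> borel_measurable borel" "integrable (tor N) g" and k: "k \<in> latt"
  shows "fc N (\<lambda>y. g (y $ j)) k = (if k = axis j (k $ j) then fc N g (k $ j) else 0)"
proof -
  define k' where "k' = upd j 0 k"
  have k': "k' \<in> latt" unfolding latt_iff_nth k'_def upd_nth using k latt_nth[OF k] latt_closed(1) by auto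
  have ki: "k \<bullet> upd j x y = k $ j \<bullet> x + k' \<bullet> y" for x y
    unfolding inner_vec_def k'_def by (subst (1 2) sum.remove[of UNIV j]) (auto simp: upd_nth intro!: sum.cong)
  have eu: "ee N (- k) (upd j x y) = ee N (- (k $ j)) x * ee N (- k') y" for x y
    unfolding ee_def cis_mult inner_minus_left ki by (rule arg_cong[where f=cis]) (simp add: algebra_simps)
  have gm: "(\<lambda>y :: real^3^'n. g (y $ j)) \<in> borel_measurable borel"
    by (rule measurable_compose[OF _ g(1)]) (intro borel_measurable_continuous_onI continuous_intros)
  have m: "(\<lambda>y. g (y $ j) * ee N (- k) y) \<in> borel_measurable borel" using gm by measurable
  have i: "integrable (tor N) (\<lambda>y. g (y $ j) * ee N (- k) y)"
    by (rule integrable_tor_mult_bounded[OF component_integrable[OF N g], where C=1]) (auto simp: ee_simps)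
  have "of_real (real N ^ 3) * (LINT y|tor N. g (y $ j) * ee N (- k) y) = (LINT x|tor N. LINT y|tor N. g (upd j x y $ j) * ee N (- k) (upd j x y))"
    by (rule slice_integral(2)[OF m i, symmetric])
  also have "\<dots> = (LINT x|tor N. (g x * ee N (- (k $ j)) x) * (LINT y|tor N. ee N (- k') y))"
    by (simp add: upd_nth eu mult.assoc[symmetric])
  also have "\<dots> = (LINT x|tor N. g x * ee N (- (k $ j)) x) * (LINT y|tor N. ee N (- k') y)" by simp
  also have "\<dots> = (of_real (real N ^ 3) * fc N g (k $ j)) * (if k' = 0 then of_real (real N ^ DIM(real^3^'n)) else 0)"
    using integral_ee[OF N latt_closed(4)[OF k']] N by (simp add: fc_tor)
  finally have "of_real (real N ^ 3) * (LINT y|tor N. g (y $ j) * ee N (- k) y) = of_real (real N ^ 3) * (fc N g (k $ j) * (if k' = 0 then of_real (real N ^ DIM(real^3^'n)) else 0))"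
    by (simp only: mult.assoc)
  then have "(LINT y|tor N. g (y $ j) * ee N (- k) y) = fc N g (k $ j) * (if k' = 0 then of_real (real N ^ DIM(real^3^'n)) else 0)"
    using N by simp
  moreover have "k' = 0 \<longleftrightarrow> k = axis j (k $ j)" unfolding k'_def vec_eq_iff upd_nth axis_def by auto
  ultimately show ?thesis using N by (auto simp: fc_tor)
qed

section \<open>Coefficients of ion profiles, densities and products\<close>

lemma L2_continuous: "continuous_on UNIV f \<Longrightarrow> L2 N (f :: _ \<Rightarrow> complex)"
  unfolding L2_iff by (auto intro!: borel_measurable_continuous_onI integrable_tor_continuous continuous_intros)

lemma C2_continuous_derivative:
  assumes "C2 f"
  obtains D where "continuous_on UNIV f" "\<And>v. continuous_on UNIV (\<lambda>x. blinfun_apply (D x) v)"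
    "\<And>x v. ((\<lambda>t. complex_of_real (f (x + t *\<^sub>R v))) has_vector_derivative of_real (blinfun_apply (D x) v)) (at 0)"
proof -
  obtain D D2 where "\<forall>x. (f has_derivative blinfun_apply (D x)) (at x)" "\<forall>x. (D has_derivative blinfun_apply (D2 x)) (at x)"
    using assms unfolding C2_def by (elim exE conjE) (rule that; assumption)
  note D = this[rule_format]
  show thesis
  proof (rule that[of D])
    show "continuous_on UNIV f" using has_derivative_continuous[OF D(1)] by (simp add: continuous_on_eq_continuous_at)
    have "continuous_on UNIV D" using has_derivative_continuous[OF D(2)] by (simp add: continuous_on_eq_continuous_at)
    then show "continuous_on UNIV (\<lambda>x. blinfun_apply (D x) v)" for v by (intro continuous_intros)
    fix x v
    have "((\<lambda>t. f (x + t *\<^sub>R v)) has_derivative (\<lambda>t. blinfun_apply (D x) (t *\<^sub>R v))) (at 0)"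
      by (rule has_derivative_compose[where g=f and f="\<lambda>t. x + t *\<^sub>R v", simplified]) (auto intro!: derivative_eq_intros D(1))
    then have "((\<lambda>t. f (x + t *\<^sub>R v)) has_vector_derivative blinfun_apply (D x) v) (at 0)"
      by (simp add: has_vector_derivative_def blinfun.scaleR_right)
    from bounded_linear.has_vector_derivative[OF bounded_linear_of_real this]
    show "((\<lambda>t. complex_of_real (f (x + t *\<^sub>R v))) has_vector_derivative of_real (blinfun_apply (D x) v)) (at 0)" .
  qed
qed

lemma summable_on_finite_sum:
  fixes f :: "'i \<Rightarrow> 'k \<Rightarrow> real"
  assumes "\<And>i. i \<in> I \<Longrightarrow> f i summable_on A" shows "(\<lambda>k. \<Sum>i\<in>I. f i k) summable_on A"
  using assms by (induction I rule: infinite_finite_induct) (auto intro!: summable_on_add)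

text \<open>The squared weight collects the coefficients of the function and of its first partial
  derivatives, which are continuous and hence square integrable.\<close>

lemma C2_wt_summable:
  fixes f :: "'a::euclidean_space \<Rightarrow> real"
  assumes N: "N \<ge> 1" and f: "C2 f" "per N f"
  shows "(\<lambda>k. (cmod (of_real (wt N k) * fc N (\<lambda>x. of_real (f x)) k))\<^sup>2) summable_on latt"
proof -
  obtain D where D: "continuous_on UNIV f" "\<And>v. continuous_on UNIV (\<lambda>x. blinfun_apply (D x) v)"
    "\<And>x v. ((\<lambda>t. complex_of_real (f (x + t *\<^sub>R v))) has_vector_derivative of_real (blinfun_apply (D x) v)) (at 0)"
    by (rule C2_continuous_derivative[OF f(1)]) (rule that)
  let ?f = "\<lambda>x. complex_of_real (f x)"
  have c: "continuous_on UNIV ?f" using D(1) by (intro continuous_intros)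
  have c': "continuous_on UNIV (\<lambda>x. complex_of_real (blinfun_apply (D x) v))" for v by (rule continuous_on_of_real[OF D(2)])
  have p: "per N ?f" using f(2) by (simp add: per_def)
  have fc': "fc N (\<lambda>x. of_real (blinfun_apply (D x) v)) k = \<i> * of_real ((2 * pi / real N) * (k \<bullet> v)) * fc N ?f k" if "k \<in> latt" for k v
    by (rule fc_dir_derivative[OF N that c p c' D(3)])
  have s: "(\<lambda>k. (cmod (fc N ?f k))\<^sup>2 + (\<Sum>b\<in>Basis. (cmod (fc N (\<lambda>x. of_real (blinfun_apply (D x) b)) k))\<^sup>2)) summable_on latt"
    by (intro summable_on_add summable_on_finite_sum parseval(1)[OF N] L2_continuous c c') 
  show ?thesis
  proof (rule summable_on_cong[THEN iffD1, OF _ s])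
    fix k :: 'a assume k: "k \<in> latt"
    have "(cmod (of_real (wt N k) * fc N ?f k))\<^sup>2 = (1 + (2 * pi / real N)\<^sup>2 * (\<Sum>b\<in>Basis. (k \<bullet> b)\<^sup>2)) * (cmod (fc N ?f k))\<^sup>2"
      using wt_sq[of N k] by (simp only: norm_mult norm_of_real power_mult_distrib power2_abs norm_sq_Basis)
    also have "\<dots> = (cmod (fc N ?f k))\<^sup>2 + (\<Sum>b\<in>Basis. ((2 * pi / real N) * (k \<bullet> b))\<^sup>2 * (cmod (fc N ?f k))\<^sup>2)"
      by (simp only: distrib_right mult_1 sum_distrib_left sum_distrib_right power_mult_distrib mult.assoc)
    also have "\<dots> = (cmod (fc N ?f k))\<^sup>2 + (\<Sum>b\<in>Basis. (cmod (fc N (\<lambda>x. of_real (blinfun_apply (D x) b)) k))\<^sup>2)"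
      by (simp only: fc'[OF k] norm_mult norm_of_real norm_ii mult_1 power_mult_distrib[of "cmod _"] power_mult_distrib[of "abs _"] power2_abs mult_1)
    finally show "(cmod (fc N ?f k))\<^sup>2 + (\<Sum>b\<in>Basis. (cmod (fc N (\<lambda>x. of_real (blinfun_apply (D x) b)) k))\<^sup>2) = (cmod (of_real (wt N k) * fc N ?f k))\<^sup>2" ..
  qed
qed

lemma fc_shift:
  fixes f :: "'a::euclidean_space \<Rightarrow> complex"
  assumes N: "N \<ge> 1" and f: "L2 N f" "per N f" and k: "k \<in> latt"
  shows "fc N (\<lambda>x. f (x - a)) k = ee N (- k) a * fc N f k"
proof -
  let ?g = "\<lambda>x. f x * ee N (- k) x"
  have gm: "?g \<in> borel_measurable borel" using L2_measurable[OF f(1)] by measurable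
  have gp: "per N ?g" using f(2) ee_per[OF N latt_closed(4)[OF k]] by (simp add: per_def)
  have gi: "integrable (tor N) ?g" by (rule integrable_tor_mult_bounded[OF L2_integrable[OF f(1)], where C=1]) (auto simp: ee_simps)
  have "(LINT x|tor N. f (x - a) * ee N (- k) x) = (LINT x|tor N. ee N (- k) a * ?g (x + - a))"
  proof (intro Bochner_Integration.integral_cong refl)
    fix x :: 'a
    have "ee N (- k) x = ee N (- k) (x - a) * ee N (- k) a" using ee_simps(3)[of N "- k" "x - a" a] by (simp only: diff_add_cancel)
    then show "f (x - a) * ee N (- k) x = ee N (- k) a * ?g (x + - a)" by (simp only: add_uminus_conv_diff mult_ac)
  qed
  also have "\<dots> = ee N (- k) a * (LINT x|tor N. ?g (x + - a))" by (rule integral_mult_right_zero)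
  also have "(LINT x|tor N. ?g (x + - a)) = (LINT x|tor N. ?g x)" using tor_shift[OF N gm gp gi, of "- a"] by blast
  finally show ?thesis by (simp add: fc_tor)
qed

lemma fc_real_herm: "fc N (\<lambda>x. complex_of_real (f x)) (- k) = cnj (fc N (\<lambda>x. complex_of_real (f x)) k)"
  using fc_cnj[of N "\<lambda>x. complex_of_real (f x)" "- k"] by simp

text \<open>Averaging the complex function with its conjugate makes it real and, the coefficients
  being Hermitian, does not change them.\<close>

lemma riesz_fischer_real:
  fixes c :: "'a::euclidean_space \<Rightarrow> complex"
  assumes N: "N \<ge> 1" and c: "(\<lambda>k. (cmod (c k))\<^sup>2) summable_on latt" "\<And>k. k \<in> latt \<Longrightarrow> c (- k) = cnj (c k)"
  obtains g where "L2 N (\<lambda>x. complex_of_real (g x))" "per N g" "g \<in> borel_measurable borel" "integrable (tor N) g"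
    "\<And>k. k \<in> latt \<Longrightarrow> fc N (\<lambda>x. complex_of_real (g x)) k = c k"
proof -
  obtain h where h: "L2 N h" "per N h" "\<And>k. k \<in> latt \<Longrightarrow> fc N h k = c k"
    by (rule riesz_fischer[OF N c(1)]) (rule that)
  have i: "integrable (tor N) h" by (rule L2_integrable[OF h(1)])
  have e: "complex_of_real (Re (h x)) = (1/2) * (h x + cnj (h x))" for x by (simp add: complex_add_cnj)
  have ic: "integrable (tor N) (\<lambda>x. cnj (h x))" by (rule L2_integrable[OF L2_cnj[OF h(1)]])
  have ia: "integrable (tor N) (\<lambda>x. h x + cnj (h x))" using i ic by simp
  show thesis
  proof (rule that[of "\<lambda>x. Re (h x)"])
    show "L2 N (\<lambda>x. complex_of_real (Re (h x)))" unfolding e by (intro L2_cmult L2_add L2_cnj h(1))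
    show "per N (\<lambda>x. Re (h x))" using h(2) by (simp add: per_def)
    show "(\<lambda>x. Re (h x)) \<in> borel_measurable borel" using L2_measurable[OF h(1)] by simp
    show "integrable (tor N) (\<lambda>x. Re (h x))" using i by simp
    fix k :: 'a assume k: "k \<in> latt"
    show "fc N (\<lambda>x. complex_of_real (Re (h x))) k = c k"
      unfolding e fc_linear(3)[OF ia ia] fc_linear(1)[OF i ic] fc_cnj h(3)[OF k] h(3)[OF latt_closed(4)[OF k]] c(2)[OF k] by simp
  qed
qed

lemma weak_deriv_real_exists:
  fixes f :: "'a::euclidean_space \<Rightarrow> real"
  assumes N: "N \<ge> 1" and f: "L2 N (\<lambda>x. complex_of_real (f x))"
    and s: "(\<lambda>k. (cmod (\<i> * of_real ((2 * pi / real N) * (k \<bullet> v)) * fc N (\<lambda>x. of_real (f x)) k))\<^sup>2) summable_on latt"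
  shows "\<exists>g. weak_deriv N f v g \<and> L2 N (\<lambda>x. complex_of_real (g x))"
proof -
  let ?c = "\<lambda>k. \<i> * of_real ((2 * pi / real N) * (k \<bullet> v)) * fc N (\<lambda>x. of_real (f x)) k"
  obtain g where g: "L2 N (\<lambda>x. complex_of_real (g x))" "per N g" "g \<in> borel_measurable borel" "integrable (tor N) g"
    "\<And>k. k \<in> latt \<Longrightarrow> fc N (\<lambda>x. complex_of_real (g x)) k = ?c k"
  proof (rule riesz_fischer_real[OF N s])
    show "?c (- k) = cnj (?c k)" for k by (simp add: fc_real_herm)
  qed (rule that)
  have "(LINT x|tor N. f x * \<phi>' x) = - (LINT x|tor N. g x * \<phi> x)"
    if p: "smooth \<phi>" "per N \<phi>" and d: "\<And>x. ((\<lambda>t. \<phi> (x + t *\<^sub>R v)) has_vector_derivative \<phi>' x) (at 0)" for \<phi> \<phi>'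
  proof -
    have "(LINT x|tor N. complex_of_real (f x) * complex_of_real (\<phi>' x)) = - (LINT x|tor N. complex_of_real (g x) * complex_of_real (\<phi> x))"
    proof (rule integration_by_parts_L2[OF N f g(1) g(5)])
      show "continuous_on UNIV (\<lambda>x. complex_of_real (\<phi> x))" "continuous_on UNIV (\<lambda>x. complex_of_real (\<phi>' x))"
        using smooth_derivative_continuous[OF p(1) d] by (auto intro!: continuous_intros)
      show "per N (\<lambda>x. complex_of_real (\<phi> x))" using p(2) by (simp add: per_def)
      show "((\<lambda>t. complex_of_real (\<phi> (x + t *\<^sub>R v))) has_vector_derivative complex_of_real (\<phi>' x)) (at 0)" for x
        by (rule bounded_linear.has_vector_derivative[OF bounded_linear_of_real d])
    qed
    then have "complex_of_real (LINT x|tor N. f x * \<phi>' x) = complex_of_real (- (LINT x|tor N. g x * \<phi> x))"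
      by (simp only: of_real_mult[symmetric] integral_complex_of_real of_real_minus)
    then show ?thesis by (simp only: of_real_eq_iff)
  qed
  then have "weak_deriv N f v g" using g(2-4) unfolding weak_deriv_def set_integral_tor set_integrable_tor by blast
  then show ?thesis using g(1) by blast
qed

lemma parseval_real:
  fixes f g :: "'a::euclidean_space \<Rightarrow> real"
  assumes N: "N \<ge> 1" and f: "L2 N (\<lambda>x. complex_of_real (f x))" and g: "L2 N (\<lambda>x. complex_of_real (g x))"
    and u: "\<And>k. k \<in> latt \<Longrightarrow> cf u k = of_real c * fc N (\<lambda>x. of_real (f x)) k" "\<And>k. k \<notin> latt \<Longrightarrow> cf u k = 0"
    and v: "\<And>k. k \<in> latt \<Longrightarrow> cf v k = of_real d * fc N (\<lambda>x. of_real (g x)) k"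
  shows "inner u v = c * d * (LINT x|tor N. f x * g x) / real N ^ DIM('a)"
proof -
  let ?I = "(LINT x|tor N. f x * g x) / real N ^ DIM('a)"
  have I: "(LINT x|tor N. complex_of_real (f x) * cnj (complex_of_real (g x))) / real N ^ DIM('a) = complex_of_real ?I"
    by (simp only: complex_cnj_complex_of_real of_real_mult[symmetric] integral_complex_of_real of_real_divide of_real_power of_real_of_nat_eq)
  have "((\<lambda>k. Re (fc N (\<lambda>x. complex_of_real (f x)) k * cnj (fc N (\<lambda>x. complex_of_real (g x)) k))) has_sum Re (complex_of_real ?I)) latt"
    by (rule has_sum_bounded_linear[OF bounded_linear_Re parseval_inner[OF N f g, unfolded I], unfolded o_def])
  then have "((\<lambda>k. Re (fc N (\<lambda>x. complex_of_real (f x)) k * cnj (fc N (\<lambda>x. complex_of_real (g x)) k))) has_sum ?I) latt"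
    by (simp only: Re_complex_of_real)
  from has_sum_cmult_right[OF this, of "c * d"]
  have 1: "((\<lambda>k. c * d * Re (fc N (\<lambda>x. complex_of_real (f x)) k * cnj (fc N (\<lambda>x. complex_of_real (g x)) k))) has_sum (c * d * ((LINT x|tor N. f x * g x) / real N ^ DIM('a)))) latt" .
  have "inner u v = infsum (\<lambda>k. Re (cf u k * cnj (cf v k))) latt"
    unfolding inner_ell2_def by (rule infsum_cong_neutral) (auto simp: u(2))
  also have "\<dots> = infsum (\<lambda>k. c * d * Re (fc N (\<lambda>x. complex_of_real (f x)) k * cnj (fc N (\<lambda>x. complex_of_real (g x)) k))) latt"
    by (rule infsum_cong) (simp add: u(1) v algebra_simps)
  also have "\<dots> = c * d * ((LINT x|tor N. f x * g x) / real N ^ DIM('a))" by (rule infsumI[OF 1])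
  finally show ?thesis by simp
qed

text \<open>The character in the coordinate \<open>j\<close> is absorbed into one of the two copies
  of \<open>f\<close>, where it shifts the frequency by \<open>axis j m\<close>; Parseval then gives
  an autocorrelation of the coefficients.\<close>

lemma fc_density:
  fixes f :: "real^3^'n::finite \<Rightarrow> complex"
  assumes N: "N \<ge> 1" and f: "L2 N f" and m: "m \<in> latt"
  shows "fc N (\<lambda>x. of_real (LINT y|tor N. (cmod (f (upd j x y)))\<^sup>2)) m = of_real (real N ^ DIM(real^3^'n)) * (\<Sum>\<^sub>\<infinity>b\<in>latt. fc N f (b + axis j m) * cnj (fc N f b))"
    "(\<lambda>x. LINT y|tor N. (cmod (f (upd j x y)))\<^sup>2) \<in> borel_measurable borel"
    "integrable (tor N) (\<lambda>x. LINT y|tor N. (cmod (f (upd j x y)))\<^sup>2)"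
proof -
  let ?F = "\<lambda>y. complex_of_real ((cmod (f y))\<^sup>2)" and ?a = "axis j m :: real^3^'n"
  let ?V = "real N ^ DIM(real^3^'n)"
  have a: "?a \<in> latt" by (rule latt_axis[OF m])
  have Fm: "?F \<in> borel_measurable borel" using L2_measurable[OF f] by measurable
  have Fi: "integrable (tor N) ?F" using f by (simp add: L2_iff complex_of_real_integrable_eq del: of_real_power)
  have c: "(LINT y|tor N. ?F (upd j x y)) = complex_of_real (LINT y|tor N. (cmod (f (upd j x y)))\<^sup>2)" for x
    by (rule integral_complex_of_real)
  show "integrable (tor N) (\<lambda>x. LINT y|tor N. (cmod (f (upd j x y)))\<^sup>2)"
    using slice_integral(1)[OF Fm Fi, of j] unfolding c by (simp add: complex_of_real_integrable_eq)
  have "(\<lambda>x. Re (complex_of_real (LINT y|tor N. (cmod (f (upd j x y)))\<^sup>2))) \<in> borel_measurable borel"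
    using slice_measurable[OF Fm, of N j] unfolding c by (rule measurable_compose) (rule borel_measurable_Re)
  then show "(\<lambda>x. LINT y|tor N. (cmod (f (upd j x y)))\<^sup>2) \<in> borel_measurable borel" by simp
  have Gm: "(\<lambda>y. ?F y * ee N (- ?a) y) \<in> borel_measurable borel" using Fm by measurable
  have Gi: "integrable (tor N) (\<lambda>y. ?F y * ee N (- ?a) y)"
    by (rule integrable_tor_mult_bounded[OF Fi, where C=1]) (auto simp: ee_simps)
  have eu: "ee N (- ?a) (upd j x y) = ee N (- m) x" for x y
  proof -
    have "?a \<bullet> upd j x y = m \<bullet> x" unfolding inner_commute[of ?a] inner_axis by (simp add: upd_nth inner_commute)
    then show ?thesis by (simp add: ee_def)
  qed
  have "(LINT x|tor N. complex_of_real (LINT y|tor N. (cmod (f (upd j x y)))\<^sup>2) * ee N (- m) x) = (LINT x|tor N. LINT y|tor N. ?F (upd j x y) * ee N (- ?a) (upd j x y))"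
    unfolding c[symmetric] eu integral_mult_left_zero ..
  also have "\<dots> = of_real (real N ^ 3) * (LINT y|tor N. ?F y * ee N (- ?a) y)" by (rule slice_integral(2)[OF Gm Gi])
  also have "(LINT y|tor N. ?F y * ee N (- ?a) y) = (LINT y|tor N. f y * cnj (f y * ee N ?a y))"
    by (intro Bochner_Integration.integral_cong refl) (simp only: complex_norm_square complex_cnj_mult ee_simps(4) mult.assoc)
  finally have 1: "fc N (\<lambda>x. of_real (LINT y|tor N. (cmod (f (upd j x y)))\<^sup>2)) m = (LINT y|tor N. f y * cnj (f y * ee N ?a y))"
    using N by (simp add: fc_tor)
  have L: "L2 N (\<lambda>y. f y * ee N ?a y)"
    using L2_mult_bounded[OF f ee_measurable[of N "?a"], where C=1] by (simp add: ee_simps mult.commute)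
  have "((\<lambda>k. fc N f k * cnj (fc N f (k - ?a))) has_sum ((LINT y|tor N. f y * cnj (f y * ee N ?a y)) / ?V)) latt"
    using parseval_inner[OF N f L] unfolding fc_mult_ee .
  then have "(\<Sum>\<^sub>\<infinity>k\<in>latt. fc N f k * cnj (fc N f (k - ?a))) = (LINT y|tor N. f y * cnj (f y * ee N ?a y)) / ?V" by (rule infsumI)
  moreover have "(\<Sum>\<^sub>\<infinity>k\<in>latt. fc N f k * cnj (fc N f (k - ?a))) = (\<Sum>\<^sub>\<infinity>b\<in>latt. fc N f (b + ?a) * cnj (fc N f b))"
  proof (rule infsum_reindex_bij_witness[where j="\<lambda>k. k - ?a" and i="\<lambda>b. b + ?a"])
    show "k - ?a \<in> latt" if "k \<in> latt" for k using latt_closed(3)[OF that a] .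
    show "k + ?a \<in> latt" if "k \<in> latt" for k using latt_closed(2)[OF that a] .
  qed auto
  ultimately show "fc N (\<lambda>x. of_real (LINT y|tor N. (cmod (f (upd j x y)))\<^sup>2)) m = of_real ?V * (\<Sum>\<^sub>\<infinity>b\<in>latt. fc N f (b + ?a) * cnj (fc N f b))"
    using N unfolding 1 by simp
qed

text \<open>A convolution obtained from Parseval. Only frequencies on the \<open>j\<close>-th axis
  contribute, so the sum over the frequencies of all particles collapses to a three-dimensional
  one.\<close>

lemma fc_component_mult:
  fixes f :: "real^3^'n::finite \<Rightarrow> complex" and g :: "real^3 \<Rightarrow> complex"
  assumes N: "N \<ge> 1" and f: "L2 N f" and g: "L2 N g" and a: "a \<in> latt"
  shows "fc N (\<lambda>x. g (x $ j) * f x) a = (\<Sum>\<^sub>\<infinity>m\<in>latt. fc N g m * fc N f (a - axis j m))"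
    "integrable (tor N) (\<lambda>x. g (x $ j) * f x)"
proof -
  let ?V = "real N ^ DIM(real^3^'n)"
  have gm: "(\<lambda>y :: real^3^'n. g (y $ j)) \<in> borel_measurable borel"
    by (rule measurable_compose[OF _ L2_measurable[OF g]]) (intro borel_measurable_continuous_onI continuous_intros)
  have L: "L2 N (\<lambda>y :: real^3^'n. g (y $ j))"
  proof -
    have "integrable (tor N) (\<lambda>y :: real^3^'n. complex_of_real ((cmod (g (y $ j)))\<^sup>2))"
      by (rule component_integrable[OF N]) (use g in \<open>auto simp: L2_iff complex_of_real_integrable_eq simp del: of_real_power\<close>)
    then show ?thesis using gm by (simp add: L2_iff complex_of_real_integrable_eq del: of_real_power)
  qed
  show "integrable (tor N) (\<lambda>x. g (x $ j) * f x)" by (rule L2_mult_integrable[OF L f])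
  have L': "L2 N (\<lambda>y. cnj (f y) * ee N a y)"
    using L2_mult_bounded[OF L2_cnj[OF f] ee_measurable[of N a], where C=1] by (simp add: ee_simps mult.commute)
  have gk: "fc N (\<lambda>y. g (y $ j)) k = (if k = axis j (k $ j) then fc N g (k $ j) else 0)" if "k \<in> latt" for k :: "real^3^'n"
    by (rule fc_component[OF N L2_measurable[OF g] L2_integrable[OF g] that])
  have I: "(LINT y|tor N. g (y $ j) * cnj (cnj (f y) * ee N a y)) / ?V = fc N (\<lambda>x. g (x $ j) * f x) a"
    by (simp add: fc_tor ee_simps(4) mult.assoc)
  have "fc N (\<lambda>x. g (x $ j) * f x) a = (\<Sum>\<^sub>\<infinity>k\<in>latt. fc N (\<lambda>y. g (y $ j)) k * fc N f (a - k))"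
    using infsumI[OF parseval_inner[OF N L L', unfolded I fc_mult_ee fc_cnj complex_cnj_cnj minus_diff_eq]] ..
  also have "\<dots> = (\<Sum>\<^sub>\<infinity>k\<in>axis j ` latt. fc N (\<lambda>y. g (y $ j)) k * fc N f (a - k))"
  proof (rule infsum_cong_neutral)
    fix k :: "real^3^'n" assume k: "k \<in> latt - axis j ` latt"
    then have "k \<noteq> axis j (k $ j)" using latt_nth[of k j] by blast
    then show "fc N (\<lambda>y. g (y $ j)) k * fc N f (a - k) = 0" using gk k by simp
  qed (auto simp: latt_axis)
  also have "\<dots> = (\<Sum>\<^sub>\<infinity>m\<in>latt. fc N g m * fc N f (a - axis j m))"
    by (subst infsum_reindex) (auto simp: inj_on_def axis_eq_axis o_def gk[OF latt_axis] intro!: infsum_cong)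
  finally show "fc N (\<lambda>x. g (x $ j) * f x) a = (\<Sum>\<^sub>\<infinity>m\<in>latt. fc N g m * fc N f (a - axis j m))" .
qed

lemma summable_on_cf_latt: "(\<lambda>k. (cmod (cf u k))\<^sup>2) summable_on A"
  by (rule summable_on_subset_banach[OF cf_norm_summable]) simp

section \<open>The Schroedinger--Poisson--Newton system\<close>

text \<open>\<open>g\<close> identifies the index type of the electrons with the ion sites, so that
  positions and momenta become vectors in \<open>real^3^'n\<close>.\<close>

locale spn_system =
  fixes N :: nat and e M :: real and \<sigma> :: "real^3 \<Rightarrow> real" and g :: "'n::finite \<Rightarrow> int^3"
  assumes N1: "N \<ge> 1" and M0: "M > 0" and e0: "e \<noteq> 0" and sC2: "C2 \<sigma>" and sper: "per N \<sigma>" and g: "bij_betw g UNIV (Gam N)"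
begin

abbreviation sc :: "real^3 \<Rightarrow> complex" where "sc x \<equiv> complex_of_real (\<sigma> x)"

text \<open>The factor \<open>wt\<close> is divided out again by \<open>Eph\<close>; it makes \<open>Eph\<close> Lipschitz in the position.\<close>

definition sg :: "'n \<Rightarrow> (real^3) ell2" where
  "sg n = Ell2 (\<lambda>m. if m \<in> latt then of_real (real N ^ 3) * ee N (- m) (rv (g n)) * (of_real (wt N m) * fc N sc m) else 0)"

lemma cf_sg: "cf (sg n) m = (if m \<in> latt then of_real (real N ^ 3) * ee N (- m) (rv (g n)) * (of_real (wt N m) * fc N sc m) else 0)"
proof -
  have "(\<lambda>m. (cmod (of_real (real N ^ 3) * ee N (- m) (rv (g n)) * (of_real (wt N m) * fc N sc m)))\<^sup>2) summable_on latt"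
    unfolding norm_mult[of "of_real _ * ee N _ _"] norm_mult[of "of_real _" "ee N _ _"] power_mult_distrib[of "cmod _ * cmod _"]
    unfolding ee_simps(5) by (intro summable_on_cmult_right C2_wt_summable[OF N1 sC2 sper])
  then show ?thesis unfolding sg_def by (simp only: cf_Ell2[OF sq_summable_latt])
qed

lemma herm_sg: "herm (sg n)"
  unfolding herm_def cf_sg
proof
  fix m :: "real^3"
  have "- m \<in> latt \<longleftrightarrow> m \<in> latt" using latt_closed(4)[of m] latt_closed(4)[of "- m"] by auto
  then show "(if - m \<in> latt then of_real (real N ^ 3) * ee N (- (- m)) (rv (g n)) * (of_real (wt N (- m)) * fc N sc (- m)) else 0)
    = cnj (if m \<in> latt then of_real (real N ^ 3) * ee N (- m) (rv (g n)) * (of_real (wt N m) * fc N sc m) else 0)"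
    by (simp add: fc_real_herm ee_simps(4))
qed

sublocale spn N e M sg
  by unfold_locales (rule N1, rule M0, rule herm_sg)

lemma sig_cont: "continuous_on UNIV \<sigma>"
  by (rule C2_continuous_derivative[OF sC2])

lemma sc_L2: "L2 N (\<lambda>x. sc (x - a))"
  by (intro L2_continuous continuous_on_of_real continuous_on_compose2[OF sig_cont]) (auto intro!: continuous_intros)

lemma sig_teq: assumes "teq N a b" shows "\<sigma> (x - a) = \<sigma> (x - b)"
proof -
  obtain m where m: "m \<in> latt" "a - b = real N *\<^sub>R m" using assms unfolding teq_def by blast
  have "x - b = x - a + real N *\<^sub>R m" unfolding m(2)[symmetric] by simp
  then have "\<sigma> (x - b) = \<sigma> (x - a + real N *\<^sub>R m)" by (rule arg_cong)
  then show ?thesis unfolding perD[OF sper m(1)] ..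
qed

lemma cf_Eph_sg: 
  assumes m: "m \<in> latt" shows "cf (Eph a (sg n)) m = of_real (real N ^ 3) * fc N (\<lambda>x. sc (x - rv (g n) - a)) m"
proof -
  have e: "ee N (- m) a = cis (- kap * (m \<bullet> a))" by (simp add: ee_def kap_def)
  have p: "per N sc" using sper by (simp add: per_def)
  have w: "complex_of_real (1 / wt N m) * (complex_of_real (wt N m) * z) = z" for z
    using wt_pos[of N m] by (simp flip: of_real_mult mult.assoc)
  have "fc N (\<lambda>x. sc (x - (rv (g n) + a))) m = ee N (- m) (rv (g n) + a) * fc N sc m"
    by (rule fc_shift[OF N1 _ p m]) (use sc_L2[of 0] in simp)
  then have f: "fc N (\<lambda>x. sc (x - rv (g n) - a)) m = ee N (- m) (rv (g n)) * ee N (- m) a * fc N sc m"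
    by (simp only: diff_diff_eq ee_simps(3))
  have "cf (Eph a (sg n)) m = (cis (- kap * (m \<bullet> a)) * of_real (1 / wt N m)) * (of_real (real N ^ 3) * ee N (- m) (rv (g n)) * (of_real (wt N m) * fc N sc m))"
    using m unfolding Eph_def cf_diag[OF Eph_multiplier_le] cf_sg by (simp only: if_True)
  also have "\<dots> = of_real (real N ^ 3) * (ee N (- m) (rv (g n)) * cis (- kap * (m \<bullet> a)) * (of_real (1 / wt N m) * (of_real (wt N m) * fc N sc m)))"
    by (simp only: mult_ac)
  finally show ?thesis unfolding f w e by (simp only: mult_ac)
qed

lemma cf_Eph_sg_outside: "m \<notin> latt \<Longrightarrow> cf (Eph a (sg n)) m = 0"
  unfolding Eph_def cf_diag[OF Eph_multiplier_le] cf_sg by simp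

lemma cf_rr_outside: "m \<notin> latt \<Longrightarrow> cf (rr u q) m = 0"
  unfolding rr_def Sq_def by (simp add: cf_Eph_sg_outside cf_Dop_outside[OF N1])

text \<open>The vector \<open>q\<close> lifts the positions continuously, while \<open>qs X\<close> is determined only modulo \<open>N\<close>.\<close>

definition cst :: "'n state \<Rightarrow> real^3^'n \<Rightarrow> bool" where
  "cst X q \<longleftrightarrow> H1 N (wf X) \<and> (\<forall>n. teq N (qs X (g n)) (q $ n))"

lemma sum_Gam: "(\<Sum>n\<in>Gam N. f n) = (\<Sum>n\<in>UNIV. f (g n))"
  by (rule sum.reindex_bij_betw[OF g, symmetric])

lemma rho_eq:
  assumes "cst X q"
  shows "rho N e \<sigma> X x = (\<Sum>n\<in>UNIV. \<sigma> (x - rv (g n) - q $ n)) + (\<Sum>j\<in>UNIV. (- e * c3) * (LINT y|tor N. (cmod (wf X (upd j x y)))\<^sup>2))"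
proof -
  have "\<sigma> (x - rv (g n) - qs X (g n)) = \<sigma> (x - rv (g n) - q $ n)" for n
    by (rule sig_teq) (use assms in \<open>auto simp: cst_def\<close>)
  then show ?thesis
    unfolding rho_def rho_i_def rho_e_def sum_Gam set_integral_tor upd_def[symmetric] c3_def sum_distrib_left by simp
qed

text \<open>The squared modulus of the wave function is a priori only integrable. That the density
  is square integrable is read off its coefficients, which are those of the \<open>ell2\<close>
  vector \<open>rr\<close> up to a constant.\<close>

lemma rho_facts:
  assumes X: "cst X q"
  shows "rho N e \<sigma> X \<in> borel_measurable borel" "integrable (tor N) (rho N e \<sigma> X)"
    "m \<in> latt \<Longrightarrow> cf (rr (Cf N (wf X)) q) m = of_real (real N ^ 3) * fc N (\<lambda>x. of_real (rho N e \<sigma> X x)) m"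
    "L2 N (\<lambda>x. complex_of_real (rho N e \<sigma> X x))"
proof -
  have H: "H1 N (wf X)" and L: "L2 N (wf X)" using X by (auto simp: cst_def H1_def)
  let ?d = "\<lambda>j x. LINT y|tor N. (cmod (wf X (upd j x y)))\<^sup>2"
  note d = fc_density[OF N1 L]
  have z: "(0 :: real^3) \<in> latt" by (rule latt_closed(1))
  have eq: "rho N e \<sigma> X = (\<lambda>x. (\<Sum>n\<in>UNIV. \<sigma> (x - rv (g n) - q $ n)) + (\<Sum>j\<in>UNIV. (- e * c3) * ?d j x))"
    by (rule ext) (rule rho_eq[OF X])
  have sm: "continuous_on UNIV (\<lambda>x. \<sigma> (x - a - b))" for a b
    by (rule continuous_on_compose2[OF sig_cont]) (auto intro!: continuous_intros)
  show m: "rho N e \<sigma> X \<in> borel_measurable borel" unfolding eq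
    by (intro borel_measurable_add borel_measurable_sum borel_measurable_times borel_measurable_const d(2)[OF z] borel_measurable_continuous_onI[OF sm])
  show i: "integrable (tor N) (rho N e \<sigma> X)" unfolding eq
    by (intro Bochner_Integration.integrable_add Bochner_Integration.integrable_sum integrable_mult_right d(3)[OF z] integrable_tor_continuous[OF sm])
  have is': "integrable (tor N) (\<lambda>x. sc (x - a - b))" for a b using L2_integrable[OF sc_L2[of "a + b"]] by (simp add: diff_diff_eq)
  have id: "integrable (tor N) (\<lambda>x. complex_of_real (?d j x))" for j using d(3)[OF z] by (simp add: complex_of_real_integrable_eq)
  show *: "cf (rr (Cf N (wf X)) q) m = of_real (real N ^ 3) * fc N (\<lambda>x. of_real (rho N e \<sigma> X x)) m" if m: "m \<in> latt" for m
  proof -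
    let ?V = "real N ^ DIM(real^3^'n)"
    have idc: "integrable (tor N) (\<lambda>x. of_real (- e * c3) * complex_of_real (?d j x))" for j using id by (rule integrable_mult_right)
    have "fc N (\<lambda>x. of_real (rho N e \<sigma> X x)) m = fc N (\<lambda>x. (\<Sum>n\<in>UNIV. sc (x - rv (g n) - q $ n)) + (\<Sum>j\<in>UNIV. of_real (- e * c3) * of_real (?d j x))) m"
      unfolding eq of_real_add of_real_sum of_real_mult ..
    also have "\<dots> = (\<Sum>n\<in>UNIV. fc N (\<lambda>x. sc (x - rv (g n) - q $ n)) m) + (\<Sum>j\<in>UNIV. of_real (- e * c3) * fc N (\<lambda>x. of_real (?d j x)) m)"
      by (subst fc_linear(1), intro Bochner_Integration.integrable_sum is', intro Bochner_Integration.integrable_sum idc)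
         (simp only: fc_sum[OF is'] fc_sum[OF idc] fc_linear(3)[OF id id])
    finally have 1: "of_real (real N ^ 3) * fc N (\<lambda>x. of_real (rho N e \<sigma> X x)) m = (\<Sum>n\<in>UNIV. of_real (real N ^ 3) * fc N (\<lambda>x. sc (x - rv (g n) - q $ n)) m)
       + (\<Sum>j\<in>UNIV. of_real (real N ^ 3) * of_real (- e * c3) * fc N (\<lambda>x. of_real (?d j x)) m)"
      by (simp only: distrib_left sum_distrib_left mult.assoc)
    have c: "complex_of_real (real N ^ 3) * of_real (- e * c3) = of_real (- e)" using N1 unfolding of_real_mult[symmetric] c3_def by simp
    have V: "complex_of_real (sqrt ?V) * of_real (sqrt ?V) = of_real ?V" unfolding of_real_mult[symmetric] by simp
    have k: "cf (Cf N (wf X)) k / of_real (wt N k) = of_real (sqrt ?V) * fc N (wf X) k" if "k \<in> latt" for k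
      using that wt_pos[of N k] by (simp add: cf_Cf[OF N1 H] mult.assoc)
    have "cf (Dop N (Cf N (wf X)) (Cf N (wf X))) m = (\<Sum>j\<in>UNIV. fc N (\<lambda>x. of_real (?d j x)) m)"
      unfolding cf_Dop[OF N1 m] d(1)[OF m] infsum_cmult_right'[symmetric]
    proof (intro sum.cong refl infsum_cong)
      fix j :: 'n and b :: "real^3^'n" assume b: "b \<in> latt"
      have ba: "b + axis j m \<in> latt" by (rule latt_closed(2)[OF b latt_axis[OF m]])
      show "cf (Cf N (wf X)) (b + axis j m) / of_real (wt N (b + axis j m)) * cnj (cf (Cf N (wf X)) b / of_real (wt N b))
         = of_real ?V * (fc N (wf X) (b + axis j m) * cnj (fc N (wf X) b))"
        unfolding k[OF b] k[OF ba] V[symmetric] by simp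
    qed
    then show ?thesis
      unfolding 1 c rr_def Sq_def cf_diff cf_sum cf_simps cf_Eph_sg[OF m] by (simp add: sum_distrib_left scaleR_conv_of_real sum_negf)
  qed
  show "L2 N (\<lambda>x. complex_of_real (rho N e \<sigma> X x))"
  proof (rule L2_of_coefficients[OF N1])
    show "(\<lambda>x. complex_of_real (rho N e \<sigma> X x)) \<in> borel_measurable borel" using m by measurable
    show "integrable (tor N) (\<lambda>x. complex_of_real (rho N e \<sigma> X x))" using i by (simp add: complex_of_real_integrable_eq)
    show "(\<lambda>k. (cmod (fc N (\<lambda>x. complex_of_real (rho N e \<sigma> X x)) k))\<^sup>2) summable_on latt"
    proof (rule summable_on_cong[THEN iffD2, OF _ summable_on_cf_latt[of "c3 *\<^sub>R rr (Cf N (wf X)) q"]])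
      fix m :: "real^3" assume "m \<in> latt"
      then show "(cmod (fc N (\<lambda>x. complex_of_real (rho N e \<sigma> X x)) m))\<^sup>2 = (cmod (cf (c3 *\<^sub>R rr (Cf N (wf X)) q) m))\<^sup>2"
        using N1 by (simp add: * c3_def norm_mult norm_power)
    qed
  qed
qed

text \<open>\<open>Phi\<close> is an arbitrary choice among the functions with prescribed
  coefficients. One exists by the real Riesz-Fischer theorem, and the listed properties follow from
  the coefficients, hence hold for any choice.\<close>

lemma Phi_facts:
  assumes X: "cst X q"
  shows "per N (Phi N e \<sigma> X)" "Phi N e \<sigma> X \<in> borel_measurable borel" "integrable (tor N) (Phi N e \<sigma> X)"
    "L2 N (\<lambda>x. complex_of_real (Phi N e \<sigma> X x))"
    "m \<in> latt \<Longrightarrow> fc N (\<lambda>x. of_real (Phi N e \<sigma> X x)) m = of_real c3 * cf (Gm (rr (Cf N (wf X)) q)) m"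
proof -
  let ?r = "rr (Cf N (wf X)) q"
  have cG: "cf (Gm ?r) m = of_real (gam N m) * cf ?r m" for m unfolding Gm_def cf_diag[OF Gm_multiplier_le] ..
  have fr: "fc N (\<lambda>x. of_real (rho N e \<sigma> X x)) m = of_real c3 * cf ?r m" if "m \<in> latt" for m
    using rho_facts(3)[OF X that] N1 by (simp add: c3_def)
  have iff: "(if m = 0 then 0 else fc N (\<lambda>x. of_real (rho N e \<sigma> X x)) m / of_real ((2 * pi / real N)\<^sup>2 * (norm m)\<^sup>2)) = of_real c3 * cf (Gm ?r) m"
    if "m \<in> latt" for m
    using that unfolding fr[OF that] cG gam_def by simp
  have "\<exists>f. is_G N (rho N e \<sigma> X) f"
  proof -
    have s: "(\<lambda>k. (cmod (of_real c3 * cf (Gm ?r) k))\<^sup>2) summable_on latt"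
      using summable_on_cf_latt[of "c3 *\<^sub>R Gm ?r"] by (simp add: scaleR_conv_of_real)
    have h: "of_real c3 * cf (Gm ?r) (- k) = cnj (of_real c3 * cf (Gm ?r) k)" for k
      using herm_rr[of "Cf N (wf X)" q] unfolding cG herm_def by simp
    obtain f where f: "L2 N (\<lambda>x. complex_of_real (f x))" "per N f" "f \<in> borel_measurable borel" "integrable (tor N) f"
      "\<And>k. k \<in> latt \<Longrightarrow> fc N (\<lambda>x. complex_of_real (f x)) k = of_real c3 * cf (Gm ?r) k"
      by (rule riesz_fischer_real[OF N1 s h]) (rule that)
    have "is_G N (rho N e \<sigma> X) f"
      unfolding is_G_def set_integrable_tor using f iff by simp
    then show ?thesis by (rule exI[of _ f])
  qed
  then have G: "is_G N (rho N e \<sigma> X) (Phi N e \<sigma> X)" unfolding Phi_def Gop_def by (rule someI_ex)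
  then show p: "per N (Phi N e \<sigma> X)" and m: "Phi N e \<sigma> X \<in> borel_measurable borel" and i: "integrable (tor N) (Phi N e \<sigma> X)"
    by (auto simp: is_G_def set_integrable_tor)
  show f: "fc N (\<lambda>x. of_real (Phi N e \<sigma> X x)) m = of_real c3 * cf (Gm ?r) m" if "m \<in> latt" for m
    using G that iff[OF that] unfolding is_G_def by simp
  show "L2 N (\<lambda>x. complex_of_real (Phi N e \<sigma> X x))"
  proof (rule L2_of_coefficients[OF N1])
    show "(\<lambda>x. complex_of_real (Phi N e \<sigma> X x)) \<in> borel_measurable borel" using m by measurable
    show "integrable (tor N) (\<lambda>x. complex_of_real (Phi N e \<sigma> X x))" using i by (simp add: complex_of_real_integrable_eq)
    show "(\<lambda>k. (cmod (fc N (\<lambda>x. complex_of_real (Phi N e \<sigma> X x)) k))\<^sup>2) summable_on latt"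
    proof (rule summable_on_cong[THEN iffD2, OF _ summable_on_cf_latt[of "c3 *\<^sub>R Gm ?r"]])
      fix m :: "real^3" assume "m \<in> latt"
      then show "(cmod (fc N (\<lambda>x. complex_of_real (Phi N e \<sigma> X x)) m))\<^sup>2 = (cmod (cf (c3 *\<^sub>R Gm ?r) m))\<^sup>2"
        by (simp add: f scaleR_conv_of_real)
    qed
  qed
qed

text \<open>On weighted coefficients the nonlinearity is exactly \<open>Bop\<close>, with
  \<open>c3\<close> correcting the normalization of \<open>rr\<close>.\<close>

lemma NL_facts:
  assumes X: "cst X q"
  shows "integrable (tor N) (NL N e \<sigma> X)"
    "a \<in> latt \<Longrightarrow> of_real (sqrt (real N ^ DIM(real^3^'n)) * wt N a) * fc N (NL N e \<sigma> X) a = of_real c3 * cf (Bop N (rr (Cf N (wf X)) q) (Cf N (wf X))) a"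
proof -
  have H: "H1 N (wf X)" and L: "L2 N (wf X)" using X by (auto simp: cst_def H1_def)
  let ?P = "\<lambda>x. complex_of_real (Phi N e \<sigma> X x)" and ?V = "real N ^ DIM(real^3^'n)" and ?r = "rr (Cf N (wf X)) q"
  have eq: "NL N e \<sigma> X = (\<lambda>x. \<Sum>j\<in>UNIV. ?P (x $ j) * wf X x)"
    by (rule ext) (simp only: NL_def of_real_sum sum_distrib_right)
  note f = fc_component_mult[OF N1 L Phi_facts(4)[OF X]]
  have i: "integrable (tor N) (\<lambda>x. ?P (x $ j) * wf X x)" for j by (rule f(2)[OF latt_closed(1)])
  show "integrable (tor N) (NL N e \<sigma> X)" unfolding eq by (intro Bochner_Integration.integrable_sum i)
  assume a: "a \<in> latt"
  have k: "cf (Cf N (wf X)) k / of_real (wt N k) = of_real (sqrt ?V) * fc N (wf X) k" if "k \<in> latt" for k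
    using that wt_pos[of N k] by (simp add: cf_Cf[OF N1 H] mult.assoc)
  have "fc N (NL N e \<sigma> X) a = (\<Sum>j\<in>UNIV. \<Sum>\<^sub>\<infinity>m\<in>latt. fc N ?P m * fc N (wf X) (a - axis j m))"
    unfolding eq fc_sum[OF i] f(1)[OF a] ..
  then show "of_real (sqrt ?V * wt N a) * fc N (NL N e \<sigma> X) a = of_real c3 * cf (Bop N ?r (Cf N (wf X))) a"
    unfolding cf_Bop[OF N1 a]
  proof (simp only: sum_distrib_left infsum_cmult_right'[symmetric], intro sum.cong refl infsum_cong)
    fix j :: 'n and m :: "real^3" assume m: "m \<in> latt"
    have am: "a - axis j m \<in> latt" by (rule latt_closed(3)[OF a latt_axis[OF m]])
    show "of_real (sqrt ?V * wt N a) * (fc N ?P m * fc N (wf X) (a - axis j m))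
       = of_real c3 * (of_real (wt N a) * (of_real (gam N m) * cf ?r m * (cf (Cf N (wf X)) (a - axis j m) / of_real (wt N (a - axis j m)))))"
      unfolding k[OF am] Phi_facts(5)[OF X m] Gm_def cf_diag[OF Gm_multiplier_le] by (simp only: of_real_mult mult_ac)
  qed
qed

text \<open>The gradient of the potential is again an arbitrarily chosen weak derivative; its
  coefficients identify it with \<open>Gb b\<close>, and Parseval gives its pairing with the
  translated profile.\<close>

lemma force_eq:
  assumes X: "cst X q"
  shows "force N e \<sigma> X (g n) = frc (rr (Cf N (wf X)) q) q n"
proof -
  let ?r = "rr (Cf N (wf X)) q" and ?P = "Phi N e \<sigma> X"
  have "(LINT x|tor N. wd N ?P b x * \<sigma> (x - rv (g n) - qs X (g n))) = c3 * inner (Gb b ?r) (Eph (q $ n) (sg n))" if b: "b \<in> Basis" for b :: "real^3"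
  proof -
    let ?w = "wd N ?P b"
    note bb = Gb_multiplier_le[OF norm_Basis3[OF b]]
    have cg: "\<i> * of_real ((2 * pi / real N) * (k \<bullet> b)) * fc N (\<lambda>x. of_real (?P x)) k = of_real c3 * cf (Gb b ?r) k" if k: "k \<in> latt" for k
      unfolding Phi_facts(5)[OF X k] Gm_def cf_diag[OF Gm_multiplier_le] Gb_def cf_diag[OF bb] unfolding kap_def by (simp only: of_real_mult mult_ac)
    have "\<exists>h. weak_deriv N ?P b h \<and> L2 N (\<lambda>x. complex_of_real (h x))"
    proof (rule weak_deriv_real_exists[OF N1 Phi_facts(4)[OF X]])
      show "(\<lambda>k. (cmod (\<i> * of_real ((2 * pi / real N) * (k \<bullet> b)) * fc N (\<lambda>x. of_real (?P x)) k))\<^sup>2) summable_on latt"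
      proof (rule summable_on_cong[THEN iffD2, OF _ summable_on_cf_latt[of "c3 *\<^sub>R Gb b ?r"]])
        fix k :: "real^3" assume "k \<in> latt"
        then show "(cmod (\<i> * of_real ((2 * pi / real N) * (k \<bullet> b)) * fc N (\<lambda>x. of_real (?P x)) k))\<^sup>2 = (cmod (cf (c3 *\<^sub>R Gb b ?r) k))\<^sup>2"
          by (simp only: cg cf_simps scaleR_conv_of_real)
      qed
    qed
    then obtain h where h: "weak_deriv N ?P b h" "L2 N (\<lambda>x. complex_of_real (h x))" by blast
    have w: "weak_deriv N ?P b ?w" unfolding wd_def by (rule someI[where P="weak_deriv N ?P b", OF h(1)])
    have fw: "fc N (\<lambda>x. of_real (?w x)) k = of_real c3 * cf (Gb b ?r) k" if k: "k \<in> latt" for k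
      using weak_deriv_real_fc[OF N1 w Phi_facts(3)[OF X] k] unfolding cg[OF k] .
    have wm: "?w \<in> borel_measurable borel" "integrable (tor N) ?w" using w by (auto simp: weak_deriv_def set_integrable_tor)
    have Lw: "L2 N (\<lambda>x. complex_of_real (?w x))"
    proof (rule L2_of_coefficients[OF N1])
      show "(\<lambda>x. complex_of_real (?w x)) \<in> borel_measurable borel" using wm(1) by measurable
      show "integrable (tor N) (\<lambda>x. complex_of_real (?w x))" using wm(2) by (simp add: complex_of_real_integrable_eq)
      show "(\<lambda>k. (cmod (fc N (\<lambda>x. complex_of_real (?w x)) k))\<^sup>2) summable_on latt"
      proof (rule summable_on_cong[THEN iffD2, OF _ summable_on_cf_latt[of "c3 *\<^sub>R Gb b ?r"]])
        fix k :: "real^3" assume "k \<in> latt"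
        then show "(cmod (fc N (\<lambda>x. complex_of_real (?w x)) k))\<^sup>2 = (cmod (cf (c3 *\<^sub>R Gb b ?r) k))\<^sup>2"
          by (simp only: fw cf_simps scaleR_conv_of_real)
      qed
    qed
    have st: "\<sigma> (x - rv (g n) - qs X (g n)) = \<sigma> (x - rv (g n) - q $ n)" for x
      by (rule sig_teq) (use X in \<open>auto simp: cst_def\<close>)
    have Ls: "L2 N (\<lambda>x. complex_of_real (\<sigma> (x - rv (g n) - q $ n)))" using sc_L2[of "rv (g n) + q $ n"] by (simp only: diff_diff_eq)
    have "inner (Gb b ?r) (Eph (q $ n) (sg n)) = real N ^ 3 * real N ^ 3 * (LINT x|tor N. ?w x * \<sigma> (x - rv (g n) - q $ n)) / real N ^ DIM(real^3)"
    proof (rule parseval_real[OF N1 Lw Ls])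
      show "cf (Gb b ?r) k = of_real (real N ^ 3) * fc N (\<lambda>x. of_real (?w x)) k" if "k \<in> latt" for k
        using N1 unfolding fw[OF that] c3_def by simp
      show "cf (Gb b ?r) k = 0" if "k \<notin> latt" for k unfolding Gb_def cf_diag[OF bb] cf_rr_outside[OF that] by simp
      show "cf (Eph (q $ n) (sg n)) k = of_real (real N ^ 3) * fc N (\<lambda>x. of_real (\<sigma> (x - rv (g n) - q $ n))) k" if "k \<in> latt" for k
        by (rule cf_Eph_sg[OF that])
    qed
    then show ?thesis using N1 unfolding st c3_def by simp
  qed
  then show ?thesis unfolding force_def frc_def set_integral_tor by simp
qed

lemma Qc_eq:
  assumes "H1 N (wf X)" shows "Qc N X = Qf (Cf N (wf X))"
proof -
  let ?V = "real N ^ DIM(real^3^'n)"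
  have L: "L2 N (wf X)" using assms by (auto simp: H1_def)
  have "Qf (Cf N (wf X)) = (\<Sum>\<^sub>\<infinity>k\<in>latt. ?V * (cmod (fc N (wf X) k))\<^sup>2)"
    unfolding Qf_def inner_ell2_def Wm_def cf_diag[OF Wm_multiplier_le]
  proof (rule infsum_cong_neutral)
    fix k :: "real^3^'n" assume "k \<in> UNIV \<inter> latt"
    then have c: "cf (Cf N (wf X)) k = of_real (sqrt ?V * wt N k) * fc N (wf X) k" by (simp add: cf_Cf[OF N1 assms])
    have "of_real (1 / (wt N k)\<^sup>2) * cf (Cf N (wf X)) k * cnj (cf (Cf N (wf X)) k) = of_real (1 / (wt N k)\<^sup>2 * (cmod (cf (Cf N (wf X)) k))\<^sup>2)"
      by (simp only: mult.assoc of_real_mult complex_norm_square[symmetric])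
    also have "1 / (wt N k)\<^sup>2 * (cmod (cf (Cf N (wf X)) k))\<^sup>2 = ?V * (cmod (fc N (wf X) k))\<^sup>2"
      unfolding c norm_mult norm_of_real power_mult_distrib power2_abs using wt_pos[of N k] by simp
    finally show "Re (of_real (1 / (wt N k)\<^sup>2) * cf (Cf N (wf X)) k * cnj (cf (Cf N (wf X)) k)) = ?V * (cmod (fc N (wf X) k))\<^sup>2" by simp
  qed (auto simp: cf_Cf[OF N1 assms])
  also have "\<dots> = Qc N X" unfolding Qc_def set_integral_tor parseval(2)[OF N1 L] infsum_cmult_right' ..
  finally show ?thesis ..
qed

lemma En_eq:
  assumes X: "cst X q"
  shows "En N e M \<sigma> X = Ef (Cf N (wf X)) q (\<chi> n. ps X (g n))"
proof -
  let ?V = "real N ^ DIM(real^3^'n)" and ?u = "Cf N (wf X)" and ?r = "rr (Cf N (wf X)) q"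
  have H: "H1 N (wf X)" using X by (auto simp: cst_def)
  have "inner (Am ?u) ?u = (\<Sum>\<^sub>\<infinity>k\<in>latt. ?V * ((2 * pi / real N)\<^sup>2 * (norm k)\<^sup>2 * (cmod (fc N (wf X) k))\<^sup>2))"
    unfolding inner_ell2_def Am_def cf_diag[OF Am_multiplier_le]
  proof (rule infsum_cong_neutral)
    fix k :: "real^3^'n" assume "k \<in> UNIV \<inter> latt"
    then have c: "cf ?u k = of_real (sqrt ?V * wt N k) * fc N (wf X) k" by (simp add: cf_Cf[OF N1 H])
    have "of_real (1 - 1 / (wt N k)\<^sup>2) * cf ?u k * cnj (cf ?u k) = of_real ((1 - 1 / (wt N k)\<^sup>2) * (cmod (cf ?u k))\<^sup>2)"
      by (simp only: mult.assoc of_real_mult complex_norm_square[symmetric])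
    also have "(1 - 1 / (wt N k)\<^sup>2) * (cmod (cf ?u k))\<^sup>2 = ?V * (((wt N k)\<^sup>2 - 1) * (cmod (fc N (wf X) k))\<^sup>2)"
      unfolding c norm_mult norm_of_real power_mult_distrib power2_abs using wt_pos[of N k] by (simp add: field_simps)
    finally show "Re (of_real (1 - 1 / (wt N k)\<^sup>2) * cf ?u k * cnj (cf ?u k)) = ?V * ((2 * pi / real N)\<^sup>2 * (norm k)\<^sup>2 * (cmod (fc N (wf X) k))\<^sup>2)"
      unfolding wt_sq by simp
  qed (auto simp: cf_Cf[OF N1 H])
  then have 1: "inner (Am ?u) ?u = (LINT x|tor N. (\<Sum>b\<in>Basis. (cmod (wd N (wf X) b x))\<^sup>2))"
    unfolding gradient_parseval(2)[OF N1 H] infsum_cmult_right' .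
  have "inner (Gm ?r) ?r = real N ^ 3 * real N ^ 3 * (LINT x|tor N. Phi N e \<sigma> X x * rho N e \<sigma> X x) / real N ^ DIM(real^3)"
  proof (rule parseval_real[OF N1 Phi_facts(4)[OF X] rho_facts(4)[OF X]])
    show "cf (Gm ?r) k = of_real (real N ^ 3) * fc N (\<lambda>x. of_real (Phi N e \<sigma> X x)) k" if "k \<in> latt" for k
      using N1 unfolding Phi_facts(5)[OF X that] c3_def by simp
    show "cf (Gm ?r) k = 0" if "k \<notin> latt" for k unfolding Gm_def cf_diag[OF Gm_multiplier_le] cf_rr_outside[OF that] by simp
    show "cf ?r k = of_real (real N ^ 3) * fc N (\<lambda>x. of_real (rho N e \<sigma> X x)) k" if "k \<in> latt" for k
      by (rule rho_facts(3)[OF X that])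
  qed
  then have 2: "c3 / 2 * inner (Gm ?r) ?r = 1/2 * (LINT x|tor N. rho N e \<sigma> X x * Phi N e \<sigma> X x)"
    using N1 by (simp add: c3_def mult.commute)
  have 3: "inner (\<chi> n. ps X (g n)) (\<chi> n. ps X (g n)) / (2 * M) = (\<Sum>n\<in>Gam N. (norm (ps X n))\<^sup>2 / (2 * M))"
    unfolding sum_Gam inner_vec_def[of "\<chi> n. ps X (g n)"] by (simp add: power2_norm_eq_inner sum_divide_distrib)
  show ?thesis unfolding Ef_def En_def set_integral_tor 1 2 3 ..
qed

end

text \<open>Solutions are defined by interval Lebesgue integrals, the differential equation is
  solved with gauge integrals; for continuous integrands both give \<open>primit\<close>.\<close>

lemma interval_integral_primit:
  fixes f :: "real \<Rightarrow> 'a::euclidean_space"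
  assumes f: "continuous_on UNIV f"
  shows "interval_lebesgue_integrable lborel (ereal 0) (ereal t) f" "(LBINT s=ereal 0..ereal t. f s) = primit f t"
proof -
  have c: "isCont f x" for x using f by (simp add: continuous_on_eq_continuous_at)
  show "interval_lebesgue_integrable lborel (ereal 0) (ereal t) f" by (rule interval_integrable_isCont[OF c])
  have i: "set_integrable lborel {a..b} f" for a b
    by (rule borel_integrable_atLeastAtMost'[OF continuous_on_subset[OF f subset_UNIV]])
  show "(LBINT s=ereal 0..ereal t. f s) = primit f t"
  proof (cases "0 \<le> t")
    case True
    have "integral {t..0} f = 0" using True by (cases "t = 0") auto
    then show ?thesis unfolding interval_integral_eq_integral[OF True i] primit_def by simp
  next
    case False
    then have "t \<le> 0" "integral {0..t} f = 0" by auto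
    then show ?thesis
      unfolding interval_integral_endpoints_reverse[of "ereal 0" "ereal t"] interval_integral_eq_integral[OF \<open>t \<le> 0\<close> i] primit_def by simp
  qed
qed

text \<open>Coordinates pass through the integral, which links the integral in \<open>ell2\<close>
  to the Duhamel formula of each Fourier coefficient.\<close>

lemma primit_bounded_linear:
  assumes h: "bounded_linear h" and f: "continuous_on UNIV f"
  shows "h (primit f t) = primit (\<lambda>s. h (f s)) t"
proof -
  have "h (primit f t) = h (primit f 0) + primit (\<lambda>s. h (f s)) t"
    by (rule has_vector_derivative_eq_primit)
       (auto intro!: bounded_linear.has_vector_derivative[OF h] primit_has_vector_derivative f bounded_linear.continuous_on[OF h f])
  then show ?thesis by (simp add: linear_0[OF bounded_linear.linear[OF h]])
qed

lemma teq_refl: "teq N a a"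
  unfolding teq_def by (rule bexI[of _ 0]) (auto simp: latt_closed)

lemma teq_trans: assumes "teq N a c" "teq N b c" shows "teq N a b"
proof -
  obtain m l where "m \<in> latt" "a - c = real N *\<^sub>R m" "l \<in> latt" "b - c = real N *\<^sub>R l" using assms unfolding teq_def by blast
  then have "m - l \<in> latt" "a - b = real N *\<^sub>R (m - l)" by (auto simp: latt_closed algebra_simps)
  then show ?thesis unfolding teq_def by blast
qed

lemma tdist_nonneg: "0 \<le> tdist N x y"
  unfolding tdist_def by (rule cInf_greatest) (use latt_closed(1) in auto)

lemma tdist_le: "tdist N x y \<le> norm (x - y)"
  unfolding tdist_def
proof (rule cInf_lower)
  show "norm (x - y) \<in> (\<lambda>m. norm (x - y - real N *\<^sub>R m)) ` latt"
    by (rule image_eqI[of _ _ 0]) (auto simp: latt_closed)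
  show "bdd_below ((\<lambda>m. norm (x - y - real N *\<^sub>R m)) ` latt)" by (rule bdd_belowI[of _ 0]) auto
qed

lemma tdist_teq: assumes "teq N x y" shows "tdist N x y = 0"
proof -
  obtain m where m: "m \<in> latt" "x - y = real N *\<^sub>R m" using assms unfolding teq_def by blast
  have "tdist N x y \<le> 0"
    unfolding tdist_def
  proof (rule cInf_lower)
    show "0 \<in> (\<lambda>m. norm (x - y - real N *\<^sub>R m)) ` latt" by (rule image_eqI[OF _ m(1)]) (simp add: m(2))
    show "bdd_below ((\<lambda>m. norm (x - y - real N *\<^sub>R m)) ` latt)" by (rule bdd_belowI[of _ 0]) auto
  qed
  then show ?thesis using tdist_nonneg[of N x y] by simp
qed

lemma card_Gam: "finite (Gam N)" "card (Gam N) = N ^ 3"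
proof -
  have im: "vec_nth ` Gam N = (\<Pi>\<^sub>E i\<in>(UNIV :: 3 set). {0..<int N})"
  proof (intro set_eqI iffI)
    fix f assume "f \<in> (\<Pi>\<^sub>E i\<in>(UNIV :: 3 set). {0..<int N})"
    then have "vec_lambda f \<in> Gam N" by (auto simp: Gam_def PiE_iff)
    then have "vec_nth (vec_lambda f) \<in> vec_nth ` Gam N" by (rule imageI)
    then show "f \<in> vec_nth ` Gam N" by (simp add: vec_lambda_inverse)
  qed (auto simp: Gam_def PiE_iff)
  have inj: "inj_on vec_nth (Gam N)" by (auto simp: inj_on_def vec_eq_iff)
  have "finite (vec_nth ` Gam N)" unfolding im by (intro finite_PiE) auto
  then show "finite (Gam N)" by (rule finite_imageD[OF _ inj])
  show "card (Gam N) = N ^ 3" unfolding card_image[OF inj, symmetric] im by (simp add: card_PiE)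
qed

text \<open>Dividing by the weight and the normalization leaves square-summable coefficients, so
  Riesz-Fischer supplies the function.\<close>

lemma H1_Cf_surj:
  fixes v :: "'a::euclidean_space ell2"
  assumes N: "N \<ge> 1" and v: "\<And>k. k \<notin> latt \<Longrightarrow> cf v k = 0"
  shows "\<exists>f. H1 N f \<and> Cf N f = v"
proof -
  let ?V = "real N ^ DIM('a)"
  let ?c = "\<lambda>k. of_real (1 / sqrt ?V) * cf v k"
  have V: "sqrt ?V > 0" using N by simp
  have V1: "1 / sqrt ?V \<le> 1" "1 / sqrt ?V \<ge> 0" using N by auto
  have cb: "cmod (?c k) \<le> cmod (cf v k)" for k
    using mult_right_mono[OF V1(1) norm_ge_zero[of "cf v k"]] V1 by (simp only: norm_mult norm_of_real abs_of_nonneg mult_1)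
  have wb: "cmod (of_real (1 / wt N k)) \<le> 1" for k :: 'a using wt_ge1[of N k] by (simp only: norm_of_real) simp
  have s: "(\<lambda>k. (cmod (?c k))\<^sup>2) summable_on latt"
    by (rule summable_on_comparison_test[OF summable_on_cf_latt[of v]]) (rule power_mono[OF cb norm_ge_zero], rule zero_le_power2)
  have s2: "(\<lambda>k. (cmod (of_real (1 / wt N k) * ?c k))\<^sup>2) summable_on latt"
  proof (rule summable_on_comparison_test[OF s])
    fix k :: 'a assume "k \<in> latt"
    show "(cmod (of_real (1 / wt N k) * ?c k))\<^sup>2 \<le> (cmod (?c k))\<^sup>2"
      using mult_right_mono[OF wb[of k] norm_ge_zero[of "?c k"]] by (intro power_mono) (simp_all only: norm_mult[of "of_real (1 / wt N k)"] mult_1 norm_ge_zero mult_nonneg_nonneg)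
  qed auto
  obtain f where f: "L2 N f" "per N f" "\<And>k. k \<in> latt \<Longrightarrow> fc N f k = of_real (1 / wt N k) * ?c k"
    by (rule riesz_fischer[OF N s2]) (rule that)
  have w: "of_real (wt N k) * fc N f k = ?c k" if "k \<in> latt" for k
    unfolding f(3)[OF that] mult.assoc[symmetric] of_real_mult[symmetric] using wt_pos[of N k] by simp
  have H: "H1 N f"
    by (rule H1_of_coefficients[OF N f(2,1)]) (rule summable_on_cong[THEN iffD2, OF _ s], simp only: w)
  have "Cf N f = v"
  proof (rule ell2_eqI)
    fix k :: 'a
    show "cf (Cf N f) k = cf v k"
    proof (cases "k \<in> latt")
      case True
      have "cf (Cf N f) k = of_real (sqrt ?V) * (of_real (wt N k) * fc N f k)" using True by (simp only: cf_Cf[OF N H] if_True of_real_mult mult.assoc)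
      also have "\<dots> = cf v k" unfolding w[OF True] mult.assoc[symmetric] of_real_mult[symmetric] using V by simp
      finally show ?thesis .
    qed (simp add: cf_Cf[OF N H] v)
  qed
  then show ?thesis using H by blast
qed

text \<open>The sign is its own inverse, so the relation between coefficients can be read as a
  fixed-point equation.\<close>

lemma antisymm_iff_Pop:
  fixes f :: "real^3^'n::finite \<Rightarrow> complex"
  assumes N: "N \<ge> 1" and f: "H1 N f"
  shows "antisymm_wf f \<longleftrightarrow> (\<forall>\<pi>. \<pi> permutes UNIV \<longrightarrow> Pop \<pi> (Cf N f) = Cf N f)"
proof -
  have L: "L2 N f" "per N f" using f by (auto simp: H1_def)
  have "(\<forall>k\<in>latt. fc N f (prm \<pi> k) = of_int (sign \<pi>) * fc N f k) \<longleftrightarrow> Pop \<pi> (Cf N f) = Cf N f" if p: "\<pi> permutes UNIV" for \<pi>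
  proof -
    let ?s = "complex_of_int (sign \<pi>)"
    have s: "z = ?s * w \<longleftrightarrow> ?s * z = w" for z w by (auto simp: sign_def)
    have "Pop \<pi> (Cf N f) = Cf N f \<longleftrightarrow> (\<forall>k. cf (Pop \<pi> (Cf N f)) k = cf (Cf N f) k)" using ell2_eqI by metis
    also have "\<dots> \<longleftrightarrow> (\<forall>k\<in>latt. ?s * fc N f (prm \<pi> k) = fc N f k)"
    proof -
      have "cf (Pop \<pi> (Cf N f)) k = cf (Cf N f) k \<longleftrightarrow> (k \<in> latt \<longrightarrow> ?s * fc N f (prm \<pi> k) = fc N f k)" for k
      proof (cases "k \<in> latt")
        case True
        let ?d = "complex_of_real (sqrt (real N ^ DIM(real^3^'n)) * wt N k)"
        have d: "?d \<noteq> 0" using N wt_pos[of N k] by simp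
        have "cf (Pop \<pi> (Cf N f)) k = ?d * (?s * fc N f (prm \<pi> k))" "cf (Cf N f) k = ?d * fc N f k"
          using True by (simp_all only: cf_Pop[OF p] cf_Cf[OF N f] latt_prm[OF p] wt_prm[OF p] if_True mult_ac)
        then show ?thesis by (simp only: mult_left_cancel[OF d] True simp_thms)
      qed (simp add: cf_Pop[OF p] cf_Cf[OF N f] latt_prm[OF p])
      then show ?thesis by blast
    qed
    finally show ?thesis unfolding s by blast
  qed
  then show ?thesis unfolding antisymm_iff_fc[OF N L] by blast
qed

lemma sqrt_sum_norm: "sqrt (\<Sum>n\<in>UNIV. (norm (x $ n))\<^sup>2) = norm x" for x :: "real^3^'n::finite"
  by (simp add: norm_vec_def L2_set_def)

lemma tendsto_of_norm_diff_le:
  fixes f :: "'a \<Rightarrow> 'b::real_normed_vector"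
  assumes "(d \<longlongrightarrow> 0) F" "\<And>s. norm (f s - l) \<le> d s"
  shows "(f \<longlongrightarrow> l) F"
  by (rule LIM_zero_cancel, rule Lim_null_comparison[OF _ assms(1)]) (simp add: assms(2))

lemma factor_out_mult_divide: "c \<noteq> 0 \<Longrightarrow> c * (a * z + a / c * p) = a * (c * z + p)" for a c z p :: complex
  by (simp add: field_simps)

section \<open>Equivalence of the Duhamel formulation and the differential equation\<close>

context spn_system
begin

text \<open>Couples a curve in coefficient space with a curve of states. Wave functions are tied by
  their coefficients and positions modulo the lattice, so no continuous choice of representatives is
  required of the states.\<close>

definition tracks :: "(real \<Rightarrow> (real^3^'n) ell2 \<times> (real^3^'n) \<times> (real^3^'n)) \<Rightarrow> (real \<Rightarrow> 'n state) \<Rightarrow> bool" where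
  "tracks y X \<longleftrightarrow> continuous_on UNIV y \<and> (\<forall>s. cst (X s) (fst (snd (y s))) \<and> Cf N (wf (X s)) = Uop s (fst (y s)) \<and> (\<forall>n. ps (X s) (g n) = snd (snd (y s)) $ n))"

lemma tracksD:
  assumes "tracks y X"
  shows "cst (X s) (fst (snd (y s)))" "Cf N (wf (X s)) = Uop s (fst (y s))" "ps (X s) (g n) = snd (snd (y s)) $ n"
    "continuous_on UNIV y" "continuous_on UNIV (\<lambda>s. Fld s (y s))"
  using assms adm_cont[OF adm_Fld, of y] by (auto simp: tracks_def)

abbreviation cwt :: "real^3^'n \<Rightarrow> complex" where
  "cwt k \<equiv> complex_of_real (sqrt (real N ^ DIM(real^3^'n)) * wt N k)"

lemma cwt_nz: "cwt k \<noteq> 0"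
  using N1 wt_pos[of N k] by simp

lemma cf_Fld:
  assumes t: "tracks y X" and k: "k \<in> latt"
  shows "cf (fst (Fld s (y s))) k = \<i> * of_real e * (cis (s * omega N k) * (cwt k * fc N (NL N e \<sigma> (X s)) k))"
proof -
  have "fst (Fld s (y s)) = (e * c3) *\<^sub>R Ii (Uop (- s) (Bop N (rr (Cf N (wf (X s))) (fst (snd (y s)))) (Cf N (wf (X s)))))"
    unfolding Fld_def fst_conv tracksD(2)[OF t] ..
  then have "cf (fst (Fld s (y s))) k = of_real (e * c3) * (\<i> * (cis (- (- s) * omega N k) * cf (Bop N (rr (Cf N (wf (X s))) (fst (snd (y s)))) (Cf N (wf (X s)))) k))"
    by (simp only: cf_simps Ii_def cf_diag[OF Ii_multiplier_le] Uop_def cf_diag[OF Uop_multiplier_le] scaleR_conv_of_real)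
  also have "\<dots> = \<i> * of_real e * (cis (s * omega N k) * (of_real c3 * cf (Bop N (rr (Cf N (wf (X s))) (fst (snd (y s)))) (Cf N (wf (X s)))) k))"
    by (simp only: of_real_mult minus_minus mult_ac)
  finally show ?thesis unfolding NL_facts(2)[OF tracksD(1)[OF t] k] .
qed

lemma duhamel_integral:
  assumes t: "tracks y X" and k: "k \<in> latt"
  shows "interval_lebesgue_integrable lborel (ereal 0) (ereal \<tau>) (\<lambda>s. cis (- (\<tau> - s) * omega N k) * fc N (NL N e \<sigma> (X s)) k)"
    "\<i> * of_real e * (LBINT s=ereal 0..ereal \<tau>. cis (- (\<tau> - s) * omega N k) * fc N (NL N e \<sigma> (X s)) k)
       = cis (- \<tau> * omega N k) / cwt k * cf (primit (\<lambda>s. fst (Fld s (y s))) \<tau>) k"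
proof -
  let ?f = "\<lambda>s. cis (- (\<tau> - s) * omega N k) * fc N (NL N e \<sigma> (X s)) k" and ?G = "\<lambda>s. cf (fst (Fld s (y s))) k"
  let ?i = "\<i> * complex_of_real e" and ?c = "cis (- \<tau> * omega N k) / cwt k"
  have i: "?i \<noteq> 0" using e0 by simp
  have F: "continuous_on UNIV (\<lambda>s. fst (Fld s (y s)))" using tracksD(5)[OF t] by (intro continuous_intros)
  have G: "continuous_on UNIV ?G" by (rule bounded_linear.continuous_on[OF bounded_linear_cf F])
  \<comment> \<open>The integrand is a multiple, constant in \<open>s\<close>, of a coefficient of
    the vector field. This gives its continuity; \<open>e \<noteq> 0\<close> permits the
    division.\<close>
  have fG: "?f s = ?c / ?i * ?G s" for s
  proof -
    have "cis (- \<tau> * omega N k) * cis (s * omega N k) = cis (- (\<tau> - s) * omega N k)"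
      unfolding cis_mult by (rule arg_cong[where f=cis]) (simp add: algebra_simps)
    moreover have "?c / ?i * ?G s = (cis (- \<tau> * omega N k) * cis (s * omega N k)) * fc N (NL N e \<sigma> (X s)) k * (cwt k / cwt k) * (?i / ?i)"
      unfolding cf_Fld[OF t k] times_divide_eq_right times_divide_eq_left by (simp only: divide_divide_eq_left mult_ac)
    ultimately show ?thesis by (simp only: divide_self[OF i] divide_self[OF cwt_nz] mult_1_right)
  qed
  have fc': "continuous_on UNIV ?f" unfolding fG by (intro continuous_intros G)
  show "interval_lebesgue_integrable lborel (ereal 0) (ereal \<tau>) ?f" by (rule interval_integral_primit(1)[OF fc'])
  have "(LBINT s=ereal 0..ereal \<tau>. ?f s) = primit ?f \<tau>" by (rule interval_integral_primit(2)[OF fc'])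
  also have "\<dots> = ?c / ?i * primit ?G \<tau>" unfolding fG by (rule primit_bounded_linear[OF bounded_linear_mult_right G, symmetric])
  also have "primit ?G \<tau> = cf (primit (\<lambda>s. fst (Fld s (y s))) \<tau>) k" by (rule primit_bounded_linear[OF bounded_linear_cf F, symmetric])
  finally have I: "(LBINT s=ereal 0..ereal \<tau>. ?f s) = ?c / ?i * cf (primit (\<lambda>s. fst (Fld s (y s))) \<tau>) k" .
  have "z \<noteq> 0 \<Longrightarrow> z * (a / z * p) = a * p" for z a p :: complex by simp
  then show "?i * (LBINT s=ereal 0..ereal \<tau>. ?f s) = ?c * cf (primit (\<lambda>s. fst (Fld s (y s))) \<tau>) k"
    unfolding I using i by blast
qed

lemma bounded_linear_nth: "bounded_linear (\<lambda>x :: real^3^'n. x $ n)"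
  by (rule bounded_linear_vec_nth)

lemma force_integral:
  assumes t: "tracks y X"
  shows "interval_lebesgue_integrable lborel (ereal 0) (ereal \<tau>) (\<lambda>s. force N e \<sigma> (X s) (g n))"
    "(LBINT s=ereal 0..ereal \<tau>. force N e \<sigma> (X s) (g n)) = - (primit (\<lambda>s. snd (snd (Fld s (y s)))) \<tau> $ n)"
proof -
  have eq: "force N e \<sigma> (X s) (g n) = - (snd (snd (Fld s (y s))) $ n)" for s
    unfolding force_eq[OF tracksD(1)[OF t]] Fld_def tracksD(2)[OF t] by simp
  have F: "continuous_on UNIV (\<lambda>s. snd (snd (Fld s (y s))))" using tracksD(5)[OF t] by (intro continuous_intros)
  have bl: "bounded_linear (\<lambda>x :: real^3^'n. - (x $ n))" by (rule bounded_linear_minus[OF bounded_linear_nth])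
  note c = bounded_linear.continuous_on[OF bl F]
  show "interval_lebesgue_integrable lborel (ereal 0) (ereal \<tau>) (\<lambda>s. force N e \<sigma> (X s) (g n))"
    unfolding eq by (rule interval_integral_primit(1)[OF c])
  show "(LBINT s=ereal 0..ereal \<tau>. force N e \<sigma> (X s) (g n)) = - (primit (\<lambda>s. snd (snd (Fld s (y s)))) \<tau> $ n)"
    unfolding eq interval_integral_primit(2)[OF c] by (rule primit_bounded_linear[OF bl F, symmetric])
qed

lemma momentum_integral:
  fixes X :: "real \<Rightarrow> 'n state"
  assumes c: "continuous_on UNIV P" and P: "\<And>s n. ps (X s) (g n) = P s $ n"
  shows "interval_lebesgue_integrable lborel (ereal 0) (ereal \<tau>) (\<lambda>s. ps (X s) (g n))"
    "(LBINT s=ereal 0..ereal \<tau>. ps (X s) (g n)) = primit P \<tau> $ n"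
proof -
  note c' = bounded_linear.continuous_on[OF bounded_linear_nth c]
  show "interval_lebesgue_integrable lborel (ereal 0) (ereal \<tau>) (\<lambda>s. ps (X s) (g n))"
    unfolding P by (rule interval_integral_primit(1)[OF c'])
  show "(LBINT s=ereal 0..ereal \<tau>. ps (X s) (g n)) = primit P \<tau> $ n"
    unfolding P interval_integral_primit(2)[OF c'] by (rule primit_bounded_linear[OF bounded_linear_nth c, symmetric])
qed

lemma Gam_obtain: assumes "n \<in> Gam N" obtains k where "n = g k"
  using assms g unfolding bij_betw_def by blast

lemma g_Gam: "g k \<in> Gam N"
  using g unfolding bij_betw_def by blast

text \<open>\<open>dV\<close> controls the wave function and the momenta, but not the lifted
  positions: \<open>tdist\<close> is merely bounded above by the distance of the lifts.\<close>

lemma dV_bounds: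
  assumes X: "H1 N (wf X)" and Y: "H1 N (wf Y)"
  shows "norm (Cf N (wf X) - Cf N (wf Y)) \<le> dV N X Y" "norm ((\<chi> n. ps X (g n)) - (\<chi> n. ps Y (g n))) \<le> dV N X Y"
    "dV N X Y \<le> norm (Cf N (wf X) - Cf N (wf Y)) + norm ((\<chi> n. qs X (g n)) - (\<chi> n. qs Y (g n))) + norm ((\<chi> n. ps X (g n)) - (\<chi> n. ps Y (g n)))"
    "(\<And>n. teq N (qs X (g n)) (qs Y (g n))) \<Longrightarrow> dV N X Y = norm (Cf N (wf X) - Cf N (wf Y)) + norm ((\<chi> n. ps X (g n)) - (\<chi> n. ps Y (g n)))"
proof -
  let ?Q = "sqrt (\<Sum>n\<in>UNIV. (tdist N (qs X (g n)) (qs Y (g n)))\<^sup>2)"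
  have F: "Fnorm N (\<lambda>x. wf X x - wf Y x) = norm (Cf N (wf X) - Cf N (wf Y))"
    unfolding Fnorm_Cf[OF N1 H1_diff(1)[OF N1 X Y]] H1_diff(2)[OF N1 X Y] ..
  have P: "sqrt (\<Sum>n\<in>UNIV. (norm (ps X (g n) - ps Y (g n)))\<^sup>2) = norm ((\<chi> n. ps X (g n)) - (\<chi> n. ps Y (g n)))"
    using sqrt_sum_norm[of "(\<chi> n. ps X (g n)) - (\<chi> n. ps Y (g n))"] by simp
  have d: "dV N X Y = norm (Cf N (wf X) - Cf N (wf Y)) + ?Q + norm ((\<chi> n. ps X (g n)) - (\<chi> n. ps Y (g n)))"
    unfolding dV_def F sum_Gam P ..
  have Q0: "?Q \<ge> 0" by (simp add: sum_nonneg)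
  show "norm (Cf N (wf X) - Cf N (wf Y)) \<le> dV N X Y" "norm ((\<chi> n. ps X (g n)) - (\<chi> n. ps Y (g n))) \<le> dV N X Y"
    unfolding d using Q0 by auto
  have Qn: "sqrt (\<Sum>n\<in>UNIV. (norm (qs X (g n) - qs Y (g n)))\<^sup>2) = norm ((\<chi> n. qs X (g n)) - (\<chi> n. qs Y (g n)))"
    using sqrt_sum_norm[of "(\<chi> n. qs X (g n)) - (\<chi> n. qs Y (g n))"] by simp
  have "?Q \<le> norm ((\<chi> n. qs X (g n)) - (\<chi> n. qs Y (g n)))" unfolding Qn[symmetric]
    by (intro real_sqrt_le_mono sum_mono power_mono tdist_le tdist_nonneg)
  then show "dV N X Y \<le> norm (Cf N (wf X) - Cf N (wf Y)) + norm ((\<chi> n. qs X (g n)) - (\<chi> n. qs Y (g n))) + norm ((\<chi> n. ps X (g n)) - (\<chi> n. ps Y (g n)))"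
    unfolding d by linarith
  assume "\<And>n. teq N (qs X (g n)) (qs Y (g n))"
  then show "dV N X Y = norm (Cf N (wf X) - Cf N (wf Y)) + norm ((\<chi> n. ps X (g n)) - (\<chi> n. ps Y (g n)))"
    unfolding d by (simp add: tdist_teq)
qed

text \<open>Continuity in \<open>dV\<close> makes the vector field continuous along the curve; the
  integral equations then exhibit the curve as a primitive of a continuous function, hence as
  differentiable.\<close>

lemma sol_imp_ode:
  fixes X :: "real \<Rightarrow> 'n state"
  assumes X: "sol N e M \<sigma> X"
  obtains y where "tracks y X" "\<And>t. (y has_vector_derivative Fld t (y t)) (at t)"
    "y 0 = (Cf N (wf (X 0)), (\<chi> n. qs (X 0) (g n)), (\<chi> n. ps (X 0) (g n)))"
proof -
  have H: "H1 N (wf (X t))" for t using X by (simp add: sol_def Vsp_def Fsp_def)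
  define u where "u t = Cf N (wf (X t))" for t
  define P where "P t = (\<chi> n. ps (X t) (g n))" for t
  \<comment> \<open>The positions of \<open>X\<close> may jump by periods. The lift is therefore
    defined by integrating the momenta; it is differentiable and agrees with \<open>qs\<close>
    modulo \<open>N\<close>.\<close>
  define q where "q t = (\<chi> n. qs (X 0) (g n)) + (1 / M) *\<^sub>R primit P t" for t
  define y where "y t = (Uop (- t) (u t), q t, P t)" for t
  have d0: "((\<lambda>s. dV N (X s) (X t)) \<longlongrightarrow> 0) (at t)" for t using X by (simp add: sol_def)
  have uc: "continuous_on UNIV u"
    unfolding continuous_on_def u_def
    using dV_bounds(1)[OF H H] by (intro ballI tendsto_of_norm_diff_le[OF d0])
  have Pc: "continuous_on UNIV P"
    unfolding continuous_on_def P_def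
    using dV_bounds(2)[OF H H] by (intro ballI tendsto_of_norm_diff_le[OF d0])
  have qd: "(q has_vector_derivative (1 / M) *\<^sub>R P t) (at t)" for t
    unfolding q_def[abs_def] using has_vector_derivative_add[OF has_vector_derivative_const
      bounded_linear.has_vector_derivative[OF bounded_linear_scaleR_right primit_has_vector_derivative[OF Pc]]] by simp
  have qc: "continuous_on UNIV q" by (rule has_vector_derivative_imp_continuous_on[OF qd])
  have Uc: "continuous_on UNIV (\<lambda>t. Uop (- t) (u t))"
    using adm_cont[OF adm_U'[OF adm_fst], of "\<lambda>t. (u t, 0, 0)"] uc by (simp add: continuous_on_Pair)
  have yc: "continuous_on UNIV y" unfolding y_def[abs_def] by (intro continuous_on_Pair Uc qc Pc)
  have Pn: "ps (X s) (g n) = P s $ n" for s n by (simp add: P_def)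
  have tq: "teq N (qs (X t) (g n)) (q t $ n)" for t n
  proof -
    have "teq N (qs (X t) (g n)) (qs (X 0) (g n) + (1 / M) *\<^sub>R (LBINT s=ereal 0..ereal t. ps (X s) (g n)))"
      using X g_Gam[of n] unfolding sol_def by blast
    then show ?thesis unfolding momentum_integral(2)[OF Pc Pn] by (simp add: q_def)
  qed
  have tr: "tracks y X" unfolding tracks_def y_def
    using yc H tq by (simp add: y_def[abs_def] cst_def Pn Uop_inverse u_def)
  let ?F1 = "\<lambda>s. fst (Fld s (y s))" and ?F3 = "\<lambda>s. snd (snd (Fld s (y s)))"
  have F1: "continuous_on UNIV ?F1" and F3: "continuous_on UNIV ?F3" by (intro continuous_on_fst continuous_on_snd tracksD(5)[OF tr])+
  have U0: "Uop 0 v = v" for v by (rule ell2_eqI) (unfold Uop_def cf_diag[OF Uop_multiplier_le], simp)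
  have e1: "Uop (- t) (u t) = u 0 + primit ?F1 t" for t
  proof (rule ell2_eqI)
    fix k :: "real^3^'n"
    show "cf (Uop (- t) (u t)) k = cf (u 0 + primit ?F1 t) k"
    proof (cases "k \<in> latt")
      case True
      have cu: "cf (u t) k = cwt k * fc N (wf (X t)) k" for t using True by (simp add: u_def cf_Cf[OF N1 H])
      have "fc N (wf (X t)) k = cis (- t * omega N k) * fc N (wf (X 0)) k + \<i> * of_real e *
            (LBINT s=ereal 0..ereal t. cis (- (t - s) * omega N k) * fc N (NL N e \<sigma> (X s)) k)"
        using X True unfolding sol_def by blast
      then have "cwt k * fc N (wf (X t)) k = cwt k * (cis (- t * omega N k) * fc N (wf (X 0)) k + cis (- t * omega N k) / cwt k * cf (primit ?F1 t) k)"
        unfolding duhamel_integral(2)[OF tr True] by (rule arg_cong)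
      also have "\<dots> = cis (- t * omega N k) * (cwt k * fc N (wf (X 0)) k + cf (primit ?F1 t) k)"
        by (rule factor_out_mult_divide[OF cwt_nz])
      finally have "cf (u t) k = cis (- t * omega N k) * (cf (u 0) k + cf (primit ?F1 t) k)" unfolding cu .
      then show ?thesis unfolding Uop_def cf_diag[OF Uop_multiplier_le] by (simp add: cis_mult mult.assoc[symmetric])
    next
      case False
      have z: "cf (?F1 s) k = 0" for s
        unfolding Fld_def fst_conv cf_simps Ii_def cf_diag[OF Ii_multiplier_le] Uop_def cf_diag[OF Uop_multiplier_le] cf_Bop_outside[OF N1 False] by simp
      have "cf (primit ?F1 t) k = primit (\<lambda>s. 0) t" unfolding primit_bounded_linear[OF bounded_linear_cf F1] z ..
      also have "\<dots> = 0" by (simp add: primit_def)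
      finally show ?thesis using False unfolding Uop_def cf_diag[OF Uop_multiplier_le] by (simp add: u_def cf_Cf[OF N1 H])
    qed
  qed
  have e3: "P t = P 0 + primit ?F3 t" for t
  proof -
    have "ps (X t) (g n) = ps (X 0) (g n) - (LBINT s=ereal 0..ereal t. force N e \<sigma> (X s) (g n))" for n
      using X g_Gam[of n] unfolding sol_def by blast
    then show ?thesis unfolding force_integral(2)[OF tr] Pn by (simp add: vec_eq_iff)
  qed
  have d1: "((\<lambda>t. Uop (- t) (u t)) has_vector_derivative ?F1 t) (at t)" for t
    unfolding e1 using has_vector_derivative_add[OF has_vector_derivative_const primit_has_vector_derivative[OF F1]] by simp
  have d3: "(P has_vector_derivative ?F3 t) (at t)" for t
  proof -
    have "((\<lambda>t. P 0 + primit ?F3 t) has_vector_derivative ?F3 t) (at t)"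
      using has_vector_derivative_add[OF has_vector_derivative_const primit_has_vector_derivative[OF F3]] by simp
    then show ?thesis unfolding e3[symmetric] .
  qed
  show thesis
  proof (rule that[OF tr])
    fix t
    have f2: "fst (snd (Fld t (y t))) = (1 / M) *\<^sub>R P t" by (simp add: Fld_def y_def)
    have "(y has_vector_derivative (?F1 t, (1 / M) *\<^sub>R P t, ?F3 t)) (at t)"
      unfolding y_def[abs_def] using d1 qd d3 unfolding y_def by (intro has_vector_derivative_Pair)
    then show "(y has_vector_derivative Fld t (y t)) (at t)" unfolding f2[symmetric] prod.collapse .
    show "y 0 = (Cf N (wf (X 0)), (\<chi> n. qs (X 0) (g n)), (\<chi> n. ps (X 0) (g n)))"
      by (simp add: y_def u_def q_def P_def U0)
  qed
qed

text \<open>Two solutions may differ on null sets, by periods of the positions and outside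
  \<open>Gam N\<close>, so vanishing distance is the appropriate form of equality.\<close>

lemma sol_unique:
  fixes X Y :: "real \<Rightarrow> 'n state"
  assumes X: "sol N e M \<sigma> X" and Y: "sol N e M \<sigma> Y" and XY: "X 0 = Y 0"
  shows "dV N (X t) (Y t) = 0"
proof -
  obtain x where x: "tracks x X" "\<And>t. (x has_vector_derivative Fld t (x t)) (at t)"
    "x 0 = (Cf N (wf (X 0)), (\<chi> n. qs (X 0) (g n)), (\<chi> n. ps (X 0) (g n)))" by (rule sol_imp_ode[OF X]) (rule that)
  obtain y where y: "tracks y Y" "\<And>t. (y has_vector_derivative Fld t (y t)) (at t)"
    "y 0 = (Cf N (wf (Y 0)), (\<chi> n. qs (Y 0) (g n)), (\<chi> n. ps (Y 0) (g n)))" by (rule sol_imp_ode[OF Y]) (rule that)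
  have e: "x t = y t" by (rule dyn_unique[OF x(2) y(2)]) (simp only: x(3) y(3) XY)
  have H: "H1 N (wf (X t))" "H1 N (wf (Y t))" and q: "teq N (qs (X t) (g n)) (fst (snd (x t)) $ n)" "teq N (qs (Y t) (g n)) (fst (snd (y t)) $ n)" for n
    using tracksD(1)[OF x(1), of t] tracksD(1)[OF y(1), of t] by (auto simp: cst_def)
  have "dV N (X t) (Y t) = norm (Cf N (wf (X t)) - Cf N (wf (Y t))) + norm ((\<chi> n. ps (X t) (g n)) - (\<chi> n. ps (Y t) (g n)))"
    by (rule dV_bounds(4)[OF H teq_trans[OF q(1) q(2)[folded e]]])
  then show ?thesis by (simp add: tracksD(2,3)[OF x(1)] tracksD(2,3)[OF y(1)] e)
qed

lemma sol_conserved: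
  fixes X :: "real \<Rightarrow> 'n state"
  assumes X: "sol N e M \<sigma> X"
  shows "En N e M \<sigma> (X t) = En N e M \<sigma> (X 0) \<and> Qc N (X t) = Qc N (X 0)"
proof -
  obtain y where y: "tracks y X" "\<And>t. (y has_vector_derivative Fld t (y t)) (at t)" by (rule sol_imp_ode[OF X]) (rule that)
  have H: "H1 N (wf (X t))" for t using tracksD(1)[OF y(1), of t] by (auto simp: cst_def)
  have p: "(\<chi> n. ps (X t) (g n)) = snd (snd (y t))" for t by (simp add: tracksD(3)[OF y(1)])
  note c = conserved[of t y, OF y(2)]
  have "En N e M \<sigma> (X t) = En N e M \<sigma> (X 0)"
    unfolding En_eq[OF tracksD(1)[OF y(1)]] tracksD(2)[OF y(1)] p using c(2) by simp
  moreover have "Qc N (X t) = Qc N (X 0)"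
    unfolding Qc_eq[OF H] tracksD(2)[OF y(1)] Qf_Uop by (rule c(1))
  ultimately show ?thesis ..
qed

lemma sol_exists:
  fixes X0 :: "'n state"
  assumes X0: "Vsp N X0"
  shows "\<exists>X. sol N e M \<sigma> X \<and> X 0 = X0"
proof -
  have H0: "H1 N (wf X0)" and A0: "antisymm_wf (wf X0)" using X0 by (auto simp: Vsp_def Fsp_def)
  obtain y where y0: "y 0 = (Cf N (wf X0), (\<chi> n. qs X0 (g n)), (\<chi> n. ps X0 (g n)))" and yd: "\<And>t. (y has_vector_derivative Fld t (y t)) (at t)"
    using dyn_exists[of "(Cf N (wf X0), (\<chi> n. qs X0 (g n)), (\<chi> n. ps X0 (g n)))"] by (elim exE conjE) (rule that, assumption, erule spec)
  have yc: "continuous_on UNIV y" by (rule has_vector_derivative_imp_continuous_on[OF yd])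
  have Fc: "continuous_on UNIV (\<lambda>s. Fld s (y s))" by (rule adm_cont[OF adm_Fld yc])
  let ?F1 = "\<lambda>s. fst (Fld s (y s))" and ?F2 = "\<lambda>s. fst (snd (Fld s (y s)))" and ?F3 = "\<lambda>s. snd (snd (Fld s (y s)))"
  have F: "continuous_on UNIV ?F1" "continuous_on UNIV ?F2" "continuous_on UNIV ?F3" by (intro continuous_on_fst continuous_on_snd Fc)+
  have e1: "fst (y t) = fst (y 0) + primit ?F1 t" for t
    by (rule has_vector_derivative_eq_primit[OF F(1)]) (intro bounded_linear.has_vector_derivative[OF bounded_linear_fst] yd)
  have e2: "fst (snd (y t)) = fst (snd (y 0)) + primit ?F2 t" for t
    by (rule has_vector_derivative_eq_primit[OF F(2)])
       (intro bounded_linear.has_vector_derivative[OF bounded_linear_fst] bounded_linear.has_vector_derivative[OF bounded_linear_snd] yd)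
  have e3: "snd (snd (y t)) = snd (snd (y 0)) + primit ?F3 t" for t
    by (rule has_vector_derivative_eq_primit[OF F(3)]) (intro bounded_linear.has_vector_derivative[OF bounded_linear_snd] yd)
  have U0: "Uop 0 v = v" for v by (rule ell2_eqI) (unfold Uop_def cf_diag[OF Uop_multiplier_le], simp)
  define v where "v t = Uop t (fst (y t))" for t
  have vc: "continuous_on UNIV v" unfolding v_def[abs_def] by (rule adm_cont[OF adm_U[OF adm_fst] yc])
  have out: "cf (v t) k = 0" if k: "k \<notin> latt" for t k
  proof -
    have z: "cf (?F1 s) k = 0" for s
      unfolding Fld_def fst_conv cf_simps Ii_def cf_diag[OF Ii_multiplier_le] Uop_def cf_diag[OF Uop_multiplier_le] cf_Bop_outside[OF N1 k] by simp
    have "cf (primit ?F1 t) k = primit (\<lambda>s. 0) t" unfolding primit_bounded_linear[OF bounded_linear_cf F(1)] z ..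
    also have "\<dots> = 0" by (simp add: primit_def)
    finally have "cf (fst (y t)) k = 0" unfolding e1[of t] y0 using k by (simp add: cf_Cf[OF N1 H0])
    then show ?thesis unfolding v_def Uop_def cf_diag[OF Uop_multiplier_le] by simp
  qed
  have P: "Pop \<pi> (v t) = v t" if p: "\<pi> permutes UNIV" for \<pi> t
  proof -
    have "Pop \<pi> (fst (y t)) = fst (y t)"
      by (rule solution_Pop[OF p yd]) (use A0 p in \<open>simp add: y0 antisymm_iff_Pop[OF N1 H0]\<close>)
    then show ?thesis unfolding v_def Uop_Pop[OF p, symmetric] by simp
  qed
  have "\<forall>t. \<exists>f. H1 N f \<and> Cf N f = v t" using H1_Cf_surj[OF N1 out] by blast
  then obtain f where f: "\<And>t. H1 N (f t) \<and> Cf N (f t) = v t" by (rule choice[THEN exE]) (rule that, erule spec)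
  \<comment> \<open>At time 0 the given state itself is used: the function recovered from its
    coefficients may differ from it on a null set, and its positions and momenta outside
    \<open>Gam N\<close> would be lost.\<close>
  define X :: "real \<Rightarrow> 'n state" where "X t = (if t = 0 then X0
     else (f t, (\<lambda>n. fst (snd (y t)) $ inv g n), (\<lambda>n. snd (snd (y t)) $ inv g n)))" for t
  have ig: "inv g (g n) = n" for n using g by (simp add: bij_betw_def)
  have H: "H1 N (wf (X t))" for t using f[of t] H0 by (simp add: X_def wf_def)
  have C: "Cf N (wf (X t)) = v t" for t
    using f[of t] by (cases "t = 0") (simp_all add: X_def wf_def v_def y0 U0)
  have Q: "qs (X t) (g n) = fst (snd (y t)) $ n" and R: "ps (X t) (g n) = snd (snd (y t)) $ n" for t n
    by (simp_all add: X_def qs_def ps_def y0 ig)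
  have tr: "tracks y X"
    unfolding tracks_def cst_def using yc H C R by (simp add: Q teq_refl v_def)
  have V: "Vsp N (X t)" for t
    unfolding Vsp_def Fsp_def antisymm_iff_Pop[OF N1 H] C using H P by blast
  have cont: "((\<lambda>s. dV N (X s) (X t)) \<longlongrightarrow> 0) (at t)" for t
  proof (rule Lim_null_comparison)
    let ?b = "\<lambda>s. norm (v s - v t) + norm (fst (snd (y s)) - fst (snd (y t))) + norm (snd (snd (y s)) - snd (snd (y t)))"
    have "norm (dV N (X s) (X t)) \<le> ?b s" for s
      using dV_bounds(3)[OF H H, of s t] order_trans[OF norm_ge_zero dV_bounds(1)[OF H H, of s t]] by (simp add: C Q R)
    then show "eventually (\<lambda>s. norm (dV N (X s) (X t)) \<le> ?b s) (at t)" by simp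
    have "isCont v t" "isCont y t" using vc yc by (auto simp: continuous_on_eq_continuous_at)
    then have "((\<lambda>s. ?b s) \<longlongrightarrow> norm (v t - v t) + norm (fst (snd (y t)) - fst (snd (y t))) + norm (snd (snd (y t)) - snd (snd (y t)))) (at t)"
      unfolding isCont_def by (intro tendsto_intros)
    then show "(?b \<longlongrightarrow> 0) (at t)" by simp
  qed
  have "sol N e M \<sigma> X"
    unfolding sol_def
  proof (intro conjI allI ballI)
    show "Vsp N (X t)" "((\<lambda>s. dV N (X s) (X t)) \<longlongrightarrow> 0) (at t)" for t by (rule V, rule cont)
    show "set_integrable lborel (Tb N) (NL N e \<sigma> (X s))" for s
      unfolding set_integrable_tor by (rule NL_facts(1)[OF tracksD(1)[OF tr]])
    fix t
    show "interval_lebesgue_integrable lborel (ereal 0) (ereal t) (\<lambda>s. cis (- (t - s) * omega N k) * fc N (NL N e \<sigma> (X s)) k)"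
      if "k \<in> latt" for k by (rule duhamel_integral(1)[OF tr that])
    show "fc N (wf (X t)) k = cis (- t * omega N k) * fc N (wf (X 0)) k + \<i> * of_real e *
            (LBINT s=ereal 0..ereal t. cis (- (t - s) * omega N k) * fc N (NL N e \<sigma> (X s)) k)" if k: "k \<in> latt" for k
    proof -
      have cu: "cf (v t) k = cwt k * fc N (wf (X t)) k" for t using k C[of t, symmetric] by (simp add: cf_Cf[OF N1 H])
      have "cf (v t) k = cis (- t * omega N k) * (cf (v 0) k + cf (primit ?F1 t) k)"
        unfolding v_def U0 unfolding Uop_def cf_diag[OF Uop_multiplier_le] e1[of t] cf_simps ..
      also have "\<dots> = cwt k * (cis (- t * omega N k) * fc N (wf (X 0)) k + cis (- t * omega N k) / cwt k * cf (primit ?F1 t) k)"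
        unfolding cu by (rule factor_out_mult_divide[OF cwt_nz, symmetric])
      finally have "fc N (wf (X t)) k = cis (- t * omega N k) * fc N (wf (X 0)) k + cis (- t * omega N k) / cwt k * cf (primit ?F1 t) k"
        unfolding cu by (simp only: mult_left_cancel[OF cwt_nz])
      then show ?thesis unfolding duhamel_integral(2)[OF tr k] .
    qed
    fix n assume "n \<in> Gam N"
    then obtain j where n: "n = g j" by (rule Gam_obtain)
    have pc: "continuous_on UNIV (\<lambda>s. snd (snd (y s)))" using yc by (intro continuous_intros)
    show "interval_lebesgue_integrable lborel (ereal 0) (ereal t) (\<lambda>s. ps (X s) n)"
      unfolding n by (rule momentum_integral(1)[OF pc R])
    show "teq N (qs (X t) n) (qs (X 0) n + (1 / M) *\<^sub>R (LBINT s=ereal 0..ereal t. ps (X s) n))"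
    proof -
      have "primit ?F2 t = (1 / M) *\<^sub>R primit (\<lambda>s. snd (snd (y s))) t"
        unfolding Fld_def snd_conv fst_conv by (rule primit_bounded_linear[OF bounded_linear_scaleR_right pc, symmetric])
      then show ?thesis unfolding n momentum_integral(2)[OF pc R] Q e2[of t] by (simp add: teq_refl)
    qed
    show "interval_lebesgue_integrable lborel (ereal 0) (ereal t) (\<lambda>s. force N e \<sigma> (X s) n)"
      unfolding n by (rule force_integral(1)[OF tr])
    show "ps (X t) n = ps (X 0) n - (LBINT s=ereal 0..ereal t. force N e \<sigma> (X s) n)"
      unfolding n force_integral(2)[OF tr] R e3[of t] by simp
  qed
  moreover have "X 0 = X0" by (simp add: X_def)
  ultimately show ?thesis by blast
qed

end

theorem theoremA1:
  fixes N :: nat and e Z M :: real and \<sigma> :: "real^3 \<Rightarrow> real"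
    and X0 :: "('n::finite) state"
  assumes "N \<ge> 1" and "CARD('n) = N ^ 3"
    and "e > 0" and "Z > 0" and "M > 0"
    and "C2 \<sigma>" and "per N \<sigma>"
    and "(LINT x:Tb N|lborel. \<sigma> x) = e * Z"
    and "X0 \<in> Mset N Z"
  shows "(\<exists>X. sol N e M \<sigma> X \<and> X 0 = X0)
       \<and> (\<forall>X Y. sol N e M \<sigma> X \<and> X 0 = X0 \<and> sol N e M \<sigma> Y \<and> Y 0 = X0
                \<longrightarrow> (\<forall>t. dV N (X t) (Y t) = 0))
       \<and> (\<forall>X. sol N e M \<sigma> X \<and> X 0 = X0
                \<longrightarrow> (\<forall>t. En N e M \<sigma> (X t) = En N e M \<sigma> (X 0) \<and> Qc N (X t) = Qc N (X 0)))"
proof -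
  \<comment> \<open>There are as many electrons as ion sites, namely \<open>N ^ 3\<close>.\<close>
  have "\<exists>g. bij_betw g (UNIV :: 'n set) (Gam N)"
    by (rule finite_same_card_bij) (simp_all add: card_Gam assms(2))
  then obtain g :: "'n \<Rightarrow> int^3" where g: "bij_betw g UNIV (Gam N)" by blast
  interpret S: spn_system N e M \<sigma> g
    by unfold_locales (use assms g in auto)
  have V: "Vsp N X0" using assms(9) by (simp add: Mset_def)
  show ?thesis
  proof (intro conjI allI impI)
    show "\<exists>X. sol N e M \<sigma> X \<and> X 0 = X0" by (rule S.sol_exists[OF V])
    show "dV N (X t) (Y t) = 0" if "sol N e M \<sigma> X \<and> X 0 = X0 \<and> sol N e M \<sigma> Y \<and> Y 0 = X0" for X Y :: "real \<Rightarrow> 'n state" and t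
      by (rule S.sol_unique) (use that in auto)
    show "En N e M \<sigma> (X t) = En N e M \<sigma> (X 0)" "Qc N (X t) = Qc N (X 0)" if "sol N e M \<sigma> X \<and> X 0 = X0" for X :: "real \<Rightarrow> 'n state" and t
      using S.sol_conserved[of X t] that by auto
  qed
qed

end
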